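(* Let $X_0,X_1,\dots,X_n$ be vector fields on a bounded domain $\Omega\subset\mathbb{R}^p$, with $X_1,\dots,X_n$ having $C^{r-1,\alpha}(\Omega)$ coefficients and $X_0$ having $C^{r-2,\alpha}(\Omega)$ coefficients ($r\ge2$ integer, $\alpha\in(0,1]$), satisfying Hörmander's condition of step $r$ in $\Omega$ and free up to weight $r$ in $\Omega$. Let $Y_{[I]}$ be the left invariant homogeneous vector fields on the homogeneous group $G$, and $\Theta_y(\cdot)$ the map given by regularized canonical coordinates centered at $y$ (both defined in the context). Then for every multiindex $I$ with $|I|\le r$, every $y\in\Omega$, every smooth function $f$ on a neighborhood of $0$ in $G=\mathbb{R}^p$, and every $x$ in a neighborhood of $y$, $$X_{[I]}^{x}\bigl(f(\Theta_y(x))\bigr)=\bigl(Y_{[I]}f+R_{y,[I]}f\bigr)(\Theta_y(x)),$$ where $X^x_{[I]}$ denotes $X_{[I]}$ acting in the variable $x$, $\Theta_y(\cdot)$ is a smooth diffeomorphism (from a neighborhood of $y$ onto a neighborhood of $0$) depending on $y$ in a $C^\alpha$ continuous way, and the $R_{y,[I]}$ are $C^{r-|I|,\alpha}$ vector fields (in the variables $u$) of weight $\ge\alpha-|I|$, depending on $y$ in a $C^\alpha$ continuous way.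
   Context: Weights and commutators: $X_0$ has weight $p_0=2$, $X_i$ has weight $p_i=1$ for $i\ge1$. For $I=(i_1,\dots,i_k)$, $i_j\in\{0,\dots,n\}$, $|I|=\sum_j p_{i_j}$ and $X_{[I]}=[X_{i_1},[X_{i_2},\dots[X_{i_{k-1}},X_{i_k}]\dots]]$, $X_{[(i)]}=X_i$. Hörmander's condition of step $r$ in $\Omega$: $\{(X_{[I]})_x\}_{|I|\le r}$ spans $\mathbb{R}^p$ for every $x\in\Omega$. In noncommuting indeterminates $\xi_0,\dots,\xi_n$ write $\xi_{[I]}=[\xi_{i_1},[\dots,\xi_{i_k}]\dots]=\sum_JA_{IJ}\xi_J$. The fields are free up to weight $r$ in $\Omega$ if at each $x\in\Omega$: $\sum_{|I|\le r}a_I(X_{[I]})_x=0$ (real constants $a_I$) implies $\sum_{|I|\le r} a_IA_{IJ}=0$ for all $J$. A set $B$ of $p$ multiindices of weight $\le r$ is fixed so that $\{(X_{[I]})_x\}_{I\in B}$ is a basis of $\mathbb{R}^p$ at every $x\in\Omega$. Smooth approximating fields: if $X_i=\sum_j b_{ij}(x)\partial_{x_j}$, then for $y\in\Omega$, $S_i^{y}=\sum_j p_{ij}(x)\partial_{x_j}$, where $p_{ij}$ is the Taylor polynomial of $b_{ij}$ centered at $y$ of order $r-p_i$. These are smooth on $\mathbb{R}^p$ and $(S^y_{[I]})_y=(X_{[I]})_y$ for $|I|\le r$. Regularized canonical coordinates and $\Theta$: $\exp(Z)(y)$ is the time-1 value of the solution of $\phi'=Z_\phi$, $\phi(0)=y$.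 Near $u=0$ in $\mathbb{R}^p$ (coordinates $u=(u_I)_{I\in B}$) the map $u\mapsto E(u,y)=\exp(\sum_{I\in B}u_IS^y_{[I]})(y)$ is a smooth diffeomorphism onto a neighborhood of $y$; $u=\Theta_y(x)$ is its inverse. The $u$ are the regularized canonical coordinates centered at $y$. Weight of a (possibly nonsmooth) vector field: with $\|u\|=\sum_{J\in B}|u_J|^{1/|J|}$, a vector field which in regularized canonical coordinates centered at $y$ is $\sum_{J\in B}c_J(u)\partial_{u_J}$ has weight $\ge k\in\mathbb{R}$ (near $y$) if $|c_J(u)|\le c\|u\|^{k+|J|}$ for $u$ in a neighborhood of $0$ and all $J\in B$. The group $G$ and the fields $Y$: $G$ is $\mathbb{R}^p$ (coordinates $u=(u_I)_{I\in B}$) with a Lie group law with identity $0$ and automorphisms (dilations) $\delta_\lambda(u)=(\lambda^{|I|}u_I)_{I\in B}$, $\lambda>0$, and $Y_0,\dots,Y_n$ are smooth vector fields on it such that: they are free up to weight $r$ and $\{(Y_{[I]})_u\}_{|I|\le r}$ spans $\mathbb{R}^p$ at every $u$; each $Y_{[I]}$ is left invariant and homogeneous of degree $|I|$, i.e. $Y_{[I]}(f\circ\delta_\lambda)=\lambda^{|I|}(Y_{[I]}f)\circ\delta_\lambda$; $(Y_{[I]})_0=\partial_{u_I}$ for $I\in B$; $\sum_{I\in B}u_I\partial_{u_I}=\sum_{I\in B}u_IY_{[I]}$; and $u^{-1}=-u$. (Such $G$ and $Y_i$ exist; they are fixed, independently of $y$.) "Depends on $y$ in a $C^\alpha$ continuous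 way" means: is (locally) Hölder continuous of exponent $\alpha$ as a function of $y$ (for vector fields: their coefficients are).
   Formalization: For |I|=r and α<1 the coefficients of R_{y,[I]} at fixed u need not be C^α in y (only C^{α²} in examples); there the C^α dependence on y is stated for the coefficients at Θ_y(x) with x fixed. For |I|<r or α=1 both forms are stated. *)

theory Defs
  imports "HOL-Analysis.Analysis"
begin

section \<open>Regularity classes\<close>

text \<open>The domains \<open>S\<close> below are meant to be open.\<close>

primrec C_on :: "nat \<Rightarrow> 'a::euclidean_space set \<Rightarrow> ('a \<Rightarrow> 'b::real_normed_vector) \<Rightarrow> bool" where
  "C_on 0 S f \<longleftrightarrow> continuous_on S f"
| "C_on (Suc k) S f \<longleftrightarrow> (\<forall>x\<in>S. f differentiable (at x)) \<and>
     (\<forall>v\<in>Basis. C_on k S (\<lambda>x. frechet_derivative f (at x) v))"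

definition smooth_on :: "'a::euclidean_space set \<Rightarrow> ('a \<Rightarrow> 'b::real_normed_vector) \<Rightarrow> bool" where
  "smooth_on S f \<longleftrightarrow> (\<forall>k. C_on k S f)"

definition locally_holder_on ::
    "real \<Rightarrow> 'a::metric_space set \<Rightarrow> ('a \<Rightarrow> 'b::metric_space) \<Rightarrow> bool" where
  "locally_holder_on \<alpha> S f \<longleftrightarrow>
     (\<forall>x\<in>S. \<exists>\<epsilon>>0. \<exists>C. \<forall>y\<in>S \<inter> ball x \<epsilon>. \<forall>z\<in>S \<inter> ball x \<epsilon>.
        dist (f y) (f z) \<le> C * dist y z powr \<alpha>)"

text \<open>The class of exponent \<open>k,\<alpha>\<close> is the local one: no uniformity up to the boundary of \<open>S\<close>.\<close>

primrec C_holder_on ::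
    "real \<Rightarrow> nat \<Rightarrow> 'a::euclidean_space set \<Rightarrow> ('a \<Rightarrow> 'b::real_normed_vector) \<Rightarrow> bool" where
  "C_holder_on \<alpha> 0 S f \<longleftrightarrow> locally_holder_on \<alpha> S f"
| "C_holder_on \<alpha> (Suc k) S f \<longleftrightarrow> (\<forall>x\<in>S. f differentiable (at x)) \<and>
     (\<forall>v\<in>Basis. C_holder_on \<alpha> k S (\<lambda>x. frechet_derivative f (at x) v))"

text \<open>\<open>F y x\<close>, defined for \<open>(x, y) \<in> D\<close>, is locally Hoelder continuous as a function
  of the parameter \<open>y\<close>, with a constant that is locally uniform in \<open>x\<close>. For a family of vector fields given in
  coordinates \<open>u = \<Theta> y x\<close> that move with \<open>y\<close>, the coefficients can be compared at the same
  point \<open>x\<close> or at the same \<open>u\<close>. The two notions differ if the coefficients are only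
  \<open>\<alpha>\<close>-Hoelder continuous in \<open>x\<close>: composing with \<open>y \<mapsto> \<Theta> y\<^sup>-\<^sup>1 u\<close>, which is itself only
  \<open>\<alpha>\<close>-Hoelder continuous, may lower the exponent to \<open>\<alpha>\<^sup>2\<close>.\<close>

definition holder_dependence :: "real \<Rightarrow> ('a::metric_space \<times> 'b::metric_space) set \<Rightarrow>
    ('b \<Rightarrow> 'a \<Rightarrow> 'c::metric_space) \<Rightarrow> bool" where
  "holder_dependence \<alpha> D F \<longleftrightarrow>
     (\<forall>(x0, y0)\<in>D. \<exists>\<epsilon>>0. \<exists>C. \<forall>x\<in>ball x0 \<epsilon>. \<forall>y1\<in>ball y0 \<epsilon>. \<forall>y2\<in>ball y0 \<epsilon>.
        (x, y1) \<in> D \<longrightarrow> (x, y2) \<in> D \<longrightarrow> dist (F y1 x) (F y2 x) \<le> C * dist y1 y2 powr \<alpha>)"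

definition diffeomorphism ::
    "'a::euclidean_space set \<Rightarrow> 'b::euclidean_space set \<Rightarrow> ('a \<Rightarrow> 'b) \<Rightarrow> ('b \<Rightarrow> 'a) \<Rightarrow> bool" where
  "diffeomorphism S T f g \<longleftrightarrow>
     open S \<and> open T \<and> homeomorphism S T f g \<and> smooth_on S f \<and> smooth_on T g"


section \<open>Vector fields, weights and commutators\<close>

text \<open>A vector field is identified with the vector of its coefficients.\<close>

definition vf_apply ::
    "('a \<Rightarrow> 'a) \<Rightarrow> ('a \<Rightarrow> real) \<Rightarrow> 'a::real_normed_vector \<Rightarrow> real" where
  "vf_apply V f x = frechet_derivative f (at x) (V x)"

text \<open>In coordinates, \<open>[V, W]\<close> has the coefficients \<open>V W\<^sub>j - W V\<^sub>j\<close>.\<close>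

definition lie_bracket :: "('a \<Rightarrow> 'a) \<Rightarrow> ('a \<Rightarrow> 'a) \<Rightarrow> 'a \<Rightarrow> 'a::real_normed_vector" where
  "lie_bracket V W x = frechet_derivative W (at x) (V x) - frechet_derivative V (at x) (W x)"

definition field_weight :: "nat \<Rightarrow> nat" where
  "field_weight i = (if i = 0 then 2 else 1)"

definition weight :: "nat list \<Rightarrow> nat" where
  "weight I = sum_list (map field_weight I)"

definition multiindices :: "nat \<Rightarrow> nat list set" where
  "multiindices n = {I. I \<noteq> [] \<and> set I \<subseteq> {0..n}}"

definition multiindices_upto :: "nat \<Rightarrow> nat \<Rightarrow> nat list set" where
  "multiindices_upto n r = {I \<in> multiindices n. weight I \<le> r}"

text \<open>The value at the empty list is irrelevant, here and for \<open>nc_commutator\<close> below.\<close>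

fun commutator :: "(nat \<Rightarrow> 'a \<Rightarrow> 'a) \<Rightarrow> nat list \<Rightarrow> 'a \<Rightarrow> 'a::real_normed_vector" where
  "commutator X [] = (\<lambda>x. 0)"
| "commutator X [i] = X i"
| "commutator X (i # j # I) = lie_bracket (X i) (commutator X (j # I))"

definition hormander ::
    "nat \<Rightarrow> nat \<Rightarrow> 'a::euclidean_space set \<Rightarrow> (nat \<Rightarrow> 'a \<Rightarrow> 'a) \<Rightarrow> bool" where
  "hormander n r S X \<longleftrightarrow>
     (\<forall>x\<in>S. span ((\<lambda>I. commutator X I x) ` multiindices_upto n r) = UNIV)"


section \<open>Freeness up to a given weight\<close>

text \<open>A noncommutative polynomial is represented by the function sending a word \<open>J\<close> to the
  coefficient of the monomial \<open>\<xi>\<^sub>J\<close>; then \<open>nc_commutator I J\<close> is the number \<open>A\<^sub>I\<^sub>J\<close>.\<close>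

definition nc_var :: "nat \<Rightarrow> nat list \<Rightarrow> real" where
  "nc_var i J = (if J = [i] then 1 else 0)"

definition nc_mult ::
    "(nat list \<Rightarrow> real) \<Rightarrow> (nat list \<Rightarrow> real) \<Rightarrow> nat list \<Rightarrow> real" where
  "nc_mult P Q J = (\<Sum>k\<le>length J. P (take k J) * Q (drop k J))"

fun nc_commutator :: "nat list \<Rightarrow> nat list \<Rightarrow> real" where
  "nc_commutator [] = (\<lambda>J. 0)"
| "nc_commutator [i] = nc_var i"
| "nc_commutator (i # j # I) =
     (\<lambda>J. nc_mult (nc_var i) (nc_commutator (j # I)) J
        - nc_mult (nc_commutator (j # I)) (nc_var i) J)"

definition free_upto ::
    "nat \<Rightarrow> nat \<Rightarrow> 'a::euclidean_space set \<Rightarrow> (nat \<Rightarrow> 'a \<Rightarrow> 'a) \<Rightarrow> bool" where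
  "free_upto n r S X \<longleftrightarrow> (\<forall>x\<in>S. \<forall>a :: nat list \<Rightarrow> real.
     (\<Sum>I\<in>multiindices_upto n r. a I *\<^sub>R commutator X I x) = 0 \<longrightarrow>
     (\<forall>J. (\<Sum>I\<in>multiindices_upto n r. a I * nc_commutator I J) = 0))"

text \<open>The set of \<open>p\<close> multiindices selecting a basis is given as an injective family \<open>B\<close> indexed by
  the index type of \<open>real^'p\<close>, so that the coordinate \<open>u\<^sub>I\<close> with \<open>I = B j\<close> is \<open>u $ j\<close>.\<close>

definition basis_multiindices :: "nat \<Rightarrow> nat \<Rightarrow> (real^'p) set \<Rightarrow>
    (nat \<Rightarrow> real^'p \<Rightarrow> real^'p) \<Rightarrow> ('p::finite \<Rightarrow> nat list) \<Rightarrow> bool" where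
  "basis_multiindices n r S X B \<longleftrightarrow> inj B \<and> range B \<subseteq> multiindices_upto n r \<and>
     (\<forall>x\<in>S. inj (\<lambda>j. commutator X (B j) x) \<and>
        independent (range (\<lambda>j. commutator X (B j) x)) \<and>
        span (range (\<lambda>j. commutator X (B j) x)) = UNIV)"


section \<open>Smooth approximating fields and regularized canonical coordinates\<close>

primrec iterated_partial :: "'p list \<Rightarrow> (real^'p \<Rightarrow> real) \<Rightarrow> real^'p::finite \<Rightarrow> real" where
  "iterated_partial [] f = f"
| "iterated_partial (j # js) f =
     (\<lambda>x. frechet_derivative (iterated_partial js f) (at x) (axis j 1))"

text \<open>The sum runs over ordered tuples of directions, whence the factor \<open>1 / k!\<close> in place of
  the multinomial one.\<close>

definition taylor_poly ::
    "nat \<Rightarrow> (real^'p \<Rightarrow> real) \<Rightarrow> real^'p \<Rightarrow> real^'p::finite \<Rightarrow> real" where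
  "taylor_poly m f y x =
     (\<Sum>js | length js \<le> m.
        iterated_partial js f y * prod_list (map (\<lambda>j. x $ j - y $ j) js) / fact (length js))"

definition approx_field ::
    "nat \<Rightarrow> (nat \<Rightarrow> real^'p \<Rightarrow> real^'p) \<Rightarrow> real^'p \<Rightarrow> nat \<Rightarrow> real^'p \<Rightarrow> real^'p::finite" where
  "approx_field r X y i x =
     (\<chi> j. taylor_poly (r - field_weight i) (\<lambda>z. X i z $ j) y x)"

text \<open>\<open>z\<close> is the value at time 1 of an integral curve of \<open>Z\<close> which starts at \<open>y\<close>; such a curve
  need not exist up to time 1 in general.\<close>

definition is_exp :: "('a \<Rightarrow> 'a) \<Rightarrow> 'a \<Rightarrow> 'a::real_normed_vector \<Rightarrow> bool" where
  "is_exp Z y z \<longleftrightarrow> (\<exists>\<phi>. \<phi> 0 = y \<and> \<phi> 1 = z \<and>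
     (\<forall>t\<in>{0..1::real}. (\<phi> has_vector_derivative Z (\<phi> t)) (at t within {0..1})))"

definition vf_exp :: "('a \<Rightarrow> 'a) \<Rightarrow> 'a \<Rightarrow> 'a::real_normed_vector" where
  "vf_exp Z y = (THE z. is_exp Z y z)"

definition canonical_field :: "nat \<Rightarrow> (nat \<Rightarrow> real^'p \<Rightarrow> real^'p) \<Rightarrow> ('p \<Rightarrow> nat list) \<Rightarrow>
    real^'p \<Rightarrow> real^'p \<Rightarrow> real^'p \<Rightarrow> real^'p::finite" where
  "canonical_field r X B y u x = (\<Sum>j\<in>UNIV. (u $ j) *\<^sub>R commutator (approx_field r X y) (B j) x)"

definition canonical_exp :: "nat \<Rightarrow> (nat \<Rightarrow> real^'p \<Rightarrow> real^'p) \<Rightarrow> ('p \<Rightarrow> nat list) \<Rightarrow>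
    real^'p \<Rightarrow> real^'p \<Rightarrow> real^'p::finite" where
  "canonical_exp r X B y u = vf_exp (canonical_field r X B y u) y"


section \<open>Weight of a vector field\<close>

definition hom_norm :: "('p \<Rightarrow> nat list) \<Rightarrow> real^'p::finite \<Rightarrow> real" where
  "hom_norm B u = (\<Sum>j\<in>UNIV. \<bar>u $ j\<bar> powr (1 / real (weight (B j))))"

text \<open>\<open>Z\<close> is expressed in the coordinates \<open>u\<close>. Since \<open>0 powr a = 0\<close> also for \<open>a \<le> 0\<close>, the bound
  at the origin is imposed for positive exponents only; for exponents \<open>\<le> 0\<close> it would be void.\<close>

definition vf_weight_ge :: "('p \<Rightarrow> nat list) \<Rightarrow> real \<Rightarrow> (real^'p \<Rightarrow> real^'p::finite) \<Rightarrow> bool" where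
  "vf_weight_ge B k Z \<longleftrightarrow> (\<exists>N C. open N \<and> 0 \<in> N \<and>
     (\<forall>u\<in>N. \<forall>j. u \<noteq> 0 \<or> 0 < k + real (weight (B j)) \<longrightarrow>
        \<bar>Z u $ j\<bar> \<le> C * hom_norm B u powr (k + real (weight (B j)))))"


section \<open>The homogeneous group and its left invariant fields\<close>

definition dilation :: "('p \<Rightarrow> nat list) \<Rightarrow> real \<Rightarrow> real^'p \<Rightarrow> real^'p::finite" where
  "dilation B s u = (\<chi> j. s ^ weight (B j) * u $ j)"

definition left_invariant ::
    "('a \<Rightarrow> 'a \<Rightarrow> 'a) \<Rightarrow> ('a::euclidean_space \<Rightarrow> 'a) \<Rightarrow> bool" where
  "left_invariant gm V \<longleftrightarrow> (\<forall>f v u. smooth_on UNIV f \<longrightarrow>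
     vf_apply V (f \<circ> gm v) u = vf_apply V f (gm v u))"

definition homogeneous_field ::
    "('p \<Rightarrow> nat list) \<Rightarrow> nat \<Rightarrow> (real^'p \<Rightarrow> real^'p::finite) \<Rightarrow> bool" where
  "homogeneous_field B d V \<longleftrightarrow> (\<forall>f s u. smooth_on UNIV f \<longrightarrow> 0 < s \<longrightarrow>
     vf_apply V (f \<circ> dilation B s) u = s ^ d * vf_apply V f (dilation B s u))"

text \<open>\<open>gm\<close> is the group law; \<open>group gm 0 uminus\<close> includes that \<open>- u\<close> is the inverse of \<open>u\<close>.\<close>

definition homogeneous_group :: "nat \<Rightarrow> nat \<Rightarrow> ('p::finite \<Rightarrow> nat list) \<Rightarrow>
    (real^'p \<Rightarrow> real^'p \<Rightarrow> real^'p) \<Rightarrow> (nat \<Rightarrow> real^'p \<Rightarrow> real^'p) \<Rightarrow> bool" where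
  "homogeneous_group n r B gm Y \<longleftrightarrow>
     group gm 0 uminus \<and> smooth_on UNIV (\<lambda>(u, v). gm u v) \<and>
     (\<forall>s>0. \<forall>u v. dilation B s (gm u v) = gm (dilation B s u) (dilation B s v)) \<and>
     (\<forall>i\<le>n. smooth_on UNIV (Y i)) \<and>
     free_upto n r UNIV Y \<and> hormander n r UNIV Y \<and>
     (\<forall>I\<in>multiindices n. left_invariant gm (commutator Y I) \<and>
        homogeneous_field B (weight I) (commutator Y I)) \<and>
     (\<forall>j. commutator Y (B j) 0 = axis j 1) \<and>
     (\<forall>u. u = (\<Sum>j\<in>UNIV. (u $ j) *\<^sub>R commutator Y (B j) u))"

end

theory Submission
  imports Defs "HOL-Complex_Analysis.Cauchy_Integral_Formula"
begin

text \<open>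
  Let \<open>E y\<close> be the exponential of the approximating fields \<open>S\<close> and \<open>\<Theta> y\<close> its inverse. In the coordinates
  \<open>u\<close> the field \<open>X\<^sub>I\<close> has the coefficients \<open>(DE\<^sub>y)\<^sup>-\<^sup>1 X\<^sub>I \<circ> E\<^sub>y\<close>, so the formula holds with
  \<open>R\<^sub>y\<^sub>,\<^sub>I = (DE\<^sub>y)\<^sup>-\<^sup>1 X\<^sub>I \<circ> E\<^sub>y - Y\<^sub>I\<close>, whose regularity is that of \<open>X\<^sub>I\<close>. For the weight, split off the
  contribution of \<open>X\<^sub>I - S\<^sub>I\<close>: its derivatives of order \<open>\<le> r - |I|\<close> vanish at \<open>y\<close>. What remains compares
  the fields \<open>S\<close> and \<open>Y\<close>, each in its own canonical coordinates. Since \<open>Y\<close> is free, the brackets of both frames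
  obey the same universal structure constants up to weight \<open>r\<close>, and each frame is governed by the
  transport equation of its structure functions along rays; a bootstrap in powers of the homogeneous norm shows that
  the two solutions differ by one power more than either of them vanishes.

  The coefficients of the approximating fields are polynomials in \<open>x\<close> that depend on \<open>y\<close> in a Hoelder continuous way. Picard
  iteration for complex polynomials therefore yields \<open>E y u\<close> on a ball that is locally uniform in \<open>y\<close>, and \<open>E\<close> and its
  first derivatives in \<open>u\<close> are Hoelder continuous in \<open>y\<close>. That the domains of \<open>\<Theta>\<close> are open in \<open>(x, y)\<close> follows
  from invariance of domain, as \<open>E\<close> is merely continuous in \<open>y\<close>.
\<close>

section \<open>Calculus of regularity classes\<close>

text \<open>The weight \<alpha> - |I| arises for two reasons. The Taylor error X_I - S_I has size
  ||u|| to the power r - |I| + \<alpha>, and |J| \<le> r makes this sufficient for every component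
  J; the comparison of S with Y gives |J| - |I| + 1, and \<alpha> \<le> 1. The obstacle is that no
  universal relation is available for brackets of total weight above r. In the transport equation,
  however, every structure function with indices i, j, k is multiplied by the coordinate u_i: if w_i
  + w_j > r, then w_i exceeds w_k - w_j, so a merely bounded structure function is harmless. Nothing
  can be differentiated in y, which rules out the usual theory of smooth dependence on parameters.
  Derivatives in u are controlled by sup norms on complex balls instead, which is why real
  polynomials are evaluated at complex points. Constants are kept uniform for y in small balls,
  since the domains must be open in both variables and the Hoelder constants locally
  uniform.\<close>

primrec Ck :: "(('a::euclidean_space \<Rightarrow> 'b::real_normed_vector) \<Rightarrow> bool) \<Rightarrow> nat \<Rightarrow> 'a set \<Rightarrow>
    ('a \<Rightarrow> 'b) \<Rightarrow> bool" where
  "Ck P 0 S f \<longleftrightarrow> P f"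
| "Ck P (Suc k) S f \<longleftrightarrow> (\<forall>x\<in>S. f differentiable (at x)) \<and>
     (\<forall>v\<in>Basis. Ck P k S (\<lambda>x. frechet_derivative f (at x) v))"

lemma C_on_eq_Ck: "C_on k S f = Ck (continuous_on S) k S f"
  by (induction k arbitrary: f) auto

lemma C_holder_on_eq_Ck: "C_holder_on \<alpha> k S f = Ck (locally_holder_on \<alpha> S) k S f"
  by (induction k arbitrary: f) auto

lemma frechet_derivative_unique:
  "(f has_derivative f') (at x) \<Longrightarrow> frechet_derivative f (at x) = f'"
  using frechet_derivative_at by metis

lemma frechet_derivative_has_derivative:
  "f differentiable (at x) \<Longrightarrow> (f has_derivative frechet_derivative f (at x)) (at x)"
  using frechet_derivative_works by blast

lemma frechet_derivative_Basis_sum: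
  fixes f :: "'a::euclidean_space \<Rightarrow> 'b::real_normed_vector"
  assumes "f differentiable (at x)"
  shows "frechet_derivative f (at x) h = (\<Sum>b\<in>Basis. (h \<bullet> b) *\<^sub>R frechet_derivative f (at x) b)"
proof -
  interpret linear "frechet_derivative f (at x)"
    using assms linear_frechet_derivative by blast
  have "frechet_derivative f (at x) (\<Sum>b\<in>Basis. (h \<bullet> b) *\<^sub>R b) =
      (\<Sum>b\<in>Basis. (h \<bullet> b) *\<^sub>R frechet_derivative f (at x) b)"
    by (simp add: sum scale)
  then show ?thesis by (simp add: euclidean_representation)
qed

lemma norm_frechet_derivative_le:
  fixes f :: "'a::euclidean_space \<Rightarrow> 'b::real_normed_vector"
  assumes "f differentiable (at x)"
    and "\<And>b. b \<in> Basis \<Longrightarrow> norm (frechet_derivative f (at x) b) \<le> C"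
  shows "norm (frechet_derivative f (at x) h) \<le> real DIM('a) * C * norm h"
proof -
  have "norm (frechet_derivative f (at x) h) \<le> (\<Sum>b\<in>Basis. norm ((h \<bullet> b) *\<^sub>R frechet_derivative f (at x) b))"
    by (subst frechet_derivative_Basis_sum[OF assms(1)]) (rule norm_sum)
  also have "\<dots> \<le> (\<Sum>b\<in>(Basis::'a set). norm h * C)"
    by (intro sum_mono) (auto intro!: mult_mono assms(2) Basis_le_norm)
  finally show ?thesis by (simp add: mult_ac)
qed

lemma lipschitz_from_partials:
  fixes f :: "'a::euclidean_space \<Rightarrow> 'b::real_normed_vector"
  assumes "convex S" "\<And>x. x \<in> S \<Longrightarrow> f differentiable (at x)"
    and "\<And>x b. x \<in> S \<Longrightarrow> b \<in> Basis \<Longrightarrow> norm (frechet_derivative f (at x) b) \<le> C"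
    and "y \<in> S" "z \<in> S"
  shows "norm (f y - f z) \<le> real DIM('a) * C * norm (y - z)"
proof (rule differentiable_bound[OF assms(1) _ _ assms(4,5), rotated])
  show "onorm (frechet_derivative f (at x)) \<le> real DIM('a) * C" if "x \<in> S" for x
    by (rule onorm_le) (simp add: norm_frechet_derivative_le assms(2,3) that)
  show "(f has_derivative frechet_derivative f (at x)) (at x within S)" if "x \<in> S" for x
    using assms(2)[OF that] frechet_derivative_has_derivative has_derivative_at_withinI by blast
qed

text \<open>\<open>P\<close> is either continuity or local Hoelder continuity on \<open>S\<close>; the classes \<open>C_on k\<close> and
  \<open>C_holder_on \<alpha> k\<close> are obtained from it by demanding \<open>P\<close> of all derivatives of order \<open>k\<close>.\<close>

locale regularity =
  fixes S :: "'a::euclidean_space set" and P :: "('a \<Rightarrow> real) \<Rightarrow> bool"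
  assumes open_S: "open S"
    and P_cong: "\<lbrakk>P f; \<And>x. x \<in> S \<Longrightarrow> f x = g x\<rbrakk> \<Longrightarrow> P g"
    and P_const: "P (\<lambda>x. c)"
    and P_add: "\<lbrakk>P f; P g\<rbrakk> \<Longrightarrow> P (\<lambda>x. f x + g x)"
    and P_mult: "\<lbrakk>P f; P g\<rbrakk> \<Longrightarrow> P (\<lambda>x. f x * g x)"
    and P_recip: "\<lbrakk>P f; \<And>x. x \<in> S \<Longrightarrow> f x \<noteq> 0\<rbrakk> \<Longrightarrow> P (\<lambda>x. inverse (f x))"
    and P_C1: "\<lbrakk>\<And>x. x \<in> S \<Longrightarrow> f differentiable (at x);
                \<And>v. v \<in> Basis \<Longrightarrow> P (\<lambda>x. frechet_derivative f (at x) v)\<rbrakk> \<Longrightarrow> P f"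
begin

lemma differentiable_cong:
  assumes "x \<in> S" "\<And>x. x \<in> S \<Longrightarrow> f x = g x" "(f has_derivative f') (at x)"
  shows "(g has_derivative f') (at x)"
  using has_derivative_transform_within_open[OF assms(3) open_S assms(1,2)] .

lemma Ck_cong:
  assumes "Ck P k S f" "\<And>x. x \<in> S \<Longrightarrow> f x = g x"
  shows "Ck P k S g"
  using assms
proof (induction k arbitrary: f g)
  case 0
  then show ?case using P_cong by auto
next
  case (Suc k)
  have 1: "(g has_derivative frechet_derivative f (at x)) (at x)" if "x \<in> S" for x
    by (rule differentiable_cong[OF that Suc.prems(2)])
      (use Suc.prems(1) that frechet_derivative_has_derivative in auto)
  have "frechet_derivative f (at x) v = frechet_derivative g (at x) v" if "x \<in> S" for x v
    using frechet_derivative_unique[OF 1[OF that]] by simp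
  moreover have "Ck P k S (\<lambda>x. frechet_derivative f (at x) v)" if "v \<in> Basis" for v
    using Suc.prems(1) that by auto
  ultimately have "Ck P k S (\<lambda>x. frechet_derivative g (at x) v)" if "v \<in> Basis" for v
    using Suc.IH[of "\<lambda>x. frechet_derivative f (at x) v" "\<lambda>x. frechet_derivative g (at x) v"] that
    by blast
  moreover have "\<forall>x\<in>S. g differentiable (at x)"
    using 1 differentiableI by blast
  ultimately show ?case by simp
qed

lemma Ck_SucI:
  assumes "\<And>x. x \<in> S \<Longrightarrow> (f has_derivative f' x) (at x)"
    and "\<And>v. v \<in> Basis \<Longrightarrow> Ck P k S (\<lambda>x. f' x v)"
  shows "Ck P (Suc k) S f"
proof -
  have "Ck P k S (\<lambda>x. frechet_derivative f (at x) v)" if "v \<in> Basis" for v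
    using Ck_cong[OF assms(2)[OF that]] frechet_derivative_unique[OF assms(1)] by simp
  then show ?thesis using assms(1) by (auto simp: differentiable_def)
qed

text \<open>The classes are nested as soon as this holds at level 0, where it is
  \<open>P_C1\<close>; the induction only carries the claim down to the derivatives of top
  order.\<close>

lemma Ck_Suc_imp: "Ck P (Suc k) S f \<Longrightarrow> Ck P k S f"
proof (induction k arbitrary: f)
  case 0
  then show ?case using P_C1 by simp
next
  case (Suc k)
  then show ?case by (metis Ck.simps(2))
qed

lemma Ck_mono: "Ck P k S f \<Longrightarrow> l \<le> k \<Longrightarrow> Ck P l S f"
  by (induction k) (auto simp: le_Suc_eq Ck_Suc_imp simp del: Ck.simps(2))

lemma Ck_const: "Ck P k S (\<lambda>x. c)"
proof (induction k arbitrary: c)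
  case 0
  then show ?case by (simp add: P_const)
next
  case (Suc k)
  show ?case by (rule Ck_SucI[of _ "\<lambda>x h. 0"]) (use Suc in \<open>auto\<close>)
qed

lemma Ck_add: "\<lbrakk>Ck P k S f; Ck P k S g\<rbrakk> \<Longrightarrow> Ck P k S (\<lambda>x. f x + g x)"
proof (induction k arbitrary: f g)
  case 0
  then show ?case by (simp add: P_add)
next
  case (Suc k)
  show ?case
    by (rule Ck_SucI[of _ "\<lambda>x h. frechet_derivative f (at x) h + frechet_derivative g (at x) h"])
      (use Suc in \<open>auto intro!: has_derivative_add frechet_derivative_has_derivative\<close>)
qed

lemma Ck_mult: "\<lbrakk>Ck P k S f; Ck P k S g\<rbrakk> \<Longrightarrow> Ck P k S (\<lambda>x. f x * g x)"
proof (induction k arbitrary: f g)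
  case 0
  then show ?case by (simp add: P_mult)
next
  case (Suc k)
  have "Ck P k S f" "Ck P k S g" using Suc.prems Ck_Suc_imp by blast+
  then show ?case
    by (intro Ck_SucI[of _ "\<lambda>x h. f x * frechet_derivative g (at x) h + frechet_derivative f (at x) h * g x"])
      (use Suc in \<open>auto intro!: has_derivative_mult frechet_derivative_has_derivative Ck_add\<close>)
qed

lemma Ck_cmult: "Ck P k S f \<Longrightarrow> Ck P k S (\<lambda>x. c * f x)"
  by (intro Ck_mult Ck_const)

lemma Ck_minus: "Ck P k S f \<Longrightarrow> Ck P k S (\<lambda>x. - f x)"
  using Ck_cmult[of k f "-1"] by simp

lemma Ck_diff: "\<lbrakk>Ck P k S f; Ck P k S g\<rbrakk> \<Longrightarrow> Ck P k S (\<lambda>x. f x - g x)"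
  using Ck_add[of k f "\<lambda>x. - g x"] Ck_minus[of k g] by simp

lemma Ck_sum: "(\<And>i. i \<in> I \<Longrightarrow> Ck P k S (f i)) \<Longrightarrow> Ck P k S (\<lambda>x. \<Sum>i\<in>I. f i x)"
  by (induction I rule: infinite_finite_induct) (auto intro: Ck_const Ck_add)

lemma Ck_prod: "(\<And>i. i \<in> I \<Longrightarrow> Ck P k S (f i)) \<Longrightarrow> Ck P k S (\<lambda>x. \<Prod>i\<in>I. f i x)"
  by (induction I rule: infinite_finite_induct) (auto intro: Ck_const Ck_mult)

lemma Ck_recip:
  "\<lbrakk>Ck P k S f; \<And>x. x \<in> S \<Longrightarrow> f x \<noteq> 0\<rbrakk> \<Longrightarrow> Ck P k S (\<lambda>x. inverse (f x))"
proof (induction k arbitrary: f)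
  case 0
  then show ?case by (simp add: P_recip)
next
  case (Suc k)
  have "Ck P k S f" using Suc.prems Ck_Suc_imp by blast
  then have "Ck P k S (\<lambda>x. inverse (f x))" using Suc by blast
  then show ?case
    by (intro Ck_SucI[of _ "\<lambda>x h. - (inverse (f x) * frechet_derivative f (at x) h * inverse (f x))"])
      (use Suc in \<open>auto intro!: Deriv.has_derivative_inverse frechet_derivative_has_derivative Ck_minus Ck_mult\<close>)
qed

lemma Ck_inner: "Ck P k S (\<lambda>x. x \<bullet> b)"
proof -
  have "Ck P (Suc k) S (\<lambda>x. x \<bullet> b)"
    by (rule Ck_SucI[of _ "\<lambda>x h. h \<bullet> b"]) (auto intro!: Ck_const derivative_eq_intros)
  then show ?thesis by (rule Ck_Suc_imp)
qed

end

text \<open>By the chain rule a derivative of \<open>f (g x)\<close> is a sum of products of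
  partials of \<open>g\<close> with partials of \<open>f\<close> at \<open>g x\<close>, which are
  again composites with one order less; hence the induction over \<open>k\<close> for all
  \<open>f\<close> at once. Only at level 0 must \<open>P\<close> be transported along
  \<open>g\<close>, so the inner and the outer function may have different domains and
  predicates.\<close>

lemma Ck_compose:
  assumes "regularity S P" "regularity T Q" and im: "\<And>x. x \<in> T \<Longrightarrow> g x \<in> S"
    and PQ: "\<And>f. P f \<Longrightarrow> Q (\<lambda>x. f (g x))"
    and g: "\<And>b. b \<in> Basis \<Longrightarrow> Ck Q k T (\<lambda>x. g x \<bullet> b)"
    and f: "Ck P k S f"
  shows "Ck Q k T (\<lambda>x. f (g x))"
  using g f
proof (induction k arbitrary: f)
  case 0
  then show ?case using PQ by simp
next
  case (Suc k)
  interpret S: regularity S P by fact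
  interpret T: regularity T Q by fact
  let ?g' = "\<lambda>x h. \<Sum>b\<in>Basis. frechet_derivative (\<lambda>x. g x \<bullet> b) (at x) h *\<^sub>R b"
  have dg: "(g has_derivative ?g' x) (at x)" if "x \<in> T" for x
    unfolding has_derivative_componentwise_within[of g]
    using that Suc.prems(1)
    by (auto simp: inner_sum_left inner_Basis if_distrib cong: if_cong
        intro!: frechet_derivative_has_derivative)
  have df: "(f has_derivative frechet_derivative f (at (g x))) (at (g x))" if "x \<in> T" for x
    using Suc.prems(2) im[OF that] frechet_derivative_has_derivative by auto
  have "((\<lambda>x. f (g x)) has_derivative (\<lambda>h. frechet_derivative f (at (g x)) (?g' x h))) (at x)"
    if "x \<in> T" for x
    using has_derivative_compose[OF dg df] that by simp
  moreover have "frechet_derivative f (at (g x)) (?g' x h) =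
      (\<Sum>b\<in>Basis. frechet_derivative (\<lambda>x. g x \<bullet> b) (at x) h * frechet_derivative f (at (g x)) b)"
    if "x \<in> T" for x h
    using frechet_derivative_Basis_sum[of f "g x" "?g' x h"] Suc.prems(2) im[OF that]
    by (simp add: inner_sum_left inner_Basis if_distrib cong: if_cong)
  ultimately have 1: "((\<lambda>x. f (g x)) has_derivative (\<lambda>h. \<Sum>b\<in>Basis.
      frechet_derivative (\<lambda>x. g x \<bullet> b) (at x) h * frechet_derivative f (at (g x)) b)) (at x)"
    if "x \<in> T" for x
    using that by simp
  show ?case
  proof (rule T.Ck_SucI[OF 1])
    fix v :: 'b assume v: "v \<in> Basis"
    have "Ck Q k T (\<lambda>x. frechet_derivative f (at (g x)) b)" if "b \<in> Basis" for b
    proof (rule Suc.IH[of "\<lambda>z. frechet_derivative f (at z) b"])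
      show "Ck Q k T (\<lambda>x. g x \<bullet> b)" if "b \<in> Basis" for b
        using Suc.prems(1)[OF that] by (rule T.Ck_Suc_imp)
      show "Ck P k S (\<lambda>z. frechet_derivative f (at z) b)" using Suc.prems(2) that by simp
    qed
    moreover have "Ck Q k T (\<lambda>x. frechet_derivative (\<lambda>x. g x \<bullet> b) (at x) v)" if "b \<in> Basis" for b
      using Suc.prems(1)[OF that] v by simp
    ultimately show "Ck Q k T (\<lambda>x. \<Sum>b\<in>Basis.
      frechet_derivative (\<lambda>x. g x \<bullet> b) (at x) v * frechet_derivative f (at (g x)) b)"
      by (intro T.Ck_sum T.Ck_mult)
  qed
qed

lemma Ck_componentwise:
  fixes f :: "'a::euclidean_space \<Rightarrow> 'b::euclidean_space"
  assumes "regularity S Q" and PQ: "\<And>f. P f \<longleftrightarrow> (\<forall>b\<in>Basis. Q (\<lambda>x. f x \<bullet> b))"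
  shows "Ck P k S f \<longleftrightarrow> (\<forall>b\<in>Basis. Ck Q k S (\<lambda>x. f x \<bullet> b))"
proof (induction k arbitrary: f)
  case 0
  then show ?case using PQ by simp
next
  case (Suc k)
  interpret regularity S Q by fact
  have diff: "f differentiable (at x) \<longleftrightarrow> (\<forall>b\<in>Basis. (\<lambda>x. f x \<bullet> b) differentiable (at x))" for x
    using differentiable_componentwise_within by blast
  have "frechet_derivative f (at x) v \<bullet> b = frechet_derivative (\<lambda>x. f x \<bullet> b) (at x) v"
    if "f differentiable (at x)" for x v b
  proof -
    have "((\<lambda>x. f x \<bullet> b) has_derivative (\<lambda>h. frechet_derivative f (at x) h \<bullet> b)) (at x)"
      using frechet_derivative_has_derivative[OF that] by (auto intro!: derivative_eq_intros)
    then show ?thesis using frechet_derivative_unique by metis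
  qed
  note inner_eq = this
  have "Ck Q k S (\<lambda>x. frechet_derivative f (at x) v \<bullet> b) \<longleftrightarrow>
      Ck Q k S (\<lambda>x. frechet_derivative (\<lambda>x. f x \<bullet> b) (at x) v)"
    if d: "\<forall>x\<in>S. f differentiable (at x)" for v b
  proof
    assume "Ck Q k S (\<lambda>x. frechet_derivative f (at x) v \<bullet> b)"
    then show "Ck Q k S (\<lambda>x. frechet_derivative (\<lambda>x. f x \<bullet> b) (at x) v)"
      by (rule Ck_cong) (rule inner_eq, use d in blast)
  next
    assume "Ck Q k S (\<lambda>x. frechet_derivative (\<lambda>x. f x \<bullet> b) (at x) v)"
    then show "Ck Q k S (\<lambda>x. frechet_derivative f (at x) v \<bullet> b)"
      by (rule Ck_cong) (rule inner_eq[symmetric], use d in blast)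
  qed
  then show ?case
    using Suc.IH[of "\<lambda>x. frechet_derivative f (at x) v" for v] diff by (simp; blast)
qed

subsection \<open>The two instances\<close>

lemma regularity_continuous: "open S \<Longrightarrow> regularity S (continuous_on S)"
proof (unfold_locales, goal_cases)
  case (2 f g)
  then show ?case using continuous_on_cong by metis
next
  case (6 f)
  then show ?case by (auto intro: continuous_on_inverse)
next
  case (7 f)
  then show ?case
    by (meson continuous_at_imp_continuous_on differentiable_imp_continuous_within)
qed (auto intro: continuous_intros)

lemma locally_holder_onE:
  assumes "locally_holder_on \<alpha> S f" "x \<in> S"
  obtains \<epsilon> C where "\<epsilon> > 0" "C \<ge> 0"
    "\<And>y z. \<lbrakk>y \<in> S; z \<in> S; dist x y < \<epsilon>; dist x z < \<epsilon>\<rbrakk> \<Longrightarrow> dist (f y) (f z) \<le> C * dist y z powr \<alpha>"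
proof -
  obtain \<epsilon> C where "\<epsilon> > 0"
    and *: "\<forall>y\<in>S \<inter> ball x \<epsilon>. \<forall>z\<in>S \<inter> ball x \<epsilon>. dist (f y) (f z) \<le> C * dist y z powr \<alpha>"
    using assms unfolding locally_holder_on_def by blast
  have 1: "dist (f y) (f z) \<le> C * dist y z powr \<alpha>"
    if "y \<in> S" "z \<in> S" "dist x y < \<epsilon>" "dist x z < \<epsilon>" for y z
    using * that by simp
  have "dist (f y) (f z) \<le> max C 0 * dist y z powr \<alpha>" if "y \<in> S" "z \<in> S" "dist x y < \<epsilon>" "dist x z < \<epsilon>" for y z
    using 1[OF that] by (rule order_trans) (auto intro!: mult_right_mono)
  then show ?thesis using that[of \<epsilon> "max C 0"] \<open>\<epsilon> > 0\<close> by auto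
qed

lemma locally_holder_onI:
  assumes "\<And>x. x \<in> S \<Longrightarrow> \<exists>\<epsilon>>0. \<exists>C. \<forall>y z. y \<in> S \<longrightarrow> z \<in> S \<longrightarrow> dist x y < \<epsilon> \<longrightarrow> dist x z < \<epsilon> \<longrightarrow> dist (f y) (f z) \<le> C * dist y z powr \<alpha>"
  shows "locally_holder_on \<alpha> S f"
  unfolding locally_holder_on_def
proof
  fix x assume "x \<in> S"
  from assms[OF this] obtain \<epsilon> C where "\<epsilon> > 0"
    and *: "\<forall>y z. y \<in> S \<longrightarrow> z \<in> S \<longrightarrow> dist x y < \<epsilon> \<longrightarrow> dist x z < \<epsilon> \<longrightarrow> dist (f y) (f z) \<le> C * dist y z powr \<alpha>"
    by blast
  then show "\<exists>\<epsilon>>0. \<exists>C. \<forall>y\<in>S \<inter> ball x \<epsilon>. \<forall>z\<in>S \<inter> ball x \<epsilon>. dist (f y) (f z) \<le> C * dist y z powr \<alpha>"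
    by (intro exI[of _ \<epsilon>] conjI exI[of _ C] ballI) simp_all
qed

lemma powr_le_powr_of_dist_le_1:
  fixes d :: real assumes "0 \<le> d" "d \<le> 1" "\<alpha> \<le> 1" shows "d \<le> d powr \<alpha>"
proof (cases "d = 0")
  case False
  then have "d powr 1 \<le> d powr \<alpha>" using assms by (intro powr_mono') auto
  then show ?thesis using assms by simp
qed simp

lemma locally_holder_imp_continuous:
  assumes "0 < \<alpha>" "locally_holder_on \<alpha> S f"
  shows "continuous_on S f"
  unfolding continuous_on_def
proof
  fix x assume x: "x \<in> S"
  obtain \<epsilon> C where e: "\<epsilon> > 0" "C \<ge> 0"
    "\<And>y z. \<lbrakk>y \<in> S; z \<in> S; dist x y < \<epsilon>; dist x z < \<epsilon>\<rbrakk> \<Longrightarrow> dist (f y) (f z) \<le> C * dist y z powr \<alpha>"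
    using locally_holder_onE[OF assms(2) x] by metis
  have "((\<lambda>y. C * dist y x powr \<alpha>) \<longlongrightarrow> C * dist x x powr \<alpha>) (at x within S)"
    using \<open>0 < \<alpha>\<close> by (intro tendsto_intros) auto
  then have lim: "((\<lambda>y. C * dist y x powr \<alpha>) \<longlongrightarrow> 0) (at x within S)" using \<open>0 < \<alpha>\<close> by simp
  have "\<forall>\<^sub>F y in at x within S. dist (f y) (f x) \<le> C * dist y x powr \<alpha>"
    unfolding eventually_at using e x by (intro exI[of _ \<epsilon>]) (auto simp: dist_commute)
  then have "((\<lambda>y. dist (f y) (f x)) \<longlongrightarrow> 0) (at x within S)"
    by (intro tendsto_sandwich[OF _ _ tendsto_const lim]) auto
  then show "(f \<longlongrightarrow> f x) (at x within S)" using tendsto_dist_iff by blast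
qed

text \<open>Continuous partials are bounded near each point, so \<open>f\<close> is Lipschitz there,
  and at small distances this is stronger than a Hoelder bound.\<close>

lemma C1_imp_locally_holder:
  fixes f :: "'a::euclidean_space \<Rightarrow> real"
  assumes "open S" "\<alpha> \<le> 1" and diff: "\<And>x. x \<in> S \<Longrightarrow> f differentiable (at x)"
    and cont: "\<And>v. v \<in> Basis \<Longrightarrow> continuous_on S (\<lambda>x. frechet_derivative f (at x) v)"
  shows "locally_holder_on \<alpha> S f"
  proof (rule locally_holder_onI)
    fix x assume x: "x \<in> S"
    have "\<exists>d>0. \<forall>y\<in>S. dist y x < d \<longrightarrow> \<bar>frechet_derivative f (at y) v\<bar> \<le> \<bar>frechet_derivative f (at x) v\<bar> + 1"
      if "v \<in> Basis" for v
    proof -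
      have "\<exists>d>0. \<forall>y\<in>S. dist y x < d \<longrightarrow> dist (frechet_derivative f (at y) v) (frechet_derivative f (at x) v) < 1"
        using cont[OF that] x unfolding continuous_on_iff
        by (meson zero_less_one)
      then show ?thesis by (fastforce simp: dist_real_def)
    qed
    then obtain d where d: "\<And>v. v \<in> Basis \<Longrightarrow> d v > 0"
      "\<And>v y. v \<in> Basis \<Longrightarrow> y \<in> S \<Longrightarrow> dist y x < d v \<Longrightarrow> \<bar>frechet_derivative f (at y) v\<bar> \<le> \<bar>frechet_derivative f (at x) v\<bar> + 1"
      by metis
    define C where "C = (\<Sum>v\<in>Basis. \<bar>frechet_derivative f (at x) v\<bar> + 1)"
    obtain e where e: "e > 0" "ball x e \<subseteq> S" using open_contains_ball assms(1) x by blast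
    \<comment> \<open>The entry \<open>1/2\<close> bounds the distance of two points of the ball by
      1, the range in which \<open>d \<le> d powr \<alpha>\<close>.\<close>
    define \<epsilon> where "\<epsilon> = min (min e (1/2)) (Min (d ` Basis))"
    have \<epsilon>: "\<epsilon> > 0" "\<epsilon> \<le> e" "\<epsilon> \<le> 1/2" "\<And>v. v \<in> Basis \<Longrightarrow> \<epsilon> \<le> d v"
      unfolding \<epsilon>_def using d(1) e(1) by (auto intro: min.coboundedI2)
    have "dist (f y) (f z) \<le> (real DIM('a) * C) * dist y z powr \<alpha>"
      if "dist x y < \<epsilon>" "dist x z < \<epsilon>" for y z
    proof -
      have "norm (f y - f z) \<le> real DIM('a) * C * norm (y - z)"
      proof (rule lipschitz_from_partials[of "ball x \<epsilon>"])
        show "f differentiable (at w)" if "w \<in> ball x \<epsilon>" for w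
          using diff e \<epsilon>(2) that by (meson mem_ball order_less_le_trans subsetD)
        show "norm (frechet_derivative f (at w) b) \<le> C" if "w \<in> ball x \<epsilon>" "b \<in> Basis" for w b
        proof -
          have "w \<in> S" using e \<epsilon>(2) that by (meson mem_ball order_less_le_trans subsetD)
          then have "\<bar>frechet_derivative f (at w) b\<bar> \<le> \<bar>frechet_derivative f (at x) b\<bar> + 1"
            using d(2)[of b w] that \<epsilon>(4)[of b] by (auto simp: dist_commute)
          also have "\<dots> \<le> C" unfolding C_def
            using that(2) by (intro member_le_sum[of b Basis "\<lambda>v. \<bar>frechet_derivative f (at x) v\<bar> + 1"]) auto
          finally show ?thesis by simp
        qed
      qed (use that in auto)
      also have "\<dots> \<le> real DIM('a) * C * dist y z powr \<alpha>"
      proof (rule mult_left_mono)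
        have "dist y z \<le> dist x y + dist x z" by (metis dist_commute dist_triangle)
        then have "dist y z \<le> 1" using that \<epsilon>(3) by linarith
        then show "norm (y - z) \<le> dist y z powr \<alpha>"
          using powr_le_powr_of_dist_le_1[of "dist y z" \<alpha>] assms(2) by (simp add: dist_norm)
        show "0 \<le> real DIM('a) * C" unfolding C_def by (intro mult_nonneg_nonneg sum_nonneg) auto
      qed
      finally show ?thesis by (simp add: dist_norm)
    qed
    then show "\<exists>\<epsilon>>0. \<exists>C. \<forall>y z. y \<in> S \<longrightarrow> z \<in> S \<longrightarrow> dist x y < \<epsilon> \<longrightarrow> dist x z < \<epsilon> \<longrightarrow> dist (f y) (f z) \<le> C * dist y z powr \<alpha>"
      using \<epsilon>(1) by blast
  qed

lemma regularity_holder: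
  assumes "open S" "0 < \<alpha>" "\<alpha> \<le> 1"
  shows "regularity S (locally_holder_on \<alpha> S)"
proof (unfold_locales, goal_cases)
  case 1
  then show ?case by fact
next
  case (2 f g)
  then show ?case unfolding locally_holder_on_def by (metis Int_iff)
next
  case (3 c)
  then show ?case by (intro locally_holder_onI exI[of _ "1::real"] conjI exI[of _ "0::real"]) auto
next
  case (4 f g)
  show ?case
  proof (rule locally_holder_onI)
    fix x assume x: "x \<in> S"
    obtain e C where e: "e > 0" "C \<ge> 0"
      "\<And>y z. \<lbrakk>y \<in> S; z \<in> S; dist x y < e; dist x z < e\<rbrakk> \<Longrightarrow> dist (f y) (f z) \<le> C * dist y z powr \<alpha>"
      using locally_holder_onE[OF 4(1) x] by metis
    obtain e' C' where e': "e' > 0" "C' \<ge> 0"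
      "\<And>y z. \<lbrakk>y \<in> S; z \<in> S; dist x y < e'; dist x z < e'\<rbrakk> \<Longrightarrow> dist (g y) (g z) \<le> C' * dist y z powr \<alpha>"
      using locally_holder_onE[OF 4(2) x] by metis
    have "dist (f y + g y) (f z + g z) \<le> (C + C') * dist y z powr \<alpha>"
      if "y \<in> S" "z \<in> S" "dist x y < min e e'" "dist x z < min e e'" for y z
      using e(3)[of y z] e'(3)[of y z] that by (simp add: dist_real_def algebra_simps)
    then show "\<exists>\<epsilon>>0. \<exists>C. \<forall>y z. y \<in> S \<longrightarrow> z \<in> S \<longrightarrow> dist x y < \<epsilon> \<longrightarrow> dist x z < \<epsilon> \<longrightarrow> dist (f y + g y) (f z + g z) \<le> C * dist y z powr \<alpha>"
      using e(1) e'(1) by (intro exI[of _ "min e e'"] conjI exI[of _ "C + C'"]) auto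
  qed
next
  case (5 f g)
  show ?case
  proof (rule locally_holder_onI)
    fix x assume x: "x \<in> S"
    obtain e C where e: "e > 0" "C \<ge> 0"
      "\<And>y z. \<lbrakk>y \<in> S; z \<in> S; dist x y < e; dist x z < e\<rbrakk> \<Longrightarrow> dist (f y) (f z) \<le> C * dist y z powr \<alpha>"
      using locally_holder_onE[OF 5(1) x] by metis
    obtain e' C' where e': "e' > 0" "C' \<ge> 0"
      "\<And>y z. \<lbrakk>y \<in> S; z \<in> S; dist x y < e'; dist x z < e'\<rbrakk> \<Longrightarrow> dist (g y) (g z) \<le> C' * dist y z powr \<alpha>"
      using locally_holder_onE[OF 5(2) x] by metis
    \<comment> \<open>Within distance 1 the Hoelder estimate also bounds the oscillation by its
      constant. This yields the sup bounds \<open>A\<close> and \<open>A'\<close> for the product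
      rule.\<close>
    define d where "d = min (min e e') 1"
    define A where "A = \<bar>f x\<bar> + C"
    define A' where "A' = \<bar>g x\<bar> + C'"
    have pw: "dist x y powr \<alpha> \<le> 1" if "dist x y < d" for y
      using that \<open>0 < \<alpha>\<close> unfolding d_def by (intro powr_le1) auto
    have bf: "\<bar>f y\<bar> \<le> A" if "y \<in> S" "dist x y < d" for y
      using e(3)[of x y] that x \<open>e > 0\<close> mult_left_mono[OF pw[OF that(2)] e(2)] unfolding A_def d_def
      by (auto simp: dist_real_def)
    have bg: "\<bar>g y\<bar> \<le> A'" if "y \<in> S" "dist x y < d" for y
      using e'(3)[of x y] that x \<open>e' > 0\<close> mult_left_mono[OF pw[OF that(2)] e'(2)] unfolding A'_def d_def
      by (auto simp: dist_real_def)
    have "dist (f y * g y) (f z * g z) \<le> (A * C' + A' * C) * dist y z powr \<alpha>"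
      if "y \<in> S" "z \<in> S" "dist x y < d" "dist x z < d" for y z
    proof -
      have "f y * g y - f z * g z = f y * (g y - g z) + g z * (f y - f z)" by (simp add: algebra_simps)
      then have "dist (f y * g y) (f z * g z) \<le> \<bar>f y\<bar> * \<bar>g y - g z\<bar> + \<bar>g z\<bar> * \<bar>f y - f z\<bar>"
        by (metis abs_mult abs_triangle_ineq dist_real_def)
      also have "\<dots> \<le> A * (C' * dist y z powr \<alpha>) + A' * (C * dist y z powr \<alpha>)"
        using e(3)[of y z] e'(3)[of y z] bf bg that e(2) e'(2) unfolding d_def A_def A'_def
        by (intro add_mono mult_mono) (auto simp: dist_real_def)
      finally show ?thesis by (simp add: algebra_simps)
    qed
    then show "\<exists>\<epsilon>>0. \<exists>C. \<forall>y z. y \<in> S \<longrightarrow> z \<in> S \<longrightarrow> dist x y < \<epsilon> \<longrightarrow> dist x z < \<epsilon> \<longrightarrow> dist (f y * g y) (f z * g z) \<le> C * dist y z powr \<alpha>"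
      using e(1) e'(1) unfolding d_def by (intro exI[of _ "min (min e e') 1"] conjI exI[of _ "A * C' + A' * C"]) auto
  qed
next
  case (6 f)
  show ?case
  proof (rule locally_holder_onI)
    fix x assume x: "x \<in> S"
    obtain e C where e: "e > 0" "C \<ge> 0"
      "\<And>y z. \<lbrakk>y \<in> S; z \<in> S; dist x y < e; dist x z < e\<rbrakk> \<Longrightarrow> dist (f y) (f z) \<le> C * dist y z powr \<alpha>"
      using locally_holder_onE[OF 6(1) x] by metis
    have fx: "\<bar>f x\<bar> / 2 > 0" using 6(2)[OF x] by simp
    obtain d where d: "d > 0" "\<And>y. y \<in> S \<Longrightarrow> dist y x < d \<Longrightarrow> dist (f y) (f x) < \<bar>f x\<bar> / 2"
      using locally_holder_imp_continuous[OF assms(2) 6(1)] x fx unfolding continuous_on_iff by blast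
    have low: "\<bar>f y\<bar> \<ge> \<bar>f x\<bar> / 2" if "y \<in> S" "dist x y < d" for y
      using d(2)[of y] that abs_triangle_ineq2[of "f x" "f y"] by (simp add: dist_real_def dist_commute abs_minus_commute)
    have "dist (inverse (f y)) (inverse (f z)) \<le> (C / (\<bar>f x\<bar> / 2) ^ 2) * dist y z powr \<alpha>"
      if "y \<in> S" "z \<in> S" "dist x y < min e d" "dist x z < min e d" for y z
    proof -
      have nz: "f y \<noteq> 0" "f z \<noteq> 0" using 6(2) that by auto
      have "dist (inverse (f y)) (inverse (f z)) = dist (f y) (f z) / (\<bar>f y\<bar> * \<bar>f z\<bar>)"
      proof -
        have "inverse (f y) - inverse (f z) = (f z - f y) / (f y * f z)" using nz by (simp add: field_simps)
        then show ?thesis by (simp add: dist_real_def abs_mult abs_minus_commute)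
      qed
      also have "\<dots> \<le> (C * dist y z powr \<alpha>) / ((\<bar>f x\<bar> / 2) ^ 2)"
        unfolding power2_eq_square
        using e(3)[of y z] low[of y] low[of z] that fx e(2)
        by (intro frac_le mult_mono mult_pos_pos) auto
      finally show ?thesis by simp
    qed
    then show "\<exists>\<epsilon>>0. \<exists>C. \<forall>y z. y \<in> S \<longrightarrow> z \<in> S \<longrightarrow> dist x y < \<epsilon> \<longrightarrow> dist x z < \<epsilon> \<longrightarrow> dist (inverse (f y)) (inverse (f z)) \<le> C * dist y z powr \<alpha>"
      using e(1) d(1) by (intro exI[of _ "min e d"] conjI exI[of _ "C / (\<bar>f x\<bar> / 2) ^ 2"]) auto
  qed
next
  case (7 f)
  then show ?case using locally_holder_imp_continuous[OF assms(2)]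
    by (intro C1_imp_locally_holder assms) auto
qed

lemma C_on_Suc_imp_C_holder_on:
  fixes f :: "'a::euclidean_space \<Rightarrow> real"
  assumes "open S" "\<alpha> \<le> 1" "C_on (Suc k) S f"
  shows "C_holder_on \<alpha> k S f"
  using assms(3)
proof (induction k arbitrary: f)
  case 0
  then show ?case using C1_imp_locally_holder[OF assms(1,2)] by simp
qed auto

lemma C_on_componentwise:
  fixes f :: "'a::euclidean_space \<Rightarrow> 'b::euclidean_space"
  assumes "open S"
  shows "C_on k S f \<longleftrightarrow> (\<forall>b\<in>Basis. C_on k S (\<lambda>x. f x \<bullet> b))"
  unfolding C_on_eq_Ck
  by (rule Ck_componentwise[OF regularity_continuous[OF assms]]) (rule continuous_on_componentwise)

lemma locally_holder_on_componentwise: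
  fixes f :: "'a::metric_space \<Rightarrow> 'b::euclidean_space"
  shows "locally_holder_on \<alpha> S f \<longleftrightarrow> (\<forall>b\<in>Basis. locally_holder_on \<alpha> S (\<lambda>x. f x \<bullet> b))"
proof safe
  fix b :: 'b assume b: "b \<in> Basis" and f: "locally_holder_on \<alpha> S f"
  show "locally_holder_on \<alpha> S (\<lambda>x. f x \<bullet> b)"
  proof (rule locally_holder_onI)
    fix x assume x: "x \<in> S"
    obtain e C where e: "e > 0" "C \<ge> 0"
      "\<And>y z. \<lbrakk>y \<in> S; z \<in> S; dist x y < e; dist x z < e\<rbrakk> \<Longrightarrow> dist (f y) (f z) \<le> C * dist y z powr \<alpha>"
      using locally_holder_onE[OF f x] by metis
    have "dist (f y \<bullet> b) (f z \<bullet> b) \<le> dist (f y) (f z)" for y z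
      using Basis_le_norm[OF b, of "f y - f z"] by (simp add: dist_norm inner_diff_left)
    then show "\<exists>\<epsilon>>0. \<exists>C. \<forall>y z. y \<in> S \<longrightarrow> z \<in> S \<longrightarrow> dist x y < \<epsilon> \<longrightarrow> dist x z < \<epsilon> \<longrightarrow> dist (f y \<bullet> b) (f z \<bullet> b) \<le> C * dist y z powr \<alpha>"
      using e by (meson order_trans)
  qed
next
  assume f: "\<forall>b\<in>Basis. locally_holder_on \<alpha> S (\<lambda>x. f x \<bullet> b)"
  show "locally_holder_on \<alpha> S f"
  proof (rule locally_holder_onI)
    fix x assume x: "x \<in> S"
    have "\<forall>b\<in>Basis. \<exists>e C. e > 0 \<and> (\<forall>y z. y \<in> S \<longrightarrow> z \<in> S \<longrightarrow> dist x y < e \<longrightarrow> dist x z < e \<longrightarrow> dist (f y \<bullet> b) (f z \<bullet> b) \<le> C * dist y z powr \<alpha>)"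
      using f x by (metis locally_holder_onE)
    then obtain e C where e: "\<And>b. b \<in> Basis \<Longrightarrow> e b > 0"
      "\<And>b y z. \<lbrakk>b \<in> Basis; y \<in> S; z \<in> S; dist x y < e b; dist x z < e b\<rbrakk> \<Longrightarrow> dist (f y \<bullet> b) (f z \<bullet> b) \<le> C b * dist y z powr \<alpha>"
      by metis
    have "dist (f y) (f z) \<le> (\<Sum>b\<in>Basis. C b) * dist y z powr \<alpha>"
      if "y \<in> S" "z \<in> S" "dist x y < Min (e ` Basis)" "dist x z < Min (e ` Basis)" for y z
    proof -
      have "dist (f y) (f z) \<le> (\<Sum>b\<in>Basis. \<bar>(f y - f z) \<bullet> b\<bar>)"
        unfolding dist_norm by (rule norm_le_l1)
      also have "\<dots> \<le> (\<Sum>b\<in>Basis. C b * dist y z powr \<alpha>)"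
        using e(2)[OF _ that(1,2)] that(3,4) by (intro sum_mono) (auto simp: dist_real_def inner_diff_left)
      finally show ?thesis by (simp add: sum_distrib_right)
    qed
    moreover have "Min (e ` Basis) > 0" using e(1) by auto
    ultimately show "\<exists>\<epsilon>>0. \<exists>C. \<forall>y z. y \<in> S \<longrightarrow> z \<in> S \<longrightarrow> dist x y < \<epsilon> \<longrightarrow> dist x z < \<epsilon> \<longrightarrow> dist (f y) (f z) \<le> C * dist y z powr \<alpha>"
      by blast
  qed
qed

lemma C_holder_on_componentwise:
  fixes f :: "'a::euclidean_space \<Rightarrow> 'b::euclidean_space"
  assumes "open S" "0 < \<alpha>" "\<alpha> \<le> 1"
  shows "C_holder_on \<alpha> k S f \<longleftrightarrow> (\<forall>b\<in>Basis. C_holder_on \<alpha> k S (\<lambda>x. f x \<bullet> b))"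
  unfolding C_holder_on_eq_Ck
  by (rule Ck_componentwise[OF regularity_holder[OF assms]]) (rule locally_holder_on_componentwise)

lemma ball_Basis_vec:
  "(\<forall>b\<in>(Basis :: (real^'p::finite) set). Q b) \<longleftrightarrow> (\<forall>i. Q (axis i 1))"
  by (auto simp: Basis_vec_def)

lemma C_on_vec:
  fixes f :: "'a::euclidean_space \<Rightarrow> real^'p::finite"
  shows "open S \<Longrightarrow> C_on k S f \<longleftrightarrow> (\<forall>i. C_on k S (\<lambda>x. f x $ i))"
  by (subst C_on_componentwise) (simp_all add: ball_Basis_vec inner_axis)

lemma C_holder_on_vec:
  fixes f :: "'a::euclidean_space \<Rightarrow> real^'p::finite"
  shows "\<lbrakk>open S; 0 < \<alpha>; \<alpha> \<le> 1\<rbrakk> \<Longrightarrow> C_holder_on \<alpha> k S f \<longleftrightarrow> (\<forall>i. C_holder_on \<alpha> k S (\<lambda>x. f x $ i))"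
  by (subst C_holder_on_componentwise) (simp_all add: ball_Basis_vec inner_axis)

lemma smooth_on_vec:
  fixes f :: "'a::euclidean_space \<Rightarrow> real^'p::finite"
  shows "open S \<Longrightarrow> smooth_on S f \<longleftrightarrow> (\<forall>i. smooth_on S (\<lambda>x. f x $ i))"
  by (auto simp: smooth_on_def C_on_vec)

section \<open>Smooth vector fields as operators\<close>

lemma (in regularity) Ck_frechet_derivative:
  assumes "Ck P (Suc k) S f"
  shows "Ck P k S (\<lambda>x. frechet_derivative f (at x) v)"
proof -
  have "Ck P k S (\<lambda>x. \<Sum>b\<in>Basis. (v \<bullet> b) * frechet_derivative f (at x) b)"
    using assms by (intro Ck_sum Ck_cmult) auto
  then show ?thesis
  proof (rule Ck_cong)
    fix x assume "x \<in> S"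
    then have "f differentiable (at x)" using assms by simp
    from frechet_derivative_Basis_sum[OF this, of v]
    show "(\<Sum>b\<in>Basis. (v \<bullet> b) * frechet_derivative f (at x) b) = frechet_derivative f (at x) v" by simp
  qed
qed

text \<open>Two applications of the mean value theorem to the second difference, first along
  \<open>v\<close>, then along \<open>w\<close>. The step \<open>h\<close> is exposed because it is
  symmetric in \<open>v\<close> and \<open>w\<close>: exchanging them leads to the same second
  difference.\<close>

lemma mixed_second_derivative:
  fixes f :: "'a::euclidean_space \<Rightarrow> real"
  assumes "open S" "ball x d \<subseteq> S" "0 < d"
    and f: "\<And>z. z \<in> S \<Longrightarrow> f differentiable (at z)"
    and g: "\<And>z. z \<in> S \<Longrightarrow> (\<lambda>z. frechet_derivative f (at z) v) differentiable (at z)"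
  shows "\<exists>p\<in>ball x d. \<exists>h>0. (f (x + h *\<^sub>R v + h *\<^sub>R w) - f (x + h *\<^sub>R v)) - (f (x + h *\<^sub>R w) - f x)
      = h * h * frechet_derivative (\<lambda>z. frechet_derivative f (at z) v) (at p) w \<and> h = d / (2 * (1 + norm v + norm w))"
proof -
  \<comment> \<open>The factor 2 keeps the parallelogram strictly inside the ball; the summand 1
    keeps the denominator positive even if both directions vanish.\<close>
  define h where "h = d / (2 * (1 + norm v + norm w))"
  have den: "1 + norm v + norm w > 0" by (smt (verit) norm_ge_zero)
  have h: "h > 0" unfolding h_def using den \<open>0 < d\<close> by simp
  have hd: "h * (norm v + norm w) < d"
  proof -
    have "h * (norm v + norm w) \<le> h * (1 + norm v + norm w)" using h by (intro mult_left_mono) auto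
    also have "\<dots> = d / 2" unfolding h_def using den by (simp add: field_simps)
    finally show ?thesis using \<open>0 < d\<close> by simp
  qed
  have inb: "x + s *\<^sub>R v + t *\<^sub>R w \<in> ball x d" if "0 \<le> s" "s \<le> h" "0 \<le> t" "t \<le> h" for s t
  proof -
    have "norm (s *\<^sub>R v + t *\<^sub>R w) \<le> s * norm v + t * norm w"
      using norm_triangle_ineq[of "s *\<^sub>R v" "t *\<^sub>R w"] that by simp
    also have "\<dots> \<le> h * (norm v + norm w)"
      using that by (simp add: distrib_left add_mono mult_right_mono)
    finally show ?thesis using hd
      by (metis (no_types, lifting) add.assoc add_diff_cancel_left' dist_commute dist_norm mem_ball order_le_less_trans)
  qed
  have inb0: "x + s *\<^sub>R v \<in> ball x d" if "0 \<le> s" "s \<le> h" for s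
    using inb[OF that, of 0] h by simp
  let ?D = "\<lambda>z. frechet_derivative f (at z) v"
  let ?\<phi> = "\<lambda>s. f (x + s *\<^sub>R v + h *\<^sub>R w) - f (x + s *\<^sub>R v)"
  have d1: "(?\<phi> has_real_derivative ?D (x + s *\<^sub>R v + h *\<^sub>R w) - ?D (x + s *\<^sub>R v)) (at s)"
    if "0 \<le> s" "s \<le> h" for s
  proof -
    have a: "f differentiable (at (x + s *\<^sub>R v + h *\<^sub>R w))" "f differentiable (at (x + s *\<^sub>R v))"
      using f inb[OF that, of h] inb0[OF that] h \<open>ball x d \<subseteq> S\<close> by auto
    have b: "((\<lambda>s. x + s *\<^sub>R v + h *\<^sub>R w) has_derivative (\<lambda>t. t *\<^sub>R v)) (at s)"
      "((\<lambda>s. x + s *\<^sub>R v) has_derivative (\<lambda>t. t *\<^sub>R v)) (at s)"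
      by (auto intro!: derivative_eq_intros)
    have "(?\<phi> has_derivative (\<lambda>t. frechet_derivative f (at (x + s *\<^sub>R v + h *\<^sub>R w)) (t *\<^sub>R v)
         - frechet_derivative f (at (x + s *\<^sub>R v)) (t *\<^sub>R v))) (at s)"
      using has_derivative_compose[OF b(1) frechet_derivative_has_derivative[OF a(1)]]
        has_derivative_compose[OF b(2) frechet_derivative_has_derivative[OF a(2)]]
      by (intro has_derivative_diff) auto
    moreover have "frechet_derivative f (at (x + s *\<^sub>R v + h *\<^sub>R w)) (t *\<^sub>R v) - frechet_derivative f (at (x + s *\<^sub>R v)) (t *\<^sub>R v)
       = (?D (x + s *\<^sub>R v + h *\<^sub>R w) - ?D (x + s *\<^sub>R v)) * t" for t
      using linear_scale[OF linear_frechet_derivative[OF a(1)], of t v] linear_scale[OF linear_frechet_derivative[OF a(2)], of t v]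
      by (simp add: algebra_simps)
    ultimately show ?thesis unfolding has_field_derivative_def by simp
  qed
  obtain s where s: "0 < s" "s < h" "?\<phi> h - ?\<phi> 0 = (h - 0) * (?D (x + s *\<^sub>R v + h *\<^sub>R w) - ?D (x + s *\<^sub>R v))"
    using MVT2[OF h, of ?\<phi> "\<lambda>s. ?D (x + s *\<^sub>R v + h *\<^sub>R w) - ?D (x + s *\<^sub>R v)", OF d1] by auto
  have d2: "((\<lambda>t. ?D (x + s *\<^sub>R v + t *\<^sub>R w)) has_real_derivative frechet_derivative ?D (at (x + s *\<^sub>R v + t *\<^sub>R w)) w) (at t)"
    if "0 \<le> t" "t \<le> h" for t
  proof -
    have a: "?D differentiable (at (x + s *\<^sub>R v + t *\<^sub>R w))"
      using g inb[of s t] that s \<open>ball x d \<subseteq> S\<close> by auto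
    have b: "((\<lambda>t. x + s *\<^sub>R v + t *\<^sub>R w) has_derivative (\<lambda>t. t *\<^sub>R w)) (at t)"
      by (auto intro!: derivative_eq_intros)
    show ?thesis
      using has_derivative_compose[OF b frechet_derivative_has_derivative[OF a]]
        linear_scale[OF linear_frechet_derivative[OF a]]
      unfolding has_field_derivative_def by (simp add: mult.commute[of _ "frechet_derivative ?D (at (x + s *\<^sub>R v + t *\<^sub>R w)) w"])
  qed
  obtain t where t: "0 < t" "t < h" "?D (x + s *\<^sub>R v + h *\<^sub>R w) - ?D (x + s *\<^sub>R v + 0 *\<^sub>R w) = (h - 0) * frechet_derivative ?D (at (x + s *\<^sub>R v + t *\<^sub>R w)) w"
    using MVT2[OF h, of "\<lambda>t. ?D (x + s *\<^sub>R v + t *\<^sub>R w)" "\<lambda>t. frechet_derivative ?D (at (x + s *\<^sub>R v + t *\<^sub>R w)) w", OF d2] by auto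
  have "x + s *\<^sub>R v + t *\<^sub>R w \<in> ball x d" using inb[of s t] s t by simp
  moreover have "(f (x + h *\<^sub>R v + h *\<^sub>R w) - f (x + h *\<^sub>R v)) - (f (x + h *\<^sub>R w) - f x)
      = h * h * frechet_derivative ?D (at (x + s *\<^sub>R v + t *\<^sub>R w)) w"
    using s(3) t(3) by (simp add: algebra_simps)
  ultimately show ?thesis using h h_def by blast
qed

text \<open>Both mixed derivatives, taken at suitable points \<open>p\<close> and \<open>q\<close>
  arbitrarily close to \<open>x\<close>, equal one and the same difference quotient. If they
  differed at \<open>x\<close>, continuity would keep each within half the gap of its value there, a
  contradiction.\<close>

lemma second_derivative_symmetric:
  fixes f :: "'a::euclidean_space \<Rightarrow> real"
  assumes "open S" "x \<in> S" "C_on 2 S f"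
  shows "frechet_derivative (\<lambda>z. frechet_derivative f (at z) v) (at x) w =
    frechet_derivative (\<lambda>z. frechet_derivative f (at z) w) (at x) v" (is "?a = ?b")
proof (rule ccontr)
  assume ne: "?a \<noteq> ?b"
  interpret regularity S "continuous_on S" by (rule regularity_continuous[OF assms(1)])
  have f2: "Ck (continuous_on S) (Suc (Suc 0)) S f" using assms(3) by (simp add: C_on_eq_Ck numeral_2_eq_2)
  have f1: "f differentiable (at z)" if "z \<in> S" for z using f2 that by simp
  have D: "Ck (continuous_on S) (Suc 0) S (\<lambda>z. frechet_derivative f (at z) v)" for v
    using f2 by (rule Ck_frechet_derivative)
  have D1: "(\<lambda>z. frechet_derivative f (at z) v) differentiable (at z)" if "z \<in> S" for z v
    using D that by simp
  have DD: "continuous_on S (\<lambda>p. frechet_derivative (\<lambda>z. frechet_derivative f (at z) v) (at p) w)" for v w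
    using Ck_frechet_derivative[OF D] by simp
  define e where "e = \<bar>?a - ?b\<bar> / 2"
  have "e > 0" using ne by (simp add: e_def)
  have "\<exists>d>0. \<forall>p\<in>S. dist p x < d \<longrightarrow> dist (frechet_derivative (\<lambda>z. frechet_derivative f (at z) v) (at p) w) (frechet_derivative (\<lambda>z. frechet_derivative f (at z) v) (at x) w) < e" for v w
    using DD[of v w] assms(2) \<open>e > 0\<close> unfolding continuous_on_iff by blast
  then obtain d1 d2 where d: "d1 > 0" "\<And>p. p \<in> S \<Longrightarrow> dist p x < d1 \<Longrightarrow> dist (frechet_derivative (\<lambda>z. frechet_derivative f (at z) v) (at p) w) ?a < e"
    "d2 > 0" "\<And>p. p \<in> S \<Longrightarrow> dist p x < d2 \<Longrightarrow> dist (frechet_derivative (\<lambda>z. frechet_derivative f (at z) w) (at p) v) ?b < e"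
    by metis
  obtain d3 where d3: "d3 > 0" "ball x d3 \<subseteq> S" using assms open_contains_ball by blast
  define d where "d = min (min d1 d2) d3"
  have dd: "d > 0" "ball x d \<subseteq> S" "d \<le> d1" "d \<le> d2" using d d3 by (auto simp: d_def)
  obtain p h where p: "p \<in> ball x d" "h > 0" "(f (x + h *\<^sub>R v + h *\<^sub>R w) - f (x + h *\<^sub>R v)) - (f (x + h *\<^sub>R w) - f x)
      = h * h * frechet_derivative (\<lambda>z. frechet_derivative f (at z) v) (at p) w" "h = d / (2 * (1 + norm v + norm w))"
    using mixed_second_derivative[OF assms(1) dd(2,1) f1 D1, of v w] by blast
  obtain q h' where q: "q \<in> ball x d" "h' > 0" "(f (x + h' *\<^sub>R w + h' *\<^sub>R v) - f (x + h' *\<^sub>R w)) - (f (x + h' *\<^sub>R v) - f x)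
      = h' * h' * frechet_derivative (\<lambda>z. frechet_derivative f (at z) w) (at q) v" "h' = d / (2 * (1 + norm w + norm v))"
    using mixed_second_derivative[OF assms(1) dd(2,1) f1 D1, of w v] by blast
  have hh: "h' = h" using p(4) q(4) by (simp add: add_ac)
  have comm: "x + h *\<^sub>R w + h *\<^sub>R v = x + h *\<^sub>R v + h *\<^sub>R w" by (simp add: add_ac)
  have "h * h * frechet_derivative (\<lambda>z. frechet_derivative f (at z) v) (at p) w =
      h * h * frechet_derivative (\<lambda>z. frechet_derivative f (at z) w) (at q) v"
    using p(3) q(3) unfolding hh comm by linarith
  then have eq: "frechet_derivative (\<lambda>z. frechet_derivative f (at z) v) (at p) w =
      frechet_derivative (\<lambda>z. frechet_derivative f (at z) w) (at q) v" using p(2) by simp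
  have "dist (frechet_derivative (\<lambda>z. frechet_derivative f (at z) v) (at p) w) ?a < e"
    by (rule d(2)) (use p(1) dd in \<open>auto simp: dist_commute\<close>)
  moreover have "dist (frechet_derivative (\<lambda>z. frechet_derivative f (at z) w) (at q) v) ?b < e"
    by (rule d(4)) (use q(1) dd in \<open>auto simp: dist_commute\<close>)
  ultimately have "\<bar>?a - ?b\<bar> < e + e" unfolding eq dist_real_def by linarith
  then show False unfolding e_def by simp
qed

section \<open>Closure properties of smooth functions\<close>

lemma smooth_on_eq_Ck: "smooth_on S f \<longleftrightarrow> (\<forall>k. Ck (continuous_on S) k S f)"
  by (simp add: smooth_on_def C_on_eq_Ck)

lemma smooth_on_differentiable: "smooth_on S f \<Longrightarrow> x \<in> S \<Longrightarrow> f differentiable (at x)"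
  unfolding smooth_on_eq_Ck by (metis Ck.simps(2))

lemma smooth_on_cong:
  fixes f :: "'a::euclidean_space \<Rightarrow> real"
  shows "\<lbrakk>open S; smooth_on S f; \<And>x. x \<in> S \<Longrightarrow> f x = g x\<rbrakk> \<Longrightarrow> smooth_on S g"
  unfolding smooth_on_eq_Ck using regularity.Ck_cong[OF regularity_continuous] by blast

context
  fixes S :: "'a::euclidean_space set"
  assumes S: "open S"
begin

lemma smooth_on_const: "smooth_on S (\<lambda>x. c::real)"
  unfolding smooth_on_eq_Ck by (simp add: regularity.Ck_const[OF regularity_continuous[OF S]])

lemma smooth_on_inner: "smooth_on S (\<lambda>x. x \<bullet> b)"
  unfolding smooth_on_eq_Ck by (simp add: regularity.Ck_inner[OF regularity_continuous[OF S]])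

context
  fixes f g :: "'a \<Rightarrow> real"
  assumes f: "smooth_on S f" and g: "smooth_on S g"
begin

lemma smooth_on_add: "smooth_on S (\<lambda>x. f x + g x)"
  using f g unfolding smooth_on_eq_Ck by (simp add: regularity.Ck_add[OF regularity_continuous[OF S]])

lemma smooth_on_diff: "smooth_on S (\<lambda>x. f x - g x)"
  using f g unfolding smooth_on_eq_Ck by (simp add: regularity.Ck_diff[OF regularity_continuous[OF S]])

lemma smooth_on_mult: "smooth_on S (\<lambda>x. f x * g x)"
  using f g unfolding smooth_on_eq_Ck by (simp add: regularity.Ck_mult[OF regularity_continuous[OF S]])

end

lemma smooth_on_sum:
  fixes f :: "'i \<Rightarrow> 'a \<Rightarrow> real"
  shows "(\<And>i. i \<in> I \<Longrightarrow> smooth_on S (f i)) \<Longrightarrow> smooth_on S (\<lambda>x. \<Sum>i\<in>I. f i x)"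
  unfolding smooth_on_eq_Ck by (simp add: regularity.Ck_sum[OF regularity_continuous[OF S]])

lemma smooth_on_prod:
  fixes f :: "'i \<Rightarrow> 'a \<Rightarrow> real"
  shows "(\<And>i. i \<in> I \<Longrightarrow> smooth_on S (f i)) \<Longrightarrow> smooth_on S (\<lambda>x. \<Prod>i\<in>I. f i x)"
  unfolding smooth_on_eq_Ck by (simp add: regularity.Ck_prod[OF regularity_continuous[OF S]])

lemma smooth_on_recip:
  fixes f :: "'a \<Rightarrow> real"
  shows "smooth_on S f \<Longrightarrow> (\<And>x. x \<in> S \<Longrightarrow> f x \<noteq> 0) \<Longrightarrow> smooth_on S (\<lambda>x. inverse (f x))"
  unfolding smooth_on_eq_Ck by (simp add: regularity.Ck_recip[OF regularity_continuous[OF S]])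

lemma smooth_on_frechet_derivative:
  fixes f :: "'a \<Rightarrow> real"
  shows "smooth_on S f \<Longrightarrow> smooth_on S (\<lambda>x. frechet_derivative f (at x) v)"
  unfolding smooth_on_eq_Ck
  by (intro allI regularity.Ck_frechet_derivative[OF regularity_continuous[OF S]]) (elim allE)

lemma smooth_on_componentwise:
  fixes f :: "'a \<Rightarrow> 'b::euclidean_space"
  shows "smooth_on S f \<longleftrightarrow> (\<forall>b\<in>Basis. smooth_on S (\<lambda>x. f x \<bullet> b))"
  unfolding smooth_on_def using C_on_componentwise[OF S] by blast

lemmas smooth_on_componentwiseI = smooth_on_componentwise[THEN iffD2, rule_format]

lemma smooth_on_inner_right:
  fixes f :: "'a \<Rightarrow> 'b::euclidean_space"
  assumes "smooth_on S f"
  shows "smooth_on S (\<lambda>x. f x \<bullet> v)"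
proof -
  have "smooth_on S (\<lambda>x. \<Sum>b\<in>Basis. f x \<bullet> b * (v \<bullet> b))"
    using assms smooth_on_componentwise[of f] by (intro smooth_on_sum smooth_on_mult smooth_on_const) auto
  moreover have "(\<lambda>x. \<Sum>b\<in>Basis. f x \<bullet> b * (v \<bullet> b)) = (\<lambda>x. f x \<bullet> v)"
    by (subst euclidean_inner) (simp add: inner_commute)
  ultimately show ?thesis by simp
qed

end

lemma smooth_on_compose:
  fixes f :: "'b::euclidean_space \<Rightarrow> real" and g :: "'a::euclidean_space \<Rightarrow> 'b"
  assumes "open S" "open T" "\<And>x. x \<in> T \<Longrightarrow> g x \<in> S" "smooth_on S f" "smooth_on T g"
  shows "smooth_on T (\<lambda>x. f (g x))"
  unfolding smooth_on_eq_Ck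
proof
  fix k
  show "Ck (continuous_on T) k T (\<lambda>x. f (g x))"
  proof (rule Ck_compose[OF regularity_continuous[OF assms(1)] regularity_continuous[OF assms(2)] assms(3)])
    have "continuous_on T g" using assms(5) unfolding smooth_on_def by (metis C_on.simps(1))
    then show "continuous_on T (\<lambda>x. h (g x))" if "continuous_on S h" for h :: "'b \<Rightarrow> real"
      using continuous_on_compose2[OF that] assms(3) by blast
    show "Ck (continuous_on T) k T (\<lambda>x. g x \<bullet> b)" if "b \<in> Basis" for b
      using assms(5) smooth_on_componentwise[OF assms(2)] that unfolding smooth_on_eq_Ck by blast
    show "Ck (continuous_on S) k S f" using assms(4) unfolding smooth_on_eq_Ck by blast
  qed
qed

section \<open>Smooth fields as derivations and their Lie brackets\<close>

lemma smooth_vf_apply: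
  fixes V :: "'a::euclidean_space \<Rightarrow> 'a"
  assumes "open S" "smooth_on S V" "smooth_on S f"
  shows "smooth_on S (vf_apply V f)"
proof (rule smooth_on_cong[OF assms(1)])
  show "smooth_on S (\<lambda>x. \<Sum>b\<in>Basis. (V x \<bullet> b) * frechet_derivative f (at x) b)"
    using assms smooth_on_componentwise[OF assms(1), of V]
    by (intro smooth_on_sum smooth_on_mult smooth_on_frechet_derivative) auto
  show "(\<Sum>b\<in>Basis. (V x \<bullet> b) * frechet_derivative f (at x) b) = vf_apply V f x" if "x \<in> S" for x
    using frechet_derivative_Basis_sum[OF smooth_on_differentiable[OF assms(3) that], of "V x"]
    by (simp add: vf_apply_def)
qed

lemma lie_bracket_inner:
  fixes V W :: "'a::euclidean_space \<Rightarrow> 'a"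
  assumes "V differentiable (at x)" "W differentiable (at x)"
  shows "lie_bracket V W x \<bullet> b = frechet_derivative (\<lambda>x. W x \<bullet> b) (at x) (V x) - frechet_derivative (\<lambda>x. V x \<bullet> b) (at x) (W x)"
proof -
  have "frechet_derivative (\<lambda>x. U x \<bullet> b) (at x) = (\<lambda>h. frechet_derivative U (at x) h \<bullet> b)"
    if "U differentiable (at x)" for U
    by (rule frechet_derivative_unique)
      (use frechet_derivative_has_derivative[OF that] in \<open>auto intro!: derivative_eq_intros\<close>)
  then show ?thesis using assms by (simp add: lie_bracket_def inner_diff_left)
qed

lemma smooth_lie_bracket:
  fixes V W :: "'a::euclidean_space \<Rightarrow> 'a"
  assumes "open S" "smooth_on S V" "smooth_on S W"
  shows "smooth_on S (lie_bracket V W)"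
proof (rule smooth_on_componentwiseI[OF assms(1)])
  fix b :: 'a assume "b \<in> Basis"
  have "smooth_on S (\<lambda>x. vf_apply V (\<lambda>x. W x \<bullet> b) x - vf_apply W (\<lambda>x. V x \<bullet> b) x)"
    by (intro smooth_on_diff smooth_vf_apply smooth_on_inner_right assms)
  then show "smooth_on S (\<lambda>x. lie_bracket V W x \<bullet> b)"
    by (rule smooth_on_cong[OF assms(1)])
      (simp add: vf_apply_def lie_bracket_inner smooth_on_differentiable[OF assms(2)] smooth_on_differentiable[OF assms(3)])
qed

text \<open>A product of two derivations splits into a first-order part and a Hessian part with the
  inner field frozen at \<open>x\<close> (\<open>key\<close>). By symmetry of second derivatives the
  Hessian parts cancel.\<close>

lemma vf_apply_lie_bracket:
  fixes V W :: "'a::euclidean_space \<Rightarrow> 'a"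
  assumes V: "smooth_on UNIV V" and W: "smooth_on UNIV W" and f: "smooth_on UNIV f"
  shows "vf_apply (lie_bracket V W) f x = vf_apply V (vf_apply W f) x - vf_apply W (vf_apply V f) x"
proof -
  note diff = smooth_on_differentiable[OF _ UNIV_I]
  have Df: "smooth_on UNIV (\<lambda>z. frechet_derivative f (at z) v)" for v
    by (rule smooth_on_frechet_derivative[OF open_UNIV f])
  let ?D = "\<lambda>z. frechet_derivative f (at z)"
  have key: "vf_apply U (vf_apply Z f) x =
      ?D x (frechet_derivative Z (at x) (U x)) + frechet_derivative (\<lambda>z. ?D z (Z x)) (at x) (U x)"
    if U: "smooth_on UNIV U" and Z: "smooth_on UNIV Z" for U Z
  proof -
    have eq: "vf_apply Z f = (\<lambda>x. \<Sum>b\<in>Basis. (Z x \<bullet> b) * ?D x b)"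
      by (rule ext, unfold vf_apply_def, subst frechet_derivative_Basis_sum[OF diff[OF f]]) simp
    have d1: "((\<lambda>x. Z x \<bullet> b) has_derivative (\<lambda>h. frechet_derivative Z (at x) h \<bullet> b)) (at x)" for b
      using frechet_derivative_has_derivative[OF diff[OF Z, of x]] by (auto intro!: derivative_eq_intros)
    have "(vf_apply Z f has_derivative (\<lambda>h. \<Sum>b\<in>Basis.
        (Z x \<bullet> b) * frechet_derivative (\<lambda>x. ?D x b) (at x) h + (frechet_derivative Z (at x) h \<bullet> b) * ?D x b)) (at x)"
      unfolding eq
      by (intro has_derivative_sum has_derivative_mult d1 frechet_derivative_has_derivative diff Df)
    then have "vf_apply U (vf_apply Z f) x = (\<Sum>b\<in>Basis.
        (Z x \<bullet> b) * frechet_derivative (\<lambda>x. ?D x b) (at x) (U x)) + (\<Sum>b\<in>Basis. (frechet_derivative Z (at x) (U x) \<bullet> b) * ?D x b)"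
      by (simp add: vf_apply_def[of U] frechet_derivative_unique sum.distrib)
    moreover have "(\<Sum>b\<in>Basis. (frechet_derivative Z (at x) (U x) \<bullet> b) * ?D x b) = ?D x (frechet_derivative Z (at x) (U x))"
      using frechet_derivative_Basis_sum[OF diff[OF f, of x], of "frechet_derivative Z (at x) (U x)"] by simp
    moreover have "((\<lambda>z. ?D z (Z x)) has_derivative (\<lambda>h. \<Sum>b\<in>Basis. (Z x \<bullet> b) * frechet_derivative (\<lambda>x. ?D x b) (at x) h)) (at x)"
    proof -
      have "(\<lambda>z. ?D z (Z x)) = (\<lambda>z. \<Sum>b\<in>Basis. (Z x \<bullet> b) * ?D z b)"
        by (rule ext, subst frechet_derivative_Basis_sum[OF diff[OF f]]) simp
      then show ?thesis
        by (simp) (intro has_derivative_sum has_derivative_mult_right frechet_derivative_has_derivative diff Df)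
    qed
    ultimately show ?thesis by (simp add: frechet_derivative_unique)
  qed
  have "frechet_derivative (\<lambda>z. ?D z (W x)) (at x) (V x) = frechet_derivative (\<lambda>z. ?D z (V x)) (at x) (W x)"
    using second_derivative_symmetric[of UNIV x f] f unfolding smooth_on_def by simp
  moreover have "?D x (a - b) = ?D x a - ?D x b" for a b
    using linear_diff[OF linear_frechet_derivative[OF diff[OF f]]] by blast
  ultimately show ?thesis
    unfolding key[OF V W] key[OF W V] by (simp add: vf_apply_def[of "lie_bracket V W"] lie_bracket_def)
qed

text \<open>The coordinate functions suffice as test functions, so identities between fields may be
  proved as identities between operators.\<close>

lemma vf_eqI:
  fixes V W :: "'a::euclidean_space \<Rightarrow> 'a"
  assumes "\<And>f. smooth_on UNIV f \<Longrightarrow> vf_apply V f x = vf_apply W f x"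
  shows "V x = W x"
proof (rule euclidean_eqI)
  fix b :: 'a
  have "frechet_derivative (\<lambda>x. x \<bullet> b) (at x) = (\<lambda>h. h \<bullet> b)"
    by (rule frechet_derivative_unique) (auto intro!: derivative_eq_intros)
  then show "V x \<bullet> b = W x \<bullet> b"
    using assms[OF smooth_on_inner[OF open_UNIV, of b]] by (simp add: vf_apply_def)
qed

lemma vf_apply_diff_fun:
  assumes "smooth_on UNIV f" "smooth_on UNIV g"
  shows "vf_apply V (\<lambda>x. f x - g x) x = vf_apply V f x - vf_apply V g x"
proof -
  have "((\<lambda>x. f x - g x) has_derivative (\<lambda>h. frechet_derivative f (at x) h - frechet_derivative g (at x) h)) (at x)"
    by (intro has_derivative_diff frechet_derivative_has_derivative smooth_on_differentiable[OF _ UNIV_I] assms)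
  then show ?thesis by (simp add: vf_apply_def frechet_derivative_unique)
qed

lemma vf_apply_field_linear:
  assumes "smooth_on UNIV f"
  shows "vf_apply (\<lambda>x. V x + W x) f x = vf_apply V f x + vf_apply W f x"
    and "vf_apply (\<lambda>x. V x - W x) f x = vf_apply V f x - vf_apply W f x"
    and "vf_apply (\<lambda>x. c *\<^sub>R V x) f x = c * vf_apply V f x"
    and "vf_apply (\<lambda>x. \<Sum>i\<in>I. c' i *\<^sub>R V' i x) f x = (\<Sum>i\<in>I. c' i * vf_apply (V' i) f x)"
proof -
  interpret linear "frechet_derivative f (at x)"
    by (rule linear_frechet_derivative) (rule smooth_on_differentiable[OF assms UNIV_I])
  show "vf_apply (\<lambda>x. V x + W x) f x = vf_apply V f x + vf_apply W f x"
    "vf_apply (\<lambda>x. V x - W x) f x = vf_apply V f x - vf_apply W f x"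
    "vf_apply (\<lambda>x. c *\<^sub>R V x) f x = c * vf_apply V f x"
    "vf_apply (\<lambda>x. \<Sum>i\<in>I. c' i *\<^sub>R V' i x) f x = (\<Sum>i\<in>I. c' i * vf_apply (V' i) f x)"
    by (simp_all add: vf_apply_def add diff scale sum)
qed

text \<open>As operators both sides are sums of threefold compositions, which cancel formally; no
  derivative of a coefficient has to be written out.\<close>

lemma jacobi:
  fixes U V W :: "'a::euclidean_space \<Rightarrow> 'a"
  assumes U: "smooth_on UNIV U" and V: "smooth_on UNIV V" and W: "smooth_on UNIV W"
  shows "lie_bracket (lie_bracket U V) W x = lie_bracket U (lie_bracket V W) x - lie_bracket V (lie_bracket U W) x"
proof -
  have "vf_apply (lie_bracket (lie_bracket U V) W) f x =
      vf_apply (\<lambda>x. lie_bracket U (lie_bracket V W) x - lie_bracket V (lie_bracket U W) x) f x"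
    if f: "smooth_on UNIV f" for f
  proof -
    note s = smooth_lie_bracket[OF open_UNIV] smooth_vf_apply[OF open_UNIV] assms f
    have eq: "vf_apply (lie_bracket A B) g = (\<lambda>x. vf_apply A (vf_apply B g) x - vf_apply B (vf_apply A g) x)"
      if "smooth_on UNIV A" "smooth_on UNIV B" "smooth_on UNIV g" for A B :: "'a \<Rightarrow> 'a" and g
      using vf_apply_lie_bracket[OF that] by blast
    show ?thesis
      by (simp add: vf_apply_field_linear[OF f] eq s vf_apply_diff_fun)
  qed
  from vf_eqI[OF this] show ?thesis .
qed

lemma lie_bracket_add_right:
  assumes "W differentiable (at x)" "W' differentiable (at x)" "V differentiable (at x)"
  shows "lie_bracket V (\<lambda>x. c *\<^sub>R W x + W' x) x = c *\<^sub>R lie_bracket V W x + lie_bracket V W' x"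
proof -
  interpret linear "frechet_derivative V (at x)" using assms linear_frechet_derivative by blast
  have "((\<lambda>x. c *\<^sub>R W x + W' x) has_derivative (\<lambda>h. c *\<^sub>R frechet_derivative W (at x) h + frechet_derivative W' (at x) h)) (at x)"
    using assms by (intro has_derivative_add has_derivative_scaleR_right frechet_derivative_has_derivative)
  then show ?thesis
    by (simp add: lie_bracket_def frechet_derivative_unique add scale algebra_simps)
qed

lemma smooth_commutator:
  fixes F :: "nat \<Rightarrow> 'a::euclidean_space \<Rightarrow> 'a"
  assumes "\<And>i. i \<in> set I \<Longrightarrow> smooth_on UNIV (F i)"
  shows "smooth_on UNIV (commutator F I)"
  using assms
proof (induction F I rule: commutator.induct)
  case (1 F)
  show ?case by (rule smooth_on_componentwiseI) (simp_all add: smooth_on_const)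
qed (auto intro: smooth_lie_bracket)

text \<open>A list of terms rather than a function on words: it is built by recursion, words may
  repeat, and one list can be evaluated in every family \<open>F\<close>.\<close>

primrec lin_comb :: "(real \<times> nat list) list \<Rightarrow> (nat \<Rightarrow> 'a \<Rightarrow> 'a) \<Rightarrow> 'a \<Rightarrow> 'a::real_normed_vector" where
  "lin_comb [] F x = 0"
| "lin_comb (t # L) F x = fst t *\<^sub>R commutator F (snd t) x + lin_comb L F x"

lemma lin_comb_append: "lin_comb (L @ L') F x = lin_comb L F x + lin_comb L' F x"
  by (induction L) auto

lemma lin_comb_uminus: "lin_comb (map (\<lambda>(c, K). (- c, K)) L) F x = - lin_comb L F x"
  by (induction L) auto

lemma smooth_lin_comb:
  fixes F :: "nat \<Rightarrow> 'a::euclidean_space \<Rightarrow> 'a"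
  assumes "\<And>t i. t \<in> set L \<Longrightarrow> i \<in> set (snd t) \<Longrightarrow> smooth_on UNIV (F i)"
  shows "smooth_on UNIV (lin_comb L F)"
  using assms
proof (induction L)
  case Nil
  show ?case by (rule smooth_on_componentwiseI) (simp_all add: smooth_on_const)
next
  case (Cons t L)
  have "smooth_on UNIV (commutator F (snd t))"
    by (rule smooth_commutator, rule Cons.prems[of t]) simp_all
  moreover have "smooth_on UNIV (lin_comb L F)"
    by (rule Cons.IH, rule Cons.prems) simp_all
  ultimately have "smooth_on UNIV (\<lambda>x. fst t * (commutator F (snd t) x \<bullet> b) + lin_comb L F x \<bullet> b)" for b
    by (intro smooth_on_add smooth_on_mult smooth_on_const smooth_on_inner_right open_UNIV)
  then show ?case
    by (intro smooth_on_componentwiseI[OF open_UNIV, where f = "lin_comb (t # L) F"]) (simp_all add: inner_add_left)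
qed

lemma lie_bracket_lin_comb:
  fixes F :: "nat \<Rightarrow> 'a::euclidean_space \<Rightarrow> 'a"
  assumes "smooth_on UNIV (F i)" "\<And>t. t \<in> set L \<Longrightarrow> snd t \<noteq> []"
    and "\<And>t i. t \<in> set L \<Longrightarrow> i \<in> set (snd t) \<Longrightarrow> smooth_on UNIV (F i)"
  shows "lie_bracket (F i) (lin_comb L F) x = lin_comb (map (\<lambda>(c, K). (c, i # K)) L) F x"
  using assms
proof (induction L)
  case Nil
  then show ?case
    using linear_0[OF linear_frechet_derivative[OF smooth_on_differentiable[OF Nil(1) UNIV_I]]]
    by (simp add: lie_bracket_def frechet_derivative_const)
next
  case (Cons t L)
  note d = smooth_on_differentiable[OF _ UNIV_I]
  have "lie_bracket (F i) (lin_comb (t # L) F) x =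
     fst t *\<^sub>R lie_bracket (F i) (commutator F (snd t)) x + lie_bracket (F i) (lin_comb L F) x"
    unfolding lin_comb.simps(2)[abs_def]
  proof (intro lie_bracket_add_right d smooth_commutator smooth_lin_comb Cons.prems(1))
    show "smooth_on UNIV (F k)" if "k \<in> set (snd t)" for k
      using Cons.prems(3)[of t k] that by simp
    show "smooth_on UNIV (F k)" if "s \<in> set L" "k \<in> set (snd s)" for s k
      using Cons.prems(3)[of s k] that by simp
  qed
  moreover have "lie_bracket (F i) (commutator F (snd t)) = commutator F (i # snd t)"
    using Cons.prems(2)[of t] by (cases "snd t") auto
  moreover have "lie_bracket (F i) (lin_comb L F) x = lin_comb (map (\<lambda>(c, K). (c, i # K)) L) F x"
    by (rule Cons.IH[OF Cons.prems(1)]) (use Cons.prems(2,3) in \<open>metis list.set_intros(2)\<close>)+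
  ultimately have eq: "lie_bracket (F i) (lin_comb (t # L) F) x =
      fst t *\<^sub>R commutator F (i # snd t) x + lin_comb (map (\<lambda>(c, K). (c, i # K)) L) F x"
    by (simp only:)
  show ?case unfolding eq by (simp add: case_prod_unfold)
qed

text \<open>The Jacobi identity [[i,I],J] = [i,[I,J]] - [I,[i,J]] shortens the left factor, whence
  the induction for all \<open>J\<close>. The list is chosen before \<open>F\<close>, which makes
  its coefficients universal; that letters are merely rearranged will fix the weight of each
  term.\<close>

lemma lie_bracket_commutators:
  assumes "I \<noteq> []" "J \<noteq> []"
  shows "\<exists>L. (\<forall>t\<in>set L. mset (snd t) = mset I + mset J) \<and>
    (\<forall>F :: nat \<Rightarrow> 'a::euclidean_space \<Rightarrow> 'a. (\<forall>i\<in>set I \<union> set J. smooth_on UNIV (F i)) \<longrightarrow>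
       lie_bracket (commutator F I) (commutator F J) = lin_comb L F)"
  using assms
proof (induction I arbitrary: J)
  case Nil
  then show ?case by simp
next
  case (Cons i I)
  obtain j J' where J: "J = j # J'" using Cons.prems by (cases J) auto
  show ?case
  proof (cases "I = []")
    case True
    then show ?thesis by (intro exI[of _ "[(1, i # J)]"]) (auto simp: fun_eq_iff J)
  next
    case False
    obtain L1 where L1: "\<forall>t\<in>set L1. mset (snd t) = mset I + mset J"
      "\<And>F :: nat \<Rightarrow> 'a \<Rightarrow> 'a. (\<forall>i\<in>set I \<union> set J. smooth_on UNIV (F i)) \<Longrightarrow> lie_bracket (commutator F I) (commutator F J) = lin_comb L1 F"
      using Cons.IH[OF False Cons.prems(2)] by blast
    obtain L2 where L2: "\<forall>t\<in>set L2. mset (snd t) = mset I + mset (i # J)"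
      "\<And>F :: nat \<Rightarrow> 'a \<Rightarrow> 'a. (\<forall>k\<in>set I \<union> set (i # J). smooth_on UNIV (F k)) \<Longrightarrow> lie_bracket (commutator F I) (commutator F (i # J)) = lin_comb L2 F"
      using Cons.IH[OF False, of "i # J"] by blast
    let ?L = "map (\<lambda>(c, K). (c, i # K)) L1 @ map (\<lambda>(c, K). (- c, K)) L2"
    have "lie_bracket (commutator F (i # I)) (commutator F J) = lin_comb ?L F"
      if F: "\<forall>k\<in>set (i # I) \<union> set J. smooth_on UNIV (F k)" for F :: "nat \<Rightarrow> 'a \<Rightarrow> 'a"
    proof
      fix x
      have iI: "commutator F (i # I) = lie_bracket (F i) (commutator F I)"
        using False by (cases I) auto
      have iJ: "commutator F (i # J) = lie_bracket (F i) (commutator F J)"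
        by (simp add: J)
      have s: "smooth_on UNIV (commutator F I)" "smooth_on UNIV (commutator F J)" "smooth_on UNIV (F i)"
        using F by (auto intro!: smooth_commutator)
      have set_L1: "set (snd t) = set I \<union> set J" if "t \<in> set L1" for t
        using L1(1) that by (metis set_mset_mset set_mset_union)
      have "lie_bracket (commutator F (i # I)) (commutator F J) x =
          lie_bracket (F i) (lie_bracket (commutator F I) (commutator F J)) x - lie_bracket (commutator F I) (commutator F (i # J)) x"
        unfolding iI iJ by (rule jacobi[OF s(3,1,2)])
      also have "lie_bracket (commutator F I) (commutator F J) = lin_comb L1 F"
        using F by (intro L1(2)) auto
      also have "lie_bracket (commutator F I) (commutator F (i # J)) = lin_comb L2 F"
        using F by (intro L2(2)) auto
      also have "lie_bracket (F i) (lin_comb L1 F) x = lin_comb (map (\<lambda>(c, K). (c, i # K)) L1) F x"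
        using F s set_L1 False by (intro lie_bracket_lin_comb) fastforce+
      finally show "lie_bracket (commutator F (i # I)) (commutator F J) x = lin_comb ?L F x"
        by (simp add: lin_comb_append lin_comb_uminus)
    qed
    moreover have "\<forall>t\<in>set ?L. mset (snd t) = mset (i # I) + mset J"
      using L1(1) L2(1) by auto
    ultimately show ?thesis by blast
  qed
qed

section \<open>Universal relations between commutators\<close>

lemma nc_mult_var_left:
  "nc_mult (nc_var i) P J = (case J of [] \<Rightarrow> 0 | a # J' \<Rightarrow> if a = i then P J' else 0)"
proof (cases J)
  case (Cons a J')
  have "nc_mult (nc_var i) P J = (\<Sum>k\<in>{1}. nc_var i (take k J) * P (drop k J))"
    unfolding nc_mult_def
  proof (rule sum.mono_neutral_right)
    have "take k J \<noteq> [i]" if "k \<noteq> 1" "k \<le> length J" for k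
    proof
      assume "take k J = [i]"
      then have "length (take k J) = 1" by simp
      then show False using that by simp
    qed
    then show "\<forall>k\<in>{..length J} - {1}. nc_var i (take k J) * P (drop k J) = 0"
      by (auto simp: nc_var_def)
  qed (auto simp: Cons)
  then show ?thesis by (auto simp: Cons nc_var_def)
qed (simp add: nc_mult_def nc_var_def)

lemma nc_mult_var_right:
  "nc_mult P (nc_var i) J = (if J \<noteq> [] \<and> last J = i then P (butlast J) else 0)"
proof (cases J rule: rev_cases)
  case (snoc J' a)
  have "nc_mult P (nc_var i) J = (\<Sum>k\<in>{length J'}. P (take k J) * nc_var i (drop k J))"
    unfolding nc_mult_def
  proof (rule sum.mono_neutral_right)
    have "drop k J \<noteq> [i]" if "k \<noteq> length J'" "k \<le> length J" for k
    proof
      assume "drop k J = [i]"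
      then have "length (drop k J) = 1" by simp
      then show False using that snoc by simp
    qed
    then show "\<forall>k\<in>{..length J} - {length J'}. P (take k J) * nc_var i (drop k J) = 0"
      by (auto simp: nc_var_def)
  qed (auto simp: snoc)
  then show ?thesis by (auto simp: snoc nc_var_def)
qed (simp add: nc_mult_def nc_var_def)

lemma nc_commutator_mset: "nc_commutator I J \<noteq> 0 \<Longrightarrow> mset J = mset I"
proof (induction I arbitrary: J rule: nc_commutator.induct)
  case (2 i)
  then show ?case by (auto simp: nc_var_def split: if_splits)
next
  case (3 i j I)
  have "nc_mult (nc_var i) (nc_commutator (j # I)) J \<noteq> 0 \<or> nc_mult (nc_commutator (j # I)) (nc_var i) J \<noteq> 0"
    using "3.prems" by auto
  then show ?case
  proof
    assume "nc_mult (nc_var i) (nc_commutator (j # I)) J \<noteq> 0"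
    then obtain J' where "J = i # J'" "nc_commutator (j # I) J' \<noteq> 0"
      by (auto simp: nc_mult_var_left split: list.splits if_splits)
    then show ?thesis using "3.IH" by simp
  next
    assume "nc_mult (nc_commutator (j # I)) (nc_var i) J \<noteq> 0"
    then have "J \<noteq> []" "last J = i" "nc_commutator (j # I) (butlast J) \<noteq> 0"
      by (auto simp: nc_mult_var_right split: if_splits)
    then show ?thesis using "3.IH"[of "butlast J"]
      by (metis add_mset_add_single append_butlast_last_id mset.simps(2) mset_append mset.simps(1) union_commute union_mset_add_mset_left)
  qed
qed auto

text \<open>The monomial with word \<open>J\<close> evaluated at the fields, as a differential
  operator.\<close>

primrec iterated_vf_apply :: "(nat \<Rightarrow> 'a \<Rightarrow> 'a) \<Rightarrow> nat list \<Rightarrow> ('a \<Rightarrow> real) \<Rightarrow> 'a::real_normed_vector \<Rightarrow> real" where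
  "iterated_vf_apply F [] f = f"
| "iterated_vf_apply F (j # J) f = vf_apply (F j) (iterated_vf_apply F J f)"

lemma iterated_vf_apply_snoc:
  "iterated_vf_apply F (J @ [i]) f = iterated_vf_apply F J (vf_apply (F i) f)"
  by (induction J) auto

lemma smooth_iterated_vf_apply:
  fixes F :: "nat \<Rightarrow> 'a::euclidean_space \<Rightarrow> 'a"
  assumes "\<And>i. i \<in> set J \<Longrightarrow> smooth_on UNIV (F i)" "smooth_on UNIV f"
  shows "smooth_on UNIV (iterated_vf_apply F J f)"
  using assms by (induction J) (auto intro: smooth_vf_apply)

lemma vf_apply_sum_fun:
  assumes "\<And>i. i \<in> I \<Longrightarrow> smooth_on UNIV (g i)"
  shows "vf_apply V (\<lambda>x. \<Sum>i\<in>I. c i * g i x) x = (\<Sum>i\<in>I. c i * vf_apply V (g i) x)"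
proof -
  have "((\<lambda>x. \<Sum>i\<in>I. c i * g i x) has_derivative (\<lambda>h. \<Sum>i\<in>I. c i * frechet_derivative (g i) (at x) h)) (at x)"
    by (intro has_derivative_sum has_derivative_mult_right frechet_derivative_has_derivative smooth_on_differentiable[OF _ UNIV_I] assms)
  then show ?thesis by (simp add: vf_apply_def frechet_derivative_unique)
qed

definition words :: "nat \<Rightarrow> nat \<Rightarrow> nat list set" where
  "words n m = {J. set J \<subseteq> {0..n} \<and> length J = m}"

lemma finite_words: "finite (words n m)"
  unfolding words_def by (rule finite_lists_length_eq) simp

lemma sum_words_Cons:
  assumes "i \<le> n"
  shows "(\<Sum>K\<in>words n (Suc m). nc_mult (nc_var i) P K * G K) = (\<Sum>J\<in>words n m. P J * G (i # J))"
proof -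
  have "(\<Sum>K\<in>words n (Suc m). nc_mult (nc_var i) P K * G K) = (\<Sum>K\<in>(#) i ` words n m. nc_mult (nc_var i) P K * G K)"
    using assms
    by (intro sum.mono_neutral_right finite_words)
      (auto simp: words_def nc_mult_var_left image_iff split: list.splits)
  also have "\<dots> = (\<Sum>J\<in>words n m. P J * G (i # J))"
    by (subst sum.reindex) (auto simp: nc_mult_var_left)
  finally show ?thesis .
qed

lemma sum_words_snoc:
  assumes "i \<le> n"
  shows "(\<Sum>K\<in>words n (Suc m). nc_mult P (nc_var i) K * G K) = (\<Sum>J\<in>words n m. P J * G (J @ [i]))"
proof -
  have sub: "(\<lambda>J. J @ [i]) ` words n m \<subseteq> words n (Suc m)" using assms by (auto simp: words_def)
  have zero: "nc_mult P (nc_var i) K * G K = 0" if "K \<in> words n (Suc m) - (\<lambda>J. J @ [i]) ` words n m" for K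
  proof (cases K rule: rev_cases)
    case (snoc K' a)
    then have "a \<noteq> i" using that by (auto simp: words_def)
    then show ?thesis by (simp add: nc_mult_var_right snoc)
  qed (use that in \<open>simp add: words_def\<close>)
  have "(\<Sum>K\<in>words n (Suc m). nc_mult P (nc_var i) K * G K) = (\<Sum>K\<in>(\<lambda>J. J @ [i]) ` words n m. nc_mult P (nc_var i) K * G K)"
    using zero sub by (intro sum.mono_neutral_right finite_words) auto
  also have "\<dots> = (\<Sum>J\<in>words n m. P J * G (J @ [i]))"
    by (subst sum.reindex) (auto simp: nc_mult_var_right inj_on_def)
  finally show ?thesis .
qed

text \<open>Substituting fields for the indeterminates respects products, hence sends formal
  commutators to Lie brackets. Words of length \<open>length I\<close> suffice because
  \<open>nc_commutator I\<close> is homogeneous in the length.\<close>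

lemma vf_apply_commutator:
  fixes F :: "nat \<Rightarrow> 'a::euclidean_space \<Rightarrow> 'a"
  assumes F: "\<And>i. i \<le> n \<Longrightarrow> smooth_on UNIV (F i)"
    and "I \<noteq> []" "set I \<subseteq> {0..n}" "smooth_on UNIV f"
  shows "vf_apply (commutator F I) f x = (\<Sum>J\<in>words n (length I). nc_commutator I J * iterated_vf_apply F J f x)"
  using assms(2-)
proof (induction I arbitrary: f x rule: nc_commutator.induct)
  case (2 i)
  have "(\<Sum>J\<in>words n (length [i]). nc_commutator [i] J * iterated_vf_apply F J f x) = (\<Sum>J\<in>{[i]}. nc_commutator [i] J * iterated_vf_apply F J f x)"
    using 2 by (intro sum.mono_neutral_right finite_words) (auto simp: nc_var_def words_def)
  then show ?case by (simp add: nc_var_def)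
next
  case (3 i j I)
  let ?I = "j # I"
  have i: "i \<le> n" and sub: "set ?I \<subseteq> {0..n}" using "3.prems" by auto
  have s: "smooth_on UNIV (F i)" "smooth_on UNIV (commutator F ?I)" "smooth_on UNIV f"
    using "3.prems" F by (auto intro!: smooth_commutator F)
  have sf: "smooth_on UNIV (vf_apply (F i) f)" by (intro smooth_vf_apply s) auto
  have "vf_apply (commutator F (i # ?I)) f x = vf_apply (F i) (vf_apply (commutator F ?I) f) x - vf_apply (commutator F ?I) (vf_apply (F i) f) x"
    using vf_apply_lie_bracket[OF s] by simp
  also have "vf_apply (commutator F ?I) f = (\<lambda>x. \<Sum>J\<in>words n (length ?I). nc_commutator ?I J * iterated_vf_apply F J f x)"
    using "3.IH"(1)[OF _ sub s(3)] by auto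
  also have "vf_apply (F i) \<dots> x = (\<Sum>J\<in>words n (length ?I). nc_commutator ?I J * iterated_vf_apply F (i # J) f x)"
    using s(3) by (subst vf_apply_sum_fun) (auto intro!: smooth_iterated_vf_apply F simp: words_def)
  also have "vf_apply (commutator F ?I) (vf_apply (F i) f) x = (\<Sum>J\<in>words n (length ?I). nc_commutator ?I J * iterated_vf_apply F (J @ [i]) f x)"
    unfolding iterated_vf_apply_snoc by (rule "3.IH"(1)[OF _ sub sf]) simp
  also have "(\<Sum>J\<in>words n (length ?I). nc_commutator ?I J * iterated_vf_apply F (i # J) f x) - (\<Sum>J\<in>words n (length ?I). nc_commutator ?I J * iterated_vf_apply F (J @ [i]) f x)
    = (\<Sum>K\<in>words n (Suc (length ?I)). nc_commutator (i # ?I) K * iterated_vf_apply F K f x)"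
    unfolding sum_words_Cons[OF i, where G = "\<lambda>K. iterated_vf_apply F K f x", symmetric]
      sum_words_snoc[OF i, where G = "\<lambda>K. iterated_vf_apply F K f x", symmetric] nc_commutator.simps
    by (simp add: left_diff_distrib sum_subtractf)
  finally show ?case by simp
qed simp

text \<open>A relation in the free algebra survives the substitution of arbitrary smooth fields.
  Through this, freeness of one family has consequences for all others.\<close>

lemma commutator_relation:
  fixes F :: "nat \<Rightarrow> 'a::euclidean_space \<Rightarrow> 'a"
  assumes F: "\<And>i. i \<le> n \<Longrightarrow> smooth_on UNIV (F i)"
    and T: "finite T" "T \<subseteq> multiindices n"
    and a: "\<And>J. (\<Sum>I\<in>T. a I * nc_commutator I J) = 0"
  shows "(\<Sum>I\<in>T. a I *\<^sub>R commutator F I x) = 0"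
proof -
  \<comment> \<open>One finite set of words for all \<open>I\<close>, so that the sums over
    \<open>I\<close> and \<open>J\<close> can be exchanged.\<close>
  define W where "W = (\<Union>I\<in>T. words n (length I))"
  have W: "finite W" using T(1) finite_words by (auto simp: W_def)
  have "vf_apply (\<lambda>x. \<Sum>I\<in>T. a I *\<^sub>R commutator F I x) f x = vf_apply (\<lambda>x. 0) f x" if f: "smooth_on UNIV f" for f
  proof -
    have "vf_apply (\<lambda>x. \<Sum>I\<in>T. a I *\<^sub>R commutator F I x) f x = (\<Sum>I\<in>T. a I * vf_apply (commutator F I) f x)"
      by (rule vf_apply_field_linear(4)[OF f])
    also have "\<dots> = (\<Sum>I\<in>T. a I * (\<Sum>J\<in>W. nc_commutator I J * iterated_vf_apply F J f x))"
    proof (rule sum.cong[OF refl])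
      fix I assume I: "I \<in> T"
      have "I \<noteq> []" "set I \<subseteq> {0..n}" using I T(2) by (auto simp: multiindices_def)
      then have "vf_apply (commutator F I) f x = (\<Sum>J\<in>words n (length I). nc_commutator I J * iterated_vf_apply F J f x)"
        by (intro vf_apply_commutator F f)
      also have "\<dots> = (\<Sum>J\<in>W. nc_commutator I J * iterated_vf_apply F J f x)"
      proof (rule sum.mono_neutral_left[OF W])
        show "words n (length I) \<subseteq> W" using I by (auto simp: W_def)
        show "\<forall>J\<in>W - words n (length I). nc_commutator I J * iterated_vf_apply F J f x = 0"
        proof
          fix J assume J: "J \<in> W - words n (length I)"
          have "nc_commutator I J = 0"
          proof (rule ccontr)
            assume "nc_commutator I J \<noteq> 0"
            then have "mset J = mset I" by (rule nc_commutator_mset)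
            then have "length J = length I" "set J = set I" by (metis size_mset, metis set_mset_mset)
            then show False using J \<open>set I \<subseteq> {0..n}\<close> by (auto simp: words_def)
          qed
          then show "nc_commutator I J * iterated_vf_apply F J f x = 0" by simp
        qed
      qed
      finally show "a I * vf_apply (commutator F I) f x = a I * (\<Sum>J\<in>W. nc_commutator I J * iterated_vf_apply F J f x)" by simp
    qed
    also have "\<dots> = (\<Sum>J\<in>W. (\<Sum>I\<in>T. a I * nc_commutator I J) * iterated_vf_apply F J f x)"
      by (simp add: sum_distrib_left sum_distrib_right mult_ac sum.swap[of _ W])
    also have "\<dots> = 0" by (simp add: a)
    finally show ?thesis
      using linear_0[OF linear_frechet_derivative[OF smooth_on_differentiable[OF f UNIV_I]]]
      by (simp add: vf_apply_def)
  qed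
  from vf_eqI[OF this] show ?thesis .
qed

section \<open>Weights and the reduction to the basis multiindices\<close>

lemma weight_cong_mset: "mset I = mset J \<Longrightarrow> weight I = weight J"
  unfolding weight_def by (metis mset_map sum_mset_sum_list)

lemma nc_commutator_weight: "nc_commutator I J \<noteq> 0 \<Longrightarrow> weight J = weight I"
  by (rule weight_cong_mset[OF nc_commutator_mset])

lemma length_le_weight: "length I \<le> weight I"
  by (induction I) (auto simp: weight_def field_weight_def)

lemma weight_Cons: "weight (i # I) = field_weight i + weight I"
  by (simp add: weight_def)

lemma field_weight_pos: "0 < field_weight i"
  by (simp add: field_weight_def)

lemma multiindices_weight_pos: "I \<in> multiindices n \<Longrightarrow> 0 < weight I"
  using length_le_weight[of I] by (cases I) (auto simp: multiindices_def)

lemma finite_multiindices_upto: "finite (multiindices_upto n r)"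
proof (rule finite_subset)
  show "multiindices_upto n r \<subseteq> {I. set I \<subseteq> {0..n} \<and> length I \<le> r}"
  proof
    fix I assume I: "I \<in> multiindices_upto n r"
    then have "length I \<le> r" using length_le_weight[of I] by (simp add: multiindices_upto_def)
    then show "I \<in> {I. set I \<subseteq> {0..n} \<and> length I \<le> r}"
      using I by (simp add: multiindices_upto_def multiindices_def)
  qed
qed (rule finite_lists_length_le, simp)

text \<open>The relation expressing \<open>I\<close> through the basis, written with one coefficient
  per multiindex as \<open>free_upto\<close> requires. A vector-valued \<open>G\<close> lets it be
  read both for fields at a point and for the numbers \<open>nc_commutator K J\<close>.\<close>

lemma sum_indicator_minus_basis:
  fixes G :: "nat list \<Rightarrow> 'v::real_vector" and B :: "'p::finite \<Rightarrow> nat list"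
  assumes "finite T" "I \<in> T" "range B \<subseteq> T"
  shows "(\<Sum>K\<in>T. ((if K = I then 1 else 0) - (\<Sum>j\<in>UNIV. c j * (if K = B j then 1 else 0))) *\<^sub>R G K)
      = G I - (\<Sum>j\<in>UNIV. c j *\<^sub>R G (B j))"
proof -
  have "(\<Sum>K\<in>T. (if K = I then 1 else 0) *\<^sub>R G K) = G I"
    using assms(1,2) by (simp add: if_distrib[of "\<lambda>c. c *\<^sub>R _"] sum.delta' cong: if_cong)
  moreover have "(\<Sum>K\<in>T. (\<Sum>j\<in>UNIV. c j * (if K = B j then 1 else 0)) *\<^sub>R G K) = (\<Sum>j\<in>UNIV. \<Sum>K\<in>T. (c j * (if K = B j then 1 else 0)) *\<^sub>R G K)"
    by (subst sum.swap) (simp add: scaleR_sum_left)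
  moreover have "(\<Sum>K\<in>T. (c j * (if K = B j then 1 else 0)) *\<^sub>R G K) = c j *\<^sub>R G (B j)" for j
  proof -
    have "B j \<in> T" using assms(3) by auto
    have "(\<Sum>K\<in>T. (c j * (if K = B j then 1 else 0)) *\<^sub>R G K) = (\<Sum>K\<in>T. if K = B j then c j *\<^sub>R G K else 0)"
      by (intro sum.cong) auto
    then show ?thesis using assms(1) \<open>B j \<in> T\<close> by simp
  qed
  ultimately show ?thesis by (simp add: scaleR_diff_left sum_subtractf)
qed

text \<open>At the origin the fields with index in \<open>B\<close> are the unit vectors, so the
  coordinates of \<open>commutator Y I 0\<close> are the coefficients of a linear relation there.
  Freeness lifts this relation from a single point to the free algebra, from where it descends to
  every smooth family, at all points and with the same coefficients.\<close>

theorem universal_relation: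
  fixes Y :: "nat \<Rightarrow> real^'p \<Rightarrow> real^'p" and B :: "'p::finite \<Rightarrow> nat list"
  assumes free: "free_upto n r UNIV Y" and basis: "\<And>j. commutator Y (B j) 0 = axis j 1"
    and B: "range B \<subseteq> multiindices_upto n r" and I: "I \<in> multiindices_upto n r"
  shows "\<exists>c :: 'p \<Rightarrow> real. (\<forall>j. c j \<noteq> 0 \<longrightarrow> weight (B j) = weight I) \<and>
    (\<forall>F :: nat \<Rightarrow> real^'p \<Rightarrow> real^'p. (\<forall>i\<le>n. smooth_on UNIV (F i)) \<longrightarrow>
       (\<forall>x. commutator F I x = (\<Sum>j\<in>UNIV. c j *\<^sub>R commutator F (B j) x)))"
proof -
  let ?T = "multiindices_upto n r"
  note ind = sum_indicator_minus_basis[OF finite_multiindices_upto[of n r] I B]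
  define c0 where "c0 j = commutator Y I 0 $ j" for j
  have "(\<Sum>K\<in>?T. ((if K = I then 1 else 0) - (\<Sum>j\<in>UNIV. c0 j * (if K = B j then 1 else 0))) *\<^sub>R commutator Y K 0) = 0"
    unfolding ind by (simp add: basis c0_def vec_eq_iff axis_def if_distrib cong: if_cong)
  then have "(\<Sum>K\<in>?T. ((if K = I then 1 else 0) - (\<Sum>j\<in>UNIV. c0 j * (if K = B j then 1 else 0))) * nc_commutator K J) = 0" for J
    using free unfolding free_upto_def
    by (elim ballE[of _ _ 0] allE[of _ "\<lambda>K. (if K = I then 1 else 0) - (\<Sum>j\<in>UNIV. c0 j * (if K = B j then 1 else 0))"]) simp_all
  then have A: "nc_commutator I J = (\<Sum>j\<in>UNIV. c0 j * nc_commutator (B j) J)" for J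
    using ind[of c0 "\<lambda>K. nc_commutator K J"] by simp
  \<comment> \<open>Coefficients at indices of another weight are dropped. The relation survives,
    since for a fixed word \<open>J\<close> only commutators of the weight of \<open>J\<close>
    contribute.\<close>
  define c where "c j = (if weight (B j) = weight I then c0 j else 0)" for j
  have A': "nc_commutator I J = (\<Sum>j\<in>UNIV. c j * nc_commutator (B j) J)" for J
  proof (cases "weight J = weight I")
    case True
    have "c0 j * nc_commutator (B j) J = c j * nc_commutator (B j) J" for j
      using nc_commutator_weight[of "B j" J] True by (cases "nc_commutator (B j) J = 0") (simp_all add: c_def)
    then show ?thesis by (simp only: A[of J])
  next
    case False
    have "c j * nc_commutator (B j) J = 0" for j
      using nc_commutator_weight[of "B j" J] False by (cases "nc_commutator (B j) J = 0") (simp_all add: c_def)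
    moreover have "nc_commutator I J = 0"
      using nc_commutator_weight[of I J] False by auto
    ultimately show ?thesis by (simp only: sum.neutral_const)
  qed
  have "commutator F I x = (\<Sum>j\<in>UNIV. c j *\<^sub>R commutator F (B j) x)"
    if F: "\<And>i. i \<le> n \<Longrightarrow> smooth_on UNIV (F i)" for F :: "nat \<Rightarrow> real^'p \<Rightarrow> real^'p" and x
  proof -
    have "(\<Sum>K\<in>?T. ((if K = I then 1 else 0) - (\<Sum>j\<in>UNIV. c j * (if K = B j then 1 else 0))) *\<^sub>R commutator F K x) = 0"
    proof (rule commutator_relation[OF _ finite_multiindices_upto])
      show "smooth_on UNIV (F i)" if "i \<le> n" for i by (rule F[OF that])
      show "?T \<subseteq> multiindices n" by (auto simp: multiindices_upto_def)
      show "(\<Sum>K\<in>?T. ((if K = I then 1 else 0) - (\<Sum>j\<in>UNIV. c j * (if K = B j then 1 else 0))) * nc_commutator K J) = 0" for J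
        using ind[of c "\<lambda>K. nc_commutator K J"] A'[of J] by simp
    qed
    then show ?thesis unfolding ind by simp
  qed
  moreover have "\<forall>j. c j \<noteq> 0 \<longrightarrow> weight (B j) = weight I" by (auto simp: c_def)
  ultimately show ?thesis by blast
qed

text \<open>The bracket is a combination of words in the joint letters of \<open>B i\<close> and
  \<open>B j\<close>. Their weight \<open>weight (B i) + weight (B j)\<close> is at most
  \<open>r\<close>, so each of them reduces to the basis.\<close>

corollary universal_structure_constants:
  fixes Y :: "nat \<Rightarrow> real^'p \<Rightarrow> real^'p" and B :: "'p::finite \<Rightarrow> nat list"
  assumes free: "free_upto n r UNIV Y" and basis: "\<And>j. commutator Y (B j) 0 = axis j 1"
    and B: "range B \<subseteq> multiindices_upto n r" and ij: "weight (B i) + weight (B j) \<le> r"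
  shows "\<exists>c :: 'p \<Rightarrow> real. (\<forall>k. c k \<noteq> 0 \<longrightarrow> weight (B k) = weight (B i) + weight (B j)) \<and>
    (\<forall>F :: nat \<Rightarrow> real^'p \<Rightarrow> real^'p. (\<forall>i\<le>n. smooth_on UNIV (F i)) \<longrightarrow>
       (\<forall>x. lie_bracket (commutator F (B i)) (commutator F (B j)) x = (\<Sum>k\<in>UNIV. c k *\<^sub>R commutator F (B k) x)))"
proof -
  have Bn: "B k \<noteq> []" "set (B k) \<subseteq> {0..n}" for k
    using B by (auto simp: multiindices_upto_def multiindices_def)
  obtain L where L: "\<forall>t\<in>set L. mset (snd t) = mset (B i) + mset (B j)"
    "\<And>F :: nat \<Rightarrow> real^'p \<Rightarrow> real^'p. (\<forall>k\<in>set (B i) \<union> set (B j). smooth_on UNIV (F k)) \<Longrightarrow>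
       lie_bracket (commutator F (B i)) (commutator F (B j)) = lin_comb L F"
    using lie_bracket_commutators[OF Bn(1) Bn(1)] by blast
  have "\<exists>c :: 'p \<Rightarrow> real. (\<forall>k. c k \<noteq> 0 \<longrightarrow> weight (B k) = weight (B i) + weight (B j)) \<and>
    (\<forall>F :: nat \<Rightarrow> real^'p \<Rightarrow> real^'p. (\<forall>i\<le>n. smooth_on UNIV (F i)) \<longrightarrow>
       (\<forall>x. lin_comb L F x = (\<Sum>k\<in>UNIV. c k *\<^sub>R commutator F (B k) x)))"
    using L(1)
  proof (induction L)
    case Nil
    then show ?case by (intro exI[of _ "\<lambda>_. 0"]) simp
  next
    case (Cons t L)
    have m: "mset (snd t) = mset (B i @ B j)" using Cons.prems by simp
    have w: "weight (snd t) = weight (B i) + weight (B j)"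
      using weight_cong_mset[OF m] by (simp add: weight_def)
    have "set (snd t) = set (B i) \<union> set (B j)" using m by (metis set_append set_mset_mset)
    moreover have "snd t \<noteq> []" using m Bn by (metis Nil_is_append_conv mset_zero_iff)
    ultimately have "snd t \<in> multiindices_upto n r"
      using Bn w ij by (auto simp: multiindices_upto_def multiindices_def)
    from universal_relation[OF free basis B this] obtain c1 where c1:
      "\<forall>k. c1 k \<noteq> 0 \<longrightarrow> weight (B k) = weight (snd t)"
      "\<And>F :: nat \<Rightarrow> real^'p \<Rightarrow> real^'p. (\<forall>i\<le>n. smooth_on UNIV (F i)) \<Longrightarrow>
       (\<forall>x. commutator F (snd t) x = (\<Sum>j\<in>UNIV. c1 j *\<^sub>R commutator F (B j) x))" by blast
    obtain c2 where c2:
      "\<forall>k. c2 k \<noteq> 0 \<longrightarrow> weight (B k) = weight (B i) + weight (B j)"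
      "\<And>F :: nat \<Rightarrow> real^'p \<Rightarrow> real^'p. (\<forall>i\<le>n. smooth_on UNIV (F i)) \<Longrightarrow>
       (\<forall>x. lin_comb L F x = (\<Sum>k\<in>UNIV. c2 k *\<^sub>R commutator F (B k) x))" using Cons by auto
    show ?case
    proof (intro exI[of _ "\<lambda>k. fst t * c1 k + c2 k"] conjI allI impI)
      fix k assume "fst t * c1 k + c2 k \<noteq> 0"
      then have "c1 k \<noteq> 0 \<or> c2 k \<noteq> 0" by auto
      then show "weight (B k) = weight (B i) + weight (B j)" using c1(1) c2(1) w by auto
    next
      fix F :: "nat \<Rightarrow> real^'p \<Rightarrow> real^'p" and x
      assume "\<forall>i\<le>n. smooth_on UNIV (F i)"
      then show "lin_comb (t # L) F x = (\<Sum>k\<in>UNIV. (fst t * c1 k + c2 k) *\<^sub>R commutator F (B k) x)"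
        using c1(2) c2(2) by (simp add: scaleR_add_left sum.distrib scaleR_sum_right)
    qed
  qed
  then obtain c :: "'p \<Rightarrow> real" where c: "\<forall>k. c k \<noteq> 0 \<longrightarrow> weight (B k) = weight (B i) + weight (B j)"
    "\<And>F :: nat \<Rightarrow> real^'p \<Rightarrow> real^'p. (\<forall>i\<le>n. smooth_on UNIV (F i)) \<Longrightarrow>
       (\<forall>x. lin_comb L F x = (\<Sum>k\<in>UNIV. c k *\<^sub>R commutator F (B k) x))" by blast
  show ?thesis
  proof (intro exI[of _ c] conjI allI impI)
    show "weight (B k) = weight (B i) + weight (B j)" if "c k \<noteq> 0" for k
      using c(1) that by blast
    fix F :: "nat \<Rightarrow> real^'p \<Rightarrow> real^'p" and x
    assume F: "\<forall>i\<le>n. smooth_on UNIV (F i)"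
    have "\<forall>k\<in>set (B i) \<union> set (B j). smooth_on UNIV (F k)"
      using F Bn(2)[of i] Bn(2)[of j] by auto
    then show "lie_bracket (commutator F (B i)) (commutator F (B j)) x = (\<Sum>k\<in>UNIV. c k *\<^sub>R commutator F (B k) x)"
      using L(2) c(2)[OF F] by simp
  qed
qed

section \<open>Taylor approximation of Hoelder regular fields\<close>

lemma frechet_derivative_cong:
  assumes "open S" "x \<in> S" "\<And>x. x \<in> S \<Longrightarrow> f x = g x"
  shows "frechet_derivative f (at x) = frechet_derivative g (at x)"
proof -
  have "(f has_derivative D) (at x) \<longleftrightarrow> (g has_derivative D) (at x)" for D
    using has_derivative_transform_within_open[OF _ assms(1,2), of f D UNIV g]
      has_derivative_transform_within_open[OF _ assms(1,2), of g D UNIV f] assms(3) by auto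
  then show ?thesis unfolding frechet_derivative_def by simp
qed

text \<open>\<open>vanishes k y f\<close>: all partial derivatives of order \<open>\<le> k\<close> of \<open>f\<close> vanish at \<open>y\<close>.\<close>

primrec vanishes :: "nat \<Rightarrow> 'a \<Rightarrow> ('a::euclidean_space \<Rightarrow> real) \<Rightarrow> bool" where
  "vanishes 0 y f \<longleftrightarrow> f y = 0"
| "vanishes (Suc k) y f \<longleftrightarrow> f y = 0 \<and> (\<forall>b\<in>Basis. vanishes k y (\<lambda>x. frechet_derivative f (at x) b))"

lemma vanishes_Suc_imp: "vanishes (Suc k) y f \<Longrightarrow> vanishes k y f"
proof (induction k arbitrary: f)
  case (Suc k)
  then show ?case by (metis vanishes.simps(2))
qed simp

lemma vanishes_imp_zero: "vanishes k y f \<Longrightarrow> f y = 0"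
  by (cases k) auto

locale regularity_at = regularity +
  fixes y assumes y_in_S: "y \<in> S"
begin

lemma vanishes_cong:
  assumes "vanishes k y f" "\<And>x. x \<in> S \<Longrightarrow> f x = g x"
  shows "vanishes k y g"
  using assms
proof (induction k arbitrary: f g)
  case 0
  then show ?case using y_in_S by simp
next
  case (Suc k)
  have "vanishes k y (\<lambda>x. frechet_derivative g (at x) b)" if "b \<in> Basis" for b
  proof (rule Suc.IH)
    show "vanishes k y (\<lambda>x. frechet_derivative f (at x) b)" using Suc.prems(1) that by simp
    show "frechet_derivative f (at x) b = frechet_derivative g (at x) b" if "x \<in> S" for x
      using frechet_derivative_cong[OF open_S that Suc.prems(2)] by simp
  qed
  then show ?case using Suc.prems y_in_S by simp
qed

lemma vanishes_SucI:
  assumes "\<And>x. x \<in> S \<Longrightarrow> (f has_derivative f' x) (at x)" "f y = 0"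
    and "\<And>b. b \<in> Basis \<Longrightarrow> vanishes k y (\<lambda>x. f' x b)"
  shows "vanishes (Suc k) y f"
proof -
  have "vanishes k y (\<lambda>x. frechet_derivative f (at x) b)" if "b \<in> Basis" for b
    using vanishes_cong[OF assms(3)[OF that]] frechet_derivative_unique[OF assms(1)] by simp
  then show ?thesis using assms(2) by simp
qed

lemma vanishes_zero: "vanishes k y (\<lambda>x. 0)"
proof (induction k)
  case (Suc k)
  show ?case by (rule vanishes_SucI[of _ "\<lambda>x h. 0"]) (use Suc in auto)
qed simp

lemma vanishes_add:
  assumes "vanishes k y f" "vanishes k y g" "Ck P k S f" "Ck P k S g"
  shows "vanishes k y (\<lambda>x. f x + g x)"
  using assms
proof (induction k arbitrary: f g)
  case (Suc k)
  show ?case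
  proof (rule vanishes_SucI[of _ "\<lambda>x h. frechet_derivative f (at x) h + frechet_derivative g (at x) h"])
    show "((\<lambda>x. f x + g x) has_derivative (\<lambda>h. frechet_derivative f (at x) h + frechet_derivative g (at x) h)) (at x)"
      if "x \<in> S" for x
      using Suc.prems that by (intro has_derivative_add frechet_derivative_has_derivative) auto
    show "vanishes k y (\<lambda>x. frechet_derivative f (at x) b + frechet_derivative g (at x) b)" if "b \<in> Basis" for b
      by (rule Suc.IH) (use Suc.prems that in simp_all)
  qed (use Suc.prems in simp)
qed simp

lemma vanishes_mult:
  assumes "vanishes k y f" "Ck P k S f" "Ck P k S g"
  shows "vanishes k y (\<lambda>x. f x * g x)"
  using assms
proof (induction k arbitrary: f g)
  case (Suc k)
  let ?D = "\<lambda>f x. frechet_derivative f (at x)"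
  have fk: "Ck P k S f" "Ck P k S g" "vanishes k y f"
    using Suc.prems Ck_Suc_imp vanishes_Suc_imp by blast+
  show ?case
  proof (rule vanishes_SucI[of _ "\<lambda>x h. f x * ?D g x h + ?D f x h * g x"])
    show "((\<lambda>x. f x * g x) has_derivative (\<lambda>h. f x * ?D g x h + ?D f x h * g x)) (at x)"
      if "x \<in> S" for x
      using Suc.prems that by (intro has_derivative_mult frechet_derivative_has_derivative) auto
    show "vanishes k y (\<lambda>x. f x * ?D g x b + ?D f x b * g x)" if b: "b \<in> Basis" for b
    proof -
      have d: "Ck P k S (\<lambda>x. ?D f x b)" "Ck P k S (\<lambda>x. ?D g x b)" "vanishes k y (\<lambda>x. ?D f x b)"
        using Suc.prems b by simp_all
      show ?thesis
        by (intro vanishes_add Suc.IH Ck_mult fk d)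
    qed
  qed (use Suc.prems in simp)
qed simp

lemma vanishes_minus:
  assumes "vanishes k y f" "Ck P k S f"
  shows "vanishes k y (\<lambda>x. - f x)"
  using vanishes_mult[OF assms Ck_const[of k "-1"]] by simp

lemma vanishes_sum:
  assumes "\<And>i. i \<in> I \<Longrightarrow> vanishes k y (f i)" "\<And>i. i \<in> I \<Longrightarrow> Ck P k S (f i)"
  shows "vanishes k y (\<lambda>x. \<Sum>i\<in>I. f i x)"
  using assms
proof (induction I rule: infinite_finite_induct)
  case (insert a I)
  have "vanishes k y (\<lambda>x. f a x + (\<Sum>i\<in>I. f i x))"
    by (intro vanishes_add Ck_sum insert.IH insert.prems) (simp_all add: insert.prems)
  then show ?case using insert.hyps by simp
qed (simp_all add: vanishes_zero)

end

section \<open>Lie brackets in coordinates\<close>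

abbreviation pd :: "'p::finite \<Rightarrow> (real^'p \<Rightarrow> real) \<Rightarrow> real^'p \<Rightarrow> real" where
  "pd l f x \<equiv> frechet_derivative f (at x) (axis l 1)"

lemma frechet_derivative_vec_sum:
  fixes f :: "real^'p::finite \<Rightarrow> 'b::real_normed_vector"
  assumes "f differentiable (at x)"
  shows "frechet_derivative f (at x) h = (\<Sum>l\<in>UNIV. (h $ l) *\<^sub>R frechet_derivative f (at x) (axis l 1))"
proof -
  have "(\<Sum>b\<in>(Basis :: (real^'p) set). (h \<bullet> b) *\<^sub>R frechet_derivative f (at x) b) =
      (\<Sum>b\<in>range (\<lambda>l. axis l 1). (h \<bullet> b) *\<^sub>R frechet_derivative f (at x) b)"
    by (rule sum.cong) (auto simp: Basis_vec_def)
  also have "\<dots> = (\<Sum>l\<in>UNIV. (h $ l) *\<^sub>R frechet_derivative f (at x) (axis l 1))"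
    by (subst sum.reindex) (auto simp: inj_on_def axis_eq_axis inner_axis)
  finally show ?thesis using frechet_derivative_Basis_sum[OF assms, of h] by simp
qed

lemma differentiable_nth:
  fixes V :: "'a::real_normed_vector \<Rightarrow> real^'p::finite"
  assumes "V differentiable (at x)"
  shows "(\<lambda>x. V x $ i) differentiable (at x)"
    and "frechet_derivative (\<lambda>x. V x $ i) (at x) h = frechet_derivative V (at x) h $ i"
proof -
  have "((\<lambda>x. V x $ i) has_derivative (\<lambda>h. frechet_derivative V (at x) h $ i)) (at x)"
    by (rule bounded_linear.has_derivative[OF bounded_linear_vec_nth frechet_derivative_has_derivative[OF assms]])
  then show "(\<lambda>x. V x $ i) differentiable (at x)"
    "frechet_derivative (\<lambda>x. V x $ i) (at x) h = frechet_derivative V (at x) h $ i"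
    by (auto simp: differentiable_def frechet_derivative_unique)
qed

lemma differentiable_vecI:
  fixes V :: "'a::real_normed_vector \<Rightarrow> real^'p::finite"
  assumes "\<And>i. (\<lambda>x. V x $ i) differentiable (at x)"
  shows "V differentiable (at x)"
proof -
  have "\<forall>b\<in>Basis. (\<lambda>x. V x \<bullet> b) differentiable (at x)"
    using assms by (auto simp: Basis_vec_def inner_axis)
  then show ?thesis using differentiable_componentwise_within by blast
qed

lemma lie_bracket_nth:
  fixes V W :: "real^'p \<Rightarrow> real^'p::finite"
  assumes V: "V differentiable (at x)" and W: "W differentiable (at x)"
  shows "lie_bracket V W x $ i = (\<Sum>l\<in>UNIV. V x $ l * pd l (\<lambda>x. W x $ i) x - W x $ l * pd l (\<lambda>x. V x $ i) x)"
proof -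
  have "frechet_derivative W (at x) (V x) $ i = (\<Sum>l\<in>UNIV. V x $ l * pd l (\<lambda>x. W x $ i) x)"
    using frechet_derivative_vec_sum[OF differentiable_nth(1)[OF W], of i "V x"]
    by (simp add: differentiable_nth(2)[OF W])
  moreover have "frechet_derivative V (at x) (W x) $ i = (\<Sum>l\<in>UNIV. W x $ l * pd l (\<lambda>x. V x $ i) x)"
    using frechet_derivative_vec_sum[OF differentiable_nth(1)[OF V], of i "W x"]
    by (simp add: differentiable_nth(2)[OF V])
  ultimately show ?thesis by (simp add: lie_bracket_def sum_subtractf)
qed

lemma Ck_lie_bracket:
  fixes V W :: "real^'p \<Rightarrow> real^'p::finite"
  assumes "regularity S P"
    and V: "\<And>i. Ck P (Suc k) S (\<lambda>x. V x $ i)" and W: "\<And>i. Ck P (Suc k) S (\<lambda>x. W x $ i)"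
  shows "Ck P k S (\<lambda>x. lie_bracket V W x $ i)"
proof -
  interpret regularity S P by fact
  have Vk: "Ck P k S (\<lambda>x. V x $ i)" "Ck P k S (\<lambda>x. W x $ i)" for i
    by (rule Ck_Suc_imp, rule V W)+
  have Dk: "Ck P k S (pd l (\<lambda>x. V x $ i))" "Ck P k S (pd l (\<lambda>x. W x $ i))" for i l
    using V[of i] W[of i] by simp_all
  have "Ck P k S (\<lambda>x. \<Sum>l\<in>UNIV. V x $ l * pd l (\<lambda>x. W x $ i) x - W x $ l * pd l (\<lambda>x. V x $ i) x)"
    by (intro Ck_sum Ck_diff Ck_mult Vk Dk)
  then show ?thesis
  proof (rule Ck_cong)
    fix x assume x: "x \<in> S"
    have "(\<lambda>x. V x $ i) differentiable (at x)" "(\<lambda>x. W x $ i) differentiable (at x)" for i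
      using V W x by simp_all
    note d = this
    have "V differentiable (at x)" "W differentiable (at x)"
      by (rule differentiable_vecI, rule d)+
    from lie_bracket_nth[OF this] show "(\<Sum>l\<in>UNIV. V x $ l * pd l (\<lambda>x. W x $ i) x - W x $ l * pd l (\<lambda>x. V x $ i) x) = lie_bracket V W x $ i"
      by simp
  qed
qed

lemma vanishes_lie_bracket:
  fixes V W V' W' :: "real^'p \<Rightarrow> real^'p::finite"
  assumes "regularity S P" "y \<in> S"
    and V: "\<And>i. Ck P (Suc k) S (\<lambda>x. V x $ i)" "\<And>i. Ck P (Suc k) S (\<lambda>x. W x $ i)"
      "\<And>i. Ck P (Suc k) S (\<lambda>x. V' x $ i)" "\<And>i. Ck P (Suc k) S (\<lambda>x. W' x $ i)"
    and v: "\<And>i. vanishes (Suc k) y (\<lambda>x. V x $ i - V' x $ i)" "\<And>i. vanishes (Suc k) y (\<lambda>x. W x $ i - W' x $ i)"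
  shows "vanishes k y (\<lambda>x. lie_bracket V W x $ i - lie_bracket V' W' x $ i)"
proof -
  interpret regularity S P by fact
  interpret regularity_at S P y by unfold_locales fact
  have Vk: "Ck P k S (\<lambda>x. V x $ i)" "Ck P k S (\<lambda>x. W x $ i)" "Ck P k S (\<lambda>x. V' x $ i)" "Ck P k S (\<lambda>x. W' x $ i)" for i
    by (rule Ck_Suc_imp, rule V)+
  have Dk: "Ck P k S (pd l (\<lambda>x. V x $ i))" "Ck P k S (pd l (\<lambda>x. W x $ i))"
     "Ck P k S (pd l (\<lambda>x. V' x $ i))" "Ck P k S (pd l (\<lambda>x. W' x $ i))" for i l
    using V(1)[of i] V(2)[of i] V(3)[of i] V(4)[of i] by simp_all
  have vk: "vanishes k y (\<lambda>x. V x $ i - V' x $ i)" "vanishes k y (\<lambda>x. W x $ i - W' x $ i)" for i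
    by (rule vanishes_Suc_imp, rule v)+
  have diff: "(\<lambda>x. V x $ i) differentiable (at x)" "(\<lambda>x. W x $ i) differentiable (at x)"
    "(\<lambda>x. V' x $ i) differentiable (at x)" "(\<lambda>x. W' x $ i) differentiable (at x)" if "x \<in> S" for x i
    using V that by simp_all
  have eqD: "frechet_derivative (\<lambda>x. f x - g x) (at x) h = frechet_derivative f (at x) h - frechet_derivative g (at x) h"
    if "f differentiable (at x)" "g differentiable (at x)" for f g :: "real^'p \<Rightarrow> real" and x h
    using frechet_derivative_unique[OF has_derivative_diff[OF that[THEN frechet_derivative_has_derivative]]] by simp
  have vD: "vanishes k y (\<lambda>x. pd l (\<lambda>x. V x $ i) x - pd l (\<lambda>x. V' x $ i) x)"
    "vanishes k y (\<lambda>x. pd l (\<lambda>x. W x $ i) x - pd l (\<lambda>x. W' x $ i) x)" for i l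
  proof -
    have "vanishes k y (pd l (\<lambda>x. V x $ i - V' x $ i))" "vanishes k y (pd l (\<lambda>x. W x $ i - W' x $ i))"
      using v(1)[of i] v(2)[of i] by simp_all
    from this(1) show "vanishes k y (\<lambda>x. pd l (\<lambda>x. V x $ i) x - pd l (\<lambda>x. V' x $ i) x)"
      by (rule vanishes_cong) (intro eqD diff)
    from \<open>vanishes k y (pd l (\<lambda>x. W x $ i - W' x $ i))\<close>
    show "vanishes k y (\<lambda>x. pd l (\<lambda>x. W x $ i) x - pd l (\<lambda>x. W' x $ i) x)"
      by (rule vanishes_cong) (intro eqD diff)
  qed
  \<comment> \<open>Telescoping: each product contains a difference of corresponding components or
    of their first derivatives. The latter vanish to order \<open>k\<close> only, which is the order
    lost by a bracket.\<close>
  have "vanishes k y (\<lambda>x. \<Sum>l\<in>UNIV.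
      ((V x $ l - V' x $ l) * pd l (\<lambda>x. W x $ i) x + (pd l (\<lambda>x. W x $ i) x - pd l (\<lambda>x. W' x $ i) x) * V' x $ l)
    + (- ((W x $ l - W' x $ l) * pd l (\<lambda>x. V x $ i) x) + - ((pd l (\<lambda>x. V x $ i) x - pd l (\<lambda>x. V' x $ i) x) * W' x $ l)))"
    by (intro vanishes_sum vanishes_add vanishes_minus vanishes_mult Ck_add Ck_minus Ck_diff Ck_mult vk vD Vk Dk)
  then show ?thesis
  proof (rule vanishes_cong)
    fix x assume x: "x \<in> S"
    have d: "V differentiable (at x)" "W differentiable (at x)" "V' differentiable (at x)" "W' differentiable (at x)"
      by (intro differentiable_vecI diff x)+
    show "(\<Sum>l\<in>UNIV. ((V x $ l - V' x $ l) * pd l (\<lambda>x. W x $ i) x + (pd l (\<lambda>x. W x $ i) x - pd l (\<lambda>x. W' x $ i) x) * V' x $ l)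
    + (- ((W x $ l - W' x $ l) * pd l (\<lambda>x. V x $ i) x) + - ((pd l (\<lambda>x. V x $ i) x - pd l (\<lambda>x. V' x $ i) x) * W' x $ l)))
      = lie_bracket V W x $ i - lie_bracket V' W' x $ i"
      unfolding lie_bracket_nth[OF d(1,2)] lie_bracket_nth[OF d(3,4)] sum_subtractf[symmetric]
      by (intro sum.cong refl) (simp add: algebra_simps)
  qed
qed

subsection \<open>Derivatives of Taylor polynomials\<close>

definition lists_len :: "nat \<Rightarrow> 'p list set" where
  "lists_len k = {js. length js = k}"

lemma finite_lists_len: "finite (lists_len k :: 'p::finite list set)"
  unfolding lists_len_def using finite_lists_length_eq[of "UNIV :: 'p set" k] by simp

lemma sum_lists_len_Suc:
  fixes F :: "'p::finite list \<Rightarrow> real"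
  shows "(\<Sum>js\<in>lists_len (Suc k). F js) = (\<Sum>j\<in>UNIV. \<Sum>js\<in>lists_len k. F (j # js))"
proof -
  have eq: "lists_len (Suc k) = (\<lambda>(j, js). j # js) ` (UNIV \<times> lists_len k)"
    by (auto simp: lists_len_def length_Suc_conv image_iff)
  have "(\<Sum>js\<in>lists_len (Suc k). F js) = (\<Sum>(j, js)\<in>UNIV \<times> lists_len k. F (j # js))"
    unfolding eq by (subst sum.reindex) (auto simp: inj_on_def intro!: sum.cong)
  then show ?thesis by (simp add: sum.cartesian_product)
qed

text \<open>A k-linear form with coefficient tensor \<open>a\<close>, evaluated on k copies of
  \<open>x - y\<close>; the factor 1 / k! of Taylor's formula is left out.\<close>

definition hom_part :: "nat \<Rightarrow> ('p list \<Rightarrow> real) \<Rightarrow> real^'p::finite \<Rightarrow> real^'p \<Rightarrow> real" where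
  "hom_part k a y x = (\<Sum>js\<in>lists_len k. a js * prod_list (map (\<lambda>j. x $ j - y $ j) js))"

lemma hom_part_0:
  fixes y :: "real^'p::finite"
  shows "hom_part 0 a y x = a []"
proof -
  have "lists_len 0 = {[] :: 'p list}" by (auto simp: lists_len_def)
  then show ?thesis by (simp add: hom_part_def)
qed

lemma hom_part_Suc: "hom_part (Suc k) a y x = (\<Sum>j\<in>UNIV. (x $ j - y $ j) * hom_part k (\<lambda>js. a (j # js)) y x)"
  unfolding hom_part_def sum_lists_len_Suc by (simp add: sum_distrib_left mult_ac)

text \<open>Only exchanges of neighbours are required, which is what symmetry of second derivatives
  supplies, and only for tuples no longer than the number \<open>N\<close> of available
  derivatives.\<close>

definition symmetric_upto :: "nat \<Rightarrow> ('p list \<Rightarrow> real) \<Rightarrow> bool" where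
  "symmetric_upto N a \<longleftrightarrow> (\<forall>ks j l js. length ks + length js + 2 \<le> N \<longrightarrow> a (ks @ j # l # js) = a (ks @ l # j # js))"

lemma symmetric_upto_Cons:
  fixes a :: "'p list \<Rightarrow> real"
  shows "symmetric_upto (Suc N) a \<Longrightarrow> symmetric_upto N (\<lambda>js. a (j # js))"
  unfolding symmetric_upto_def
proof (intro allI impI)
  fix ks js :: "'p list" and i l assume *: "\<forall>ks j l js. length ks + length js + 2 \<le> Suc N \<longrightarrow> a (ks @ j # l # js) = a (ks @ l # j # js)"
    and "length ks + length js + 2 \<le> N"
  then show "a (j # ks @ i # l # js) = a (j # ks @ l # i # js)"
    using *[rule_format, of "j # ks" js i l] by simp
qed

text \<open>Needed because \<open>iterated_partial\<close> differentiates in the last direction of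
  the list first, whereas the derivative of \<open>hom_part\<close> sets the first index
  free.\<close>

lemma symmetric_upto_rotate:
  assumes "symmetric_upto N a" "length ks + length js + 1 \<le> N"
  shows "a (ks @ l # js) = a (ks @ js @ [l])"
  using assms(2)
proof (induction js arbitrary: ks)
  case (Cons j js)
  have "a (ks @ l # j # js) = a (ks @ j # l # js)"
    using assms(1) Cons.prems unfolding symmetric_upto_def by simp
  also have "\<dots> = a ((ks @ [j]) @ l # js)" by simp
  also have "\<dots> = a ((ks @ [j]) @ js @ [l])" by (rule Cons.IH) (use Cons.prems in simp)
  finally show ?case by simp
qed simp

lemma has_derivative_vec_nth: "((\<lambda>x. x $ j) has_derivative (\<lambda>h. h $ j)) F"
  by (rule bounded_linear_imp_has_derivative) (rule bounded_linear_vec_nth)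

text \<open>After splitting off the first factor, the product rule gives one copy from that factor
  and, by induction, as many copies as there are other factors. Symmetry of \<open>a\<close> makes
  all of them equal, whence the factor \<open>Suc k\<close>.\<close>

lemma hom_part_has_derivative:
  fixes y :: "real^'p::finite"
  shows "symmetric_upto (Suc k) a \<Longrightarrow>
    (hom_part (Suc k) a y has_derivative (\<lambda>h. \<Sum>l\<in>UNIV. h $ l * (real (Suc k) * hom_part k (\<lambda>js. a (l # js)) y x))) (at x)"
proof (induction k arbitrary: a)
  case 0
  have eq: "hom_part (Suc 0) a y = (\<lambda>x. \<Sum>j\<in>UNIV. (x $ j - y $ j) * a [j])"
    by (rule ext) (simp add: hom_part_Suc hom_part_0)
  show ?case unfolding eq hom_part_0 by (auto intro!: derivative_eq_intros has_derivative_vec_nth)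
next
  case (Suc k)
  have eq: "hom_part (Suc (Suc k)) a y = (\<lambda>x. \<Sum>j\<in>UNIV. (x $ j - y $ j) * hom_part (Suc k) (\<lambda>js. a (j # js)) y x)"
    by (rule ext) (rule hom_part_Suc)
  have "(hom_part (Suc (Suc k)) a y has_derivative (\<lambda>h. \<Sum>j\<in>UNIV.
      (x $ j - y $ j) * (\<Sum>l\<in>UNIV. h $ l * (real (Suc k) * hom_part k (\<lambda>js. a (j # l # js)) y x))
      + h $ j * hom_part (Suc k) (\<lambda>js. a (j # js)) y x)) (at x)"
    unfolding eq
  proof (intro has_derivative_sum has_derivative_mult)
    show "((\<lambda>x. x $ j - y $ j) has_derivative (\<lambda>h. h $ j)) (at x)" for j
      by (auto intro!: derivative_eq_intros has_derivative_vec_nth)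
    show "(hom_part (Suc k) (\<lambda>js. a (j # js)) y has_derivative
        (\<lambda>h. \<Sum>l\<in>UNIV. h $ l * (real (Suc k) * hom_part k (\<lambda>js. a (j # l # js)) y x))) (at x)" for j
      by (rule Suc.IH[OF symmetric_upto_Cons[OF Suc.prems]])
  qed
  moreover have "(\<Sum>j\<in>UNIV. (x $ j - y $ j) * (\<Sum>l\<in>UNIV. h $ l * (real (Suc k) * hom_part k (\<lambda>js. a (j # l # js)) y x))
      + h $ j * hom_part (Suc k) (\<lambda>js. a (j # js)) y x) =
      (\<Sum>l\<in>UNIV. h $ l * (real (Suc (Suc k)) * hom_part (Suc k) (\<lambda>js. a (l # js)) y x))" for h
  proof -
    have sw: "hom_part k (\<lambda>js. a (j # l # js)) y x = hom_part k (\<lambda>js. a (l # j # js)) y x" for j l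
      unfolding hom_part_def
    proof (intro sum.cong refl)
      fix js :: "'p list" assume "js \<in> lists_len k"
      then have "a ([] @ j # l # js) = a ([] @ l # j # js)"
        using Suc.prems[unfolded symmetric_upto_def, rule_format, of "[]" js j l] by (simp add: lists_len_def)
      then show "a (j # l # js) * prod_list (map (\<lambda>j. x $ j - y $ j) js) = a (l # j # js) * prod_list (map (\<lambda>j. x $ j - y $ j) js)"
        by simp
    qed
    have "(\<Sum>j\<in>UNIV. (x $ j - y $ j) * (\<Sum>l\<in>UNIV. h $ l * (real (Suc k) * hom_part k (\<lambda>js. a (j # l # js)) y x)))
      = (\<Sum>j\<in>UNIV. \<Sum>l\<in>UNIV. (x $ j - y $ j) * (h $ l * (real (Suc k) * hom_part k (\<lambda>js. a (l # j # js)) y x)))"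
      by (simp add: sum_distrib_left sw)
    also have "\<dots> = (\<Sum>l\<in>UNIV. \<Sum>j\<in>UNIV. (x $ j - y $ j) * (h $ l * (real (Suc k) * hom_part k (\<lambda>js. a (l # j # js)) y x)))"
      by (rule sum.swap)
    also have "\<dots> = (\<Sum>l\<in>UNIV. h $ l * (real (Suc k) * hom_part (Suc k) (\<lambda>js. a (l # js)) y x))"
      unfolding hom_part_Suc[of k "\<lambda>js. a (_ # js)"] by (simp add: sum_distrib_left mult_ac)
    finally have eq1: "(\<Sum>j\<in>UNIV. (x $ j - y $ j) * (\<Sum>l\<in>UNIV. h $ l * (real (Suc k) * hom_part k (\<lambda>js. a (j # l # js)) y x)))
      = (\<Sum>l\<in>UNIV. h $ l * (real (Suc k) * hom_part (Suc k) (\<lambda>js. a (l # js)) y x))" .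
    have "(\<Sum>l\<in>UNIV. h $ l * (real (Suc k) * hom_part (Suc k) (\<lambda>js. a (l # js)) y x)) + (\<Sum>j\<in>UNIV. h $ j * hom_part (Suc k) (\<lambda>js. a (j # js)) y x)
      = (\<Sum>l\<in>UNIV. h $ l * (real (Suc (Suc k)) * hom_part (Suc k) (\<lambda>js. a (l # js)) y x))"
      unfolding sum.distrib[symmetric] by (intro sum.cong refl) (simp add: algebra_simps)
    then show ?thesis by (simp only: sum.distrib eq1)
  qed
  ultimately show ?case by simp
qed

lemma taylor_poly_hom_parts:
  "taylor_poly m f y x = (\<Sum>k\<le>m. hom_part k (\<lambda>js. iterated_partial js f y) y x / fact k)"
proof -
  let ?F = "\<lambda>js. iterated_partial js f y * prod_list (map (\<lambda>j. x $ j - y $ j) js) / fact (length js)"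
  have eq: "{js :: 'a list. length js \<le> m} = (\<Union>k\<in>{..m}. lists_len k)" by (auto simp: lists_len_def)
  have "taylor_poly m f y x = (\<Sum>k\<le>m. \<Sum>js\<in>lists_len k. ?F js)"
    unfolding taylor_poly_def eq
    by (rule sum.UNION_disjoint) (simp_all add: finite_lists_len, auto simp: lists_len_def)
  also have "\<dots> = (\<Sum>k\<le>m. hom_part k (\<lambda>js. iterated_partial js f y) y x / fact k)"
    unfolding hom_part_def sum_divide_distrib
    by (intro sum.cong refl) (simp add: lists_len_def)
  finally show ?thesis .
qed

lemma hom_part_cong:
  "(\<And>js. length js = k \<Longrightarrow> a js = b js) \<Longrightarrow> hom_part k a y x = hom_part k b y x"
  unfolding hom_part_def by (intro sum.cong) (auto simp: lists_len_def)

lemma iterated_partial_snoc: "iterated_partial (js @ [l]) f = iterated_partial js (pd l f)"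
  by (induction js) auto

lemma iterated_partial_append: "iterated_partial (ks @ js) f = iterated_partial ks (iterated_partial js f)"
  by (induction ks) auto

lemma iterated_partial_cong:
  assumes "open S" "\<And>x. x \<in> S \<Longrightarrow> f x = g x" "x \<in> S"
  shows "iterated_partial js f x = iterated_partial js g x"
  using assms(3)
proof (induction js arbitrary: x)
  case (Cons j js)
  show ?case
    using frechet_derivative_cong[OF assms(1) Cons.prems Cons.IH] by simp
qed (simp add: assms(2))

lemma Ck_iterated_partial:
  assumes "Ck P m S f" "length js \<le> m"
  shows "Ck P (m - length js) S (iterated_partial js f)"
  using assms(2)
proof (induction js)
  case (Cons j js)
  have "m - length js = Suc (m - length (j # js))" using Cons.prems by simp
  then have "Ck P (Suc (m - length (j # js))) S (iterated_partial js f)" using Cons by simp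
  then show ?case by simp
qed (simp add: assms(1))

text \<open>The exchange takes place in the middle of the list: symmetry holds for
  \<open>iterated_partial js f\<close> on all of \<open>S\<close>, and the outer derivatives
  \<open>ks\<close> respect equality on an open set.\<close>

lemma symmetric_upto_iterated_partial:
  fixes f :: "real^'p::finite \<Rightarrow> real"
  assumes "open S" "C_on m S f" "y \<in> S"
  shows "symmetric_upto m (\<lambda>js. iterated_partial js f y)"
  unfolding symmetric_upto_def
proof (intro allI impI)
  fix ks js :: "'p list" and j l assume len: "length ks + length js + 2 \<le> m"
  interpret regularity S "continuous_on S" by (rule regularity_continuous[OF assms(1)])
  have "Ck (continuous_on S) (m - length js) S (iterated_partial js f)"
    by (rule Ck_iterated_partial) (use assms(2) len in \<open>simp_all add: C_on_eq_Ck\<close>)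
  then have "C_on 2 S (iterated_partial js f)"
    unfolding C_on_eq_Ck by (rule Ck_mono) (use len in simp)
  from second_derivative_symmetric[OF assms(1) _ this]
  have "iterated_partial (j # l # js) f x = iterated_partial (l # j # js) f x" if "x \<in> S" for x
    using that by simp
  from iterated_partial_cong[OF assms(1) this assms(3)]
  show "iterated_partial (ks @ j # l # js) f y = iterated_partial (ks @ l # j # js) f y"
    unfolding iterated_partial_append by simp
qed

lemma taylor_poly_at_center: "taylor_poly m f y y = f y"
proof -
  have "hom_part k (\<lambda>js. iterated_partial js f y) y y / fact k = (if k = 0 then f y else 0)" for k
    by (cases k) (simp_all add: hom_part_0 hom_part_Suc)
  then show ?thesis unfolding taylor_poly_hom_parts by simp
qed

text \<open>Taylor polynomials commute with partial derivatives up to one order: the factor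
  \<open>Suc k\<close> cancels against the factorial, and \<open>rot\<close> moves the free
  direction to the innermost place.\<close>

lemma taylor_poly_has_derivative:
  fixes f :: "real^'p::finite \<Rightarrow> real"
  assumes "open S" "C_on (Suc m) S f" "y \<in> S"
  shows "(taylor_poly (Suc m) f y has_derivative (\<lambda>h. \<Sum>l\<in>UNIV. h $ l * taylor_poly m (pd l f) y x)) (at x)"
proof -
  let ?a = "\<lambda>js. iterated_partial js f y"
  interpret regularity S "continuous_on S" by (rule regularity_continuous[OF assms(1)])
  have sym: "symmetric_upto (Suc k) ?a" if "k \<le> m" for k
    using symmetric_upto_iterated_partial[OF assms(1) _ assms(3), of "Suc k"] assms(2) Ck_mono[of "Suc m" f "Suc k"] that
    by (simp add: C_on_eq_Ck del: Ck.simps)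
  have "taylor_poly (Suc m) f y = (\<lambda>x. f y + (\<Sum>k\<le>m. hom_part (Suc k) ?a y x / fact (Suc k)))"
    by (rule ext) (simp add: taylor_poly_hom_parts sum.atMost_Suc_shift hom_part_0 del: fact_Suc sum.atMost_Suc)
  moreover have "((\<lambda>x. f y + (\<Sum>k\<le>m. hom_part (Suc k) ?a y x / fact (Suc k))) has_derivative
      (\<lambda>h. 0 + (\<Sum>k\<le>m. (\<Sum>l\<in>UNIV. h $ l * (real (Suc k) * hom_part k (\<lambda>js. ?a (l # js)) y x)) / fact (Suc k)))) (at x)"
    unfolding divide_inverse
    by (intro has_derivative_add has_derivative_const has_derivative_sum has_derivative_mult_left hom_part_has_derivative sym) simp
  moreover have "(\<Sum>k\<le>m. (\<Sum>l\<in>UNIV. h $ l * (real (Suc k) * hom_part k (\<lambda>js. ?a (l # js)) y x)) / fact (Suc k))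
      = (\<Sum>l\<in>UNIV. h $ l * taylor_poly m (pd l f) y x)" for h
  proof -
    have rot: "hom_part k (\<lambda>js. ?a (l # js)) y x = hom_part k (\<lambda>js. iterated_partial js (pd l f) y) y x" if "k \<le> m" for k l
    proof (rule hom_part_cong)
      fix js :: "'p list" assume "length js = k"
      then have "?a ([] @ l # js) = ?a ([] @ js @ [l])"
        by (intro symmetric_upto_rotate[OF sym[OF that]]) simp
      then show "?a (l # js) = iterated_partial js (pd l f) y" by (simp add: iterated_partial_snoc del: iterated_partial.simps)
    qed
    have "(\<Sum>k\<le>m. (\<Sum>l\<in>UNIV. h $ l * (real (Suc k) * hom_part k (\<lambda>js. ?a (l # js)) y x)) / fact (Suc k))
      = (\<Sum>k\<le>m. \<Sum>l\<in>UNIV. h $ l * (hom_part k (\<lambda>js. iterated_partial js (pd l f) y) y x / fact k))"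
      unfolding sum_divide_distrib
    proof (intro sum.cong refl)
      fix k l assume "k \<in> {..m}"
      then show "h $ l * (real (Suc k) * hom_part k (\<lambda>js. ?a (l # js)) y x) / fact (Suc k)
          = h $ l * (hom_part k (\<lambda>js. iterated_partial js (pd l f) y) y x / fact k)"
        by (subst rot) (simp_all add: fact_Suc divide_simps del: of_nat_Suc)
    qed
    also have "\<dots> = (\<Sum>l\<in>UNIV. h $ l * taylor_poly m (pd l f) y x)"
      unfolding taylor_poly_hom_parts sum_distrib_left by (rule sum.swap)
    finally show ?thesis .
  qed
  ultimately show ?thesis by simp
qed

section \<open>Taylor remainders\<close>

lemma Ck_holder_imp_C_on:
  assumes "0 < \<alpha>" "C_holder_on \<alpha> k S f" shows "C_on k S f"
  using assms(2)
  by (induction k arbitrary: f) (auto intro: locally_holder_imp_continuous[OF assms(1)])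

text \<open>By \<open>taylor_poly_has_derivative\<close> the derivative of a remainder is the
  remainder of the derivative, and each remainder is zero at the centre.\<close>

lemma vanishes_taylor_remainder:
  fixes f :: "real^'p::finite \<Rightarrow> real"
  assumes "open S" "y \<in> S" "C_on m S f"
  shows "vanishes m y (\<lambda>x. f x - taylor_poly m f y x)"
  using assms(3)
proof (induction m arbitrary: f)
  case 0
  then show ?case by (simp add: taylor_poly_at_center)
next
  case (Suc m)
  interpret regularity S "continuous_on S" by (rule regularity_continuous[OF assms(1)])
  interpret regularity_at S "continuous_on S" y by unfold_locales fact
  show ?case
  proof (rule vanishes_SucI[of _ "\<lambda>x h. frechet_derivative f (at x) h - (\<Sum>l\<in>UNIV. h $ l * taylor_poly m (pd l f) y x)"])
    show "((\<lambda>x. f x - taylor_poly (Suc m) f y x) has_derivative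
        (\<lambda>h. frechet_derivative f (at x) h - (\<Sum>l\<in>UNIV. h $ l * taylor_poly m (pd l f) y x))) (at x)" if "x \<in> S" for x
      using Suc.prems that
      by (intro has_derivative_diff frechet_derivative_has_derivative taylor_poly_has_derivative[OF assms(1) Suc.prems assms(2)]) simp
    fix b :: "real^'p" assume "b \<in> Basis"
    then obtain i where b: "b = axis i 1" by (auto simp: Basis_vec_def)
    have "vanishes m y (\<lambda>x. pd i f x - taylor_poly m (pd i f) y x)"
      using Suc.prems by (intro Suc.IH) simp
    moreover have "(\<Sum>l\<in>UNIV. b $ l * taylor_poly m (pd l f) y x) = taylor_poly m (pd i f) y x" for x
      by (simp add: b axis_def if_distrib[of "\<lambda>c. c * _"] cong: if_cong)
    ultimately show "vanishes m y (\<lambda>x. frechet_derivative f (at x) b - (\<Sum>l\<in>UNIV. b $ l * taylor_poly m (pd l f) y x))"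
      by (simp add: b)
  qed (simp add: taylor_poly_at_center)
qed

lemma smooth_taylor_poly:
  fixes f :: "real^'p::finite \<Rightarrow> real"
  shows "smooth_on UNIV (taylor_poly m f y)"
proof -
  have nth: "smooth_on UNIV (\<lambda>x::real^'p. x $ j)" for j
    using smooth_on_inner[OF open_UNIV, of "axis j 1 :: real^'p"] by (simp add: inner_axis)
  have "smooth_on UNIV (\<lambda>x::real^'p. prod_list (map (\<lambda>j. x $ j - y $ j) js))" for js
  proof (induction js)
    case (Cons j js)
    then have "smooth_on UNIV (\<lambda>x::real^'p. (x $ j - y $ j) * prod_list (map (\<lambda>j. x $ j - y $ j) js))"
      by (intro smooth_on_mult smooth_on_diff nth smooth_on_const open_UNIV)
    then show ?case by simp
  qed (simp add: smooth_on_const)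
  then have "smooth_on UNIV (\<lambda>x. \<Sum>js | length js \<le> m.
        iterated_partial js f y * prod_list (map (\<lambda>j. x $ j - y $ j) js) * inverse (fact (length js)))"
    by (intro smooth_on_sum smooth_on_mult smooth_on_const open_UNIV)
  then show ?thesis unfolding taylor_poly_def[abs_def] divide_inverse .
qed

lemma smooth_approx_field: "smooth_on UNIV (approx_field r X y i)"
  by (subst smooth_on_vec) (simp_all add: approx_field_def smooth_taylor_poly)

text \<open>Induction through the mean value inequality in place of a remainder formula: the bound
  for the first derivatives is uniform on the closed ball of radius |x - y|, and moving by that
  distance gains one power.\<close>

lemma vanishes_estimate:
  fixes f :: "'a::euclidean_space \<Rightarrow> real"
  assumes "open S" "y \<in> S" "0 < \<alpha>" "C_holder_on \<alpha> k S f" "vanishes k y f"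
  shows "\<exists>d>0. \<exists>C\<ge>0. \<forall>x\<in>ball y d. \<bar>f x\<bar> \<le> C * dist x y powr (real k + \<alpha>)"
  using assms(4,5)
proof (induction k arbitrary: f)
  case 0
  have h: "locally_holder_on \<alpha> S f" using 0 by simp
  obtain e C where e: "e > 0" "C \<ge> 0"
      "\<And>w z. \<lbrakk>w \<in> S; z \<in> S; dist y w < e; dist y z < e\<rbrakk> \<Longrightarrow> dist (f w) (f z) \<le> C * dist w z powr \<alpha>"
    using locally_holder_onE[OF h assms(2)] by metis
  obtain d where d: "d > 0" "ball y d \<subseteq> S" using assms open_contains_ball by blast
  have "\<bar>f x\<bar> \<le> C * dist x y powr \<alpha>" if "x \<in> ball y (min d e)" for x
    using e(3)[of x y] that d e(1) assms(2) 0 by (auto simp: dist_real_def)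
  then show ?case using d(1) e(1,2) by (intro exI[of _ "min d e"] conjI exI[of _ C]) auto
next
  case (Suc k)
  have "\<forall>b\<in>Basis. \<exists>d>0. \<exists>C\<ge>0. \<forall>x\<in>ball y d. \<bar>frechet_derivative f (at x) b\<bar> \<le> C * dist x y powr (real k + \<alpha>)"
    using Suc.prems by (intro ballI Suc.IH) simp_all
  then obtain d C where dC: "\<And>b. b \<in> Basis \<Longrightarrow> d b > 0" "\<And>b. b \<in> Basis \<Longrightarrow> C b \<ge> 0"
    "\<And>b x. b \<in> Basis \<Longrightarrow> x \<in> ball y (d b) \<Longrightarrow> \<bar>frechet_derivative f (at x) b\<bar> \<le> C b * dist x y powr (real k + \<alpha>)"
    by metis
  obtain d0 where d0: "d0 > 0" "ball y d0 \<subseteq> S" using assms open_contains_ball by blast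
  define e where "e = min d0 (Min (d ` Basis))"
  have e: "e > 0" "e \<le> d0" "\<And>b. b \<in> Basis \<Longrightarrow> e \<le> d b"
    using dC(1) d0(1) unfolding e_def by (auto intro: min.coboundedI2)
  define K where "K = (\<Sum>b\<in>Basis. C b)"
  have K: "C b \<le> K" if "b \<in> Basis" for b
    unfolding K_def using dC(2) that by (intro member_le_sum) auto
  have K0: "K \<ge> 0" unfolding K_def using dC(2) by (intro sum_nonneg) auto
  have fy: "f y = 0" using Suc.prems by simp
  have "\<bar>f x\<bar> \<le> (real DIM('a) * K) * dist x y powr (real (Suc k) + \<alpha>)" if x: "x \<in> ball y e" for x
  proof -
    define \<rho> where "\<rho> = dist x y"
    have sub: "z \<in> ball y e" if "z \<in> cball y \<rho>" for z
      using that x by (auto simp: \<rho>_def dist_commute)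
    have "norm (f x - f y) \<le> real DIM('a) * (K * \<rho> powr (real k + \<alpha>)) * norm (x - y)"
    proof (rule lipschitz_from_partials[of "cball y \<rho>"])
      show "f differentiable (at z)" if "z \<in> cball y \<rho>" for z
      proof -
        have "z \<in> S" using sub[OF that] e(2) d0(2) by (meson mem_ball order_less_le_trans subsetD)
        then show ?thesis using Suc.prems by simp
      qed
      show "norm (frechet_derivative f (at z) b) \<le> K * \<rho> powr (real k + \<alpha>)" if z: "z \<in> cball y \<rho>" and b: "b \<in> Basis" for z b
      proof -
        have "z \<in> ball y (d b)" using sub[OF z] e(3)[OF b] by simp
        then have "\<bar>frechet_derivative f (at z) b\<bar> \<le> C b * dist z y powr (real k + \<alpha>)" by (rule dC(3)[OF b])
        also have "\<dots> \<le> K * \<rho> powr (real k + \<alpha>)"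
          using K[OF b] K0 z \<open>0 < \<alpha>\<close> by (intro mult_mono powr_mono2) (auto simp: dist_commute)
        finally show ?thesis by simp
      qed
    qed (auto simp: \<rho>_def dist_commute)
    also have "\<dots> = (real DIM('a) * K) * (\<rho> powr (real k + \<alpha>) * \<rho>)"
      by (simp add: \<rho>_def dist_norm)
    also have "\<rho> powr (real k + \<alpha>) * \<rho> = \<rho> powr (real (Suc k) + \<alpha>)"
      using powr_add[of \<rho> "real k + \<alpha>" 1] by (simp add: \<rho>_def add_ac)
    finally show ?thesis using fy by (simp add: \<rho>_def)
  qed
  then show ?case using e(1) K0 by (intro exI[of _ e] conjI exI[of _ "real DIM('a) * K"]) auto
qed

subsection \<open>Application to commutators\<close>

locale holder_fields =
  fixes n r :: nat and \<alpha> :: real and \<Omega> :: "(real^'p::finite) set"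
    and X :: "nat \<Rightarrow> real^'p \<Rightarrow> real^'p"
  assumes r2: "2 \<le> r" and \<alpha>: "0 < \<alpha>" "\<alpha> \<le> 1" and open_\<Omega>: "open \<Omega>"
    and X1: "\<forall>i\<in>{1..n}. C_holder_on \<alpha> (r - 1) \<Omega> (X i)"
    and X0: "C_holder_on \<alpha> (r - 2) \<Omega> (X 0)"
begin

abbreviation "H \<equiv> locally_holder_on \<alpha> \<Omega>"

sublocale regularity \<Omega> H
  by (rule regularity_holder[OF open_\<Omega> \<alpha>])

lemma C_holder_on_iff: "C_holder_on \<alpha> k \<Omega> V \<longleftrightarrow> (\<forall>m. Ck H k \<Omega> (\<lambda>x. V x $ m))" for V :: "real^'p \<Rightarrow> real^'p"
  by (subst C_holder_on_vec[OF open_\<Omega> \<alpha>]) (simp add: C_holder_on_eq_Ck)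

lemma Ck_X: "i \<le> n \<Longrightarrow> Ck H (r - field_weight i) \<Omega> (\<lambda>x. X i x $ m)"
  using X0 X1 by (cases "i = 0") (simp_all add: field_weight_def C_holder_on_iff)

lemma smooth_imp_Ck:
  assumes "smooth_on UNIV f"
  shows "Ck H k \<Omega> (f :: real^'p \<Rightarrow> real)"
proof -
  have sub: "C_on k \<Omega> g" if "C_on k UNIV g" for k and g :: "real^'p \<Rightarrow> real"
    using that by (induction k arbitrary: g) (auto intro: continuous_on_subset)
  have "C_on (Suc k) UNIV f" using assms unfolding smooth_on_def by blast
  then have "C_holder_on \<alpha> k \<Omega> f" by (intro C_on_Suc_imp_C_holder_on[OF open_\<Omega> \<alpha>(2)] sub)
  then show ?thesis unfolding C_holder_on_eq_Ck .
qed

text \<open>The bookkeeping behind the commutator estimates: a bracket costs one derivative, while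
  joining two words costs each of them at least one unit of weight, so both entries have the
  derivative to spare. Truncated subtraction is harmless because the total weight is at most
  \<open>r\<close>.\<close>

lemma multiindices_upto_tl:
  assumes "i # j # I \<in> multiindices_upto n r"
  shows "j # I \<in> multiindices_upto n r" "i \<le> n"
    "Suc (r - weight (i # j # I)) \<le> r - field_weight i" "Suc (r - weight (i # j # I)) \<le> r - weight (j # I)"
proof -
  have "0 < weight (j # I)" "0 < field_weight i" using field_weight_pos by (simp_all add: weight_Cons)
  moreover have "field_weight i + weight (j # I) \<le> r"
    using assms by (simp add: multiindices_upto_def weight_Cons)
  ultimately show "j # I \<in> multiindices_upto n r" "i \<le> n"
    "Suc (r - weight (i # j # I)) \<le> r - field_weight i" "Suc (r - weight (i # j # I)) \<le> r - weight (j # I)"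
    using assms unfolding weight_Cons[of i] by (auto simp: multiindices_upto_def multiindices_def)
qed

lemma Ck_commutator_X:
  "I \<in> multiindices_upto n r \<Longrightarrow> Ck H (r - weight I) \<Omega> (\<lambda>x. commutator X I x $ m)"
proof (induction I arbitrary: m)
  case Nil
  then show ?case by (simp add: multiindices_upto_def multiindices_def)
next
  case (Cons i I)
  show ?case
  proof (cases I)
    case Nil
    then show ?thesis using Cons.prems Ck_X[of i m]
      by (simp add: multiindices_upto_def multiindices_def weight_def)
  next
    case (Cons j J)
    note tl = multiindices_upto_tl[OF Cons.prems[unfolded Cons]]
    have "Ck H (r - weight (i # I)) \<Omega> (\<lambda>x. lie_bracket (X i) (commutator X I) x $ m)"
    proof (rule Ck_lie_bracket[OF regularity_axioms])
      show "Ck H (Suc (r - weight (i # I))) \<Omega> (\<lambda>x. X i x $ m)" for m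
        by (rule Ck_mono[OF Ck_X[OF tl(2)]]) (use tl(3) Cons in simp)
      show "Ck H (Suc (r - weight (i # I))) \<Omega> (\<lambda>x. commutator X I x $ m)" for m
        by (rule Ck_mono[OF Cons.IH]) (use tl(1,4) Cons in simp_all)
    qed
    then show ?thesis by (simp add: Cons)
  qed
qed

lemma C_holder_on_commutator_X:
  "I \<in> multiindices_upto n r \<Longrightarrow> C_holder_on \<alpha> (r - weight I) \<Omega> (commutator X I)"
  using Ck_commutator_X by (simp add: C_holder_on_iff)

lemma smooth_commutator_approx: "smooth_on UNIV (commutator (approx_field r X y) I)"
  by (intro smooth_commutator smooth_approx_field)

lemma Ck_commutator_approx: "Ck H k \<Omega> (\<lambda>x. commutator (approx_field r X y) I x $ m)"
  using smooth_commutator_approx smooth_on_vec[OF open_UNIV] by (intro smooth_imp_Ck) blast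

text \<open>The Taylor order \<open>r - field_weight i\<close> makes every generator agree with its
  approximation to the order belonging to its own weight. A bracket then lowers the order by one and
  raises the weight by at least one.\<close>

lemma vanishes_commutator_diff:
  assumes "y \<in> \<Omega>"
  shows "I \<in> multiindices_upto n r \<Longrightarrow>
    vanishes (r - weight I) y (\<lambda>x. commutator X I x $ m - commutator (approx_field r X y) I x $ m)"
proof (induction I arbitrary: m)
  case Nil
  then show ?case by (simp add: multiindices_upto_def multiindices_def)
next
  case (Cons i I)
  let ?S = "approx_field r X y"
  have base: "vanishes (r - field_weight i) y (\<lambda>x. X i x $ m - ?S i x $ m)" if "i \<le> n" for i m
  proof -
    have "C_on (r - field_weight i) \<Omega> (\<lambda>x. X i x $ m)"
      using Ck_holder_imp_C_on[OF \<alpha>(1)] Ck_X[OF that] unfolding C_holder_on_eq_Ck by blast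
    from vanishes_taylor_remainder[OF open_\<Omega> assms this] show ?thesis by (simp add: approx_field_def)
  qed
  have down: "vanishes k y f" if "vanishes l y f" "k \<le> l" for k l and f :: "real^'p \<Rightarrow> real"
    using that by (induction l) (auto simp: le_Suc_eq vanishes_Suc_imp simp del: vanishes.simps(2))
  show ?case
  proof (cases I)
    case Nil
    then show ?thesis using Cons.prems base[of i m]
      by (simp add: multiindices_upto_def multiindices_def weight_def)
  next
    case (Cons j J)
    note tl = multiindices_upto_tl[OF Cons.prems[unfolded Cons]]
    have "vanishes (r - weight (i # I)) y (\<lambda>x. lie_bracket (X i) (commutator X I) x $ m - lie_bracket (?S i) (commutator ?S I) x $ m)"
    proof (rule vanishes_lie_bracket[OF regularity_axioms assms])
      show "Ck H (Suc (r - weight (i # I))) \<Omega> (\<lambda>x. X i x $ m)" for m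
        by (rule Ck_mono[OF Ck_X[OF tl(2)]]) (use tl(3) Cons in simp)
      show "Ck H (Suc (r - weight (i # I))) \<Omega> (\<lambda>x. commutator X I x $ m)" for m
        by (rule Ck_mono[OF Ck_commutator_X]) (use tl(1,4) Cons in simp_all)
      show "Ck H (Suc (r - weight (i # I))) \<Omega> (\<lambda>x. ?S i x $ m)" for m
        by (rule Ck_commutator_approx[of _ y "[i]", unfolded commutator.simps])
      show "Ck H (Suc (r - weight (i # I))) \<Omega> (\<lambda>x. commutator ?S I x $ m)" for m
        by (rule Ck_commutator_approx)
      show "vanishes (Suc (r - weight (i # I))) y (\<lambda>x. X i x $ m - ?S i x $ m)" for m
        by (rule down[OF base[OF tl(2)]]) (use tl(3) Cons in simp)
      show "vanishes (Suc (r - weight (i # I))) y (\<lambda>x. commutator X I x $ m - commutator ?S I x $ m)" for m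
        by (rule down[OF Cons.IH]) (use tl(1,4) Cons in simp_all)
    qed
    then show ?thesis by (simp add: Cons)
  qed
qed

lemma commutator_approx_center:
  assumes "y \<in> \<Omega>" "I \<in> multiindices_upto n r"
  shows "commutator (approx_field r X y) I y = commutator X I y"
  using vanishes_imp_zero[OF vanishes_commutator_diff[OF assms]] by (simp add: vec_eq_iff)

lemma commutator_approx_estimate:
  assumes "y \<in> \<Omega>" "I \<in> multiindices_upto n r"
  shows "\<exists>d>0. \<exists>C\<ge>0. \<forall>x\<in>ball y d.
    norm (commutator X I x - commutator (approx_field r X y) I x) \<le> C * dist x y powr (real (r - weight I) + \<alpha>)"
proof -
  let ?g = "\<lambda>m x. commutator X I x $ m - commutator (approx_field r X y) I x $ m"
  have "\<exists>d>0. \<exists>C\<ge>0. \<forall>x\<in>ball y d. \<bar>?g m x\<bar> \<le> C * dist x y powr (real (r - weight I) + \<alpha>)" for m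
    by (rule vanishes_estimate[OF open_\<Omega> assms(1) \<alpha>(1) _ vanishes_commutator_diff[OF assms]])
      (unfold C_holder_on_eq_Ck, intro Ck_diff Ck_commutator_X Ck_commutator_approx assms(2))
  then obtain d C where dC: "\<And>m. d m > 0" "\<And>m. C m \<ge> 0"
    "\<And>m x. x \<in> ball y (d m) \<Longrightarrow> \<bar>?g m x\<bar> \<le> C m * dist x y powr (real (r - weight I) + \<alpha>)"
    by metis
  have "norm (commutator X I x - commutator (approx_field r X y) I x) \<le> (\<Sum>m\<in>UNIV. C m) * dist x y powr (real (r - weight I) + \<alpha>)"
    if x: "x \<in> ball y (Min (range d))" for x
  proof -
    have "norm (commutator X I x - commutator (approx_field r X y) I x) \<le> (\<Sum>m\<in>UNIV. \<bar>?g m x\<bar>)"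
      using norm_le_l1_cart[of "commutator X I x - commutator (approx_field r X y) I x"] by simp
    also have "\<dots> \<le> (\<Sum>m\<in>UNIV. C m * dist x y powr (real (r - weight I) + \<alpha>))"
      using x by (intro sum_mono dC(3)) simp
    finally show ?thesis by (simp add: sum_distrib_right)
  qed
  moreover have "Min (range d) > 0" using dC(1) by simp
  moreover have "(\<Sum>m\<in>UNIV. C m) \<ge> 0" using dC(2) by (simp add: sum_nonneg)
  ultimately show ?thesis by blast
qed

end

section \<open>Polynomials with real coefficients on complex space\<close>

text \<open>The degree is kept as an index because the radial primitive divides by it. Real
  coefficients give real values at real points, while complex arguments give access to Cauchy's
  estimates.\<close>

inductive hpoly :: "nat \<Rightarrow> (complex^'p::finite \<Rightarrow> complex) \<Rightarrow> bool" where
  hp_const: "hpoly 0 (\<lambda>u. of_real c)"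
| hp_zero: "hpoly k (\<lambda>u. 0)"
| hp_var: "hpoly (Suc 0) (\<lambda>u. u $ l)"
| hp_add: "\<lbrakk>hpoly k f; hpoly k g\<rbrakk> \<Longrightarrow> hpoly k (\<lambda>u. f u + g u)"
| hp_mult: "\<lbrakk>hpoly k f; hpoly l g\<rbrakk> \<Longrightarrow> hpoly (k + l) (\<lambda>u. f u * g u)"

inductive rpoly :: "(complex^'p::finite \<Rightarrow> complex) \<Rightarrow> bool" where
  rp_hom: "hpoly k f \<Longrightarrow> rpoly f"
| rp_add: "\<lbrakk>rpoly f; rpoly g\<rbrakk> \<Longrightarrow> rpoly (\<lambda>u. f u + g u)"

lemma rpoly_const: "rpoly (\<lambda>u. of_real c)"
  by (rule rp_hom[OF hp_const])

lemma rpoly_zero: "rpoly (\<lambda>u. 0)"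
  by (rule rp_hom[OF hp_zero])

lemma rpoly_var: "rpoly (\<lambda>u. u $ l)"
  by (rule rp_hom[OF hp_var])

lemma rpoly_mult:
  assumes "rpoly f" "rpoly g"
  shows "rpoly (\<lambda>u. f u * g u)"
  using assms
proof (induction f rule: rpoly.induct)
  case (rp_hom k f)
  from rp_hom(2,1) show ?case
  proof (induction g rule: rpoly.induct)
    case (rp_hom l g)
    then show ?case by (intro rpoly.rp_hom[OF hp_mult])
  next
    case (rp_add g h)
    then have "rpoly (\<lambda>u. f u * g u + f u * h u)" by (intro rpoly.rp_add) simp_all
    then show ?case by (simp add: distrib_left)
  qed
next
  case (rp_add f h)
  then have "rpoly (\<lambda>u. f u * g u + h u * g u)" by (intro rpoly.rp_add) simp_all
  then show ?case by (simp add: distrib_right)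
qed

lemma rpoly_cmult: "rpoly f \<Longrightarrow> rpoly (\<lambda>u. of_real c * f u)"
  by (rule rpoly_mult[OF rpoly_const])

lemma rpoly_diff: "\<lbrakk>rpoly f; rpoly g\<rbrakk> \<Longrightarrow> rpoly (\<lambda>u. f u - g u)"
  using rp_add[of f "\<lambda>u. of_real (- 1) * g u"] rpoly_cmult[of g "-1"] by simp

lemma rpoly_sum: "(\<And>i. i \<in> I \<Longrightarrow> rpoly (f i)) \<Longrightarrow> rpoly (\<lambda>u. \<Sum>i\<in>I. f i u)"
  by (induction I rule: infinite_finite_induct) (auto intro: rpoly_zero rp_add)

lemma rpoly_compose:
  assumes "rpoly f" and g: "\<And>m. rpoly (g m)"
  shows "rpoly (\<lambda>u. f (\<chi> m. g m u))"
  using assms(1)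
proof (induction f rule: rpoly.induct)
  case (rp_hom k f)
  then show ?case
  proof (induction k f rule: hpoly.induct)
    case (hp_var l)
    then show ?case using g[of l] by simp
  qed (auto intro: rpoly_const rpoly_zero rpoly.rp_add rpoly_mult)
next
  case (rp_add f h)
  then show ?case by (intro rpoly.rp_add)
qed

lemma rpoly_real:
  assumes "rpoly f" "\<And>l. u $ l \<in> \<real>"
  shows "f u \<in> \<real>"
  using assms(1)
proof (induction f rule: rpoly.induct)
  case (rp_hom k f)
  then show ?case by (induction k f rule: hpoly.induct) (auto simp: assms(2))
qed auto

lemma hpoly_scale: "hpoly k f \<Longrightarrow> f (t *\<^sub>R u) = of_real t ^ k * f u"
  by (induction k f rule: hpoly.induct) (auto simp: power_add algebra_simps scaleR_conv_of_real[where 'a = complex])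

lemma has_derivative_cvec_nth: "((\<lambda>x. x $ j) has_derivative (\<lambda>h. h $ j)) F"
  by (rule bounded_linear_imp_has_derivative) (rule bounded_linear_vec_nth)

text \<open>Euler's identity is proved along with the derivative, since the step for products needs
  both for the same \<open>D\<close>.\<close>

lemma hpoly_derivative:
  fixes f :: "complex^'p::finite \<Rightarrow> complex"
  assumes "hpoly k f"
  shows "\<exists>D. (\<forall>l. rpoly (D l)) \<and> (\<forall>u. (f has_derivative (\<lambda>h. \<Sum>l\<in>UNIV. h $ l * D l u)) (at u)) \<and>
    (\<forall>u. (\<Sum>l\<in>UNIV. u $ l * D l u) = of_nat k * f u)"
  using assms
proof (induction k f rule: hpoly.induct)
  case (hp_const c)
  show ?case by (intro exI[of _ "\<lambda>l u. 0"]) (simp add: rpoly_zero)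
next
  case (hp_zero k)
  show ?case by (intro exI[of _ "\<lambda>l u. 0"]) (simp add: rpoly_zero)
next
  case (hp_var l)
  have "rpoly (\<lambda>u :: complex^'p. if m = l then 1 else 0)" for m
    using rpoly_const[of 1] rpoly_zero by (cases "m = l") simp_all
  moreover have "(\<Sum>m\<in>UNIV. h $ m * (if m = l then 1 else 0)) = h $ l" for h :: "complex^'p"
    by (simp add: if_distrib[of "\<lambda>c. _ * c"] cong: if_cong)
  ultimately show ?case
    by (intro exI[of _ "\<lambda>m u. if m = l then 1 else 0"] conjI allI) (simp_all add: has_derivative_cvec_nth)
next
  case (hp_add k f g)
  obtain D where
    "\<forall>l. rpoly (D l)" "\<forall>u. (f has_derivative (\<lambda>h. \<Sum>l\<in>UNIV. h $ l * D l u)) (at u)"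
      "\<forall>u. (\<Sum>l\<in>UNIV. u $ l * D l u) = of_nat k * f u" using hp_add.IH(1) by blast
  note D = this[rule_format]
  obtain D' where
    "\<forall>l. rpoly (D' l)" "\<forall>u. (g has_derivative (\<lambda>h. \<Sum>l\<in>UNIV. h $ l * D' l u)) (at u)"
      "\<forall>u. (\<Sum>l\<in>UNIV. u $ l * D' l u) = of_nat k * g u" using hp_add.IH(2) by blast
  note D' = this[rule_format]
  show ?case
  proof (intro exI[of _ "\<lambda>l u. D l u + D' l u"] conjI allI)
    show "rpoly (\<lambda>u. D l u + D' l u)" for l by (intro rp_add D D')
    show "((\<lambda>u. f u + g u) has_derivative (\<lambda>h. \<Sum>l\<in>UNIV. h $ l * (D l u + D' l u))) (at u)" for u
      using has_derivative_add[OF D(2) D'(2)] by (simp add: distrib_left sum.distrib)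
    show "(\<Sum>l\<in>UNIV. u $ l * (D l u + D' l u)) = of_nat k * (f u + g u)" for u
      by (simp add: distrib_left sum.distrib D(3) D'(3))
  qed
next
  case (hp_mult k f m g)
  obtain D where
    "\<forall>l. rpoly (D l)" "\<forall>u. (f has_derivative (\<lambda>h. \<Sum>l\<in>UNIV. h $ l * D l u)) (at u)"
      "\<forall>u. (\<Sum>l\<in>UNIV. u $ l * D l u) = of_nat k * f u" using hp_mult.IH(1) by blast
  note D = this[rule_format]
  obtain D' where
    "\<forall>l. rpoly (D' l)" "\<forall>u. (g has_derivative (\<lambda>h. \<Sum>l\<in>UNIV. h $ l * D' l u)) (at u)"
      "\<forall>u. (\<Sum>l\<in>UNIV. u $ l * D' l u) = of_nat m * g u" using hp_mult.IH(2) by blast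
  note D' = this[rule_format]
  show ?case
  proof (intro exI[of _ "\<lambda>l u. f u * D' l u + D l u * g u"] conjI allI)
    show "rpoly (\<lambda>u. f u * D' l u + D l u * g u)" for l
      using hp_mult.hyps by (intro rp_add rpoly_mult D D' rp_hom)
    show "((\<lambda>u. f u * g u) has_derivative (\<lambda>h. \<Sum>l\<in>UNIV. h $ l * (f u * D' l u + D l u * g u))) (at u)" for u
      using has_derivative_mult[OF D(2) D'(2), of u]
      by (simp add: distrib_left sum.distrib sum_distrib_left sum_distrib_right mult_ac)
    have "(\<Sum>l\<in>UNIV. u $ l * (f u * D' l u + D l u * g u)) = f u * (\<Sum>l\<in>UNIV. u $ l * D' l u) + (\<Sum>l\<in>UNIV. u $ l * D l u) * g u" for u
      by (simp add: distrib_left sum.distrib sum_distrib_left sum_distrib_right mult_ac)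
    then show "(\<Sum>l\<in>UNIV. u $ l * (f u * D' l u + D l u * g u)) = of_nat (k + m) * (f u * g u)" for u
      by (simp only: D(3) D'(3)) (simp add: algebra_simps)
  qed
qed

text \<open>The Frechet derivative is taken over the reals. For polynomials it is complex linear, by
  \<open>rpoly_has_derivative\<close>, so this is the complex partial derivative.\<close>

definition cpd :: "'p::finite \<Rightarrow> (complex^'p \<Rightarrow> complex) \<Rightarrow> complex^'p \<Rightarrow> complex" where
  "cpd l f u = frechet_derivative f (at u) (axis l 1)"

lemma cpd_unique:
  assumes "(f has_derivative (\<lambda>h. \<Sum>l\<in>UNIV. h $ l * D l)) (at u)"
  shows "cpd l f u = D l"
proof -
  have "cpd l f u = (\<Sum>m\<in>UNIV. axis l 1 $ m * D m)"
    unfolding cpd_def frechet_derivative_unique[OF assms] ..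
  also have "\<dots> = (\<Sum>m\<in>UNIV. if m = l then D m else 0)"
    by (intro sum.cong) (auto simp: axis_def)
  finally show ?thesis by simp
qed

lemma rpoly_derivative:
  assumes "rpoly f"
  shows "\<exists>D. (\<forall>l. rpoly (D l)) \<and> (\<forall>u. (f has_derivative (\<lambda>h. \<Sum>l\<in>UNIV. h $ l * D l u)) (at u))"
  using assms
proof (induction f rule: rpoly.induct)
  case (rp_hom k f)
  obtain D where
    "\<forall>l. rpoly (D l)" "\<forall>u. (f has_derivative (\<lambda>h. \<Sum>l\<in>UNIV. h $ l * D l u)) (at u)"
    using hpoly_derivative[OF rp_hom] by blast
  then show ?case by blast
next
  case (rp_add f g)
  obtain D where
    "\<forall>l. rpoly (D l)" "\<forall>u. (f has_derivative (\<lambda>h. \<Sum>l\<in>UNIV. h $ l * D l u)) (at u)" using rp_add.IH(1) by blast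
  note D = this[rule_format]
  obtain D' where
    "\<forall>l. rpoly (D' l)" "\<forall>u. (g has_derivative (\<lambda>h. \<Sum>l\<in>UNIV. h $ l * D' l u)) (at u)" using rp_add.IH(2) by blast
  note D' = this[rule_format]
  show ?case
  proof (intro exI[of _ "\<lambda>l u. D l u + D' l u"] conjI allI)
    show "rpoly (\<lambda>u. D l u + D' l u)" for l by (intro rpoly.rp_add D D')
    show "((\<lambda>u. f u + g u) has_derivative (\<lambda>h. \<Sum>l\<in>UNIV. h $ l * (D l u + D' l u))) (at u)" for u
      using has_derivative_add[OF D(2) D'(2)] by (simp add: distrib_left sum.distrib)
  qed
qed

lemma rpoly_has_derivative:
  assumes "rpoly f"
  shows "(f has_derivative (\<lambda>h. \<Sum>l\<in>UNIV. h $ l * cpd l f u)) (at u)"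
proof -
  obtain D where "\<forall>u. (f has_derivative (\<lambda>h. \<Sum>l\<in>UNIV. h $ l * D l u)) (at u)"
    using rpoly_derivative[OF assms] by blast
  note D = this[rule_format]
  show ?thesis using D[of u] cpd_unique[OF D[of u]] by simp
qed

lemma rpoly_cpd:
  assumes "rpoly f"
  shows "rpoly (cpd l f)"
proof -
  obtain D where "\<forall>l. rpoly (D l)" "\<forall>u. (f has_derivative (\<lambda>h. \<Sum>l\<in>UNIV. h $ l * D l u)) (at u)"
    using rpoly_derivative[OF assms] by blast
  note D = this[rule_format]
  have "cpd l f = D l" using cpd_unique[OF D(2)] by (intro ext)
  then show ?thesis using D(1) by simp
qed

lemma cpd_add: "\<lbrakk>rpoly f; rpoly g\<rbrakk> \<Longrightarrow> cpd l (\<lambda>u. f u + g u) u = cpd l f u + cpd l g u"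
  using has_derivative_add[OF rpoly_has_derivative[of f u] rpoly_has_derivative[of g u]]
  by (intro cpd_unique) (simp add: distrib_left sum.distrib)

lemma cpd_diff: "\<lbrakk>rpoly f; rpoly g\<rbrakk> \<Longrightarrow> cpd l (\<lambda>u. f u - g u) u = cpd l f u - cpd l g u"
  using has_derivative_diff[OF rpoly_has_derivative[of f u] rpoly_has_derivative[of g u]]
  by (intro cpd_unique) (simp add: right_diff_distrib sum_subtractf)

lemma cpd_mult: "\<lbrakk>rpoly f; rpoly g\<rbrakk> \<Longrightarrow> cpd l (\<lambda>u. f u * g u) u = f u * cpd l g u + cpd l f u * g u"
  using has_derivative_mult[OF rpoly_has_derivative[of f u] rpoly_has_derivative[of g u]]
  by (intro cpd_unique) (simp add: distrib_left sum.distrib sum_distrib_left sum_distrib_right mult_ac)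

lemma cpd_const: "cpd l (\<lambda>u. c) u = 0"
  by (rule cpd_unique) simp

lemma cpd_var: "cpd l (\<lambda>u. u $ m) u = (if l = m then 1 else 0)"
proof (rule cpd_unique)
  have "(\<Sum>l\<in>UNIV. h $ l * (if l = m then 1 else 0)) = h $ m" for h :: "complex^'a"
    by (simp add: if_distrib[of "\<lambda>c. _ * c"] cong: if_cong)
  then show "((\<lambda>u. u $ m) has_derivative (\<lambda>h. \<Sum>l\<in>UNIV. h $ l * (if l = m then 1 else 0))) (at u)"
    by (simp add: has_derivative_cvec_nth)
qed

text \<open>By Euler's identity, dividing the homogeneous component of degree \<open>k\<close> by \<open>k\<close> inverts the
  radial derivative; this replaces the integral in Picard's iteration.\<close>

lemma rpoly_radial_primitive_aux:
  assumes "rpoly f"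
  shows "\<exists>c g. rpoly g \<and> g 0 = 0 \<and> (\<forall>u. (\<Sum>l\<in>UNIV. u $ l * cpd l g u) = f u - c)"
  using assms
proof (induction f rule: rpoly.induct)
  case (rp_hom k f)
  show ?case
  proof (cases "k = 0")
    case True
    have "f u = f 0" for u using hpoly_scale[OF rp_hom, of 0 u] True by simp
    then show ?thesis by (intro exI[of _ "f 0"] exI[of _ "\<lambda>u. 0"]) (simp add: rpoly_zero cpd_const)
  next
    case False
    let ?g = "\<lambda>u. of_real (1 / real k) * f u"
    have g: "hpoly k ?g" using hp_mult[OF hp_const rp_hom, of "1 / real k"] by simp
    obtain D where "\<forall>u. (?g has_derivative (\<lambda>h. \<Sum>l\<in>UNIV. h $ l * D l u)) (at u)"
      "\<forall>u. (\<Sum>l\<in>UNIV. u $ l * D l u) = of_nat k * ?g u"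
      using hpoly_derivative[OF g] by blast
    note D = this[rule_format]
    have "(\<Sum>l\<in>UNIV. u $ l * cpd l ?g u) = f u - 0" for u
      unfolding cpd_unique[OF D(1)] using D(2)[of u] False by simp
    moreover have "?g 0 = 0" using hpoly_scale[OF rp_hom, of 0 0] False by (simp add: zero_power)
    ultimately show ?thesis using rpoly.rp_hom[OF g] by blast
  qed
next
  case (rp_add f1 f2)
  obtain c1 g1 where
    g1: "rpoly g1" "g1 0 = 0" "\<forall>u. (\<Sum>l\<in>UNIV. u $ l * cpd l g1 u) = f1 u - c1" using rp_add.IH(1) by blast
  obtain c2 g2 where
    g2: "rpoly g2" "g2 0 = 0" "\<forall>u. (\<Sum>l\<in>UNIV. u $ l * cpd l g2 u) = f2 u - c2" using rp_add.IH(2) by blast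
  show ?case
    by (intro exI[of _ "c1 + c2"] exI[of _ "\<lambda>u. g1 u + g2 u"])
      (simp add: rpoly.rp_add g1 g2 cpd_add distrib_left sum.distrib)
qed

definition radial_primitive :: "(complex^'p::finite \<Rightarrow> complex) \<Rightarrow> complex^'p \<Rightarrow> complex" where
  "radial_primitive f = (SOME g. rpoly g \<and> g 0 = 0 \<and> (\<forall>u. (\<Sum>l\<in>UNIV. u $ l * cpd l g u) = f u))"

lemma radial_primitive:
  assumes "rpoly f" "f 0 = 0"
  shows "rpoly (radial_primitive f)" "radial_primitive f 0 = 0"
    "(\<Sum>l\<in>UNIV. u $ l * cpd l (radial_primitive f) u) = f u"
proof -
  obtain c g where g: "rpoly g" "g 0 = 0" "\<forall>u. (\<Sum>l\<in>UNIV. u $ l * cpd l g u) = f u - c"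
    using rpoly_radial_primitive_aux[OF assms(1)] by blast
  have "c = 0" using g(3)[rule_format, of 0] assms(2) by simp
  then have "\<exists>g. rpoly g \<and> g 0 = 0 \<and> (\<forall>u. (\<Sum>l\<in>UNIV. u $ l * cpd l g u) = f u)" using g by auto
  from someI_ex[OF this] show "rpoly (radial_primitive f)" "radial_primitive f 0 = 0"
    "(\<Sum>l\<in>UNIV. u $ l * cpd l (radial_primitive f) u) = f u"
    unfolding radial_primitive_def by auto
qed

text \<open>The function \<open>g (t *\<^sub>R u)\<close> of t has the derivative
  \<open>\<Sum>j\<in>UNIV. u $ j * F j (t *\<^sub>R u)\<close>, since Euler's identity at
  \<open>t *\<^sub>R u\<close> has an extra factor t on both sides. So \<open>g u\<close> is an
  average over 0 < t < 1 of quantities bounded by \<open>B\<close>.\<close>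

lemma radial_bound:
  assumes "rpoly g" "g 0 = 0"
    and euler: "\<And>u. (\<Sum>l\<in>UNIV. u $ l * cpd l g u) = (\<Sum>j\<in>UNIV. u $ j * F j u)"
    and bound: "\<And>t. 0 < t \<Longrightarrow> t < 1 \<Longrightarrow> norm (\<Sum>j\<in>UNIV. u $ j * F j (t *\<^sub>R u)) \<le> B"
  shows "norm (g u) \<le> B"
proof -
  have der: "((\<lambda>t. g (t *\<^sub>R u)) has_vector_derivative (\<Sum>l\<in>UNIV. u $ l * cpd l g (t *\<^sub>R u))) (at t)" for t
  proof -
    have "((\<lambda>t. t *\<^sub>R u) has_derivative (\<lambda>s. s *\<^sub>R u)) (at t)" by (auto intro!: derivative_eq_intros)
    from has_derivative_compose[OF this rpoly_has_derivative[OF assms(1)]]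
    show ?thesis unfolding has_vector_derivative_def
      by (simp add: scaleR_sum_right)
  qed
  have "norm (g (1 *\<^sub>R u) - g (0 *\<^sub>R u)) \<le> B * 1 - B * 0"
  proof (rule differentiable_bound_general[where f = "\<lambda>t. g (t *\<^sub>R u)" and \<phi> = "\<lambda>t. B * t"])
    show "continuous_on {0..1} (\<lambda>t. g (t *\<^sub>R u))"
      using der by (meson continuous_at_imp_continuous_on has_vector_derivative_continuous)
    show "((\<lambda>t. B * t) has_vector_derivative B) (at t)" for t
      by (auto intro!: derivative_eq_intros simp: has_real_derivative_iff_has_vector_derivative[symmetric])
    show "norm (\<Sum>l\<in>UNIV. u $ l * cpd l g (t *\<^sub>R u)) \<le> B" if "0 < t" "t < 1" for t
    proof -
      have "of_real t * (\<Sum>l\<in>UNIV. u $ l * cpd l g (t *\<^sub>R u)) = of_real t * (\<Sum>j\<in>UNIV. u $ j * F j (t *\<^sub>R u))"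
        using euler[of "t *\<^sub>R u"] by (simp add: scaleR_conv_of_real[where 'a = complex] sum_distrib_left mult_ac)
      then show ?thesis using bound[OF that] that by simp
    qed
  qed (auto intro!: der continuous_intros)
  then show ?thesis using assms(2) by simp
qed

lemma norm_axis: "norm (axis l z) = norm z" for z :: "'b::real_inner"
  by (simp add: norm_eq_sqrt_inner inner_axis)

text \<open>Restriction to the complex line through \<open>u\<close> in direction \<open>l\<close>
  leads to Cauchy's inequality on a disc of radius \<delta>. Thus sup bounds for iterates already
  contain bounds for their derivatives.\<close>

lemma rpoly_cauchy_estimate:
  assumes "rpoly f" "\<And>v. norm v \<le> R \<Longrightarrow> norm (f v) \<le> A" "norm u + \<delta> \<le> R" "0 < \<delta>"
  shows "norm (cpd l f u) \<le> A / \<delta>"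
proof -
  define g where "g z = f (u + axis l z)" for z
  have d: "(g has_field_derivative cpd l f (u + axis l z)) (at z)" for z
  proof -
    have lin: "bounded_linear (axis l :: complex \<Rightarrow> complex^'a)"
    proof (rule bounded_linear_intro[of _ 1])
      show "axis l (a + b) = axis l a + axis l b" "axis l (c *\<^sub>R a) = c *\<^sub>R axis l a" for a b :: complex and c
        by (simp_all add: vec_eq_iff axis_def)
      show "norm (axis l a) \<le> norm a * 1" for a :: complex by (simp add: norm_axis)
    qed
    have "((\<lambda>z. u + axis l z) has_derivative (\<lambda>h. axis l h)) (at z)"
      using has_derivative_add[OF has_derivative_const bounded_linear_imp_has_derivative[OF lin], of u] by simp
    from has_derivative_compose[OF this rpoly_has_derivative[OF assms(1)]]
    have "(g has_derivative (\<lambda>h. \<Sum>m\<in>UNIV. axis l h $ m * cpd m f (u + axis l z))) (at z)"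
      unfolding g_def .
    moreover have "(\<Sum>m\<in>UNIV. axis l h $ m * cpd m f (u + axis l z)) = cpd l f (u + axis l z) * h" for h
    proof -
      have "(\<Sum>m\<in>UNIV. axis l h $ m * cpd m f (u + axis l z)) = (\<Sum>m\<in>UNIV. if m = l then h * cpd m f (u + axis l z) else 0)"
        by (intro sum.cong) (auto simp: axis_def)
      then show ?thesis by simp
    qed
    ultimately show ?thesis unfolding has_field_derivative_def by (simp add: mult_commute_abs)
  qed
  have "norm ((deriv ^^ 1) g 0) \<le> fact 1 * A / \<delta> ^ 1"
  proof (rule Cauchy_inequality)
    show "g holomorphic_on ball 0 \<delta>" using d
      by (meson field_differentiable_at_within field_differentiable_def holomorphic_on_def)
    show "continuous_on (cball 0 \<delta>) g"
      using d by (meson DERIV_continuous continuous_at_imp_continuous_on)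
    show "norm (g z) \<le> A" if "norm (0 - z) = \<delta>" for z
      unfolding g_def
    proof (rule assms(2))
      have "norm (u + axis l z) \<le> norm u + norm (axis l z)" by (rule norm_triangle_ineq)
      then show "norm (u + axis l z) \<le> R" using that assms(3) by (simp add: norm_axis)
    qed
  qed fact
  moreover have ax: "axis l 0 = (0 :: complex^'a)" by (simp add: vec_eq_iff axis_def)
  have "deriv g 0 = cpd l f u" using DERIV_imp_deriv[OF d[of 0]] unfolding ax add_0_right .
  ultimately show ?thesis by simp
qed

lemma norm_vec_le: "(\<And>i. norm (v $ i) \<le> B) \<Longrightarrow> norm v \<le> real CARD('p) * B"
  for v :: "('b::real_normed_vector)^'p::finite"
proof -
  assume *: "\<And>i. norm (v $ i) \<le> B"
  have "norm v \<le> (\<Sum>i\<in>UNIV. norm (v $ i))"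
    unfolding norm_vec_def by (rule L2_set_le_sum) simp
  also have "\<dots> \<le> (\<Sum>i\<in>(UNIV :: 'p set). B)" by (intro sum_mono *)
  finally show ?thesis by simp
qed

lemma rpoly_lipschitz:
  fixes f :: "complex^'p::finite \<Rightarrow> complex"
  assumes "rpoly f" "\<And>v l. norm v \<le> R \<Longrightarrow> norm (cpd l f v) \<le> A" "norm u \<le> R" "norm v \<le> R"
  shows "norm (f u - f v) \<le> real CARD('p) * A * norm (u - v)"
proof (rule differentiable_bound[where S = "cball 0 R"])
  show "(f has_derivative (\<lambda>h. \<Sum>l\<in>UNIV. h $ l * cpd l f w)) (at w within cball 0 R)" for w
    by (rule has_derivative_at_withinI[OF rpoly_has_derivative[OF assms(1)]])
  show "onorm (\<lambda>h. \<Sum>l\<in>UNIV. h $ l * cpd l f w) \<le> real CARD('p) * A" if "w \<in> cball 0 R" for w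
  proof (rule onorm_le)
    fix h
    have "norm (\<Sum>l\<in>UNIV. h $ l * cpd l f w) \<le> (\<Sum>l\<in>(UNIV :: 'p set). norm h * A)"
    proof (rule sum_norm_le)
      fix l :: 'p
      show "norm (h $ l * cpd l f w) \<le> norm h * A"
        unfolding norm_mult using assms(2)[of w l] that Finite_Cartesian_Product.norm_nth_le[of h l]
        by (intro mult_mono) auto
    qed
    then show "norm (\<Sum>l\<in>UNIV. h $ l * cpd l f w) \<le> real CARD('p) * A * norm h" by (simp add: mult_ac)
  qed
qed (use assms in auto)

subsection \<open>Limits\<close>

definition cvec :: "real^'p \<Rightarrow> complex^'p::finite" where
  "cvec u = (\<chi> i. of_real (u $ i))"

lemma cvec_nth [simp]: "cvec u $ i = of_real (u $ i)"
  by (simp add: cvec_def)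

lemma norm_cvec [simp]: "norm (cvec u) = norm u"
  by (simp add: norm_vec_def)

lemma cvec_add: "cvec (u + v) = cvec u + cvec v"
  and cvec_diff: "cvec (u - v) = cvec u - cvec v"
  and cvec_scaleR: "cvec (t *\<^sub>R u) = t *\<^sub>R cvec u"
  and cvec_zero [simp]: "cvec 0 = 0"
  by (simp_all add: vec_eq_iff scaleR_conv_of_real[where 'a = complex])

lemma bounded_linear_cvec: "bounded_linear cvec"
  by (rule bounded_linear_intro[of _ 1]) (auto simp: cvec_add cvec_scaleR)

lemma Re_rpoly_has_derivative:
  assumes "rpoly f"
  shows "((\<lambda>u. Re (f (cvec u))) has_derivative (\<lambda>h. \<Sum>l\<in>UNIV. h $ l * Re (cpd l f (cvec u)))) (at u)"
proof -
  have "((\<lambda>u. f (cvec u)) has_derivative (\<lambda>h. \<Sum>l\<in>UNIV. cvec h $ l * cpd l f (cvec u))) (at u)"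
    using has_derivative_compose[OF bounded_linear_imp_has_derivative[OF bounded_linear_cvec] rpoly_has_derivative[OF assms]] .
  from bounded_linear.has_derivative[OF bounded_linear_Re this] show ?thesis
    by simp
qed

text \<open>Cauchy's estimate applied to differences, on the radius halfway to \<rho>. Since all
  radii below \<rho> are treated at once, nothing is lost in the conclusion and the lemma can be
  iterated.\<close>

lemma uniformly_Cauchy_cpd:
  fixes f :: "nat \<Rightarrow> complex^'p::finite \<Rightarrow> complex"
  assumes f: "\<And>n. rpoly (f n)" and C: "\<And>r. r < \<rho> \<Longrightarrow> uniformly_Cauchy_on (cball 0 r) f" and r: "r < \<rho>"
  shows "uniformly_Cauchy_on (cball 0 r) (\<lambda>n. cpd l (f n))"
  unfolding uniformly_Cauchy_on_def
proof (intro allI impI)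
  fix e :: real assume e: "e > 0"
  define R where "R = (r + \<rho>) / 2"
  define \<delta> where "\<delta> = R - r"
  have R: "R < \<rho>" "\<delta> > 0" using r by (simp_all add: R_def \<delta>_def)
  obtain M where M: "\<And>x m n. x \<in> cball 0 R \<Longrightarrow> m \<ge> M \<Longrightarrow> n \<ge> M \<Longrightarrow> dist (f m x) (f n x) < e * \<delta> / 2"
    using C[OF R(1)] e R(2) unfolding uniformly_Cauchy_on_def
    by (metis half_gt_zero mult_pos_pos)
  have "dist (cpd l (f m) x) (cpd l (f n) x) < e" if "x \<in> cball 0 r" "m \<ge> M" "n \<ge> M" for x m n
  proof -
    have "norm (cpd l (\<lambda>u. f m u - f n u) x) \<le> (e * \<delta> / 2) / \<delta>"
    proof (rule rpoly_cauchy_estimate)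
      show "rpoly (\<lambda>u. f m u - f n u)" by (intro rpoly_diff f)
      show "norm (f m v - f n v) \<le> e * \<delta> / 2" if "norm v \<le> R" for v
        using M[of v m n] that \<open>m \<ge> M\<close> \<open>n \<ge> M\<close> by (simp add: dist_norm)
      show "norm x + \<delta> \<le> R" using that by (simp add: \<delta>_def)
    qed fact
    also have "\<dots> < e" using e R(2) by simp
    finally show ?thesis by (simp add: cpd_diff f dist_norm)
  qed
  then show "\<exists>M. \<forall>x\<in>cball 0 r. \<forall>m\<ge>M. \<forall>n\<ge>M. dist (cpd l (f m) x) (cpd l (f n) x) < e" by blast
qed

lemma uniformly_Cauchy_lim:
  fixes f :: "nat \<Rightarrow> 'a \<Rightarrow> complex"
  assumes "uniformly_Cauchy_on S f"
  shows "uniform_limit S f (\<lambda>x. lim (\<lambda>n. f n x)) sequentially"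
    and "x \<in> S \<Longrightarrow> (\<lambda>n. f n x) \<longlonglongrightarrow> lim (\<lambda>n. f n x)"
proof -
  show 1: "uniform_limit S f (\<lambda>x. lim (\<lambda>n. f n x)) sequentially"
    using assms uniformly_convergent_eq_Cauchy uniformly_convergent_uniform_limit_iff by blast
  show "x \<in> S \<Longrightarrow> (\<lambda>n. f n x) \<longlonglongrightarrow> lim (\<lambda>n. f n x)"
    by (rule tendsto_uniform_limitI[OF 1])
qed

lemma rpoly_limit_has_derivative:
  fixes f :: "nat \<Rightarrow> complex^'p::finite \<Rightarrow> complex"
  assumes f: "\<And>n. rpoly (f n)" and C: "\<And>r. r < \<rho> \<Longrightarrow> uniformly_Cauchy_on (cball 0 r) f" and u: "norm u < \<rho>"
  shows "((\<lambda>u. Re (lim (\<lambda>n. f n (cvec u)))) has_derivative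
    (\<lambda>h. \<Sum>l\<in>UNIV. h $ l * Re (lim (\<lambda>n. cpd l (f n) (cvec u))))) (at u)"
proof -
  define r where "r = (norm u + \<rho>) / 2"
  have r: "norm u < r" "r < \<rho>" using u by (simp_all add: r_def)
  let ?S = "ball 0 r :: (real^'p) set"
  let ?g' = "\<lambda>u h. \<Sum>l\<in>UNIV. h $ l * Re (lim (\<lambda>n. cpd l (f n) (cvec u)))"
  note Cd = uniformly_Cauchy_cpd[OF f C r(2)]
  have "\<exists>g. \<forall>x\<in>?S. (\<lambda>n. Re (f n (cvec x))) \<longlonglongrightarrow> g x \<and> (g has_derivative ?g' x) (at x within ?S)"
  proof (rule has_derivative_sequence)
    show "((\<lambda>u. Re (f n (cvec u))) has_derivative (\<lambda>h. \<Sum>l\<in>UNIV. h $ l * Re (cpd l (f n) (cvec x)))) (at x within ?S)" for n x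
      by (rule has_derivative_at_withinI[OF Re_rpoly_has_derivative[OF f]])
    show "0 \<in> ?S" using r(1) by (simp add: le_less_trans[OF norm_ge_zero])
    show "(\<lambda>n. Re (f n (cvec 0))) \<longlonglongrightarrow> Re (lim (\<lambda>n. f n (cvec 0)))"
      using order_trans[OF norm_ge_zero less_imp_le[OF r(1)]]
      by (intro tendsto_Re uniformly_Cauchy_lim(2)[OF C[OF r(2)]]) simp
    fix e :: real assume e: "e > 0"
    let ?e = "e / real CARD('p)"
    have "\<forall>\<^sub>F n in sequentially. \<forall>x\<in>cball 0 r. dist (cpd l (f n) x) (lim (\<lambda>n. cpd l (f n) x)) < ?e" for l
      using uniformly_Cauchy_lim(1)[OF Cd] e unfolding uniform_limit_iff by simp
    then have "\<forall>\<^sub>F n in sequentially. \<forall>l. \<forall>x\<in>cball 0 r. dist (cpd l (f n) x) (lim (\<lambda>n. cpd l (f n) x)) < ?e"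
      by (intro eventually_all_finite) simp
    then show "\<forall>\<^sub>F n in sequentially. \<forall>x\<in>?S. \<forall>h. norm ((\<Sum>l\<in>UNIV. h $ l * Re (cpd l (f n) (cvec x))) - ?g' x h) \<le> e * norm h"
    proof (rule eventually_mono)
      fix n assume n: "\<forall>l. \<forall>x\<in>cball 0 r. dist (cpd l (f n) x) (lim (\<lambda>n. cpd l (f n) x)) < ?e"
      show "\<forall>x\<in>?S. \<forall>h. norm ((\<Sum>l\<in>UNIV. h $ l * Re (cpd l (f n) (cvec x))) - ?g' x h) \<le> e * norm h"
      proof (intro ballI allI)
        fix x h assume x: "x \<in> ?S"
        have "norm ((\<Sum>l\<in>UNIV. h $ l * Re (cpd l (f n) (cvec x))) - ?g' x h) =
            norm (\<Sum>l\<in>UNIV. h $ l * Re (cpd l (f n) (cvec x) - lim (\<lambda>n. cpd l (f n) (cvec x))))"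
          by (simp add: sum_subtractf right_diff_distrib)
        also have "\<dots> \<le> (\<Sum>l\<in>(UNIV :: 'p set). norm h * ?e)"
        proof (rule sum_norm_le)
          fix l :: 'p
          have "\<bar>Re (cpd l (f n) (cvec x) - lim (\<lambda>n. cpd l (f n) (cvec x)))\<bar> \<le> ?e"
            using n[rule_format, of "cvec x" l] x abs_Re_le_cmod[of "cpd l (f n) (cvec x) - lim (\<lambda>n. cpd l (f n) (cvec x))"]
            by (simp add: dist_norm)
          then show "norm (h $ l * Re (cpd l (f n) (cvec x) - lim (\<lambda>n. cpd l (f n) (cvec x)))) \<le> norm h * ?e"
            unfolding norm_mult using Finite_Cartesian_Product.norm_nth_le[of h l] by (intro mult_mono) auto
        qed
        also have "\<dots> = e * norm h" by simp
        finally show "norm ((\<Sum>l\<in>UNIV. h $ l * Re (cpd l (f n) (cvec x))) - ?g' x h) \<le> e * norm h" .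
      qed
    qed
  qed simp
  then obtain g where g: "\<And>x. x \<in> ?S \<Longrightarrow> (\<lambda>n. Re (f n (cvec x))) \<longlonglongrightarrow> g x"
    "\<And>x. x \<in> ?S \<Longrightarrow> (g has_derivative ?g' x) (at x within ?S)" by blast
  have "g x = Re (lim (\<lambda>n. f n (cvec x)))" if "x \<in> ?S" for x
  proof (rule LIMSEQ_unique[OF g(1)[OF that]])
    show "(\<lambda>n. Re (f n (cvec x))) \<longlonglongrightarrow> Re (lim (\<lambda>n. f n (cvec x)))"
      using that by (intro tendsto_Re uniformly_Cauchy_lim(2)[OF C[OF r(2)]]) simp
  qed
  moreover have "(g has_derivative ?g' u) (at u)"
    using g(2)[of u] r(1) at_within_open[of u ?S] by simp
  ultimately show ?thesis
    by (rule_tac has_derivative_transform_within_open[of g "?g' u" u UNIV ?S]) (use r(1) in auto)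
qed

text \<open>The hypotheses pass from the sequence to its partial derivatives, so differentiability
  of the limit can be applied over and over.\<close>

lemma rpoly_limit_smooth:
  fixes f :: "nat \<Rightarrow> complex^'p::finite \<Rightarrow> complex"
  assumes f: "\<And>n. rpoly (f n)" and C: "\<And>r. r < \<rho> \<Longrightarrow> uniformly_Cauchy_on (cball 0 r) f"
  shows "smooth_on (ball 0 \<rho>) (\<lambda>u. Re (lim (\<lambda>n. f n (cvec u))))"
proof -
  interpret regularity "ball 0 \<rho> :: (real^'p) set" "continuous_on (ball 0 \<rho>)"
    by (rule regularity_continuous) simp
  have "Ck (continuous_on (ball 0 \<rho>)) k (ball 0 \<rho>) (\<lambda>u. Re (lim (\<lambda>n. f n (cvec u))))" for k
    using f C
  proof (induction k arbitrary: f)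
    case 0
    have "isCont (\<lambda>u. Re (lim (\<lambda>n. f n (cvec u)))) u" if "norm u < \<rho>" for u
      using has_derivative_continuous[OF rpoly_limit_has_derivative[OF 0 that]] .
    then show ?case by (simp add: continuous_at_imp_continuous_on)
  next
    case (Suc k)
    show ?case
    proof (rule Ck_SucI)
      show "((\<lambda>u. Re (lim (\<lambda>n. f n (cvec u)))) has_derivative
        (\<lambda>h. \<Sum>l\<in>UNIV. h $ l * Re (lim (\<lambda>n. cpd l (f n) (cvec u))))) (at u)" if "u \<in> ball 0 \<rho>" for u
        using that by (intro rpoly_limit_has_derivative[OF Suc.prems]) simp_all
      fix v :: "real^'p" assume "v \<in> Basis"
      show "Ck (continuous_on (ball 0 \<rho>)) k (ball 0 \<rho>) (\<lambda>u. \<Sum>l\<in>UNIV. v $ l * Re (lim (\<lambda>n. cpd l (f n) (cvec u))))"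
        by (intro Ck_sum Ck_cmult Suc.IH rpoly_cpd Suc.prems(1) uniformly_Cauchy_cpd[OF Suc.prems])
    qed
  qed
  then show ?thesis unfolding smooth_on_eq_Ck by blast
qed

section \<open>Polynomial fields depending on a parameter\<close>

text \<open>The parameter \<open>y\<close> enters only through Hoelder continuous coefficients and
  the variable \<open>x\<close> only polynomially. The class is closed under sums, products and
  derivatives in \<open>x\<close>, which is what makes it stable under brackets.\<close>

inductive poly_family :: "real \<Rightarrow> (real^'p::finite) set \<Rightarrow> (real^'p \<Rightarrow> complex^'p \<Rightarrow> complex) \<Rightarrow> bool"
  for \<alpha> \<Omega> where
  pf_const: "locally_holder_on \<alpha> \<Omega> a \<Longrightarrow> poly_family \<alpha> \<Omega> (\<lambda>y x. of_real (a y))"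
| pf_var: "poly_family \<alpha> \<Omega> (\<lambda>y x. x $ l)"
| pf_add: "\<lbrakk>poly_family \<alpha> \<Omega> F; poly_family \<alpha> \<Omega> G\<rbrakk> \<Longrightarrow> poly_family \<alpha> \<Omega> (\<lambda>y x. F y x + G y x)"
| pf_mult: "\<lbrakk>poly_family \<alpha> \<Omega> F; poly_family \<alpha> \<Omega> G\<rbrakk> \<Longrightarrow> poly_family \<alpha> \<Omega> (\<lambda>y x. F y x * G y x)"

lemma poly_family_rpoly: "poly_family \<alpha> \<Omega> F \<Longrightarrow> rpoly (F y)"
  by (induction F rule: poly_family.induct) (auto intro: rpoly_const rpoly_var rp_add rpoly_mult)

lemma holder_const: "locally_holder_on \<alpha> \<Omega> (\<lambda>y. c::real)"
  by (intro locally_holder_onI exI[of _ "1::real"] conjI exI[of _ "0::real"]) auto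

lemma pf_real: "poly_family \<alpha> \<Omega> (\<lambda>y x. of_real c)"
  by (rule pf_const[OF holder_const])

lemma pf_zero: "poly_family \<alpha> \<Omega> (\<lambda>y x. 0)"
  using pf_real[of \<alpha> \<Omega> 0] by simp

lemma pf_cmult: "poly_family \<alpha> \<Omega> F \<Longrightarrow> poly_family \<alpha> \<Omega> (\<lambda>y x. of_real c * F y x)"
  by (intro pf_mult pf_real)

lemma pf_diff:
  assumes "poly_family \<alpha> \<Omega> F" "poly_family \<alpha> \<Omega> G"
  shows "poly_family \<alpha> \<Omega> (\<lambda>y x. F y x - G y x)"
  using pf_add[OF assms(1) pf_cmult[OF assms(2), of "-1"]] by simp

lemma pf_sum: "(\<And>i. i \<in> I \<Longrightarrow> poly_family \<alpha> \<Omega> (F i)) \<Longrightarrow> poly_family \<alpha> \<Omega> (\<lambda>y x. \<Sum>i\<in>I. F i y x)"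
proof (induction I rule: infinite_finite_induct)
  case (insert a I)
  have "poly_family \<alpha> \<Omega> (\<lambda>y x. F a y x + (\<Sum>i\<in>I. F i y x))"
    by (rule pf_add[OF insert.prems insert.IH]) (simp_all add: insert.prems)
  then show ?case using insert.hyps by simp
qed (simp_all add: pf_zero)

lemma pf_cpd: "poly_family \<alpha> \<Omega> F \<Longrightarrow> poly_family \<alpha> \<Omega> (\<lambda>y. cpd l (F y))"
proof (induction F rule: poly_family.induct)
  case (pf_const a)
  have eq: "(\<lambda>y. cpd l (\<lambda>x. of_real (a y))) = (\<lambda>y x. 0)" by (intro ext cpd_const)
  show ?case unfolding eq by (rule pf_zero)
next
  case (pf_var m)
  have eq: "(\<lambda>y. cpd l (\<lambda>x. x $ m)) = (\<lambda>(y :: real^'a) x. of_real (if l = m then 1 else 0))"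
    by (intro ext) (simp add: cpd_var)
  show ?case unfolding eq by (rule pf_real)
next
  case (pf_add F G)
  have eq: "(\<lambda>y. cpd l (\<lambda>x. F y x + G y x)) = (\<lambda>y x. cpd l (F y) x + cpd l (G y) x)"
    using pf_add.hyps by (intro ext cpd_add poly_family_rpoly)
  show ?case unfolding eq by (rule poly_family.pf_add[OF pf_add.IH])
next
  case (pf_mult F G)
  have eq: "(\<lambda>y. cpd l (\<lambda>x. F y x * G y x)) = (\<lambda>y x. F y x * cpd l (G y) x + cpd l (F y) x * G y x)"
    using pf_mult.hyps by (intro ext cpd_mult poly_family_rpoly)
  show ?case unfolding eq by (intro poly_family.pf_add poly_family.pf_mult pf_mult.IH pf_mult.hyps)
qed

text \<open>A single constant serves for the sup, the Lipschitz bound in \<open>x\<close> and the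
  Hoelder bound in \<open>y\<close>, so that closure under sums and products has only one number to
  track.\<close>

definition lipschitz_holder_on :: "real \<Rightarrow> (real^'p) set \<Rightarrow> real \<Rightarrow> real \<Rightarrow> (real^'p::finite \<Rightarrow> complex^'p \<Rightarrow> complex) \<Rightarrow> bool" where
  "lipschitz_holder_on \<alpha> N R C F \<longleftrightarrow> 0 \<le> C \<and> (\<forall>y\<in>N. \<forall>x. norm x \<le> R \<longrightarrow> norm (F y x) \<le> C \<and>
     (\<forall>x'. norm x' \<le> R \<longrightarrow> norm (F y x - F y x') \<le> C * norm (x - x')) \<and>
     (\<forall>y'\<in>N. norm (F y x - F y' x) \<le> C * dist y y' powr \<alpha>))"

lemma lipschitz_holder_onD:
  assumes "lipschitz_holder_on \<alpha> N R C F" "y \<in> N" "norm x \<le> R"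
  shows "norm (F y x) \<le> C" "norm x' \<le> R \<Longrightarrow> norm (F y x - F y x') \<le> C * norm (x - x')"
    "y' \<in> N \<Longrightarrow> norm (F y x - F y' x) \<le> C * dist y y' powr \<alpha>"
  using assms unfolding lipschitz_holder_on_def by simp_all

lemma lipschitz_holder_onI:
  assumes "0 \<le> C" "\<And>y x. y \<in> N \<Longrightarrow> norm x \<le> R \<Longrightarrow> norm (F y x) \<le> C"
    "\<And>y x x'. y \<in> N \<Longrightarrow> norm x \<le> R \<Longrightarrow> norm x' \<le> R \<Longrightarrow> norm (F y x - F y x') \<le> C * norm (x - x')"
    "\<And>y x y'. y \<in> N \<Longrightarrow> y' \<in> N \<Longrightarrow> norm x \<le> R \<Longrightarrow> norm (F y x - F y' x) \<le> C * dist y y' powr \<alpha>"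
  shows "lipschitz_holder_on \<alpha> N R C F"
  unfolding lipschitz_holder_on_def by (intro conjI ballI allI impI assms)

lemma lipschitz_holder_on_mono:
  fixes F :: "real^'p::finite \<Rightarrow> complex^'p \<Rightarrow> complex"
  assumes "lipschitz_holder_on \<alpha> N R C F" "N' \<subseteq> N" "C \<le> C'"
  shows "lipschitz_holder_on \<alpha> N' R C' F"
proof (rule lipschitz_holder_onI)
  have C: "0 \<le> C" using assms(1) by (simp add: lipschitz_holder_on_def)
  show "0 \<le> C'" using C assms(3) by simp
  fix y :: "real^'p" and x :: "complex^'p" assume y: "y \<in> N'" and x: "norm x \<le> R"
  have y': "y \<in> N" using y assms(2) by blast
  show "norm (F y x) \<le> C'" using lipschitz_holder_onD(1)[OF assms(1) y' x] assms(3) by simp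
  show "norm (F y x - F y x') \<le> C' * norm (x - x')" if "norm x' \<le> R" for x'
    using lipschitz_holder_onD(2)[OF assms(1) y' x that] assms(3) mult_right_mono[of C C' "norm (x - x')"] by simp
  show "norm (F y x - F z x) \<le> C' * dist y z powr \<alpha>" if "z \<in> N'" for z
    using lipschitz_holder_onD(3)[OF assms(1) y' x subsetD[OF assms(2) that]] assms(3) mult_right_mono[of C C' "dist y z powr \<alpha>"] by simp
qed

lemma lipschitz_holder_on_add:
  fixes F :: "real^'p::finite \<Rightarrow> complex^'p \<Rightarrow> complex"
  assumes F: "lipschitz_holder_on \<alpha> N R C F" and G: "lipschitz_holder_on \<alpha> N R C' G"
  shows "lipschitz_holder_on \<alpha> N R (C + C') (\<lambda>y x. F y x + G y x)"
proof (rule lipschitz_holder_onI)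
  show "0 \<le> C + C'" using F G by (simp add: lipschitz_holder_on_def)
  fix y :: "real^'p" and x :: "complex^'p" assume y: "y \<in> N" and x: "norm x \<le> R"
  show "norm (F y x + G y x) \<le> C + C'"
    using lipschitz_holder_onD(1)[OF F y x] lipschitz_holder_onD(1)[OF G y x] norm_triangle_ineq[of "F y x" "G y x"] by simp
  have *: "norm ((a + b) - (a' + b')) \<le> (C + C') * d"
    if "norm (a - a') \<le> C * d" "norm (b - b') \<le> C' * d" for a a' b b' :: complex and d
    using that norm_triangle_ineq[of "a - a'" "b - b'"] by (simp add: algebra_simps)
  show "norm (F y x + G y x - (F y x' + G y x')) \<le> (C + C') * norm (x - x')" if "norm x' \<le> R" for x'
    by (rule *[OF lipschitz_holder_onD(2)[OF F y x that] lipschitz_holder_onD(2)[OF G y x that]])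
  show "norm (F y x + G y x - (F z x + G z x)) \<le> (C + C') * dist y z powr \<alpha>" if "z \<in> N" for z
    by (rule *[OF lipschitz_holder_onD(3)[OF F y x that] lipschitz_holder_onD(3)[OF G y x that]])
qed

lemma lipschitz_holder_on_mult:
  fixes F :: "real^'p::finite \<Rightarrow> complex^'p \<Rightarrow> complex"
  assumes F: "lipschitz_holder_on \<alpha> N R C F" and G: "lipschitz_holder_on \<alpha> N R C' G"
  shows "lipschitz_holder_on \<alpha> N R (2 * C * C' + C * C') (\<lambda>y x. F y x * G y x)"
proof (rule lipschitz_holder_onI)
  have C: "0 \<le> C" "0 \<le> C'" using F G by (simp_all add: lipschitz_holder_on_def)
  show "0 \<le> 2 * C * C' + C * C'" using C by simp
  fix y :: "real^'p" and x :: "complex^'p" assume y: "y \<in> N" and x: "norm x \<le> R"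
  have "norm (F y x * G y x) \<le> C * C'"
    unfolding norm_mult by (intro mult_mono lipschitz_holder_onD(1)[OF F y x] lipschitz_holder_onD(1)[OF G y x] C) simp
  then show "norm (F y x * G y x) \<le> 2 * C * C' + C * C'" using mult_nonneg_nonneg[OF C] by linarith
  have *: "norm (a * b - a' * b') \<le> (2 * C * C' + C * C') * d"
    if "norm (a - a') \<le> C * d" "norm (b - b') \<le> C' * d" "norm a \<le> C" "norm b' \<le> C'" "0 \<le> d" for a a' b b' :: complex and d
  proof -
    have "a * b - a' * b' = a * (b - b') + (a - a') * b'" by (simp add: algebra_simps)
    then have "norm (a * b - a' * b') \<le> norm a * norm (b - b') + norm (a - a') * norm b'"
      by (metis norm_mult norm_triangle_ineq)
    also have "\<dots> \<le> C * (C' * d) + (C * d) * C'"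
      using that C by (intro add_mono mult_mono) auto
    also have "\<dots> \<le> (2 * C * C' + C * C') * d" using C that(5) by (simp add: algebra_simps)
    finally show ?thesis .
  qed
  show "norm (F y x * G y x - F y x' * G y x') \<le> (2 * C * C' + C * C') * norm (x - x')" if "norm x' \<le> R" for x'
    by (rule *[OF lipschitz_holder_onD(2)[OF F y x that] lipschitz_holder_onD(2)[OF G y x that] lipschitz_holder_onD(1)[OF F y x] lipschitz_holder_onD(1)[OF G y that]]) simp
  show "norm (F y x * G y x - F z x * G z x) \<le> (2 * C * C' + C * C') * dist y z powr \<alpha>" if "z \<in> N" for z
    by (rule *[OF lipschitz_holder_onD(3)[OF F y x that] lipschitz_holder_onD(3)[OF G y x that] lipschitz_holder_onD(1)[OF F y x] lipschitz_holder_onD(1)[OF G that x]]) simp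
qed

lemma poly_family_lipschitz_holder:
  assumes "poly_family \<alpha> \<Omega> F" "y0 \<in> \<Omega>" "0 < \<alpha>" "0 \<le> R"
  shows "\<exists>\<epsilon>>0. \<exists>C. lipschitz_holder_on \<alpha> (\<Omega> \<inter> ball y0 \<epsilon>) R C F"
  using assms(1)
proof (induction F rule: poly_family.induct)
  case (pf_const a)
  obtain e C where e: "e > 0" "C \<ge> 0"
    "\<And>y z. \<lbrakk>y \<in> \<Omega>; z \<in> \<Omega>; dist y0 y < e; dist y0 z < e\<rbrakk> \<Longrightarrow> dist (a y) (a z) \<le> C * dist y z powr \<alpha>"
    using locally_holder_onE[OF pf_const assms(2)] by metis
  have "lipschitz_holder_on \<alpha> (\<Omega> \<inter> ball y0 (min e 1)) R (\<bar>a y0\<bar> + C) (\<lambda>y x. of_real (a y))"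
  proof (rule lipschitz_holder_onI)
    fix y x assume y: "y \<in> \<Omega> \<inter> ball y0 (min e 1)"
    have "dist y y0 powr \<alpha> \<le> 1" using y assms(3) by (intro powr_le1) (auto simp: dist_commute)
    then have "C * dist y y0 powr \<alpha> \<le> C" using e(2) by (simp add: mult_left_le)
    then have "dist (a y) (a y0) \<le> C" using e(3)[of y y0] y e(1) assms(2) by simp
    then show "norm (of_real (a y) :: complex) \<le> \<bar>a y0\<bar> + C" by (simp add: dist_real_def)
  next
    fix y y' assume y: "y \<in> \<Omega> \<inter> ball y0 (min e 1)" "y' \<in> \<Omega> \<inter> ball y0 (min e 1)"
    have "dist (a y) (a y') \<le> C * dist y y' powr \<alpha>" using e(3)[of y y'] y by simp
    also have "\<dots> \<le> (\<bar>a y0\<bar> + C) * dist y y' powr \<alpha>" by (intro mult_right_mono) auto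
    finally show "norm (of_real (a y) - of_real (a y') :: complex) \<le> (\<bar>a y0\<bar> + C) * dist y y' powr \<alpha>"
      by (simp add: dist_real_def flip: of_real_diff)
  qed (use e(2) in auto)
  moreover have "min e 1 > 0" using e(1) by simp
  ultimately show ?case by blast
next
  case (pf_var l)
  have "lipschitz_holder_on \<alpha> (\<Omega> \<inter> ball y0 1) R (1 + R) (\<lambda>y x. x $ l)"
  proof (rule lipschitz_holder_onI)
    fix x :: "complex^'a" assume "norm x \<le> R"
    then show "norm (x $ l) \<le> 1 + R" using Finite_Cartesian_Product.norm_nth_le[of x l] by simp
  next
    fix x x' :: "complex^'a"
    have "norm (x $ l - x' $ l) \<le> norm (x - x')" using Finite_Cartesian_Product.norm_nth_le[of "x - x'" l] by simp
    then show "norm (x $ l - x' $ l) \<le> (1 + R) * norm (x - x')" using assms(4) by (simp add: algebra_simps add_increasing2)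
  qed (use assms(4) in auto)
  then show ?case using zero_less_one by blast
next
  case (pf_add F G)
  obtain e C where F: "e > 0" "lipschitz_holder_on \<alpha> (\<Omega> \<inter> ball y0 e) R C F" using pf_add.IH(1) by auto
  obtain e' C' where G: "e' > 0" "lipschitz_holder_on \<alpha> (\<Omega> \<inter> ball y0 e') R C' G" using pf_add.IH(2) by auto
  have "lipschitz_holder_on \<alpha> (\<Omega> \<inter> ball y0 (min e e')) R (C + C') (\<lambda>y x. F y x + G y x)"
    by (intro lipschitz_holder_on_add lipschitz_holder_on_mono[OF F(2)] lipschitz_holder_on_mono[OF G(2)]) auto
  moreover have "min e e' > 0" using F(1) G(1) by simp
  ultimately show ?case by blast
next
  case (pf_mult F G)
  obtain e C where F: "e > 0" "lipschitz_holder_on \<alpha> (\<Omega> \<inter> ball y0 e) R C F" using pf_mult.IH(1) by auto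
  obtain e' C' where G: "e' > 0" "lipschitz_holder_on \<alpha> (\<Omega> \<inter> ball y0 e') R C' G" using pf_mult.IH(2) by auto
  have "lipschitz_holder_on \<alpha> (\<Omega> \<inter> ball y0 (min e e')) R (2 * C * C' + C * C') (\<lambda>y x. F y x * G y x)"
    by (intro lipschitz_holder_on_mult lipschitz_holder_on_mono[OF F(2)] lipschitz_holder_on_mono[OF G(2)]) auto
  moreover have "min e e' > 0" using F(1) G(1) by simp
  ultimately show ?case by blast
qed

section \<open>Vector fields with polynomial coefficients depending on the base point\<close>

definition poly_field :: "real \<Rightarrow> (real^'p::finite) set \<Rightarrow> (real^'p \<Rightarrow> real^'p \<Rightarrow> real^'p) \<Rightarrow> bool" where
  "poly_field \<alpha> \<Omega> V \<longleftrightarrow> (\<exists>F. \<forall>i. poly_family \<alpha> \<Omega> (F i) \<and> (\<forall>y x. V y x $ i = Re (F i y (cvec x))))"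

lemma poly_field_differentiable:
  assumes "poly_field \<alpha> \<Omega> V" shows "V y differentiable (at x)"
proof (rule differentiable_vecI)
  fix i
  obtain F where F: "\<forall>i. poly_family \<alpha> \<Omega> (F i) \<and> (\<forall>y x. V y x $ i = Re (F i y (cvec x)))"
    using assms unfolding poly_field_def by blast
  have eq: "(\<lambda>x. V y x $ i) = (\<lambda>x. Re (F i y (cvec x)))" using F by blast
  have "poly_family \<alpha> \<Omega> (F i)" using F by blast
  then show "(\<lambda>x. V y x $ i) differentiable (at x)"
    unfolding eq differentiable_def using Re_rpoly_has_derivative[OF poly_family_rpoly] by blast
qed

text \<open>Real parts multiply here because real polynomials take real values at real
  points.\<close>

lemma Re_rpoly_mult:
  assumes "rpoly f" "rpoly g"
  shows "Re (f (cvec x) * g (cvec x)) = Re (f (cvec x)) * Re (g (cvec x))"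
proof -
  have "f (cvec x) \<in> \<real>" "g (cvec x) \<in> \<real>"
    by (rule rpoly_real[OF assms(1)], simp, rule rpoly_real[OF assms(2)], simp)
  then show ?thesis by (auto elim!: Reals_cases)
qed

lemma pd_Re_rpoly:
  assumes "rpoly f" shows "pd l (\<lambda>x. Re (f (cvec x))) x = Re (cpd l f (cvec x))"
proof -
  have "pd l (\<lambda>x. Re (f (cvec x))) x = (\<Sum>m\<in>UNIV. axis l 1 $ m * Re (cpd m f (cvec x)))"
    unfolding frechet_derivative_unique[OF Re_rpoly_has_derivative[OF assms]] ..
  also have "\<dots> = (\<Sum>m\<in>UNIV. if m = l then Re (cpd m f (cvec x)) else 0)"
    by (intro sum.cong) (auto simp: axis_def)
  finally show ?thesis by simp
qed

lemma poly_field_lie_bracket: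
  assumes V: "poly_field \<alpha> \<Omega> V" and W: "poly_field \<alpha> \<Omega> W"
  shows "poly_field \<alpha> \<Omega> (\<lambda>y. lie_bracket (V y) (W y))"
proof -
  obtain F where F: "\<forall>i. poly_family \<alpha> \<Omega> (F i) \<and> (\<forall>y x. V y x $ i = Re (F i y (cvec x)))"
    using V unfolding poly_field_def by blast
  obtain G where G: "\<forall>i. poly_family \<alpha> \<Omega> (G i) \<and> (\<forall>y x. W y x $ i = Re (G i y (cvec x)))"
    using W unfolding poly_field_def by blast
  have pf: "poly_family \<alpha> \<Omega> (F i)" "poly_family \<alpha> \<Omega> (G i)" for i using F G by auto
  have rp: "rpoly (F i y)" "rpoly (G i y)" "rpoly (cpd l (F i y))" "rpoly (cpd l (G i y))" for i y l
    by (rule poly_family_rpoly[OF pf(1)], rule poly_family_rpoly[OF pf(2)],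
      rule rpoly_cpd[OF poly_family_rpoly[OF pf(1)]], rule rpoly_cpd[OF poly_family_rpoly[OF pf(2)]])
  have eq: "(\<lambda>x. V y x $ i) = (\<lambda>x. Re (F i y (cvec x)))" "(\<lambda>x. W y x $ i) = (\<lambda>x. Re (G i y (cvec x)))" for y i
    using F G by blast+
  let ?H = "\<lambda>i y x. \<Sum>l\<in>UNIV. F l y x * cpd l (G i y) x - G l y x * cpd l (F i y) x"
  have "poly_family \<alpha> \<Omega> (?H i)" for i
    by (intro pf_sum pf_diff pf_mult pf_cpd pf)
  moreover have "lie_bracket (V y) (W y) x $ i = Re (?H i y (cvec x))" for i y x
  proof -
    have "lie_bracket (V y) (W y) x $ i = (\<Sum>l\<in>UNIV. V y x $ l * pd l (\<lambda>x. W y x $ i) x - W y x $ l * pd l (\<lambda>x. V y x $ i) x)"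
      by (intro lie_bracket_nth poly_field_differentiable V[THEN poly_field_differentiable] W[THEN poly_field_differentiable])
    also have "\<dots> = (\<Sum>l\<in>UNIV. Re (F l y (cvec x)) * Re (cpd l (G i y) (cvec x)) - Re (G l y (cvec x)) * Re (cpd l (F i y) (cvec x)))"
      unfolding eq pd_Re_rpoly[OF rp(1)] pd_Re_rpoly[OF rp(2)] using F G by simp
    also have "\<dots> = Re (?H i y (cvec x))"
      by (simp add: Re_rpoly_mult[OF rp(1,4), symmetric] Re_rpoly_mult[OF rp(2,3), symmetric] del: times_complex.sel)
    finally show ?thesis .
  qed
  ultimately show ?thesis unfolding poly_field_def by (intro exI[of _ ?H]) blast
qed

lemma poly_field_commutator:
  assumes "\<And>i. i \<in> set I \<Longrightarrow> poly_field \<alpha> \<Omega> (\<lambda>y. F y i)" "I \<noteq> []"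
  shows "poly_field \<alpha> \<Omega> (\<lambda>y. commutator (F y) I)"
  using assms
proof (induction I)
  case (Cons i I)
  show ?case
  proof (cases I)
    case Nil
    then show ?thesis using Cons.prems by simp
  next
    case (Cons j J)
    have "poly_field \<alpha> \<Omega> (\<lambda>y. lie_bracket (F y i) (commutator (F y) I))"
      by (rule poly_field_lie_bracket) (use Cons Cons.prems Cons.IH in simp_all)
    then show ?thesis by (simp add: Cons)
  qed
qed simp

context holder_fields
begin

lemma poly_field_approx:
  assumes "i \<le> n"
  shows "poly_field \<alpha> \<Omega> (\<lambda>y. approx_field r X y i)"
proof -
  let ?m = "r - field_weight i"
  let ?a = "\<lambda>k js y. iterated_partial js (\<lambda>z. X i z $ k) y"
  let ?Q = "\<lambda>js y x. prod_list (map (\<lambda>j. x $ j - of_real (y $ j)) js) :: complex"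
  let ?F = "\<lambda>k y x. \<Sum>js | length js \<le> ?m. of_real (inverse (fact (length js))) * (of_real (?a k js y) * ?Q js y x)"
  have nth: "locally_holder_on \<alpha> \<Omega> (\<lambda>y. y $ j)" for j
  proof -
    have "Ck H 0 \<Omega> (\<lambda>y. y \<bullet> axis j 1)" by (rule Ck_inner)
    then show ?thesis by (simp add: inner_axis)
  qed
  have Q: "poly_family \<alpha> \<Omega> (?Q js)" for js
  proof (induction js)
    case Nil
    show ?case using pf_real[of \<alpha> \<Omega> 1] by simp
  next
    case (Cons j js)
    have "poly_family \<alpha> \<Omega> (\<lambda>y x. (x $ j - of_real (y $ j)) * ?Q js y x)"
      by (intro pf_mult pf_diff pf_var pf_const nth Cons.IH)
    then show ?case by simp
  qed
  \<comment> \<open>The Taylor polynomial involves derivatives up to order \<open>?m\<close> only,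
    and all of these are still \<alpha>-Hoelder continuous in \<open>y\<close>.\<close>
  have a: "locally_holder_on \<alpha> \<Omega> (?a k js)" if "length js \<le> ?m" for k js
  proof -
    have "Ck H (?m - length js) \<Omega> (?a k js)" by (rule Ck_iterated_partial[OF Ck_X[OF assms] that])
    from Ck_mono[OF this, of 0] show ?thesis by simp
  qed
  have "poly_family \<alpha> \<Omega> (?F k)" for k
    by (intro pf_sum pf_cmult pf_mult pf_const Q a) simp
  moreover have "approx_field r X y i x $ k = Re (?F k y (cvec x))" for k y x
  proof -
    have Qc: "?Q js y (cvec x) = of_real (prod_list (map (\<lambda>j. x $ j - y $ j) js))" for js
      by (induction js) simp_all
    have "Re (?F k y (cvec x)) = (\<Sum>js | length js \<le> ?m. inverse (fact (length js)) * (?a k js y * prod_list (map (\<lambda>j. x $ j - y $ j) js)))"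
      unfolding Re_sum Qc of_real_mult[symmetric] Re_complex_of_real ..
    then show ?thesis by (simp add: approx_field_def taylor_poly_def divide_inverse mult_ac)
  qed
  ultimately show ?thesis unfolding poly_field_def by (intro exI[of _ ?F]) blast
qed

lemma poly_field_commutator_approx:
  assumes "I \<in> multiindices n"
  shows "poly_field \<alpha> \<Omega> (\<lambda>y. commutator (approx_field r X y) I)"
proof (rule poly_field_commutator)
  show "poly_field \<alpha> \<Omega> (\<lambda>y. approx_field r X y i)" if "i \<in> set I" for i
    using that assms by (intro poly_field_approx) (auto simp: multiindices_def)
  show "I \<noteq> []" using assms by (simp add: multiindices_def)
qed

end

section \<open>Picard iteration\<close>

text \<open>The iterates solve \<open>u \<cdot> \<nabla>v = \<Sum>\<^sub>j u\<^sub>j F\<^sub>j(v)\<close> with \<open>v(0) = y\<close> instead of the equation along the rays, so that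
  they remain polynomials in \<open>u\<close>. They converge uniformly on a complex ball, and there Cauchy's estimates
  carry the convergence over to all derivatives, and the Hoelder dependence on \<open>y\<close> to the first ones.\<close>

primrec picard :: "('p::finite \<Rightarrow> 'p \<Rightarrow> complex^'p \<Rightarrow> complex) \<Rightarrow> real^'p \<Rightarrow> nat \<Rightarrow> 'p \<Rightarrow> complex^'p \<Rightarrow> complex" where
  "picard F y 0 = (\<lambda>i u. of_real (y $ i))"
| "picard F y (Suc n) = (\<lambda>i u. of_real (y $ i) + radial_primitive (\<lambda>u. \<Sum>j\<in>UNIV. u $ j * F j i (\<chi> m. picard F y n m u)) u)"

context
  fixes F :: "'p::finite \<Rightarrow> 'p \<Rightarrow> complex^'p \<Rightarrow> complex"
  assumes F: "\<And>j i. rpoly (F j i)"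
begin

lemma picard_step_rpoly:
  assumes "\<And>m. rpoly (g m)"
  shows "rpoly (\<lambda>u. \<Sum>j\<in>UNIV. u $ j * F j i (\<chi> m. g m u))"
  by (intro rpoly_sum rpoly_mult rpoly_var rpoly_compose F assms)

lemma rpoly_picard: "rpoly (picard F y n i)"
proof (induction n arbitrary: i)
  case (Suc n)
  show ?case unfolding picard.simps
    by (intro rp_add rpoly_const radial_primitive(1) picard_step_rpoly Suc.IH) simp
qed (simp add: rpoly_const)

lemma picard_primitive:
  shows "rpoly (radial_primitive (\<lambda>u. \<Sum>j\<in>UNIV. u $ j * F j i (\<chi> m. picard F y n m u)))"
    and "radial_primitive (\<lambda>u. \<Sum>j\<in>UNIV. u $ j * F j i (\<chi> m. picard F y n m u)) 0 = 0"
    and "(\<Sum>l\<in>UNIV. u $ l * cpd l (radial_primitive (\<lambda>u. \<Sum>j\<in>UNIV. u $ j * F j i (\<chi> m. picard F y n m u))) u)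
       = (\<Sum>j\<in>UNIV. u $ j * F j i (\<chi> m. picard F y n m u))"
  by (intro radial_primitive picard_step_rpoly rpoly_picard; simp)+

lemma picard_zero: "picard F y n i 0 = of_real (y $ i)"
  by (cases n) (simp_all add: picard_primitive(2))

lemma picard_radial:
  "(\<Sum>l\<in>UNIV. u $ l * cpd l (picard F y (Suc n) i) u) = (\<Sum>j\<in>UNIV. u $ j * F j i (\<chi> m. picard F y n m u))"
  unfolding picard.simps
  by (simp add: cpd_add[OF rpoly_const picard_primitive(1)] cpd_const picard_primitive(3))

end

text \<open>Two systems and two initial points, so that one estimate yields both the contraction
  (\<open>F = G\<close>, consecutive steps) and the dependence on the parameter (different
  \<open>F\<close> and \<open>G\<close>, the same step).\<close>

lemma picard_diff_bound:
  fixes F G :: "'p::finite \<Rightarrow> 'p \<Rightarrow> complex^'p \<Rightarrow> complex"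
  assumes F: "\<And>j i. rpoly (F j i)" and G: "\<And>j i. rpoly (G j i)" and u: "norm u \<le> \<rho>" and "0 \<le> A"
    and bound: "\<And>j v. norm v \<le> \<rho> \<Longrightarrow>
      norm (F j i (\<chi> m. picard F y n m v) - G j i (\<chi> m. picard G z k m v)) \<le> A"
  shows "norm (picard F y (Suc n) i u - picard G z (Suc k) i u) \<le> norm (y - z) + real CARD('p) * \<rho> * A"
proof -
  let ?f = "radial_primitive (\<lambda>u. \<Sum>j\<in>UNIV. u $ j * F j i (\<chi> m. picard F y n m u))"
  let ?g = "radial_primitive (\<lambda>u. \<Sum>j\<in>UNIV. u $ j * G j i (\<chi> m. picard G z k m u))"
  have "norm (?f u - ?g u) \<le> real CARD('p) * \<rho> * A"
  proof (rule radial_bound[where g = "\<lambda>u. ?f u - ?g u" and F = "\<lambda>j v. F j i (\<chi> m. picard F y n m v) - G j i (\<chi> m. picard G z k m v)"])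
    show "rpoly (\<lambda>u. ?f u - ?g u)" by (intro rpoly_diff picard_primitive F G)
    show "?f 0 - ?g 0 = 0" unfolding picard_primitive(2)[where F = F, OF F] picard_primitive(2)[where F = G, OF G] by simp
    show "(\<Sum>l\<in>UNIV. u $ l * cpd l (\<lambda>u. ?f u - ?g u) u) = (\<Sum>j\<in>UNIV. u $ j * (F j i (\<chi> m. picard F y n m u) - G j i (\<chi> m. picard G z k m u)))" for u
      unfolding cpd_diff[OF picard_primitive(1)[where F = F, OF F] picard_primitive(1)[where F = G, OF G]] right_diff_distrib sum_subtractf
        picard_primitive(3)[where F = F, OF F] picard_primitive(3)[where F = G, OF G] ..
    fix t :: real assume t: "0 < t" "t < 1"
    have \<rho>: "0 \<le> \<rho>" using order_trans[OF norm_ge_zero u] .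
    have tu: "norm (t *\<^sub>R u) \<le> \<rho>" using u t mult_left_le_one_le[of "norm u" t] by simp
    have "norm (\<Sum>j\<in>UNIV. u $ j * (F j i (\<chi> m. picard F y n m (t *\<^sub>R u)) - G j i (\<chi> m. picard G z k m (t *\<^sub>R u))))
        \<le> (\<Sum>j\<in>(UNIV::'p set). \<rho> * A)"
    proof (rule sum_norm_le)
      fix j :: 'p
      show "norm (u $ j * (F j i (\<chi> m. picard F y n m (t *\<^sub>R u)) - G j i (\<chi> m. picard G z k m (t *\<^sub>R u)))) \<le> \<rho> * A"
        unfolding norm_mult using Finite_Cartesian_Product.norm_nth_le[of u j] u bound[OF tu] \<open>0 \<le> A\<close> \<rho>
        by (intro mult_mono) auto
    qed
    then show "norm (\<Sum>j\<in>UNIV. u $ j * (F j i (\<chi> m. picard F y n m (t *\<^sub>R u)) - G j i (\<chi> m. picard G z k m (t *\<^sub>R u)))) \<le> real CARD('p) * \<rho> * A"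
      by (simp add: mult_ac)
  qed
  moreover have "norm (of_real (y $ i) - of_real (z $ i) :: complex) \<le> norm (y - z)"
    using Finite_Cartesian_Product.norm_nth_le[of "y - z" i] by (simp flip: of_real_diff)
  moreover have "picard F y (Suc n) i u - picard G z (Suc k) i u = (of_real (y $ i) - of_real (z $ i)) + (?f u - ?g u)"
    by simp
  ultimately show ?thesis by (smt (verit) norm_triangle_ineq)
qed

lemma picard_bound:
  fixes F :: "'p::finite \<Rightarrow> 'p \<Rightarrow> complex^'p \<Rightarrow> complex"
  assumes F: "\<And>j i. rpoly (F j i)" and u: "norm u \<le> \<rho>" and "0 \<le> A"
    and bound: "\<And>j v. norm v \<le> \<rho> \<Longrightarrow> norm (F j i (\<chi> m. picard F y n m v)) \<le> A"
  shows "norm (picard F y (Suc n) i u - of_real (y $ i)) \<le> real CARD('p) * \<rho> * A"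
proof -
  let ?f = "radial_primitive (\<lambda>u. \<Sum>j\<in>UNIV. u $ j * F j i (\<chi> m. picard F y n m u))"
  have "norm (?f u) \<le> real CARD('p) * \<rho> * A"
  proof (rule radial_bound[OF picard_primitive[where F = F, OF F]])
    fix t :: real assume t: "0 < t" "t < 1"
    have \<rho>: "0 \<le> \<rho>" using order_trans[OF norm_ge_zero u] .
    have tu: "norm (t *\<^sub>R u) \<le> \<rho>" using u t mult_left_le_one_le[of "norm u" t] by simp
    have "norm (\<Sum>j\<in>UNIV. u $ j * F j i (\<chi> m. picard F y n m (t *\<^sub>R u))) \<le> (\<Sum>j\<in>(UNIV::'p set). \<rho> * A)"
    proof (rule sum_norm_le)
      fix j :: 'p
      show "norm (u $ j * F j i (\<chi> m. picard F y n m (t *\<^sub>R u))) \<le> \<rho> * A"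
        unfolding norm_mult using Finite_Cartesian_Product.norm_nth_le[of u j] u bound[OF tu] \<open>0 \<le> A\<close> \<rho>
        by (intro mult_mono) auto
    qed
    then show "norm (\<Sum>j\<in>UNIV. u $ j * F j i (\<chi> m. picard F y n m (t *\<^sub>R u))) \<le> real CARD('p) * \<rho> * A"
      by (simp add: mult_ac)
  qed
  then show ?thesis by simp
qed

lemma uniformly_Cauchy_geometric:
  fixes f :: "nat \<Rightarrow> 'a \<Rightarrow> complex"
  assumes "\<And>n x. x \<in> S \<Longrightarrow> norm (f (Suc n) x - f n x) \<le> (1 / 2) ^ n"
  shows "uniformly_Cauchy_on S f"
  unfolding uniformly_Cauchy_on_def
proof (intro allI impI)
  fix e :: real assume "e > 0"
  then obtain M where M: "(1 / 2 :: real) ^ M < e / 4"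
    using real_arch_pow_inv[of "e / 4" "1 / 2"] by auto
  have step: "norm (f (n + k) x - f n x) \<le> 2 * (1 / 2) ^ n - 2 * (1 / 2) ^ (n + k)" if "x \<in> S" for n k x
  proof (induction k)
    case (Suc k)
    have "f (n + Suc k) x - f n x = (f (Suc (n + k)) x - f (n + k) x) + (f (n + k) x - f n x)" by simp
    then have "norm (f (n + Suc k) x - f n x) \<le> norm (f (Suc (n + k)) x - f (n + k) x) + norm (f (n + k) x - f n x)"
      by (metis norm_triangle_ineq)
    also have "\<dots> \<le> (1 / 2) ^ (n + k) + (2 * (1 / 2) ^ n - 2 * (1 / 2) ^ (n + k))"
      by (intro add_mono assms that Suc.IH)
    finally show ?case by simp
  qed simp
  have near: "norm (f m x - f M x) < e / 2" if "x \<in> S" "m \<ge> M" for m x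
  proof -
    have "norm (f m x - f M x) \<le> 2 * (1 / 2) ^ M - 2 * (1 / 2) ^ m"
      using step[OF that(1), of M "m - M"] that(2) by simp
    also have "\<dots> \<le> 2 * (1 / 2) ^ M" by simp
    finally show ?thesis using M by simp
  qed
  have "dist (f m x) (f n x) < e" if "x \<in> S" "m \<ge> M" "n \<ge> M" for m n x
    using near[OF that(1,2)] near[OF that(1,3)] dist_triangle_half_l[of "f m x" "f M x" e "f n x"]
    by (simp add: dist_norm)
  then show "\<exists>M. \<forall>x\<in>S. \<forall>m\<ge>M. \<forall>n\<ge>M. dist (f m x) (f n x) < e" by blast
qed

lemma norm_limit_le:
  fixes a :: "nat \<Rightarrow> 'b::real_normed_vector"
  assumes "a \<longlonglongrightarrow> l" "\<And>n. norm (a n) \<le> B"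
  shows "norm l \<le> B"
  by (rule LIMSEQ_le_const2[OF tendsto_norm[OF assms(1)]]) (use assms(2) in blast)

lemma has_derivative_vecI:
  fixes f :: "'a::real_normed_vector \<Rightarrow> real^'p::finite"
  assumes "\<And>i. ((\<lambda>x. f x $ i) has_derivative (\<lambda>h. f' h $ i)) (at x)"
  shows "(f has_derivative f') (at x)"
proof -
  have "\<forall>b\<in>Basis. ((\<lambda>x. f x \<bullet> b) has_derivative (\<lambda>h. f' h \<bullet> b)) (at x)"
    using assms by (auto simp: Basis_vec_def inner_axis)
  then show ?thesis using has_derivative_componentwise_within[of f f' x UNIV] by simp
qed

lemma tendsto_cvec_vecI:
  fixes a :: "nat \<Rightarrow> 'p::finite \<Rightarrow> complex"
  assumes "\<And>i. (\<lambda>n. a n i) \<longlonglongrightarrow> of_real (x $ i)"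
  shows "(\<lambda>n. \<chi> m. a n m) \<longlonglongrightarrow> cvec x"
  by (rule vec_tendstoI) (simp add: assms)

text \<open>\<open>R\<close> leaves room 1 around every base point in \<open>N\<close>; the iterates
  will be seen to stay there, so that the bounds with constant \<open>C\<close> apply at each step.
  Distances at most 1 allow |y - z| to be absorbed into its power \<alpha>.\<close>

locale polynomial_flow =
  fixes \<alpha> :: real and \<Omega> :: "(real^'p::finite) set" and S :: "'p \<Rightarrow> real^'p \<Rightarrow> real^'p \<Rightarrow> real^'p"
    and F :: "'p \<Rightarrow> 'p \<Rightarrow> real^'p \<Rightarrow> complex^'p \<Rightarrow> complex" and N :: "(real^'p) set" and R C q :: real
  assumes q_def: "q = real CARD('p)" and \<alpha>: "0 < \<alpha>" "\<alpha> \<le> 1" and N: "\<And>y z. y \<in> N \<Longrightarrow> z \<in> N \<Longrightarrow> dist y z \<le> 1"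
    and F: "\<And>j i. poly_family \<alpha> \<Omega> (F j i)" and S: "\<And>j y x i. S j y x $ i = Re (F j i y (cvec x))"
    and bounds: "\<And>j i. lipschitz_holder_on \<alpha> N R C (F j i)" and C: "1 \<le> C" and R: "\<And>y. y \<in> N \<Longrightarrow> norm y + 1 \<le> R"
begin

text \<open>Makes the contraction factor \<open>q * (q * \<rho> * C)\<close> equal to 1/4: one
  \<open>q\<close> comes from the sum over the fields, the other from passing from components to the
  norm of a vector.\<close>

definition "\<rho> = 1 / (4 * q * q * C)"

abbreviation "P y \<equiv> picard (\<lambda>j i. F j i y) y"

abbreviation "v y n u \<equiv> \<chi> m. P y n m u"

lemma q: "1 \<le> q"
proof -
  have "0 < CARD('p)" by (rule zero_less_card_finite)
  then show ?thesis unfolding q_def by linarith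
qed

lemma norm_vec_le_q: "(\<And>i. norm (w $ i) \<le> B) \<Longrightarrow> norm w \<le> q * B" for w :: "('b::real_normed_vector)^'p"
  unfolding q_def by (rule norm_vec_le)

lemma \<rho>: "0 < \<rho>" "q * (q * \<rho> * C) = 1 / 4"
  using q C by (simp_all add: \<rho>_def)

lemmas picard_bound_q = picard_bound[where 'p = 'p, folded q_def]
  and picard_diff_bound_q = picard_diff_bound[where 'p = 'p, folded q_def]
  and rpoly_lipschitz_q = rpoly_lipschitz[where 'p = 'p, folded q_def]

lemma Frp: "rpoly (F j i y)"
  by (rule poly_family_rpoly[OF F])

lemma Prp: "rpoly (P y n i)"
  by (rule rpoly_picard[OF Frp])

text \<open>The distance from the initial point is at most \<open>q * (q * \<rho> * C)\<close>, that
  is 1/4, provided the previous iterate lies where the bounds hold; hence the joint induction for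
  both claims.\<close>

lemma v_near:
  assumes "y \<in> N"
  shows "norm u \<le> \<rho> \<Longrightarrow> norm (v y n u - cvec y) \<le> 1 \<and> norm (v y n u) \<le> R"
proof (induction n arbitrary: u)
  case 0
  have "v y 0 u = cvec y" by (simp add: vec_eq_iff)
  then show ?case using R[OF assms] by simp
next
  case (Suc n)
  have "norm (P y (Suc n) i u - of_real (y $ i)) \<le> q * \<rho> * C" for i
  proof (rule picard_bound_q[OF Frp Suc.prems])
    show "norm (F j i y (v y n w)) \<le> C" if "norm w \<le> \<rho>" for j w
      using lipschitz_holder_onD(1)[OF bounds assms] Suc.IH[OF that] by blast
  qed (use C in simp)
  then have "norm (v y (Suc n) u - cvec y) \<le> q * (q * \<rho> * C)"
    by (intro norm_vec_le_q) (simp only: vec_lambda_beta vector_minus_component cvec_nth)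
  then have *: "norm (v y (Suc n) u - cvec y) \<le> 1" using \<rho> by simp
  have "norm (v y (Suc n) u) \<le> norm (v y (Suc n) u - cvec y) + norm (cvec y)"
    using norm_triangle_ineq[of "v y (Suc n) u - cvec y" "cvec y"] by simp
  then show ?case using * R[OF assms] by simp
qed

lemma P_bound: "y \<in> N \<Longrightarrow> norm u \<le> \<rho> \<Longrightarrow> norm (P y n i u) \<le> R"
  using v_near[of y u n] Finite_Cartesian_Product.norm_nth_le[of "v y n u" i] by simp

lemma v_step:
  assumes "y \<in> N"
  shows "norm u \<le> \<rho> \<Longrightarrow> norm (v y (Suc n) u - v y n u) \<le> (1 / 2) ^ n"
proof (induction n arbitrary: u)
  case 0
  have "v y 0 u = cvec y" by (simp add: vec_eq_iff)
  then show ?case using v_near[OF assms 0, of "Suc 0"] by (simp del: picard.simps)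
next
  case (Suc n)
  have "norm (P y (Suc (Suc n)) i u - P y (Suc n) i u) \<le> norm (y - y) + q * \<rho> * (C * (1 / 2) ^ n)" for i
  proof (rule picard_diff_bound_q[OF Frp Frp Suc.prems])
    show "norm (F j i y (v y (Suc n) w) - F j i y (v y n w)) \<le> C * (1 / 2) ^ n" if "norm w \<le> \<rho>" for j w
    proof -
      have "norm (F j i y (v y (Suc n) w) - F j i y (v y n w)) \<le> C * norm (v y (Suc n) w - v y n w)"
        using lipschitz_holder_onD(2)[OF bounds assms] v_near[OF assms that] by blast
      also have "\<dots> \<le> C * (1 / 2) ^ n" using Suc.IH[OF that] C by (intro mult_left_mono) auto
      finally show ?thesis .
    qed
  qed (use C in simp)
  then have "norm (v y (Suc (Suc n)) u - v y (Suc n) u) \<le> q * (q * \<rho> * (C * (1 / 2) ^ n))"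
    by (intro norm_vec_le_q) (simp only: vec_lambda_beta vector_minus_component diff_self norm_zero add_0_left)
  also have "\<dots> = q * (q * \<rho> * C) * (1 / 2) ^ n" by (simp add: mult_ac)
  also have "\<dots> \<le> (1 / 2) ^ Suc n" unfolding \<rho>(2) by simp
  finally show ?case .
qed

text \<open>The constant \<open>2 * q + 1\<close> reproduces itself: q + (2q + 2)/4 = 3q/2 + 1/2
  \<le> 2q + 1. Being independent of \<open>n\<close>, the bound passes to the limit.\<close>

lemma v_holder:
  assumes "y \<in> N" "z \<in> N"
  shows "norm u \<le> \<rho> \<Longrightarrow> norm (v y n u - v z n u) \<le> (2 * q + 1) * dist y z powr \<alpha>"
proof (induction n arbitrary: u)
  case 0
  have "v y 0 u - v z 0 u = cvec (y - z)" by (simp add: vec_eq_iff)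
  then have "norm (v y 0 u - v z 0 u) = dist y z" by (simp only: norm_cvec dist_norm)
  also have "\<dots> \<le> dist y z powr \<alpha>" using powr_le_powr_of_dist_le_1[OF _ N[OF assms] \<alpha>(2)] by simp
  also have "\<dots> \<le> (2 * q + 1) * dist y z powr \<alpha>"
    using mult_right_mono[of 1 "2 * q + 1" "dist y z powr \<alpha>"] q by simp
  finally show ?case .
next
  case (Suc n)
  let ?d = "dist y z powr \<alpha>"
  let ?K = "2 * q + 1"
  have d: "dist y z \<le> ?d" using powr_le_powr_of_dist_le_1[OF _ N[OF assms] \<alpha>(2)] by simp
  have d0: "0 \<le> ?d" by simp
  have "norm (P y (Suc n) i u - P z (Suc n) i u) \<le> norm (y - z) + q * \<rho> * (C * (?K * ?d) + C * ?d)" for i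
  proof (rule picard_diff_bound_q[OF Frp Frp Suc.prems])
    show "0 \<le> C * (?K * ?d) + C * ?d" using C q by simp
    show "norm (F j i y (v y n w) - F j i z (v z n w)) \<le> C * (?K * ?d) + C * ?d" if w: "norm w \<le> \<rho>" for j w
    proof -
      have "norm (F j i y (v y n w) - F j i y (v z n w)) \<le> C * norm (v y n w - v z n w)"
        using lipschitz_holder_onD(2)[OF bounds assms(1)] v_near[OF assms(1) w] v_near[OF assms(2) w] by blast
      also have "\<dots> \<le> C * (?K * ?d)" using Suc.IH[OF w] C by (intro mult_left_mono) auto
      finally have 1: "norm (F j i y (v y n w) - F j i y (v z n w)) \<le> C * (?K * ?d)" .
      have 2: "norm (F j i y (v z n w) - F j i z (v z n w)) \<le> C * ?d"
        using lipschitz_holder_onD(3)[OF bounds assms(1) _ assms(2)] v_near[OF assms(2) w] by blast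
      have eq: "F j i y (v y n w) - F j i z (v z n w) = (F j i y (v y n w) - F j i y (v z n w)) + (F j i y (v z n w) - F j i z (v z n w))"
        by simp
      show ?thesis unfolding eq by (rule order_trans[OF norm_triangle_ineq add_mono[OF 1 2]])
    qed
  qed
  then have "norm (v y (Suc n) u - v z (Suc n) u) \<le> q * (norm (y - z) + q * \<rho> * (C * (?K * ?d) + C * ?d))"
    by (intro norm_vec_le_q) (simp only: vec_lambda_beta vector_minus_component)
  also have "\<dots> = q * dist y z + q * (q * \<rho> * C) * ((?K + 1) * ?d)" by (simp add: dist_norm algebra_simps)
  also have "\<dots> \<le> q * ?d + 1 / 4 * ((?K + 1) * ?d)" unfolding \<rho>(2) using d q by (intro add_mono mult_left_mono) auto
  also have "\<dots> = (3 / 2 * q + 1 / 2) * ?d" by (simp add: algebra_simps)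
  also have "\<dots> \<le> ?K * ?d" using q d0 by (intro mult_right_mono) auto
  finally show ?case .
qed

lemma P_holder:
  "y \<in> N \<Longrightarrow> z \<in> N \<Longrightarrow> norm u \<le> \<rho> \<Longrightarrow> norm (P y n i u - P z n i u) \<le> (2 * q + 1) * dist y z powr \<alpha>"
  using v_holder[of y z u n] Finite_Cartesian_Product.norm_nth_le[of "v y n u - v z n u" i] by simp

lemma P_Cauchy:
  assumes "y \<in> N" "r < \<rho>"
  shows "uniformly_Cauchy_on (cball 0 r) (\<lambda>n. P y n i)"
proof (rule uniformly_Cauchy_geometric)
  fix n and u :: "complex^'p" assume "u \<in> cball 0 r"
  then have "norm u \<le> \<rho>" using assms(2) by simp
  from v_step[OF assms(1) this, of n] Finite_Cartesian_Product.norm_nth_le[of "v y (Suc n) u - v y n u" i]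
  show "norm (P y (Suc n) i u - P y n i u) \<le> (1 / 2) ^ n" by (simp del: picard.simps)
qed

definition "E y u = (\<chi> i. Re (lim (\<lambda>n. P y n i (cvec u))))"

definition "D y l u = (\<chi> i. Re (lim (\<lambda>n. cpd l (P y n i) (cvec u))))"

lemma P_lim:
  assumes "y \<in> N" "norm u < \<rho>"
  shows "(\<lambda>n. P y n i (cvec u)) \<longlonglongrightarrow> of_real (E y u $ i)"
    and "(\<lambda>n. cpd l (P y n i) (cvec u)) \<longlonglongrightarrow> lim (\<lambda>n. cpd l (P y n i) (cvec u))"
    and "(\<lambda>n. Re (cpd l (P y n i) (cvec u))) \<longlonglongrightarrow> D y l u $ i"
proof -
  let ?l = "lim (\<lambda>n. P y n i (cvec u))"
  have in_ball: "cvec u \<in> cball 0 (norm u)" by simp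
  have lim: "(\<lambda>n. P y n i (cvec u)) \<longlonglongrightarrow> ?l"
    by (rule uniformly_Cauchy_lim(2)[OF P_Cauchy[OF assms] in_ball])
  \<comment> \<open>Real coefficients keep the iterates real at real points, so the
    \<open>Re\<close> in the definition of \<open>E\<close> loses nothing.\<close>
  have "P y n i (cvec u) \<in> \<real>" for n by (rule rpoly_real[OF Prp]) simp
  then have "?l \<in> \<real>" using Lim_in_closed_set[OF closed_complex_Reals _ _ lim] by simp
  then have "?l = of_real (E y u $ i)" by (auto simp: E_def elim!: Reals_cases)
  then show "(\<lambda>n. P y n i (cvec u)) \<longlonglongrightarrow> of_real (E y u $ i)" using lim by simp
  show *: "(\<lambda>n. cpd l (P y n i) (cvec u)) \<longlonglongrightarrow> lim (\<lambda>n. cpd l (P y n i) (cvec u))"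
    by (rule uniformly_Cauchy_lim(2)[OF uniformly_Cauchy_cpd[OF Prp P_Cauchy[OF assms(1)] assms(2)] in_ball])
  from tendsto_Re[OF *] show "(\<lambda>n. Re (cpd l (P y n i) (cvec u))) \<longlonglongrightarrow> D y l u $ i"
    by (simp add: D_def)
qed

lemma smooth_E: "y \<in> N \<Longrightarrow> smooth_on (ball 0 \<rho>) (E y)"
  by (subst smooth_on_vec) (simp_all add: E_def rpoly_limit_smooth[OF Prp P_Cauchy])

lemma E_has_derivative:
  assumes "y \<in> N" "norm u < \<rho>"
  shows "(E y has_derivative (\<lambda>h. \<Sum>l\<in>UNIV. h $ l *\<^sub>R D y l u)) (at u)"
  by (rule has_derivative_vecI)
    (simp add: E_def D_def rpoly_limit_has_derivative[OF Prp P_Cauchy[OF assms(1)] assms(2)])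

lemma E_zero: "E y 0 = y"
  by (simp add: E_def picard_zero[OF Frp] vec_eq_iff)

text \<open>The limit of \<open>picard_radial\<close>. On the left the first derivatives must
  converge, which Cauchy's estimates ensure; on the right continuity of the fields is enough. The
  shift of the index between both sides disappears in the limit.\<close>

lemma E_radial:
  assumes "y \<in> N" "norm u < \<rho>"
  shows "(\<Sum>l\<in>UNIV. u $ l *\<^sub>R D y l u) = (\<Sum>j\<in>UNIV. u $ j *\<^sub>R S j y (E y u))"
proof -
  have "(\<Sum>l\<in>UNIV. u $ l * D y l u $ i) = (\<Sum>j\<in>UNIV. u $ j * S j y (E y u) $ i)" for i
  proof (rule LIMSEQ_unique)
    have "(\<lambda>n. \<Sum>l\<in>UNIV. u $ l * Re (cpd l (P y n i) (cvec u))) \<longlonglongrightarrow> (\<Sum>l\<in>UNIV. u $ l * D y l u $ i)"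
      by (intro tendsto_intros P_lim(3)[OF assms])
    from LIMSEQ_Suc[OF this]
    show "(\<lambda>n. \<Sum>l\<in>UNIV. u $ l * Re (cpd l (P y (Suc n) i) (cvec u))) \<longlonglongrightarrow> (\<Sum>l\<in>UNIV. u $ l * D y l u $ i)" .
    have "(\<lambda>n. F j i y (v y n (cvec u))) \<longlonglongrightarrow> F j i y (cvec (E y u))" for j
    proof (rule isCont_tendsto_compose[where g = "F j i y"])
      show "isCont (F j i y) (cvec (E y u))" using has_derivative_continuous[OF rpoly_has_derivative[OF Frp]] .
      show "(\<lambda>n. v y n (cvec u)) \<longlonglongrightarrow> cvec (E y u)" by (rule tendsto_cvec_vecI) (rule P_lim(1)[OF assms])
    qed
    then have "(\<lambda>n. \<Sum>j\<in>UNIV. u $ j * Re (F j i y (v y n (cvec u)))) \<longlonglongrightarrow> (\<Sum>j\<in>UNIV. u $ j * Re (F j i y (cvec (E y u))))"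
      by (intro tendsto_intros)
    moreover have "(\<Sum>l\<in>UNIV. u $ l * Re (cpd l (P y (Suc n) i) (cvec u))) = (\<Sum>j\<in>UNIV. u $ j * Re (F j i y (v y n (cvec u))))" for n
    proof -
      have "Re (\<Sum>l\<in>UNIV. cvec u $ l * cpd l (P y (Suc n) i) (cvec u)) = Re (\<Sum>j\<in>UNIV. cvec u $ j * F j i y (v y n (cvec u)))"
        by (simp only: picard_radial[where F = "\<lambda>j i. F j i y", OF Frp])
      then show ?thesis by (simp del: picard.simps)
    qed
    ultimately show "(\<lambda>n. \<Sum>l\<in>UNIV. u $ l * Re (cpd l (P y (Suc n) i) (cvec u))) \<longlonglongrightarrow> (\<Sum>j\<in>UNIV. u $ j * S j y (E y u) $ i)"
      by (simp only: S)
  qed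
  then show ?thesis by (simp add: vec_eq_iff)
qed

text \<open>The sum of four constants: for the Hoelder bounds of \<open>D\<close> and of
  \<open>E\<close> in \<open>y\<close>, then for the Lipschitz bounds of \<open>E\<close> and of
  \<open>D\<close> in \<open>u\<close>. Divisions by fractions of \<rho> are Cauchy's estimates on
  smaller balls.\<close>

definition "K = q * ((2 * q + 1) / (\<rho> / 2) + (2 * q + 1) + q * (R / (\<rho> / 4)) + q * (R / (\<rho> / 4) / (\<rho> / 4)))"

lemma K_bounds:
  assumes "N \<noteq> {}"
  shows "q * ((2 * q + 1) / (\<rho> / 2)) \<le> K" "q * (2 * q + 1) \<le> K" "q * (q * (R / (\<rho> / 4))) \<le> K" "q * (q * (R / (\<rho> / 4) / (\<rho> / 4))) \<le> K"
    "0 \<le> K"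
proof -
  obtain y where "y \<in> N" using assms by blast
  then have "0 \<le> R" using R[of y] norm_ge_zero[of y] by linarith
  then have "0 \<le> (2 * q + 1) / (\<rho> / 2)" "0 \<le> 2 * q + 1" "0 \<le> q * (R / (\<rho> / 4))" "0 \<le> q * (R / (\<rho> / 4) / (\<rho> / 4))"
    using \<rho>(1) q by simp_all
  note * = this
  show "q * ((2 * q + 1) / (\<rho> / 2)) \<le> K" "q * (2 * q + 1) \<le> K" "q * (q * (R / (\<rho> / 4))) \<le> K" "q * (q * (R / (\<rho> / 4) / (\<rho> / 4))) \<le> K"
    unfolding K_def by (rule mult_left_mono, use * in linarith, use q in simp)+
  then show "0 \<le> K" using *(2) q by (meson mult_nonneg_nonneg order_trans zero_le_one)
qed

lemma E_holder:
  assumes "y \<in> N" "z \<in> N" "norm u < \<rho> / 2"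
  shows "norm (E y u - E z u) \<le> K * dist y z powr \<alpha>"
    and "norm (D y l u - D z l u) \<le> K * dist y z powr \<alpha>"
proof -
  have u: "norm u < \<rho>" using assms(3) \<rho>(1) by simp
  have Ne: "N \<noteq> {}" using assms by blast
  let ?d = "dist y z powr \<alpha>"
  have "norm (E y u $ i - E z u $ i) \<le> (2 * q + 1) * ?d" for i
  proof -
    have "norm (of_real (E y u $ i) - of_real (E z u $ i) :: complex) \<le> (2 * q + 1) * ?d"
    proof (rule norm_limit_le)
      show "(\<lambda>n. P y n i (cvec u) - P z n i (cvec u)) \<longlonglongrightarrow> of_real (E y u $ i) - of_real (E z u $ i)"
        by (intro tendsto_diff P_lim(1) assms(1,2) u)
      show "norm (P y n i (cvec u) - P z n i (cvec u)) \<le> (2 * q + 1) * ?d" for n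
        using u by (intro P_holder assms(1,2)) simp
    qed
    then show ?thesis by (simp flip: of_real_diff)
  qed
  then have "norm (E y u - E z u) \<le> q * ((2 * q + 1) * ?d)" by (intro norm_vec_le_q) simp
  also have "\<dots> = q * (2 * q + 1) * ?d" by (simp add: mult_ac)
  also have "\<dots> \<le> K * ?d" by (intro mult_right_mono K_bounds Ne) simp
  finally show "norm (E y u - E z u) \<le> K * ?d" .
  have "norm (D y l u $ i - D z l u $ i) \<le> (2 * q + 1) * ?d / (\<rho> / 2)" for i
  proof (rule norm_limit_le)
    show "(\<lambda>n. Re (cpd l (P y n i) (cvec u)) - Re (cpd l (P z n i) (cvec u))) \<longlonglongrightarrow> D y l u $ i - D z l u $ i"
      by (intro tendsto_diff P_lim(3) assms(1,2) u)
    fix n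
    have "norm (cpd l (\<lambda>w. P y n i w - P z n i w) (cvec u)) \<le> (2 * q + 1) * ?d / (\<rho> / 2)"
    proof (rule rpoly_cauchy_estimate)
      show "rpoly (\<lambda>w. P y n i w - P z n i w)" by (intro rpoly_diff Prp)
      show "norm (P y n i w - P z n i w) \<le> (2 * q + 1) * ?d" if "norm w \<le> \<rho>" for w
        using P_holder[OF assms(1,2) that] .
    qed (use assms(3) \<rho>(1) in auto)
    then have "norm (cpd l (P y n i) (cvec u) - cpd l (P z n i) (cvec u)) \<le> (2 * q + 1) * ?d / (\<rho> / 2)"
      by (simp only: cpd_diff[OF Prp Prp])
    then show "norm (Re (cpd l (P y n i) (cvec u)) - Re (cpd l (P z n i) (cvec u))) \<le> (2 * q + 1) * ?d / (\<rho> / 2)"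
      using abs_Re_le_cmod[of "cpd l (P y n i) (cvec u) - cpd l (P z n i) (cvec u)"] by simp
  qed
  then have "norm (D y l u - D z l u) \<le> q * ((2 * q + 1) * ?d / (\<rho> / 2))" by (intro norm_vec_le_q) simp
  also have "\<dots> = q * ((2 * q + 1) / (\<rho> / 2)) * ?d" by simp
  also have "\<dots> \<le> K * ?d" by (intro mult_right_mono K_bounds Ne) simp
  finally show "norm (D y l u - D z l u) \<le> K * ?d" .
qed

lemma E_lipschitz:
  assumes "y \<in> N" "norm u < \<rho> / 2" "norm w < \<rho> / 2"
  shows "norm (E y u - E y w) \<le> K * norm (u - w)"
    and "norm (D y l u - D y l w) \<le> K * norm (u - w)"
proof -
  have u: "norm u < \<rho>" "norm w < \<rho>" using assms \<rho>(1) by simp_all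
  have Ne: "N \<noteq> {}" using assms by blast
  let ?A = "R / (\<rho> / 4)"
  let ?B = "?A / (\<rho> / 4)"
  \<comment> \<open>The radii are \<rho>, 3/4 \<rho> and 1/2 \<rho>: each derivative costs a
    quarter.\<close>
  have d1: "norm (cpd l (P y n i) x) \<le> ?A" if "norm x \<le> 3 / 4 * \<rho>" for n i x l
    by (rule rpoly_cauchy_estimate[OF Prp P_bound[OF assms(1)]]) (use that \<rho>(1) in auto)
  have d2: "norm (cpd m (cpd l (P y n i)) x) \<le> ?B" if "norm x \<le> \<rho> / 2" for n i x l m
    by (rule rpoly_cauchy_estimate[OF rpoly_cpd[OF Prp] d1]) (use that \<rho>(1) in auto)
  have "norm (E y u $ i - E y w $ i) \<le> q * ?A * norm (u - w)" for i
  proof -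
    have "norm (of_real (E y u $ i) - of_real (E y w $ i) :: complex) \<le> q * ?A * norm (u - w)"
    proof (rule norm_limit_le)
      show "(\<lambda>n. P y n i (cvec u) - P y n i (cvec w)) \<longlonglongrightarrow> of_real (E y u $ i) - of_real (E y w $ i)"
        by (intro tendsto_diff P_lim(1) assms(1) u)
      fix n
      have "norm (P y n i (cvec u) - P y n i (cvec w)) \<le> q * ?A * norm (cvec u - cvec w)"
        by (rule rpoly_lipschitz_q[OF Prp d1, where R = "\<rho> / 2"]) (use assms \<rho>(1) in auto)
      then show "norm (P y n i (cvec u) - P y n i (cvec w)) \<le> q * ?A * norm (u - w)"
        by (simp only: cvec_diff[symmetric] norm_cvec)
    qed
    then show ?thesis by (simp flip: of_real_diff)
  qed
  then have "norm (E y u - E y w) \<le> q * (q * ?A * norm (u - w))" by (intro norm_vec_le_q) simp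
  also have "\<dots> = q * (q * ?A) * norm (u - w)" by simp
  also have "\<dots> \<le> K * norm (u - w)" by (intro mult_right_mono K_bounds Ne) simp
  finally show "norm (E y u - E y w) \<le> K * norm (u - w)" .
  have "norm (D y l u $ i - D y l w $ i) \<le> q * ?B * norm (u - w)" for i
  proof (rule norm_limit_le)
    show "(\<lambda>n. Re (cpd l (P y n i) (cvec u)) - Re (cpd l (P y n i) (cvec w))) \<longlonglongrightarrow> D y l u $ i - D y l w $ i"
      by (intro tendsto_diff P_lim(3) assms(1) u)
    fix n
    have "norm (cpd l (P y n i) (cvec u) - cpd l (P y n i) (cvec w)) \<le> q * ?B * norm (cvec u - cvec w)"
      by (rule rpoly_lipschitz_q[OF rpoly_cpd[OF Prp] d2, where R = "\<rho> / 2"]) (use assms in auto)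
    then have "norm (cpd l (P y n i) (cvec u) - cpd l (P y n i) (cvec w)) \<le> q * ?B * norm (u - w)"
      by (simp only: cvec_diff[symmetric] norm_cvec)
    then show "norm (Re (cpd l (P y n i) (cvec u)) - Re (cpd l (P y n i) (cvec w))) \<le> q * ?B * norm (u - w)"
      using abs_Re_le_cmod[of "cpd l (P y n i) (cvec u) - cpd l (P y n i) (cvec w)"] by simp
  qed
  then have "norm (D y l u - D y l w) \<le> q * (q * ?B * norm (u - w))" by (intro norm_vec_le_q) simp
  also have "\<dots> = q * (q * ?B) * norm (u - w)" by simp
  also have "\<dots> \<le> K * norm (u - w)" by (intro mult_right_mono K_bounds Ne) simp
  finally show "norm (D y l u - D y l w) \<le> K * norm (u - w)" .
qed

end

text \<open>\<open>D y l\<close> is the partial derivative of \<open>E y\<close> in the direction \<open>l\<close>. Along the ray through \<open>u\<close>,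
  the radial identity says that \<open>t \<mapsto> E y (t u)\<close> is an integral curve of \<open>\<Sum>\<^sub>j u\<^sub>j S\<^sub>j\<close>.\<close>

definition flow_on :: "real \<Rightarrow> ('p \<Rightarrow> real^'p \<Rightarrow> real^'p \<Rightarrow> real^'p::finite) \<Rightarrow> (real^'p) set \<Rightarrow> real \<Rightarrow> real \<Rightarrow>
    (real^'p \<Rightarrow> real^'p \<Rightarrow> real^'p) \<Rightarrow> (real^'p \<Rightarrow> 'p \<Rightarrow> real^'p \<Rightarrow> real^'p) \<Rightarrow> bool" where
  "flow_on \<alpha> S N \<rho> K E D \<longleftrightarrow> 0 \<le> K \<and> (\<forall>y\<in>N. smooth_on (ball 0 \<rho>) (E y) \<and> E y 0 = y \<and>
     (\<forall>u\<in>ball 0 \<rho>. (E y has_derivative (\<lambda>h. \<Sum>l\<in>UNIV. h $ l *\<^sub>R D y l u)) (at u) \<and>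
        (\<Sum>l\<in>UNIV. u $ l *\<^sub>R D y l u) = (\<Sum>j\<in>UNIV. u $ j *\<^sub>R S j y (E y u)) \<and>
        (\<forall>z\<in>N. norm (E y u - E z u) \<le> K * dist y z powr \<alpha>) \<and>
        (\<forall>z\<in>N. \<forall>l. norm (D y l u - D z l u) \<le> K * dist y z powr \<alpha>) \<and>
        (\<forall>w\<in>ball 0 \<rho>. norm (E y u - E y w) \<le> K * norm (u - w)) \<and>
        (\<forall>w\<in>ball 0 \<rho>. \<forall>l. norm (D y l u - D y l w) \<le> K * norm (u - w))))"

lemma polynomial_flow_exists:
  fixes S :: "'p::finite \<Rightarrow> real^'p \<Rightarrow> real^'p \<Rightarrow> real^'p"
  assumes \<alpha>: "0 < \<alpha>" "\<alpha> \<le> 1" and \<Omega>: "open \<Omega>" "y0 \<in> \<Omega>" and S: "\<And>j. poly_field \<alpha> \<Omega> (S j)"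
  shows "\<exists>\<epsilon>>0. \<exists>\<rho>>0. \<exists>K E D. ball y0 \<epsilon> \<subseteq> \<Omega> \<and> flow_on \<alpha> S (ball y0 \<epsilon>) \<rho> K E D"
proof -
  have "\<forall>j. \<exists>F. \<forall>i. poly_family \<alpha> \<Omega> (F i) \<and> (\<forall>y x. S j y x $ i = Re (F i y (cvec x)))"
    using S unfolding poly_field_def by blast
  from choice[OF this] obtain F where
    F: "\<forall>j i. poly_family \<alpha> \<Omega> (F j i) \<and> (\<forall>y x. S j y x $ i = Re (F j i y (cvec x)))" by blast
  define R where "R = norm y0 + 2"
  have R0: "0 \<le> R" by (simp add: R_def)
  have "\<exists>\<epsilon>>0. \<exists>C. lipschitz_holder_on \<alpha> (\<Omega> \<inter> ball y0 \<epsilon>) R C (F j i)" for j i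
    by (rule poly_family_lipschitz_holder[OF _ \<Omega>(2) \<alpha>(1) R0]) (use F in blast)
  then have "\<forall>t. \<exists>\<epsilon>C. fst \<epsilon>C > 0 \<and> lipschitz_holder_on \<alpha> (\<Omega> \<inter> ball y0 (fst \<epsilon>C)) R (snd \<epsilon>C) (F (fst t) (snd t))"
    by (metis fst_conv snd_conv)
  from choice[OF this] obtain ec where
    ec: "\<forall>t. fst (ec t) > 0 \<and> lipschitz_holder_on \<alpha> (\<Omega> \<inter> ball y0 (fst (ec t))) R (snd (ec t)) (F (fst t) (snd t))" by blast
  obtain d where d: "d > 0" "ball y0 d \<subseteq> \<Omega>" using \<Omega> open_contains_ball by blast
  \<comment> \<open>The radius 1/2 keeps two base points at distance at most 1 and gives
    \<open>norm y + 1 \<le> norm y0 + 2\<close>, which is \<open>R\<close>.\<close>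
  define \<epsilon> where "\<epsilon> = min (min d (1 / 2)) (Min (range (\<lambda>t :: 'p \<times> 'p. fst (ec t))))"
  have \<epsilon>: "\<epsilon> > 0" "\<epsilon> \<le> d" "\<epsilon> \<le> 1 / 2" "\<epsilon> \<le> fst (ec t)" for t
    unfolding \<epsilon>_def using d ec by (auto intro: min.coboundedI2)
  define C where "C = 1 + (\<Sum>t\<in>UNIV. snd (ec t))"
  have ec0: "0 \<le> snd (ec t)" for t using ec[rule_format, of t] unfolding lipschitz_holder_on_def by blast
  have C: "1 \<le> C" "snd (ec t) \<le> C" for t
    unfolding C_def using ec0 member_le_sum[of t UNIV "\<lambda>t. snd (ec t)"] sum_nonneg[of UNIV "\<lambda>t. snd (ec t)"] by auto
  have sub: "ball y0 \<epsilon> \<subseteq> \<Omega>" using d(2) \<epsilon>(2) by (meson subset_ball subset_trans)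
  interpret polynomial_flow \<alpha> \<Omega> S F "ball y0 \<epsilon>" R C "real CARD('p)"
  proof
    show "dist y z \<le> 1" if "y \<in> ball y0 \<epsilon>" "z \<in> ball y0 \<epsilon>" for y z
      using that \<epsilon>(3) dist_triangle_half_r[of y0 y 1 z] by simp
    show "lipschitz_holder_on \<alpha> (ball y0 \<epsilon>) R C (F j i)" for j i
    proof (rule lipschitz_holder_on_mono)
      show "lipschitz_holder_on \<alpha> (\<Omega> \<inter> ball y0 (fst (ec (j, i)))) R (snd (ec (j, i))) (F j i)" using ec[rule_format, of "(j, i)"] by simp
      show "ball y0 \<epsilon> \<subseteq> \<Omega> \<inter> ball y0 (fst (ec (j, i)))" using sub \<epsilon>(4)[of "(j, i)"] by auto
    qed (rule C(2))
    show "norm y + 1 \<le> R" if "y \<in> ball y0 \<epsilon>" for y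
      using that \<epsilon>(3) norm_triangle_sub[of y y0] by (simp add: R_def dist_norm norm_minus_commute)
  qed (use \<alpha> F C in auto)
  have Ne: "ball y0 \<epsilon> \<noteq> {}" using \<epsilon>(1) by simp
  \<comment> \<open>\<open>E_holder\<close> and \<open>E_lipschitz\<close> were obtained on the half
    ball, as Cauchy's estimates need room.\<close>
  have "flow_on \<alpha> S (ball y0 \<epsilon>) (\<rho> / 2) K E D"
    unfolding flow_on_def
  proof (intro conjI ballI allI K_bounds(5)[OF Ne] E_zero)
    fix y assume y: "y \<in> ball y0 \<epsilon>"
    have s: "C_on k (ball 0 (\<rho> / 2)) g" if "C_on k (ball 0 \<rho>) g" for k and g :: "real^'p \<Rightarrow> real^'p"
      using that \<rho>(1) by (induction k arbitrary: g) (auto intro: continuous_on_subset)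
    show "smooth_on (ball 0 (\<rho> / 2)) (E y)" using smooth_E[OF y] s unfolding smooth_on_def by blast
    fix u :: "real^'p" assume u: "u \<in> ball 0 (\<rho> / 2)"
    have u': "norm u < \<rho>" "norm u < \<rho> / 2" using u \<rho>(1) by auto
    show "(E y has_derivative (\<lambda>h. \<Sum>l\<in>UNIV. h $ l *\<^sub>R D y l u)) (at u)" by (rule E_has_derivative[OF y u'(1)])
    show "(\<Sum>l\<in>UNIV. u $ l *\<^sub>R D y l u) = (\<Sum>j\<in>UNIV. u $ j *\<^sub>R S j y (E y u))" by (rule E_radial[OF y u'(1)])
    show "norm (E y u - E z u) \<le> K * dist y z powr \<alpha>" if "z \<in> ball y0 \<epsilon>" for z
      by (rule E_holder(1)[OF y that u'(2)])
    show "norm (D y l u - D z l u) \<le> K * dist y z powr \<alpha>" if "z \<in> ball y0 \<epsilon>" for z l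
      by (rule E_holder(2)[OF y that u'(2)])
    fix w :: "real^'p" assume w: "w \<in> ball 0 (\<rho> / 2)"
    then have w': "norm w < \<rho> / 2" by simp
    show "norm (E y u - E y w) \<le> K * norm (u - w)" by (rule E_lipschitz(1)[OF y u'(2) w'])
    show "norm (D y l u - D y l w) \<le> K * norm (u - w)" for l by (rule E_lipschitz(2)[OF y u'(2) w'])
  qed
  then show ?thesis using \<epsilon>(1) \<rho>(1) sub half_gt_zero by blast
qed

section \<open>Uniqueness of exponentials\<close>

lemma smooth_lipschitz_on_cball:
  fixes Z :: "'a::euclidean_space \<Rightarrow> 'b::real_normed_vector"
  assumes "smooth_on UNIV Z"
  shows "\<exists>L\<ge>0. \<forall>x\<in>cball 0 M. \<forall>y\<in>cball 0 M. norm (Z x - Z y) \<le> L * norm (x - y)"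
proof -
  have Z1: "C_on (Suc 0) UNIV Z" using assms unfolding smooth_on_def by blast
  have "\<exists>c. \<forall>x\<in>cball 0 M. norm (frechet_derivative Z (at x) b) \<le> c" if "b \<in> Basis" for b
  proof -
    have "continuous_on (cball 0 M) (\<lambda>x. frechet_derivative Z (at x) b)"
      using Z1 that continuous_on_subset by fastforce
    then have "bounded ((\<lambda>x. frechet_derivative Z (at x) b) ` cball 0 M)"
      by (intro compact_imp_bounded compact_continuous_image compact_cball)
    then show ?thesis unfolding bounded_iff by auto
  qed
  then obtain c where c: "\<And>b x. b \<in> Basis \<Longrightarrow> x \<in> cball 0 M \<Longrightarrow> norm (frechet_derivative Z (at x) b) \<le> c b"
    by metis
  define L where "L = (\<Sum>b\<in>Basis. \<bar>c b\<bar>)"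
  have L: "norm (frechet_derivative Z (at x) b) \<le> L" if "b \<in> Basis" "x \<in> cball 0 M" for b x
    using c[OF that] member_le_sum[of b Basis "\<lambda>b. \<bar>c b\<bar>"] that(1) unfolding L_def by force
  have "norm (Z x - Z y) \<le> real DIM('a) * L * norm (x - y)" if "x \<in> cball 0 M" "y \<in> cball 0 M" for x y
    by (rule lipschitz_from_partials[OF convex_cball[of 0 M] _ _ that]) (use Z1 L in auto)
  moreover have "0 \<le> real DIM('a) * L" by (simp add: L_def sum_nonneg)
  ultimately show ?thesis by blast
qed

text \<open>Gronwall's argument: with \<open>L\<close> a Lipschitz constant of \<open>Z\<close> on a
  ball containing both compact curves, exp(-2Lt) times their squared distance is nonincreasing, and
  it starts at 0.\<close>

lemma is_exp_unique:
  fixes Z :: "'a::euclidean_space \<Rightarrow> 'a"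
  assumes "smooth_on UNIV Z" "is_exp Z y z" "is_exp Z y z'"
  shows "z = z'"
proof -
  obtain \<phi> where \<phi>: "\<phi> 0 = y" "\<phi> 1 = z"
    "\<And>t. t \<in> {0..1} \<Longrightarrow> (\<phi> has_vector_derivative Z (\<phi> t)) (at t within {0..1})"
    using assms(2) unfolding is_exp_def by blast
  obtain \<psi> where \<psi>: "\<psi> 0 = y" "\<psi> 1 = z'"
    "\<And>t. t \<in> {0..1} \<Longrightarrow> (\<psi> has_vector_derivative Z (\<psi> t)) (at t within {0..1})"
    using assms(3) unfolding is_exp_def by blast
  have cont: "continuous_on {0..1} \<phi>" "continuous_on {0..1} \<psi>"
    using \<phi>(3) \<psi>(3) by (meson continuous_on_eq_continuous_within has_vector_derivative_continuous)+
  have "bounded (\<phi> ` {0..1} \<union> \<psi> ` {0..1})"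
    using cont by (intro bounded_Un[THEN iffD2] conjI compact_imp_bounded compact_continuous_image compact_Icc)
  then obtain M where M: "\<And>t. t \<in> {0..1} \<Longrightarrow> norm (\<phi> t) \<le> M \<and> norm (\<psi> t) \<le> M"
    unfolding bounded_iff by blast
  obtain L where L: "L \<ge> 0" "\<forall>x\<in>cball 0 M. \<forall>y\<in>cball 0 M. norm (Z x - Z y) \<le> L * norm (x - y)"
    using smooth_lipschitz_on_cball[OF assms(1)] by blast
  define g where "g t = (\<phi> t - \<psi> t) \<bullet> (\<phi> t - \<psi> t)" for t
  define h where "h t = exp (- (2 * L) * t) * g t" for t
  have "h 1 \<le> h 0"
  proof (rule DERIV_nonpos_imp_decreasing_open[of 0 1])
    show "continuous_on {0..1} h" unfolding h_def g_def by (intro continuous_intros cont)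
    fix t :: real assume t: "0 < t" "t < 1"
    have at: "at t within {0..1} = at t" using t by (intro at_within_interior) simp
    have d: "(\<phi> has_vector_derivative Z (\<phi> t)) (at t)" "(\<psi> has_vector_derivative Z (\<psi> t)) (at t)"
      using \<phi>(3)[of t] \<psi>(3)[of t] t unfolding at by auto
    have dd: "((\<lambda>t. \<phi> t - \<psi> t) has_derivative (\<lambda>s. s *\<^sub>R (Z (\<phi> t) - Z (\<psi> t)))) (at t)"
      using has_vector_derivative_diff[OF d] unfolding has_vector_derivative_def .
    have "(g has_derivative (\<lambda>s. (\<phi> t - \<psi> t) \<bullet> (s *\<^sub>R (Z (\<phi> t) - Z (\<psi> t))) + (s *\<^sub>R (Z (\<phi> t) - Z (\<psi> t))) \<bullet> (\<phi> t - \<psi> t))) (at t)"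
      unfolding g_def by (rule has_derivative_inner[OF dd dd])
    then have g': "(g has_real_derivative 2 * ((Z (\<phi> t) - Z (\<psi> t)) \<bullet> (\<phi> t - \<psi> t))) (at t)"
      unfolding has_field_derivative_def
      by (rule has_derivative_eq_rhs) (auto simp: inner_commute algebra_simps)
    have "(h has_real_derivative exp (- (2 * L) * t) * (2 * ((Z (\<phi> t) - Z (\<psi> t)) \<bullet> (\<phi> t - \<psi> t)) - 2 * L * g t)) (at t)"
      unfolding h_def by (auto intro!: derivative_eq_intros g' simp: algebra_simps)
    moreover have "2 * ((Z (\<phi> t) - Z (\<psi> t)) \<bullet> (\<phi> t - \<psi> t)) - 2 * L * g t \<le> 0"
    proof -
      have "(Z (\<phi> t) - Z (\<psi> t)) \<bullet> (\<phi> t - \<psi> t) \<le> norm (Z (\<phi> t) - Z (\<psi> t)) * norm (\<phi> t - \<psi> t)"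
        by (rule norm_cauchy_schwarz)
      also have "\<dots> \<le> L * norm (\<phi> t - \<psi> t) * norm (\<phi> t - \<psi> t)"
        using L(2) M[of t] t by (intro mult_right_mono) auto
      also have "\<dots> = L * g t" by (simp add: g_def dot_square_norm power2_eq_square)
      finally show ?thesis by simp
    qed
    ultimately show "\<exists>y. (h has_real_derivative y) (at t) \<and> y \<le> 0"
      by (intro exI[of _ "exp (- (2 * L) * t) * (2 * ((Z (\<phi> t) - Z (\<psi> t)) \<bullet> (\<phi> t - \<psi> t)) - 2 * L * g t)"] conjI mult_nonneg_nonpos) simp_all
  qed simp
  then have "g 1 \<le> 0" using \<phi>(1) \<psi>(1) by (simp add: h_def g_def mult_le_0_iff)
  then have "(\<phi> 1 - \<psi> 1) \<bullet> (\<phi> 1 - \<psi> 1) = 0" unfolding g_def by (rule antisym) (rule inner_ge_zero)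
  then have "\<phi> 1 = \<psi> 1" by simp
  then show ?thesis using \<phi>(2) \<psi>(2) by simp
qed

lemma vf_exp_eq: "smooth_on UNIV Z \<Longrightarrow> is_exp Z y z \<Longrightarrow> vf_exp Z y = z"
  for Z :: "'a::euclidean_space \<Rightarrow> 'a"
  unfolding vf_exp_def using is_exp_unique by blast

lemma flow_onD:
  assumes "flow_on \<alpha> S N \<rho> K E D" "y \<in> N"
  shows "smooth_on (ball 0 \<rho>) (E y)" "E y 0 = y"
    "norm u < \<rho> \<Longrightarrow> (E y has_derivative (\<lambda>h. \<Sum>l\<in>UNIV. h $ l *\<^sub>R D y l u)) (at u)"
    "norm u < \<rho> \<Longrightarrow> (\<Sum>l\<in>UNIV. u $ l *\<^sub>R D y l u) = (\<Sum>j\<in>UNIV. u $ j *\<^sub>R S j y (E y u))"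
    "norm u < \<rho> \<Longrightarrow> z \<in> N \<Longrightarrow> norm (E y u - E z u) \<le> K * dist y z powr \<alpha>"
    "norm u < \<rho> \<Longrightarrow> z \<in> N \<Longrightarrow> norm (D y l u - D z l u) \<le> K * dist y z powr \<alpha>"
    "norm u < \<rho> \<Longrightarrow> norm w < \<rho> \<Longrightarrow> norm (E y u - E y w) \<le> K * norm (u - w)"
    "norm u < \<rho> \<Longrightarrow> norm w < \<rho> \<Longrightarrow> norm (D y l u - D y l w) \<le> K * norm (u - w)"
    "0 \<le> K"
  using assms unfolding flow_on_def by simp_all

text \<open>For t > 0 the radial identity at \<open>t *\<^sub>R u\<close> may be divided by t and
  says that t \<mapsto> \<open>E y (t *\<^sub>R u)\<close> solves the equation. At t = 0 there is
  nothing to divide; both sides are continued along t = 1/(n+1), which at the same time gives the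
  derivative of \<open>E y\<close> at the origin.\<close>

lemma flow_is_exp:
  fixes S :: "'p::finite \<Rightarrow> real^'p \<Rightarrow> real^'p \<Rightarrow> real^'p"
  assumes flow: "flow_on \<alpha> S N \<rho> K E D" and y: "y \<in> N" and u: "norm u < \<rho>" and S: "\<And>j. smooth_on UNIV (S j y)"
  shows "is_exp (\<lambda>x. \<Sum>j\<in>UNIV. u $ j *\<^sub>R S j y x) y (E y u)"
    and "(\<Sum>l\<in>UNIV. u $ l *\<^sub>R D y l 0) = (\<Sum>j\<in>UNIV. u $ j *\<^sub>R S j y y)"
proof -
  have tu: "norm (t *\<^sub>R u) < \<rho>" if "t \<in> {0..1}" for t
    using that u mult_left_le_one_le[of "norm u" t] by auto
  have pos: "(\<Sum>l\<in>UNIV. u $ l *\<^sub>R D y l (t *\<^sub>R u)) = (\<Sum>j\<in>UNIV. u $ j *\<^sub>R S j y (E y (t *\<^sub>R u)))" if "t \<in> {0<..1}" for t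
  proof -
    have "t *\<^sub>R (\<Sum>l\<in>UNIV. u $ l *\<^sub>R D y l (t *\<^sub>R u)) = t *\<^sub>R (\<Sum>j\<in>UNIV. u $ j *\<^sub>R S j y (E y (t *\<^sub>R u)))"
      using flow_onD(4)[OF flow y tu[of t]] that by (simp add: scaleR_sum_right)
    then show ?thesis using that by simp
  qed
  let ?t = "\<lambda>n. inverse (real (Suc n))"
  have t0: "(\<lambda>n. ?t n *\<^sub>R u) \<longlonglongrightarrow> 0"
    using tendsto_scaleR[OF LIMSEQ_inverse_real_of_nat tendsto_const[of u]] by simp
  have D0: "(\<lambda>n. D y l (?t n *\<^sub>R u)) \<longlonglongrightarrow> D y l 0" for l
  proof (rule Lim_transform_bound[where g = "\<lambda>n. K * norm (?t n *\<^sub>R u)", THEN Lim_null[THEN iffD2]])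
    have "norm (D y l (?t n *\<^sub>R u) - D y l 0) \<le> K * norm (?t n *\<^sub>R u - 0)" for n
    proof (rule flow_onD(8)[OF flow y])
      show "norm (?t n *\<^sub>R u) < \<rho>" by (rule tu) (auto simp: field_simps)
      show "norm (0 :: real^'p) < \<rho>" using le_less_trans[OF norm_ge_zero u] by simp
    qed
    then have "norm (D y l (?t n *\<^sub>R u) - D y l 0) \<le> norm (K * norm (?t n *\<^sub>R u))" for n
      using flow_onD(9)[OF flow y] by (simp add: abs_mult)
    then show "\<forall>\<^sub>F n in sequentially. norm (D y l (?t n *\<^sub>R u) - D y l 0) \<le> norm (K * norm (?t n *\<^sub>R u))"
      by simp
    show "(\<lambda>n. K * norm (?t n *\<^sub>R u)) \<longlonglongrightarrow> 0"
      using tendsto_mult[OF tendsto_const tendsto_norm[OF t0], of K] by simp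
  qed
  have E0: "isCont (E y) 0" using flow_onD(3)[OF flow y, of 0] le_less_trans[OF norm_ge_zero u] has_derivative_continuous by auto
  have Sc: "isCont (S j y) x" for j x
    using smooth_on_differentiable[OF S UNIV_I] differentiable_imp_continuous_within by blast
  show zero: "(\<Sum>l\<in>UNIV. u $ l *\<^sub>R D y l 0) = (\<Sum>j\<in>UNIV. u $ j *\<^sub>R S j y y)"
  proof (rule LIMSEQ_unique)
    show "(\<lambda>n. \<Sum>l\<in>UNIV. u $ l *\<^sub>R D y l (?t n *\<^sub>R u)) \<longlonglongrightarrow> (\<Sum>l\<in>UNIV. u $ l *\<^sub>R D y l 0)"
      by (intro tendsto_intros D0)
    have "(\<lambda>n. S j y (E y (?t n *\<^sub>R u))) \<longlonglongrightarrow> S j y y" for j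
    proof (rule isCont_tendsto_compose[OF Sc])
      show "(\<lambda>n. E y (?t n *\<^sub>R u)) \<longlonglongrightarrow> y"
        using isCont_tendsto_compose[OF E0 t0] flow_onD(2)[OF flow y] by simp
    qed
    then have "(\<lambda>n. \<Sum>j\<in>UNIV. u $ j *\<^sub>R S j y (E y (?t n *\<^sub>R u))) \<longlonglongrightarrow> (\<Sum>j\<in>UNIV. u $ j *\<^sub>R S j y y)"
      by (intro tendsto_intros)
    moreover have "?t n \<in> {0<..1}" for n by (simp add: inverse_le_1_iff)
    ultimately show "(\<lambda>n. \<Sum>l\<in>UNIV. u $ l *\<^sub>R D y l (?t n *\<^sub>R u)) \<longlonglongrightarrow> (\<Sum>j\<in>UNIV. u $ j *\<^sub>R S j y y)"
      by (simp only: pos)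
  qed
  show "is_exp (\<lambda>x. \<Sum>j\<in>UNIV. u $ j *\<^sub>R S j y x) y (E y u)"
    unfolding is_exp_def
  proof (intro exI[of _ "\<lambda>t. E y (t *\<^sub>R u)"] conjI ballI)
    fix t :: real assume t: "t \<in> {0..1}"
    have "((\<lambda>t. t *\<^sub>R u) has_derivative (\<lambda>s. s *\<^sub>R u)) (at t)" by (auto intro!: derivative_eq_intros)
    from has_derivative_compose[OF this flow_onD(3)[OF flow y tu[OF t]]]
    have "((\<lambda>t. E y (t *\<^sub>R u)) has_vector_derivative (\<Sum>l\<in>UNIV. u $ l *\<^sub>R D y l (t *\<^sub>R u))) (at t)"
      unfolding has_vector_derivative_def by (simp add: scaleR_sum_right)
    moreover have "(\<Sum>l\<in>UNIV. u $ l *\<^sub>R D y l (t *\<^sub>R u)) = (\<Sum>j\<in>UNIV. u $ j *\<^sub>R S j y (E y (t *\<^sub>R u)))"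
      using pos[of t] zero t flow_onD(2)[OF flow y] by (cases "t = 0") auto
    ultimately show "((\<lambda>t. E y (t *\<^sub>R u)) has_vector_derivative (\<Sum>j\<in>UNIV. u $ j *\<^sub>R S j y (E y (t *\<^sub>R u)))) (at t within {0..1})"
      by (simp add: has_vector_derivative_at_within)
  qed (simp_all add: flow_onD(2)[OF flow y])
qed

section \<open>Inverse matrices\<close>

lemma matrix_inv_mult:
  fixes A :: "real^'p::finite^'p"
  assumes "det A \<noteq> 0"
  shows "A ** matrix_inv A = mat 1" "matrix_inv A ** A = mat 1"
proof -
  have "\<exists>A'. A ** A' = mat 1 \<and> A' ** A = mat 1"
    using assms invertible_det_nz invertible_def by blast
  from someI_ex[OF this] show "A ** matrix_inv A = mat 1" "matrix_inv A ** A = mat 1"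
    unfolding matrix_inv_def by auto
qed

text \<open>Cramer's rule for the unit vectors: the entries of the inverse are rational in those of
  \<open>A\<close>, hence as smooth as they are.\<close>

lemma matrix_inv_entry:
  fixes A :: "real^'p::finite^'p"
  assumes "det A \<noteq> 0"
  shows "matrix_inv A $ k $ i = det (\<chi> a b. if b = k then axis i 1 $ a else A $ a $ b) / det A"
proof -
  have "A *v (matrix_inv A *v axis i 1) = axis i 1"
    by (simp add: matrix_vector_mul_assoc matrix_inv_mult[OF assms])
  then have "matrix_inv A *v axis i 1 = (\<chi> k. det (\<chi> a b. if b = k then axis i 1 $ a else A $ a $ b) / det A)"
    using cramer[OF assms] by blast
  then have "(matrix_inv A *v axis i 1) $ k = det (\<chi> a b. if b = k then axis i 1 $ a else A $ a $ b) / det A"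
    by simp
  then show ?thesis by (simp add: matrix_vector_mult_basis column_def)
qed

lemma smooth_det:
  fixes A :: "'a::euclidean_space \<Rightarrow> real^'p::finite^'p"
  assumes "open S" "\<And>i j. smooth_on S (\<lambda>x. A x $ i $ j)"
  shows "smooth_on S (\<lambda>x. det (A x))"
  unfolding det_def by (intro smooth_on_sum smooth_on_mult smooth_on_const smooth_on_prod assms)

lemma smooth_matrix_inv:
  fixes A :: "'a::euclidean_space \<Rightarrow> real^'p::finite^'p"
  assumes S: "open S" and A: "\<And>i j. smooth_on S (\<lambda>x. A x $ i $ j)" and nz: "\<And>x. x \<in> S \<Longrightarrow> det (A x) \<noteq> 0"
  shows "smooth_on S (\<lambda>x. matrix_inv (A x) $ k $ i)"
proof (rule smooth_on_cong[OF S])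
  have entry: "smooth_on S (\<lambda>x. (\<chi> a b. if b = k then axis i 1 $ a else A x $ a $ b) $ c $ d)" for c d
    using smooth_on_const[OF S] A by (cases "d = k") simp_all
  show "smooth_on S (\<lambda>x. det (\<chi> a b. if b = k then axis i 1 $ a else A x $ a $ b) * inverse (det (A x)))"
    by (intro smooth_on_mult smooth_on_recip smooth_det S A entry nz)
  show "det (\<chi> a b. if b = k then axis i 1 $ a else A x $ a $ b) * inverse (det (A x)) = matrix_inv (A x) $ k $ i"
    if "x \<in> S" for x
    using matrix_inv_entry[OF nz[OF that]] by (simp add: divide_inverse)
qed

definition frame_matrix :: "('p \<Rightarrow> 'a \<Rightarrow> real^'p) \<Rightarrow> 'a \<Rightarrow> real^'p^'p::finite" where
  "frame_matrix S x = (\<chi> i j. S j x $ i)"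

lemma frame_matrix_vec: "frame_matrix S x *v c = (\<Sum>j\<in>UNIV. c $ j *\<^sub>R S j x)"
  by (simp add: frame_matrix_def matrix_vector_mult_def vec_eq_iff mult_ac)

lemma frame_coefficients_unique:
  assumes "det (frame_matrix S x) \<noteq> 0" "(\<Sum>j\<in>UNIV. a j *\<^sub>R S j x) = (\<Sum>j\<in>UNIV. b j *\<^sub>R S j x)"
  shows "a k = b k"
proof -
  have "invertible (frame_matrix S x)" using assms(1) invertible_det_nz by blast
  then have "inj ((*v) (frame_matrix S x))" by (simp add: inj_matrix_vector_mult)
  moreover have "frame_matrix S x *v (\<chi> j. a j) = frame_matrix S x *v (\<chi> j. b j)"
    unfolding frame_matrix_vec using assms(2) by simp
  ultimately have "(\<chi> j. a j) = (\<chi> j. b j)" by (rule injD)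
  then show ?thesis by (simp add: vec_eq_iff)
qed

section \<open>The transport equation of a frame in canonical coordinates\<close>

lemma second_derivative_symmetric_cong:
  fixes f :: "real^'p::finite \<Rightarrow> real"
  assumes "open T" "x \<in> T" "smooth_on T f"
    and g: "\<And>m z. z \<in> T \<Longrightarrow> g m z = pd m f z"
  shows "pd l (g m) x = pd m (g l) x"
proof -
  have "pd l (g m) x = pd l (pd m f) x" for l m
    using frechet_derivative_cong[OF assms(1,2), of "g m" "\<lambda>z. pd m f z"] g by simp
  then show ?thesis
    using second_derivative_symmetric[OF assms(1,2), of f "axis m 1" "axis l 1"] assms(3)
    by (simp add: smooth_on_def)
qed

text \<open>An abstract frame, as two instances are compared: the exponential of the approximating
  fields, and the group, where the canonical coordinates are \<open>u\<close> itself,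
  \<open>E\<close> is the identity and \<open>D\<close> consists of the unit vectors.\<close>

locale canonical_frame =
  fixes \<rho> :: real and E :: "real^'p::finite \<Rightarrow> real^'p" and D S :: "'p \<Rightarrow> real^'p \<Rightarrow> real^'p"
  assumes smooth_E: "smooth_on (ball 0 \<rho>) E"
    and dE: "\<And>u. norm u < \<rho> \<Longrightarrow> (E has_derivative (\<lambda>h. \<Sum>l\<in>UNIV. h $ l *\<^sub>R D l u)) (at u)"
    and radial: "\<And>u. norm u < \<rho> \<Longrightarrow> (\<Sum>l\<in>UNIV. u $ l *\<^sub>R D l u) = (\<Sum>j\<in>UNIV. u $ j *\<^sub>R S j (E u))"
    and smooth_S: "\<And>j. smooth_on UNIV (S j)"
    and frame: "\<And>u. norm u < \<rho> \<Longrightarrow> det (frame_matrix S (E u)) \<noteq> 0"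
begin

lemma D_eq_pd: "norm u < \<rho> \<Longrightarrow> D l u $ i = pd l (\<lambda>u. E u $ i) u"
proof -
  assume u: "norm u < \<rho>"
  have diff: "E differentiable (at u)" using dE[OF u] differentiable_def by blast
  have "pd l (\<lambda>u. E u $ i) u = (\<Sum>m\<in>UNIV. axis l 1 $ m *\<^sub>R D m u) $ i"
    unfolding differentiable_nth(2)[OF diff] frechet_derivative_unique[OF dE[OF u]] ..
  also have "(\<Sum>m\<in>UNIV. axis l 1 $ m *\<^sub>R D m u) = (\<Sum>m\<in>UNIV. if m = l then D m u else 0)"
    by (intro sum.cong) (auto simp: axis_def)
  finally show ?thesis by simp
qed

lemma smooth_E_nth: "smooth_on (ball 0 \<rho>) (\<lambda>u. E u $ i)"
  using smooth_E smooth_on_vec[OF open_ball] by blast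

lemma smooth_D: "smooth_on (ball 0 \<rho>) (\<lambda>u. D l u $ i)"
  by (rule smooth_on_cong[OF open_ball smooth_on_frechet_derivative[OF open_ball smooth_E_nth]])
    (simp add: D_eq_pd)

lemma smooth_S_E: "smooth_on (ball 0 \<rho>) (\<lambda>u. frame_matrix S (E u) $ i $ j)"
proof -
  have "smooth_on UNIV (\<lambda>x. S j x $ i)" using smooth_S smooth_on_vec[OF open_UNIV] by blast
  from smooth_on_compose[OF open_UNIV open_ball UNIV_I this smooth_E]
  show ?thesis by (simp add: frame_matrix_def)
qed

text \<open>\<open>M u\<close> expresses the coordinate fields in terms of the frame \<open>S\<close>; the idea of the transport equation is
  that, by symmetry of second derivatives, brackets of the frame are the only input.\<close>

definition "M u = matrix_inv (frame_matrix S (E u)) ** frame_matrix D u"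

lemma smooth_frame_inv: "smooth_on (ball 0 \<rho>) (\<lambda>u. matrix_inv (frame_matrix S (E u)) $ k $ i)"
  by (rule smooth_matrix_inv[OF open_ball smooth_S_E frame]) simp

lemma smooth_M: "smooth_on (ball 0 \<rho>) (\<lambda>u. M u $ k $ l)"
proof -
  have "smooth_on (ball 0 \<rho>) (\<lambda>u. \<Sum>i\<in>UNIV. matrix_inv (frame_matrix S (E u)) $ k $ i * D l u $ i)"
    by (intro smooth_on_sum smooth_on_mult smooth_frame_inv smooth_D open_ball)
  then show ?thesis by (simp add: M_def matrix_matrix_mult_def frame_matrix_def)
qed

lemma S_M: "norm u < \<rho> \<Longrightarrow> frame_matrix S (E u) ** M u = frame_matrix D u"
  by (simp add: M_def matrix_mul_assoc matrix_inv_mult[OF frame])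

lemma D_expand: "norm u < \<rho> \<Longrightarrow> D l u = (\<Sum>k\<in>UNIV. M u $ k $ l *\<^sub>R S k (E u))"
proof -
  assume "norm u < \<rho>"
  from S_M[OF this] have "frame_matrix D u $ i $ l = (frame_matrix S (E u) ** M u) $ i $ l" for i by simp
  then show ?thesis
    by (simp add: frame_matrix_def matrix_matrix_mult_def vec_eq_iff mult_ac)
qed

lemma D_differentiable: "norm u < \<rho> \<Longrightarrow> D l differentiable (at u)"
  by (rule differentiable_vecI) (rule smooth_on_differentiable[OF smooth_D], simp)

lemma S_differentiable: "S j differentiable (at x)"
  by (rule smooth_on_differentiable[OF smooth_S UNIV_I])

text \<open>The radial identity differentiated in direction \<open>l\<close>. By symmetry of second
  derivatives, the derivatives of all \<open>D m\<close> in direction \<open>l\<close> combine to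
  the derivative of \<open>D l\<close> along \<open>w\<close>.\<close>

lemma radial_derivative:
  assumes w: "norm w < \<rho>"
  shows "D l w + frechet_derivative (D l) (at w) w =
    S l (E w) + (\<Sum>j\<in>UNIV. w $ j *\<^sub>R frechet_derivative (S j) (at (E w)) (D l w))"
proof -
  have ax: "(\<Sum>m\<in>UNIV. axis l (1::real) $ m *\<^sub>R a m) = a l" for a :: "'p \<Rightarrow> real^'p"
  proof -
    have "(\<Sum>m\<in>UNIV. axis l (1::real) $ m *\<^sub>R a m) = (\<Sum>m\<in>UNIV. if m = l then a m else 0)"
      by (intro sum.cong) (auto simp: axis_def)
    then show ?thesis by simp
  qed
  have 1: "((\<lambda>u. \<Sum>m\<in>UNIV. u $ m *\<^sub>R D m u) has_derivative
      (\<lambda>h. \<Sum>m\<in>UNIV. w $ m *\<^sub>R frechet_derivative (D m) (at w) h + h $ m *\<^sub>R D m w)) (at w)"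
    by (intro has_derivative_sum has_derivative_scaleR has_derivative_vec_nth
        frechet_derivative_has_derivative D_differentiable w)
  have 2: "((\<lambda>u. \<Sum>j\<in>UNIV. u $ j *\<^sub>R S j (E u)) has_derivative
      (\<lambda>h. \<Sum>j\<in>UNIV. w $ j *\<^sub>R frechet_derivative (S j) (at (E w)) (\<Sum>m\<in>UNIV. h $ m *\<^sub>R D m w) + h $ j *\<^sub>R S j (E w))) (at w)"
    by (intro has_derivative_sum has_derivative_scaleR has_derivative_vec_nth
        has_derivative_compose[OF dE[OF w] frechet_derivative_has_derivative[OF S_differentiable]])
  have "((\<lambda>u. \<Sum>m\<in>UNIV. u $ m *\<^sub>R D m u) has_derivative
      (\<lambda>h. \<Sum>j\<in>UNIV. w $ j *\<^sub>R frechet_derivative (S j) (at (E w)) (\<Sum>m\<in>UNIV. h $ m *\<^sub>R D m w) + h $ j *\<^sub>R S j (E w))) (at w)"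
    by (rule has_derivative_transform_within_open[OF 2 open_ball[of 0 \<rho>]]) (use w radial in auto)
  from has_derivative_unique[OF 1 this, THEN fun_cong, of "axis l 1"]
  have eq: "(\<Sum>m\<in>UNIV. w $ m *\<^sub>R frechet_derivative (D m) (at w) (axis l 1)) + D l w =
     (\<Sum>j\<in>UNIV. w $ j *\<^sub>R frechet_derivative (S j) (at (E w)) (D l w)) + S l (E w)"
    by (simp only: sum.distrib ax)
  have "frechet_derivative (D m) (at w) (axis l 1) $ i = frechet_derivative (D l) (at w) (axis m 1) $ i" for m i
    using second_derivative_symmetric_cong[OF open_ball _ smooth_E_nth, of w "\<lambda>m u. D m u $ i" i l m] D_eq_pd w
    by (simp add: differentiable_nth(2)[OF D_differentiable[OF w]])
  then have "frechet_derivative (D m) (at w) (axis l 1) = frechet_derivative (D l) (at w) (axis m 1)" for m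
    by (simp add: vec_eq_iff)
  then have "(\<Sum>m\<in>UNIV. w $ m *\<^sub>R frechet_derivative (D m) (at w) (axis l 1)) = frechet_derivative (D l) (at w) w"
    using frechet_derivative_vec_sum[OF D_differentiable[OF w], of l w] by simp
  then show ?thesis using eq by (simp add: add.commute)
qed

text \<open>The vector t D_l(t u), expanded in the frame by \<open>D_expand\<close>, is
  differentiated along the ray in two ways: termwise, and by \<open>radial_derivative\<close>.
  Derivatives of frame fields pair up to brackets, and comparing coefficients in the frame leaves a
  linear system for \<open>M\<close> alone. The factor t removes the singularity of the radial
  equation at the origin.\<close>

lemma transport_equation:
  assumes u: "norm u < \<rho>" and t: "0 < t" "t < 1"
    and \<gamma>: "\<And>i j. lie_bracket (S i) (S j) (E (t *\<^sub>R u)) = (\<Sum>k\<in>UNIV. \<gamma> i j k *\<^sub>R S k (E (t *\<^sub>R u)))"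
  shows "((\<lambda>t. t * M (t *\<^sub>R u) $ k $ l) has_real_derivative
    ((if k = l then 1 else 0) - (\<Sum>j\<in>UNIV. (\<Sum>i\<in>UNIV. u $ i * \<gamma> i j k) * (t * M (t *\<^sub>R u) $ j $ l)))) (at t)"
proof -
  define w where "w = t *\<^sub>R u"
  have w: "norm w < \<rho>" using u t mult_left_le_one_le[of "norm u" t] by (simp add: w_def)
  let ?DS = "\<lambda>j. frechet_derivative (S j) (at (E w))"
  let ?V = "\<Sum>j\<in>UNIV. u $ j *\<^sub>R S j (E w)"
  define m where "m k s = s * M (s *\<^sub>R u) $ k $ l" for k s
  have ray: "((\<lambda>s. s *\<^sub>R u) has_derivative (\<lambda>s. s *\<^sub>R u)) (at t)" by (auto intro!: derivative_eq_intros)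
  have "\<exists>m'. (m k has_real_derivative m') (at t)" for k
  proof -
    have "(\<lambda>v. M v $ k $ l) differentiable (at w)" by (rule smooth_on_differentiable[OF smooth_M]) (simp add: w)
    from has_derivative_compose[OF ray frechet_derivative_has_derivative[OF this[unfolded w_def]]]
    have "(\<lambda>s. M (s *\<^sub>R u) $ k $ l) differentiable (at t)" unfolding differentiable_def by blast
    then have "m k differentiable (at t)" unfolding m_def by (intro differentiable_mult differentiable_ident)
    then show ?thesis using real_differentiableE by blast
  qed
  then obtain m' where m': "\<And>k. (m k has_real_derivative m' k) (at t)" by metis
  have lin: "linear (?DS j)" for j by (rule linear_frechet_derivative[OF S_differentiable])
  have V: "(\<Sum>m\<in>UNIV. u $ m *\<^sub>R D m w) = ?V"
  proof -
    have "t *\<^sub>R (\<Sum>m\<in>UNIV. u $ m *\<^sub>R D m w) = t *\<^sub>R ?V"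
      using radial[OF w] by (simp add: w_def scaleR_sum_right)
    then show ?thesis using t by simp
  qed
  have dE': "((\<lambda>s. E (s *\<^sub>R u)) has_derivative (\<lambda>s. s *\<^sub>R ?V)) (at t)"
  proof -
    have "(\<Sum>m\<in>UNIV. (s *\<^sub>R u) $ m *\<^sub>R D m w) = s *\<^sub>R ?V" for s
      unfolding V[symmetric] by (simp add: scaleR_sum_right)
    then show ?thesis
      using has_derivative_compose[OF ray dE[OF w, unfolded w_def]] by (simp only: w_def[symmetric])
  qed
  have dS: "((\<lambda>s. S k (E (s *\<^sub>R u))) has_derivative (\<lambda>s. s *\<^sub>R ?DS k ?V)) (at t)" for k
    using has_derivative_compose[OF dE' frechet_derivative_has_derivative[OF S_differentiable], of k]
    by (simp add: linear_scale[OF lin] flip: w_def)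
  have b: "((\<lambda>s. \<Sum>k\<in>UNIV. m k s *\<^sub>R S k (E (s *\<^sub>R u))) has_derivative
      (\<lambda>s. \<Sum>k\<in>UNIV. m k t *\<^sub>R (s *\<^sub>R ?DS k ?V) + (m' k * s) *\<^sub>R S k (E w))) (at t)"
    unfolding w_def by (intro has_derivative_sum has_derivative_scaleR dS[unfolded w_def] m'[unfolded has_field_derivative_def])
  have a: "((\<lambda>s. s *\<^sub>R D l (s *\<^sub>R u)) has_derivative (\<lambda>s. t *\<^sub>R frechet_derivative (D l) (at w) (s *\<^sub>R u) + s *\<^sub>R D l w)) (at t)"
    unfolding w_def
    by (intro has_derivative_scaleR has_derivative_ident
        has_derivative_compose[OF ray frechet_derivative_has_derivative[OF D_differentiable[OF w, unfolded w_def]]])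
  have mS: "s *\<^sub>R D l (s *\<^sub>R u) = (\<Sum>k\<in>UNIV. m k s *\<^sub>R S k (E (s *\<^sub>R u)))" if "norm (s *\<^sub>R u) < \<rho>" for s
    using D_expand[OF that, of l] by (simp add: m_def scaleR_sum_right)
  have op: "open ((\<lambda>s. s *\<^sub>R u) -` ball 0 \<rho>)"
    by (intro open_vimage open_ball continuous_intros)
  have "((\<lambda>s. \<Sum>k\<in>UNIV. m k s *\<^sub>R S k (E (s *\<^sub>R u))) has_derivative (\<lambda>s. t *\<^sub>R frechet_derivative (D l) (at w) (s *\<^sub>R u) + s *\<^sub>R D l w)) (at t)"
    by (rule has_derivative_transform_within_open[OF a op]) (use w mS in \<open>auto simp: w_def\<close>)
  from has_derivative_unique[OF b this, THEN fun_cong, of 1]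
  have eq1: "(\<Sum>k\<in>UNIV. m k t *\<^sub>R ?DS k ?V) + (\<Sum>k\<in>UNIV. m' k *\<^sub>R S k (E w)) = frechet_derivative (D l) (at w) w + D l w"
    using linear_scale[OF linear_frechet_derivative[OF D_differentiable[OF w, of l]], of t u]
    by (simp add: sum.distrib w_def)
  have tD: "t *\<^sub>R D l w = (\<Sum>k\<in>UNIV. m k t *\<^sub>R S k (E w))" using mS[of t] w by (simp add: w_def)
  have eq2: "frechet_derivative (D l) (at w) w + D l w = S l (E w) + (\<Sum>j\<in>UNIV. \<Sum>k\<in>UNIV. (u $ j * m k t) *\<^sub>R ?DS j (S k (E w)))"
  proof -
    have "w $ j *\<^sub>R ?DS j (D l w) = (\<Sum>k\<in>UNIV. (u $ j * m k t) *\<^sub>R ?DS j (S k (E w)))" for j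
    proof -
      have "w $ j *\<^sub>R ?DS j (D l w) = u $ j *\<^sub>R ?DS j (t *\<^sub>R D l w)"
        unfolding linear_scale[OF lin] by (simp add: w_def mult.commute)
      also have "\<dots> = (\<Sum>k\<in>UNIV. (u $ j * m k t) *\<^sub>R ?DS j (S k (E w)))"
        unfolding tD by (simp add: linear_sum[OF lin] linear_scale[OF lin] scaleR_sum_right)
      finally show ?thesis .
    qed
    then show ?thesis using radial_derivative[OF w, of l] by (simp add: add.commute)
  qed
  have eq3: "(\<Sum>k\<in>UNIV. m k t *\<^sub>R ?DS k ?V) = (\<Sum>j\<in>UNIV. \<Sum>k\<in>UNIV. (u $ j * m k t) *\<^sub>R ?DS k (S j (E w)))"
  proof -
    have "m k t *\<^sub>R ?DS k ?V = (\<Sum>j\<in>UNIV. (u $ j * m k t) *\<^sub>R ?DS k (S j (E w)))" for k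
      by (simp add: linear_sum[OF lin] linear_scale[OF lin] scaleR_sum_right mult.commute)
    then have "(\<Sum>k\<in>UNIV. m k t *\<^sub>R ?DS k ?V) = (\<Sum>k\<in>UNIV. \<Sum>j\<in>UNIV. (u $ j * m k t) *\<^sub>R ?DS k (S j (E w)))"
      by (intro sum.cong refl)
    also have "\<dots> = (\<Sum>j\<in>UNIV. \<Sum>k\<in>UNIV. (u $ j * m k t) *\<^sub>R ?DS k (S j (E w)))" by (rule sum.swap)
    finally show ?thesis .
  qed
  \<comment> \<open>The terms \<open>?DS j (S k (E w))\<close> and \<open>?DS k (S j (E w))\<close>
    occur with the same coefficients on opposite sides, so only their difference, a bracket,
    survives.\<close>
  have "(\<Sum>k\<in>UNIV. m' k *\<^sub>R S k (E w)) = S l (E w) - (\<Sum>j\<in>UNIV. \<Sum>k\<in>UNIV. (u $ j * m k t) *\<^sub>R lie_bracket (S j) (S k) (E w))"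
    using eq1 unfolding eq2 eq3
    by (simp add: lie_bracket_def scaleR_diff_right sum_subtractf algebra_simps)
  also have "(\<Sum>j\<in>UNIV. \<Sum>k\<in>UNIV. (u $ j * m k t) *\<^sub>R lie_bracket (S j) (S k) (E w)) =
     (\<Sum>j\<in>UNIV. \<Sum>k\<in>UNIV. \<Sum>a\<in>UNIV. (u $ j * m k t * \<gamma> j k a) *\<^sub>R S a (E w))"
    unfolding w_def \<gamma> by (simp add: scaleR_sum_right)
  also have "\<dots> = (\<Sum>j\<in>UNIV. \<Sum>a\<in>UNIV. \<Sum>k\<in>UNIV. (u $ j * m k t * \<gamma> j k a) *\<^sub>R S a (E w))"
    by (intro sum.cong refl sum.swap)
  also have "\<dots> = (\<Sum>a\<in>UNIV. \<Sum>j\<in>UNIV. \<Sum>k\<in>UNIV. (u $ j * m k t * \<gamma> j k a) *\<^sub>R S a (E w))"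
    by (rule sum.swap)
  also have "\<dots> = (\<Sum>a\<in>UNIV. (\<Sum>j\<in>UNIV. \<Sum>k\<in>UNIV. u $ j * m k t * \<gamma> j k a) *\<^sub>R S a (E w))"
    by (simp add: scaleR_sum_left)
  also have "S l (E w) = (\<Sum>a\<in>UNIV. (if a = l then 1 else 0) *\<^sub>R S a (E w))"
    by (simp add: if_distrib[of "\<lambda>c. c *\<^sub>R _"] cong: if_cong)
  finally have "(\<Sum>k\<in>UNIV. m' k *\<^sub>R S k (E w)) =
      (\<Sum>a\<in>UNIV. ((if a = l then 1 else 0) - (\<Sum>j\<in>UNIV. \<Sum>k\<in>UNIV. u $ j * m k t * \<gamma> j k a)) *\<^sub>R S a (E w))"
    by (simp only: scaleR_diff_left sum_subtractf)
  from frame_coefficients_unique[OF frame[OF w] this]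
  have "m' k = (if k = l then 1 else 0) - (\<Sum>j\<in>UNIV. \<Sum>i\<in>UNIV. u $ j * m i t * \<gamma> j i k)" .
  also have "(\<Sum>j\<in>UNIV. \<Sum>i\<in>UNIV. u $ j * m i t * \<gamma> j i k) = (\<Sum>i\<in>UNIV. (\<Sum>j\<in>UNIV. u $ j * \<gamma> j i k) * m i t)"
    by (subst sum.swap) (simp add: sum_distrib_left sum_distrib_right mult_ac)
  finally show ?thesis using m'[of k] unfolding m_def by simp
qed

end

section \<open>Weight estimates\<close>

text \<open>\<open>N\<close> is star-shaped about the origin so that estimates can be integrated
  along rays, and the homogeneous norm is at most 1 on it so that exponents can be lowered.\<close>

locale weighted =
  fixes B :: "'p::finite \<Rightarrow> nat list" and N :: "(real^'p) set" and r :: nat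
  assumes w_pos: "\<And>j. 0 < weight (B j)" and w_le: "\<And>j. weight (B j) \<le> r"
    and N_star: "\<And>u t. u \<in> N \<Longrightarrow> 0 \<le> t \<Longrightarrow> t \<le> 1 \<Longrightarrow> t *\<^sub>R u \<in> N"
    and N_unit: "\<And>u. u \<in> N \<Longrightarrow> hom_norm B u \<le> 1"
begin

abbreviation "w j \<equiv> weight (B j)"
abbreviation "Q u \<equiv> hom_norm B u"

lemma Q_nonneg: "0 \<le> Q u"
  unfolding hom_norm_def by (intro sum_nonneg) simp

lemma Q_ray:
  assumes "0 \<le> t" "t \<le> 1" shows "Q (t *\<^sub>R u) \<le> Q u"
  unfolding hom_norm_def
proof (intro sum_mono powr_mono2)
  show "\<bar>(t *\<^sub>R u) $ j\<bar> \<le> \<bar>u $ j\<bar>" for j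
    using mult_left_le_one_le[of "\<bar>u $ j\<bar>" t] assms by (simp add: abs_mult)
qed simp_all

lemma coordinate_le: "\<bar>u $ j\<bar> \<le> Q u ^ w j"
proof -
  have "\<bar>u $ j\<bar> powr (1 / real (w j)) \<le> Q u"
    unfolding hom_norm_def by (rule member_le_sum) auto
  then have "(\<bar>u $ j\<bar> powr (1 / real (w j))) ^ w j \<le> Q u ^ w j" by (rule power_mono) simp
  moreover have "(\<bar>u $ j\<bar> powr (1 / real (w j))) ^ w j = \<bar>u $ j\<bar>"
    using w_pos[of j] by (cases "u $ j = 0") (simp_all add: powr_power)
  ultimately show ?thesis by simp
qed

text \<open>Exponents are natural numbers and differences of weights are truncated at 0: for
  \<open>w k \<le> w l\<close> an estimate with exponent \<open>w k - w l\<close> claims boundedness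
  only.\<close>

definition bigo :: "nat \<Rightarrow> (real^'p \<Rightarrow> real) \<Rightarrow> bool" where
  "bigo e f \<longleftrightarrow> (\<exists>C\<ge>0. \<forall>u\<in>N. \<bar>f u\<bar> \<le> C * Q u ^ e)"

lemma bigo_mono: "bigo e f \<Longrightarrow> e' \<le> e \<Longrightarrow> bigo e' f"
  unfolding bigo_def
proof (elim exE conjE)
  fix C assume e: "e' \<le> e" and C: "0 \<le> C" "\<forall>u\<in>N. \<bar>f u\<bar> \<le> C * Q u ^ e"
  have "C * Q u ^ e \<le> C * Q u ^ e'" if "u \<in> N" for u
    by (intro mult_left_mono power_decreasing e Q_nonneg N_unit[OF that] C(1))
  then show "\<exists>C\<ge>0. \<forall>u\<in>N. \<bar>f u\<bar> \<le> C * Q u ^ e'" using C by (intro exI[of _ C]) fastforce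
qed

lemma bigo_zero: "bigo e (\<lambda>u. 0)"
  unfolding bigo_def by (intro exI[of _ 0]) simp

lemma bigo_const: "bigo 0 (\<lambda>u. c)"
  unfolding bigo_def by (intro exI[of _ "\<bar>c\<bar>"]) simp

lemma bigo_add: "bigo e f \<Longrightarrow> bigo e g \<Longrightarrow> bigo e (\<lambda>u. f u + g u)"
  unfolding bigo_def
proof (elim exE conjE)
  fix C C' assume *: "0 \<le> C" "\<forall>u\<in>N. \<bar>f u\<bar> \<le> C * Q u ^ e" "0 \<le> C'" "\<forall>u\<in>N. \<bar>g u\<bar> \<le> C' * Q u ^ e"
  have "\<bar>f u + g u\<bar> \<le> (C + C') * Q u ^ e" if "u \<in> N" for u
    using *(2,4)[rule_format, OF that] abs_triangle_ineq[of "f u" "g u"] by (simp add: algebra_simps)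
  then show "\<exists>C\<ge>0. \<forall>u\<in>N. \<bar>f u + g u\<bar> \<le> C * Q u ^ e" using * by (intro exI[of _ "C + C'"]) simp
qed

lemma bigo_mult: "bigo e f \<Longrightarrow> bigo e' g \<Longrightarrow> bigo (e + e') (\<lambda>u. f u * g u)"
  unfolding bigo_def
proof (elim exE conjE)
  fix C C' assume *: "0 \<le> C" "\<forall>u\<in>N. \<bar>f u\<bar> \<le> C * Q u ^ e" "0 \<le> C'" "\<forall>u\<in>N. \<bar>g u\<bar> \<le> C' * Q u ^ e'"
  have "\<bar>f u * g u\<bar> \<le> (C * C') * Q u ^ (e + e')" if "u \<in> N" for u
  proof -
    have "\<bar>f u * g u\<bar> \<le> (C * Q u ^ e) * (C' * Q u ^ e')"
      unfolding abs_mult using * that Q_nonneg by (intro mult_mono) auto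
    then show ?thesis by (simp add: power_add mult_ac)
  qed
  then show "\<exists>C\<ge>0. \<forall>u\<in>N. \<bar>f u * g u\<bar> \<le> C * Q u ^ (e + e')" using * by (intro exI[of _ "C * C'"]) simp
qed

lemma bigo_cmult: "bigo e f \<Longrightarrow> bigo e (\<lambda>u. c * f u)"
  using bigo_mult[OF bigo_const, of e f c] by simp

lemma bigo_diff: "bigo e f \<Longrightarrow> bigo e g \<Longrightarrow> bigo e (\<lambda>u. f u - g u)"
  using bigo_add[of e f "\<lambda>u. - 1 * g u"] bigo_cmult[of e g "- 1"] by simp

lemma bigo_sum: "(\<And>i. i \<in> I \<Longrightarrow> bigo e (f i)) \<Longrightarrow> bigo e (\<lambda>u. \<Sum>i\<in>I. f i u)"
proof (induction I rule: infinite_finite_induct)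
  case (insert a I)
  have "bigo e (\<lambda>u. f a u + (\<Sum>i\<in>I. f i u))"
    by (rule bigo_add) (simp_all add: insert.prems insert.IH)
  then show ?case using insert.hyps by simp
qed (simp_all add: bigo_zero)

lemma bigo_cong: "bigo e f \<Longrightarrow> (\<And>u. u \<in> N \<Longrightarrow> f u = g u) \<Longrightarrow> bigo e g"
  unfolding bigo_def by simp

text \<open>The function \<open>t * f (t *\<^sub>R u)\<close> runs from 0 to \<open>f u\<close>, so
  a uniform bound for its derivative is a bound for \<open>f u\<close>.\<close>

lemma bigo_ray:
  assumes cont: "\<And>u. u \<in> N \<Longrightarrow> continuous_on {0..1} (\<lambda>t. f (t *\<^sub>R u))"
    and der: "\<And>u t. u \<in> N \<Longrightarrow> 0 < t \<Longrightarrow> t < 1 \<Longrightarrow> ((\<lambda>t. t * f (t *\<^sub>R u)) has_real_derivative g u t) (at t)"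
    and bound: "0 \<le> C" "\<And>u t. u \<in> N \<Longrightarrow> 0 < t \<Longrightarrow> t < 1 \<Longrightarrow> \<bar>g u t\<bar> \<le> C * Q u ^ e"
  shows "bigo e f"
  unfolding bigo_def
proof (intro exI[of _ C] conjI ballI bound(1))
  fix u assume u: "u \<in> N"
  let ?h = "\<lambda>t. t * f (t *\<^sub>R u)"
  have "norm (?h 1 - ?h 0) \<le> (C * Q u ^ e) * 1 - (C * Q u ^ e) * 0"
  proof (rule differentiable_bound_general[where f = ?h and \<phi> = "\<lambda>t. (C * Q u ^ e) * t"])
    show "continuous_on {0..1} ?h" by (intro continuous_intros cont u)
    show "(?h has_vector_derivative g u t) (at t)" if "0 < t" "t < 1" for t
      using der[OF u that] by (simp add: has_real_derivative_iff_has_vector_derivative)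
    show "((\<lambda>t. (C * Q u ^ e) * t) has_vector_derivative C * Q u ^ e) (at t)" for t
      by (auto intro!: derivative_eq_intros simp: has_real_derivative_iff_has_vector_derivative[symmetric])
    show "norm (g u t) \<le> C * Q u ^ e" if "0 < t" "t < 1" for t using bound(2)[OF u that] by simp
  qed (auto intro!: continuous_intros)
  then show "\<bar>f u\<bar> \<le> C * Q u ^ e" by simp
qed

text \<open>Bounds in terms of the endpoint \<open>u\<close> of the ray, uniform in t: the transport
  equation mixes functions evaluated at t u with the coordinates of \<open>u\<close> itself.\<close>

definition bigo_param :: "nat \<Rightarrow> (real^'p \<Rightarrow> real \<Rightarrow> real) \<Rightarrow> bool" where
  "bigo_param e g \<longleftrightarrow> (\<exists>C\<ge>0. \<forall>u\<in>N. \<forall>t. 0 < t \<longrightarrow> t < 1 \<longrightarrow> \<bar>g u t\<bar> \<le> C * Q u ^ e)"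

lemma bigo_param_mono: "bigo_param e f \<Longrightarrow> e' \<le> e \<Longrightarrow> bigo_param e' f"
  unfolding bigo_param_def
proof (elim exE conjE)
  fix C assume e: "e' \<le> e" and C: "0 \<le> C" "\<forall>u\<in>N. \<forall>t. 0 < t \<longrightarrow> t < 1 \<longrightarrow> \<bar>f u t\<bar> \<le> C * Q u ^ e"
  have "C * Q u ^ e \<le> C * Q u ^ e'" if "u \<in> N" for u
    by (intro mult_left_mono power_decreasing e Q_nonneg N_unit[OF that] C(1))
  then show "\<exists>C\<ge>0. \<forall>u\<in>N. \<forall>t. 0 < t \<longrightarrow> t < 1 \<longrightarrow> \<bar>f u t\<bar> \<le> C * Q u ^ e'"
    using C by (intro exI[of _ C]) (meson order_trans)
qed

lemma bigo_param_add: "bigo_param e f \<Longrightarrow> bigo_param e g \<Longrightarrow> bigo_param e (\<lambda>u t. f u t + g u t)"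
  unfolding bigo_param_def
proof (elim exE conjE)
  fix C C' assume *: "0 \<le> C" "\<forall>u\<in>N. \<forall>t. 0 < t \<longrightarrow> t < 1 \<longrightarrow> \<bar>f u t\<bar> \<le> C * Q u ^ e"
    "0 \<le> C'" "\<forall>u\<in>N. \<forall>t. 0 < t \<longrightarrow> t < 1 \<longrightarrow> \<bar>g u t\<bar> \<le> C' * Q u ^ e"
  have "\<bar>f u t + g u t\<bar> \<le> (C + C') * Q u ^ e" if "u \<in> N" "0 < t" "t < 1" for u t
    using *(2,4)[rule_format, OF that] abs_triangle_ineq[of "f u t" "g u t"] by (simp add: algebra_simps)
  then show "\<exists>C\<ge>0. \<forall>u\<in>N. \<forall>t. 0 < t \<longrightarrow> t < 1 \<longrightarrow> \<bar>f u t + g u t\<bar> \<le> C * Q u ^ e"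
    using * by (intro exI[of _ "C + C'"]) simp
qed

lemma bigo_param_mult: "bigo_param e f \<Longrightarrow> bigo_param e' g \<Longrightarrow> bigo_param (e + e') (\<lambda>u t. f u t * g u t)"
  unfolding bigo_param_def
proof (elim exE conjE)
  fix C C' assume *: "0 \<le> C" "\<forall>u\<in>N. \<forall>t. 0 < t \<longrightarrow> t < 1 \<longrightarrow> \<bar>f u t\<bar> \<le> C * Q u ^ e"
    "0 \<le> C'" "\<forall>u\<in>N. \<forall>t. 0 < t \<longrightarrow> t < 1 \<longrightarrow> \<bar>g u t\<bar> \<le> C' * Q u ^ e'"
  have "\<bar>f u t * g u t\<bar> \<le> (C * C') * Q u ^ (e + e')" if "u \<in> N" "0 < t" "t < 1" for u t
  proof -
    have "\<bar>f u t * g u t\<bar> \<le> (C * Q u ^ e) * (C' * Q u ^ e')"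
      unfolding abs_mult using * that Q_nonneg by (intro mult_mono) auto
    then show ?thesis by (simp add: power_add mult_ac)
  qed
  then show "\<exists>C\<ge>0. \<forall>u\<in>N. \<forall>t. 0 < t \<longrightarrow> t < 1 \<longrightarrow> \<bar>f u t * g u t\<bar> \<le> C * Q u ^ (e + e')"
    using * by (intro exI[of _ "C * C'"]) simp
qed

lemma bigo_param_zero: "bigo_param e (\<lambda>u t. 0)"
  unfolding bigo_param_def by (intro exI[of _ 0]) simp

lemma bigo_param_minus: "bigo_param e f \<Longrightarrow> bigo_param e (\<lambda>u t. - f u t)"
  unfolding bigo_param_def by simp

lemma bigo_param_sum: "(\<And>i. i \<in> I \<Longrightarrow> bigo_param e (f i)) \<Longrightarrow> bigo_param e (\<lambda>u t. \<Sum>i\<in>I. f i u t)"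
proof (induction I rule: infinite_finite_induct)
  case (insert a I)
  have "bigo_param e (\<lambda>u t. f a u t + (\<Sum>i\<in>I. f i u t))"
    by (rule bigo_param_add) (simp_all add: insert.prems insert.IH)
  then show ?case using insert.hyps by simp
qed (simp_all add: bigo_param_zero)

lemma bigo_imp_bigo_param: "bigo e f \<Longrightarrow> bigo_param e (\<lambda>u t. t * f (t *\<^sub>R u))"
  unfolding bigo_def bigo_param_def
proof (elim exE conjE)
  fix C assume C: "0 \<le> C" "\<forall>u\<in>N. \<bar>f u\<bar> \<le> C * Q u ^ e"
  have "\<bar>t * f (t *\<^sub>R u)\<bar> \<le> C * Q u ^ e" if "u \<in> N" "0 < t" "t < 1" for u t
  proof -
    have "\<bar>t * f (t *\<^sub>R u)\<bar> \<le> \<bar>f (t *\<^sub>R u)\<bar>"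
      using that mult_left_le_one_le[of "\<bar>f (t *\<^sub>R u)\<bar>" t] by (simp add: abs_mult)
    also have "\<dots> \<le> C * Q (t *\<^sub>R u) ^ e" using C(2) N_star[OF that(1), of t] that by simp
    also have "\<dots> \<le> C * Q u ^ e" using that by (intro mult_left_mono power_mono Q_ray Q_nonneg C(1)) auto
    finally show ?thesis .
  qed
  then show "\<exists>C\<ge>0. \<forall>u\<in>N. \<forall>t. 0 < t \<longrightarrow> t < 1 \<longrightarrow> \<bar>t * f (t *\<^sub>R u)\<bar> \<le> C * Q u ^ e" using C by blast
qed

lemma bigo_param_coordinate:
  assumes "bigo 0 g" "e \<le> w i"
  shows "bigo_param e (\<lambda>u t. u $ i * g (t *\<^sub>R u))"
proof (rule bigo_param_mono[OF _ assms(2)])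
  obtain C where C: "0 \<le> C" "\<forall>u\<in>N. \<bar>g u\<bar> \<le> C" using assms(1) by (auto simp: bigo_def)
  have "\<bar>u $ i * g (t *\<^sub>R u)\<bar> \<le> C * Q u ^ w i" if "u \<in> N" "0 < t" "t < 1" for u t
  proof -
    have "\<bar>u $ i * g (t *\<^sub>R u)\<bar> \<le> Q u ^ w i * C"
      unfolding abs_mult using C N_star[OF that(1), of t] that coordinate_le[of u i] Q_nonneg
      by (intro mult_mono) auto
    then show ?thesis by (simp add: mult.commute)
  qed
  then show "bigo_param (w i) (\<lambda>u t. u $ i * g (t *\<^sub>R u))" unfolding bigo_param_def using C(1) by blast
qed

text \<open>\<open>M\<close> solves the transport equation \<open>(t M(t u))' = 1 - \<Gamma>(t u) t M(t u)\<close>, where the structure functions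
  \<open>\<gamma>\<close> of the frame agree with the universal constants \<open>c\<close> for pairs of total weight \<open>\<le> r\<close>.\<close>

definition frame_system :: "('p \<Rightarrow> 'p \<Rightarrow> 'p \<Rightarrow> real) \<Rightarrow> (real^'p \<Rightarrow> 'p \<Rightarrow> 'p \<Rightarrow> real) \<Rightarrow>
    ('p \<Rightarrow> 'p \<Rightarrow> 'p \<Rightarrow> real^'p \<Rightarrow> real) \<Rightarrow> bool" where
  "frame_system c M \<gamma> \<longleftrightarrow>
     (\<forall>i j k. bigo 0 (\<gamma> i j k)) \<and> (\<forall>k l. bigo 0 (\<lambda>u. M u k l)) \<and>
     (\<forall>i j k u. u \<in> N \<longrightarrow> w i + w j \<le> r \<longrightarrow> \<gamma> i j k u = c i j k) \<and>
     (\<forall>u\<in>N. \<forall>k l. continuous_on {0..1} (\<lambda>t. M (t *\<^sub>R u) k l) \<and> (\<forall>t. 0 < t \<longrightarrow> t < 1 \<longrightarrow>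
        ((\<lambda>t. t * M (t *\<^sub>R u) k l) has_real_derivative
         ((if k = l then 1 else 0) - (\<Sum>j\<in>UNIV. (\<Sum>i\<in>UNIV. u $ i * \<gamma> i j k (t *\<^sub>R u)) * (t * M (t *\<^sub>R u) j l)))) (at t)))"

context
  fixes c :: "'p \<Rightarrow> 'p \<Rightarrow> 'p \<Rightarrow> real"
  assumes c: "\<And>i j k. w i + w j \<le> r \<Longrightarrow> c i j k \<noteq> 0 \<Longrightarrow> w k = w i + w j"
begin

text \<open>The weight of the factor u_i decides. If \<open>w i + w j \<le> r\<close>, a nonzero
  constant forces \<open>w k = w i + w j\<close>, so u_i has just the size needed. Otherwise the
  structure function is merely bounded, but w_i > r - w_j \<ge> w_k - w_j. The maximum with 1
  records that every u_i contributes at least one power.\<close>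

lemma Gamma_bigo_param:
  assumes "frame_system c M \<gamma>"
  shows "bigo_param (max 1 (w k - w j)) (\<lambda>u t. \<Sum>i\<in>UNIV. u $ i * \<gamma> i j k (t *\<^sub>R u))"
proof (rule bigo_param_sum)
  fix i
  have b: "bigo 0 (\<gamma> i j k)" using assms by (simp add: frame_system_def)
  show "bigo_param (max 1 (w k - w j)) (\<lambda>u t. u $ i * \<gamma> i j k (t *\<^sub>R u))"
  proof (cases "w i + w j \<le> r \<and> c i j k = 0")
    case True
    have "\<gamma> i j k (t *\<^sub>R u) = 0" if "u \<in> N" "0 < t" "t < 1" for u t
      using assms N_star[OF that(1), of t] that True by (simp add: frame_system_def)
    then show ?thesis unfolding bigo_param_def by (intro exI[of _ 0]) simp
  next
    case False
    have "max 1 (w k - w j) \<le> w i"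
    proof (cases "w i + w j \<le> r")
      case True
      then have "w k = w i + w j" using False by (intro c) auto
      then show ?thesis using w_pos[of i] by simp
    next
      case False
      then show ?thesis using w_pos[of i] w_le[of k] by simp
    qed
    then show ?thesis by (rule bigo_param_coordinate[OF b])
  qed
qed

text \<open>One round of the bootstrap. The sum with the structure functions contributes at least
  one power, and the differences of weights telescope over \<open>j\<close>, so the total exponent
  reaches \<open>Suc m\<close> unless the final exponent is attained before.\<close>

lemma frame_system_bound_step:
  assumes sys: "frame_system c M \<gamma>" and M: "\<And>k l. bigo (min m (w k - w l)) (\<lambda>u. M u k l)"
  shows "bigo (min (Suc m) (max 1 (w k - w l))) (\<lambda>u. M u k l - (if k = l then 1 else 0))"
proof -
  let ?e = "min (Suc m) (max 1 (w k - w l))"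
  let ?g = "\<lambda>u t. - (\<Sum>j\<in>UNIV. (\<Sum>i\<in>UNIV. u $ i * \<gamma> i j k (t *\<^sub>R u)) * (t * M (t *\<^sub>R u) j l))"
  have "bigo_param ?e ?g"
  proof (intro bigo_param_minus bigo_param_sum)
    fix j
    have "bigo_param (max 1 (w k - w j) + min m (w j - w l)) (\<lambda>u t. (\<Sum>i\<in>UNIV. u $ i * \<gamma> i j k (t *\<^sub>R u)) * (t * M (t *\<^sub>R u) j l))"
      by (intro bigo_param_mult Gamma_bigo_param[OF sys] bigo_imp_bigo_param M)
    then show "bigo_param ?e (\<lambda>u t. (\<Sum>i\<in>UNIV. u $ i * \<gamma> i j k (t *\<^sub>R u)) * (t * M (t *\<^sub>R u) j l))"
      by (rule bigo_param_mono) arith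
  qed
  then obtain C where C: "0 \<le> C" "\<And>u t. u \<in> N \<Longrightarrow> 0 < t \<Longrightarrow> t < 1 \<Longrightarrow> \<bar>?g u t\<bar> \<le> C * Q u ^ ?e"
    unfolding bigo_param_def by blast
  show ?thesis
  proof (rule bigo_ray[OF _ _ C])
    fix u assume u: "u \<in> N"
    have Mu: "continuous_on {0..1} (\<lambda>t. M (t *\<^sub>R u) k l)" using sys u by (simp add: frame_system_def)
    then show "continuous_on {0..1} (\<lambda>t. M (t *\<^sub>R u) k l - (if k = l then 1 else 0))"
      by (intro continuous_intros)
    fix t :: real assume t: "0 < t" "t < 1"
    have "((\<lambda>t. t * M (t *\<^sub>R u) k l) has_real_derivative (if k = l then 1 else 0) + ?g u t) (at t)"
      using sys u t by (simp add: frame_system_def)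
    from DERIV_diff[OF this DERIV_cmult_Id[of "if k = l then 1 else 0"]]
    show "((\<lambda>t. t * (M (t *\<^sub>R u) k l - (if k = l then 1 else 0))) has_real_derivative ?g u t) (at t)"
      by (simp add: right_diff_distrib mult.commute)
  qed
qed

text \<open>Starting from boundedness, the step is repeated until the cap \<open>m\<close> reaches
  the difference of weights.\<close>

lemma frame_system_bound:
  assumes sys: "frame_system c M \<gamma>"
  shows "bigo (w k - w l) (\<lambda>u. M u k l)"
    and "bigo (max 1 (w k - w l)) (\<lambda>u. M u k l - (if k = l then 1 else 0))"
proof -
  have ind: "bigo (min m (w k - w l)) (\<lambda>u. M u k l)" for m k l
  proof (induction m arbitrary: k l)
    case 0
    then show ?case using sys by (simp add: frame_system_def)
  next
    case (Suc m)
    have "bigo (min (Suc m) (w k - w l)) (\<lambda>u. M u k l - (if k = l then 1 else 0))"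
      by (rule bigo_mono[OF frame_system_bound_step[OF sys Suc.IH]]) arith
    moreover have "bigo (min (Suc m) (w k - w l)) (\<lambda>u. if k = l then 1 else 0)"
      using bigo_const[of 1] bigo_zero by (cases "k = l") simp_all
    ultimately have "bigo (min (Suc m) (w k - w l)) (\<lambda>u. (M u k l - (if k = l then 1 else 0)) + (if k = l then 1 else 0))"
      by (rule bigo_add)
    then show ?case by simp
  qed
  show "bigo (w k - w l) (\<lambda>u. M u k l)" using ind[of "w k - w l" k l] by simp
  have "bigo (min (Suc (w k)) (max 1 (w k - w l))) (\<lambda>u. M u k l - (if k = l then 1 else 0))"
    by (rule frame_system_bound_step[OF sys ind])
  then show "bigo (max 1 (w k - w l)) (\<lambda>u. M u k l - (if k = l then 1 else 0))"
    by (rule bigo_mono) arith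
qed

text \<open>From A = 1 - (M - 1) A: the entries of M - 1 have at least one power to give, so the
  same bootstrap works.\<close>

lemma frame_system_inverse_bound:
  assumes sys: "frame_system c M \<gamma>" and A: "\<And>k l. bigo 0 (\<lambda>u. A u k l)"
    and inv: "\<And>u k l. u \<in> N \<Longrightarrow> (\<Sum>j\<in>UNIV. M u k j * A u j l) = (if k = l then 1 else 0)"
  shows "bigo (w k - w l) (\<lambda>u. A u k l)"
proof -
  have "bigo (min m (w k - w l)) (\<lambda>u. A u k l)" for m k l
  proof (induction m arbitrary: k l)
    case 0
    then show ?case using A by simp
  next
    case (Suc m)
    have "bigo (min (Suc m) (w k - w l)) (\<lambda>u. \<Sum>j\<in>UNIV. (M u k j - (if k = j then 1 else 0)) * A u j l)"
    proof (rule bigo_sum)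
      fix j
      have "bigo (max 1 (w k - w j) + min m (w j - w l)) (\<lambda>u. (M u k j - (if k = j then 1 else 0)) * A u j l)"
        by (intro bigo_mult frame_system_bound(2)[OF sys] Suc.IH)
      then show "bigo (min (Suc m) (w k - w l)) (\<lambda>u. (M u k j - (if k = j then 1 else 0)) * A u j l)"
        by (rule bigo_mono) arith
    qed
    moreover have "bigo (min (Suc m) (w k - w l)) (\<lambda>u. if k = l then 1 else 0)"
      using bigo_const[of 1] bigo_zero by (cases "k = l") simp_all
    ultimately have "bigo (min (Suc m) (w k - w l)) (\<lambda>u. (if k = l then 1 else 0) - (\<Sum>j\<in>UNIV. (M u k j - (if k = j then 1 else 0)) * A u j l))"
      by (intro bigo_diff)
    then show ?case
    proof (rule bigo_cong)
      fix u assume u: "u \<in> N"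
      have "(\<Sum>j\<in>UNIV. (M u k j - (if k = j then 1 else 0)) * A u j l) = (\<Sum>j\<in>UNIV. M u k j * A u j l) - (\<Sum>j\<in>UNIV. if k = j then A u j l else 0)"
        by (simp add: left_diff_distrib sum_subtractf if_distrib[of "\<lambda>c. c * _"] cong: if_cong)
      then show "(if k = l then 1 else 0) - (\<Sum>j\<in>UNIV. (M u k j - (if k = j then 1 else 0)) * A u j l) = A u k l"
        using inv[OF u, of k l] by simp
    qed
  qed
  from this[of "w k - w l" k l] show ?thesis by simp
qed

text \<open>In the difference of the two equations the inhomogeneous term cancels. It is driven by
  the difference of the structure functions, which is zero for total weight at most
  \<open>r\<close>; beyond, \<open>w i \<ge> Suc (w k) - w j\<close>, one power more than in the
  estimate of either solution.\<close>

lemma frame_system_diff: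
  assumes sys: "frame_system c M \<gamma>" "frame_system c M' \<gamma>'"
  shows "bigo (Suc (w k) - w l) (\<lambda>u. M u k l - M' u k l)"
proof -
  have "bigo (min m (Suc (w k) - w l)) (\<lambda>u. M u k l - M' u k l)" for m k l
  proof (induction m arbitrary: k l)
    case 0
    have "bigo 0 (\<lambda>u. M u k l)" "bigo 0 (\<lambda>u. M' u k l)" using sys by (simp_all add: frame_system_def)
    then show ?case by (simp add: bigo_diff)
  next
    case (Suc m)
    let ?e = "min (Suc m) (Suc (w k) - w l)"
    let ?G = "\<lambda>\<gamma> j u t. \<Sum>i\<in>UNIV. u $ i * \<gamma> i j k (t *\<^sub>R u)"
    let ?g = "\<lambda>u t. - (\<Sum>j\<in>UNIV. ?G \<gamma> j u t * (t * (M (t *\<^sub>R u) j l - M' (t *\<^sub>R u) j l))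
        + (\<Sum>i\<in>UNIV. u $ i * (\<gamma> i j k (t *\<^sub>R u) - \<gamma>' i j k (t *\<^sub>R u))) * (t * M' (t *\<^sub>R u) j l))"
    have diff: "bigo_param (max 1 (Suc (w k) - w j)) (\<lambda>u t. \<Sum>i\<in>UNIV. u $ i * (\<gamma> i j k (t *\<^sub>R u) - \<gamma>' i j k (t *\<^sub>R u)))" for j
    proof (rule bigo_param_sum)
      fix i
      show "bigo_param (max 1 (Suc (w k) - w j)) (\<lambda>u t. u $ i * (\<gamma> i j k (t *\<^sub>R u) - \<gamma>' i j k (t *\<^sub>R u)))"
      proof (cases "w i + w j \<le> r")
        case True
        have "\<gamma> i j k (t *\<^sub>R u) = \<gamma>' i j k (t *\<^sub>R u)" if "u \<in> N" "0 < t" "t < 1" for u t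
          using sys N_star[OF that(1), of t] that True by (simp add: frame_system_def)
        then show ?thesis unfolding bigo_param_def by (intro exI[of _ 0]) simp
      next
        case False
        then have "max 1 (Suc (w k) - w j) \<le> w i" using w_pos[of i] w_le[of k] by simp
        moreover have "bigo 0 (\<lambda>u. \<gamma> i j k u - \<gamma>' i j k u)"
          using sys by (intro bigo_diff) (simp_all add: frame_system_def)
        ultimately show ?thesis by (intro bigo_param_coordinate)
      qed
    qed
    have "bigo_param ?e ?g"
    proof (intro bigo_param_minus bigo_param_sum bigo_param_add)
      fix j
      have "bigo_param (max 1 (w k - w j) + min m (Suc (w j) - w l)) (\<lambda>u t. ?G \<gamma> j u t * (t * (M (t *\<^sub>R u) j l - M' (t *\<^sub>R u) j l)))"
        by (intro bigo_param_mult Gamma_bigo_param[OF sys(1)] bigo_imp_bigo_param Suc.IH)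
      then show "bigo_param ?e (\<lambda>u t. ?G \<gamma> j u t * (t * (M (t *\<^sub>R u) j l - M' (t *\<^sub>R u) j l)))"
        by (rule bigo_param_mono) arith
      have "bigo_param (max 1 (Suc (w k) - w j) + (w j - w l)) (\<lambda>u t. (\<Sum>i\<in>UNIV. u $ i * (\<gamma> i j k (t *\<^sub>R u) - \<gamma>' i j k (t *\<^sub>R u))) * (t * M' (t *\<^sub>R u) j l))"
        by (intro bigo_param_mult diff bigo_imp_bigo_param frame_system_bound(1)[OF sys(2)])
      then show "bigo_param ?e (\<lambda>u t. (\<Sum>i\<in>UNIV. u $ i * (\<gamma> i j k (t *\<^sub>R u) - \<gamma>' i j k (t *\<^sub>R u))) * (t * M' (t *\<^sub>R u) j l))"
        by (rule bigo_param_mono) arith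
    qed
    then obtain C where C: "0 \<le> C" "\<And>u t. u \<in> N \<Longrightarrow> 0 < t \<Longrightarrow> t < 1 \<Longrightarrow> \<bar>?g u t\<bar> \<le> C * Q u ^ ?e"
      unfolding bigo_param_def by blast
    show ?case
    proof (rule bigo_ray[OF _ _ C])
      fix u assume u: "u \<in> N"
      have "continuous_on {0..1} (\<lambda>t. M (t *\<^sub>R u) k l)" "continuous_on {0..1} (\<lambda>t. M' (t *\<^sub>R u) k l)"
        using sys u by (simp_all add: frame_system_def)
      then show "continuous_on {0..1} (\<lambda>t. M (t *\<^sub>R u) k l - M' (t *\<^sub>R u) k l)"
        by (intro continuous_intros)
      fix t :: real assume t: "0 < t" "t < 1"
      have d1: "((\<lambda>t. t * M (t *\<^sub>R u) k l) has_real_derivative (if k = l then 1 else 0) - (\<Sum>j\<in>UNIV. ?G \<gamma> j u t * (t * M (t *\<^sub>R u) j l))) (at t)"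
        using sys(1) u t by (simp add: frame_system_def)
      have d2: "((\<lambda>t. t * M' (t *\<^sub>R u) k l) has_real_derivative (if k = l then 1 else 0) - (\<Sum>j\<in>UNIV. ?G \<gamma>' j u t * (t * M' (t *\<^sub>R u) j l))) (at t)"
        using sys(2) u t by (simp add: frame_system_def)
      have "((if k = l then 1 else 0) - (\<Sum>j\<in>UNIV. ?G \<gamma> j u t * (t * M (t *\<^sub>R u) j l)))
          - ((if k = l then 1 else 0) - (\<Sum>j\<in>UNIV. ?G \<gamma>' j u t * (t * M' (t *\<^sub>R u) j l))) =
         - (\<Sum>j\<in>UNIV. ?G \<gamma> j u t * (t * M (t *\<^sub>R u) j l) - ?G \<gamma>' j u t * (t * M' (t *\<^sub>R u) j l))"
        by (simp add: sum_subtractf)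
      also have "\<dots> = ?g u t"
        by (intro arg_cong[of _ _ uminus] sum.cong refl) (simp add: right_diff_distrib sum_subtractf left_diff_distrib)
      finally show "((\<lambda>t. t * (M (t *\<^sub>R u) k l - M' (t *\<^sub>R u) k l)) has_real_derivative ?g u t) (at t)"
        using DERIV_diff[OF d1 d2] by (simp add: right_diff_distrib)
    qed
  qed
  from this[of "Suc (w k)" k l] show ?thesis by (rule bigo_mono) simp
qed

text \<open>A - A' = A (M' - M) A', where the outer factors preserve the weights and the middle one
  brings the extra power.\<close>

lemma frame_system_inverse_diff:
  assumes sys: "frame_system c M \<gamma>" "frame_system c M' \<gamma>'"
    and A: "\<And>k l. bigo 0 (\<lambda>u. A u k l)" "\<And>k l. bigo 0 (\<lambda>u. A' u k l)"
    and inv: "\<And>u k l. u \<in> N \<Longrightarrow> (\<Sum>j\<in>UNIV. M u k j * A u j l) = (if k = l then 1 else 0)"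
      "\<And>u k l. u \<in> N \<Longrightarrow> (\<Sum>j\<in>UNIV. A u k j * M u j l) = (if k = l then 1 else 0)"
      "\<And>u k l. u \<in> N \<Longrightarrow> (\<Sum>j\<in>UNIV. M' u k j * A' u j l) = (if k = l then 1 else 0)"
  shows "bigo (Suc (w k) - w l) (\<lambda>u. A u k l - A' u k l)"
proof -
  have "bigo (Suc (w k) - w l) (\<lambda>u. \<Sum>i\<in>UNIV. \<Sum>j\<in>UNIV. A u k i * (M' u i j - M u i j) * A' u j l)"
  proof (intro bigo_sum)
    fix i j
    have "bigo ((w k - w i) + (Suc (w i) - w j) + (w j - w l)) (\<lambda>u. A u k i * (M' u i j - M u i j) * A' u j l)"
      by (intro bigo_mult frame_system_inverse_bound[OF sys(1) A(1) inv(1)]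
          frame_system_inverse_bound[OF sys(2) A(2) inv(3)] frame_system_diff[OF sys(2,1)])
    then show "bigo (Suc (w k) - w l) (\<lambda>u. A u k i * (M' u i j - M u i j) * A' u j l)"
      by (rule bigo_mono) arith
  qed
  then show ?thesis
  proof (rule bigo_cong)
    fix u assume u: "u \<in> N"
    have 1: "(\<Sum>i\<in>UNIV. \<Sum>j\<in>UNIV. A u k i * M' u i j * A' u j l) = A u k l"
    proof -
      have "(\<Sum>j\<in>UNIV. A u k i * M' u i j * A' u j l) = A u k i * (if i = l then 1 else 0)" for i
        unfolding inv(3)[OF u, symmetric] by (simp add: sum_distrib_left mult_ac)
      then show ?thesis by (simp add: if_distrib[of "\<lambda>c. _ * c"] cong: if_cong)
    qed
    have 2: "(\<Sum>i\<in>UNIV. \<Sum>j\<in>UNIV. A u k i * M u i j * A' u j l) = A' u k l"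
    proof -
      have "(\<Sum>i\<in>UNIV. A u k i * M u i j * A' u j l) = (if k = j then 1 else 0) * A' u j l" for j
        unfolding inv(2)[OF u, symmetric] by (simp add: sum_distrib_right)
      then show ?thesis by (subst sum.swap) (simp add: if_distrib[of "\<lambda>c. c * _"] cong: if_cong)
    qed
    show "(\<Sum>i\<in>UNIV. \<Sum>j\<in>UNIV. A u k i * (M' u i j - M u i j) * A' u j l) = A u k l - A' u k l"
      by (simp add: right_diff_distrib left_diff_distrib sum_subtractf 1 2)
  qed
qed

end

end

section \<open>Local inversion\<close>

text \<open>Will be applied to a domain that is a union of balls belonging to different
  charts.\<close>

lemma C_on_local:
  fixes f :: "'a::euclidean_space \<Rightarrow> 'b::real_normed_vector"
  assumes "\<And>x. x \<in> S \<Longrightarrow> \<exists>T. open T \<and> x \<in> T \<and> C_on k T f"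
  shows "C_on k S f"
  using assms
proof (induction k arbitrary: f)
  case 0
  have "continuous (at x) f" if "x \<in> S" for x
    using 0[OF that] continuous_on_eq_continuous_at by auto
  then show ?case by (simp add: continuous_at_imp_continuous_on)
next
  case (Suc k)
  have "f differentiable (at x)" if "x \<in> S" for x using Suc.prems[OF that] by auto
  moreover have "C_on k S (\<lambda>x. frechet_derivative f (at x) v)" if v: "v \<in> Basis" for v
  proof (rule Suc.IH)
    fix x assume "x \<in> S"
    from Suc.prems[OF this] obtain T where "open T" "x \<in> T" "C_on (Suc k) T f" by blast
    then show "\<exists>T. open T \<and> x \<in> T \<and> C_on k T (\<lambda>x. frechet_derivative f (at x) v)"
      using v by (intro exI[of _ T]) simp
  qed
  ultimately show ?case by simp
qed

lemma C_on_subset: "C_on k S f \<Longrightarrow> T \<subseteq> S \<Longrightarrow> C_on k T f"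
  for f :: "'a::euclidean_space \<Rightarrow> 'b::real_normed_vector"
  by (induction k arbitrary: f) (auto intro: continuous_on_subset)

lemma smooth_on_subset: "smooth_on S f \<Longrightarrow> T \<subseteq> S \<Longrightarrow> smooth_on T f"
  for f :: "'a::euclidean_space \<Rightarrow> 'b::real_normed_vector"
  unfolding smooth_on_def using C_on_subset by blast

lemma smooth_on_cong_vec:
  fixes f :: "'a::euclidean_space \<Rightarrow> real^'p::finite"
  assumes "open S" "smooth_on S f" "\<And>x. x \<in> S \<Longrightarrow> f x = g x"
  shows "smooth_on S g"
proof (subst smooth_on_vec[OF assms(1)], rule allI)
  fix i
  have "smooth_on S (\<lambda>x. f x $ i)" using assms(2) smooth_on_vec[OF assms(1)] by blast
  then show "smooth_on S (\<lambda>x. g x $ i)"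
    by (rule smooth_on_cong[OF assms(1)]) (simp add: assms(3))
qed

lemma inj_imp_det_nonzero:
  fixes A :: "real^'p::finite^'p"
  assumes "inj ((*v) A)"
  shows "det A \<noteq> 0"
  using assms matrix_left_invertible_injective invertible_left_inverse invertible_det_nz by blast

lemma det_nonzero_of_bounded_below:
  fixes A :: "real^'p::finite^'p"
  assumes "c > 0" "\<And>h. c * norm h \<le> norm (A *v h)"
  shows "det A \<noteq> 0"
proof (rule inj_imp_det_nonzero, rule injI)
  fix x y assume "A *v x = A *v y"
  then have "A *v (x - y) = 0" by (simp add: matrix_vector_mult_diff_distrib)
  then have "norm (x - y) \<le> 0" using assms(2)[of "x - y"] assms(1) by (simp add: mult_le_0_iff)
  then show "x = y" by simp
qed

lemma frame_matrix_diff_le: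
  fixes S :: "'p::finite \<Rightarrow> 'a \<Rightarrow> real^'p"
  assumes "\<And>j. norm (S j x - S' j x') \<le> \<eta>"
  shows "norm (frame_matrix S x *v h - frame_matrix S' x' *v h) \<le> real CARD('p) * \<eta> * norm h"
proof -
  have "frame_matrix S x *v h - frame_matrix S' x' *v h = (\<Sum>j\<in>UNIV. h $ j *\<^sub>R (S j x - S' j x'))"
    unfolding frame_matrix_vec by (simp add: scaleR_diff_right sum_subtractf)
  also have "norm \<dots> \<le> (\<Sum>j\<in>(UNIV :: 'p set). norm h * \<eta>)"
  proof (rule sum_norm_le)
    fix j
    show "norm (h $ j *\<^sub>R (S j x - S' j x')) \<le> norm h * \<eta>"
      unfolding norm_scaleR using Finite_Cartesian_Product.norm_nth_le[of h j] assms[of j]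
      by (intro mult_mono) auto
  qed
  finally show ?thesis by (simp add: mult_ac)
qed

text \<open>If A a = v and A' a' = v', then A (a - a') = (v - v') + (A' - A) a'. A common lower
  bound \<open>c\<close> takes the place of norms of inverses, which is how uniformity in
  \<open>y\<close> is obtained.\<close>

lemma inverse_perturbation:
  fixes A A' :: "real^'p::finite^'p"
  assumes c: "c > 0" "\<And>h. c * norm h \<le> norm (A *v h)" "\<And>h. c * norm h \<le> norm (A' *v h)"
    and diff: "\<And>h. norm (A *v h - A' *v h) \<le> \<eta> * norm h" and v: "norm v' \<le> b" and "0 \<le> \<eta>"
  shows "norm (matrix_inv A *v v - matrix_inv A' *v v') \<le> (norm (v - v') + \<eta> * (b / c)) / c"
proof -
  define a where "a = matrix_inv A *v v"
  define a' where "a' = matrix_inv A' *v v'"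
  have Aa: "A *v a = v" "A' *v a' = v'"
    using matrix_inv_mult(1)[OF det_nonzero_of_bounded_below[OF c(1,2)]]
      matrix_inv_mult(1)[OF det_nonzero_of_bounded_below[OF c(1,3)]]
    by (simp_all add: a_def a'_def matrix_vector_mul_assoc)
  have "c * norm a' \<le> b" using c(3)[of a'] v Aa by simp
  then have a': "norm a' \<le> b / c" using c(1) by (simp add: field_simps)
  have "c * norm (a - a') \<le> norm (A *v (a - a'))" by (rule c(2))
  also have "A *v (a - a') = (v - v') + (A' *v a' - A *v a')"
    by (simp add: matrix_vector_mult_diff_distrib Aa)
  also have "norm \<dots> \<le> norm (v - v') + norm (A' *v a' - A *v a')" by (rule norm_triangle_ineq)
  also have "\<dots> \<le> norm (v - v') + \<eta> * (b / c)"
    using diff[of a'] mult_left_mono[OF a' \<open>0 \<le> \<eta>\<close>] by (simp add: norm_minus_commute)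
  finally show ?thesis unfolding a_def[symmetric] a'_def[symmetric] using c(1) by (simp add: field_simps)
qed

lemma flow_on_mono:
  fixes E :: "real^'a::finite \<Rightarrow> real^'a \<Rightarrow> real^'a"
  assumes "flow_on \<alpha> S N \<rho> K E D" "N' \<subseteq> N" "\<rho>' \<le> \<rho>"
  shows "flow_on \<alpha> S N' \<rho>' K E D"
proof -
  note flow = assms(1)
  have sub: "norm u < \<rho>" if "u \<in> ball 0 \<rho>'" for u :: "real^'a" using that assms(3) by simp
  show ?thesis
    unfolding flow_on_def
  proof (intro conjI ballI allI)
    show "0 \<le> K" using flow by (simp add: flow_on_def)
    fix y assume "y \<in> N'"
    then have y: "y \<in> N" using assms(2) by blast
    show "smooth_on (ball 0 \<rho>') (E y)"
      by (rule smooth_on_subset[OF flow_onD(1)[OF flow y] subset_ball[OF assms(3)]])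
    show "E y 0 = y" by (rule flow_onD(2)[OF flow y])
    fix u assume u: "u \<in> ball (0 :: real^'a) \<rho>'"
    note fu = flow_onD(3-8)[OF flow y sub[OF u]]
    show "(E y has_derivative (\<lambda>h. \<Sum>l\<in>UNIV. h $ l *\<^sub>R D y l u)) (at u)" by (rule fu(1))
    show "(\<Sum>l\<in>UNIV. u $ l *\<^sub>R D y l u) = (\<Sum>j\<in>UNIV. u $ j *\<^sub>R S j y (E y u))" by (rule fu(2))
    show "norm (E y u - E z u) \<le> K * dist y z powr \<alpha>" if "z \<in> N'" for z
      by (rule fu(3)[OF subsetD[OF assms(2) that]])
    show "norm (D y l u - D z l u) \<le> K * dist y z powr \<alpha>" if "z \<in> N'" for z l
      by (rule fu(4)[OF subsetD[OF assms(2) that]])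
    show "norm (E y u - E y w) \<le> K * norm (u - w)" if "w \<in> ball 0 \<rho>'" for w
      by (rule fu(5)[OF sub[OF that]])
    show "norm (D y l u - D y l w) \<le> K * norm (u - w)" if "w \<in> ball 0 \<rho>'" for w l
      by (rule fu(6)[OF sub[OF that]])
  qed
qed

section \<open>Construction of the coordinates\<close>

locale regularized_coordinates = holder_fields +
  fixes B :: "'a \<Rightarrow> nat list"
  assumes basis: "basis_multiindices n r \<Omega> X B"
begin

definition "S j y = commutator (approx_field r X y) (B j)"

definition "E y = canonical_exp r X B y"

definition "D y l u = frechet_derivative (E y) (at u) (axis l 1)"

abbreviation "J y u \<equiv> frame_matrix (D y) u"

lemma B: "B j \<in> multiindices_upto n r" "B j \<in> multiindices n"
  using basis by (auto simp: basis_multiindices_def multiindices_upto_def)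

lemma smooth_S: "smooth_on UNIV (S j y)"
  unfolding S_def by (rule smooth_commutator_approx)

lemma S_center: "y \<in> \<Omega> \<Longrightarrow> S j y y = commutator X (B j) y"
  unfolding S_def by (rule commutator_approx_center[OF _ B(1)])

lemma canonical_field_eq: "canonical_field r X B y u = (\<lambda>x. \<Sum>j\<in>UNIV. u $ j *\<^sub>R S j y x)"
  by (rule ext) (simp add: canonical_field_def S_def)

lemma smooth_canonical_field: "smooth_on UNIV (canonical_field r X B y u)"
proof (subst smooth_on_vec[OF open_UNIV], rule allI)
  fix i
  have "smooth_on UNIV (\<lambda>x. S j y x $ i)" for j using smooth_S smooth_on_vec[OF open_UNIV] by blast
  then have "smooth_on UNIV (\<lambda>x. \<Sum>j\<in>UNIV. u $ j * S j y x $ i)"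
    by (intro smooth_on_sum smooth_on_mult smooth_on_const open_UNIV)
  then show "smooth_on UNIV (\<lambda>x. canonical_field r X B y u x $ i)" by (simp add: canonical_field_eq)
qed

text \<open>\<open>E\<close> is defined through \<open>vf_exp\<close>, without reference to a chart.
  Uniqueness of integral curves identifies it with any flow constructed near \<open>y0\<close>, so
  that flows around different centres agree automatically.\<close>

lemma flow_at:
  assumes "y0 \<in> \<Omega>"
  shows "\<exists>\<epsilon>>0. \<exists>\<rho>>0. \<exists>K. ball y0 \<epsilon> \<subseteq> \<Omega> \<and> flow_on \<alpha> S (ball y0 \<epsilon>) \<rho> K E D"
proof -
  have "poly_field \<alpha> \<Omega> (S j)" for j
    using poly_field_commutator_approx[OF B(2)] unfolding S_def[abs_def] .
  from polynomial_flow_exists[where S = S, OF \<alpha> open_\<Omega> assms this] obtain \<epsilon> \<rho> K E' D' where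
    pos: "\<epsilon> > 0" "\<rho> > 0" "ball y0 \<epsilon> \<subseteq> \<Omega>" and flow: "flow_on \<alpha> S (ball y0 \<epsilon>) \<rho> K E' D'" by blast
  have E: "E' y u = E y u" if "y \<in> ball y0 \<epsilon>" "norm u < \<rho>" for y u
  proof -
    have "is_exp (canonical_field r X B y u) y (E' y u)"
      unfolding canonical_field_eq by (rule flow_is_exp(1)[OF flow that smooth_S])
    from vf_exp_eq[OF smooth_canonical_field this] show ?thesis by (simp add: E_def canonical_exp_def)
  qed
  have dE: "(E y has_derivative (\<lambda>h. \<Sum>l\<in>UNIV. h $ l *\<^sub>R D' y l u)) (at u)" if y: "y \<in> ball y0 \<epsilon>" and u: "norm u < \<rho>" for y u
    by (rule has_derivative_transform_within_open[OF flow_onD(3)[OF flow y u] open_ball[of 0 \<rho>]]) (use u E[OF y] in auto)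
  have D: "D' y l u = D y l u" if y: "y \<in> ball y0 \<epsilon>" and u: "norm u < \<rho>" for y l u
  proof -
    have "D y l u = (\<Sum>m\<in>UNIV. axis l 1 $ m *\<^sub>R D' y m u)"
      unfolding D_def frechet_derivative_unique[OF dE[OF that]] ..
    also have "\<dots> = (\<Sum>m\<in>UNIV. if m = l then D' y m u else 0)" by (intro sum.cong) (auto simp: axis_def)
    finally show ?thesis by simp
  qed
  have "flow_on \<alpha> S (ball y0 \<epsilon>) \<rho> K E D"
    unfolding flow_on_def
  proof (intro conjI ballI allI)
    show "0 \<le> K" using flow by (simp add: flow_on_def)
    fix y assume y: "y \<in> ball y0 \<epsilon>"
    show "smooth_on (ball 0 \<rho>) (E y)"
      by (rule smooth_on_cong_vec[OF open_ball flow_onD(1)[OF flow y]]) (simp add: E[OF y])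
    have z: "norm (0 :: real^'a) < \<rho>" using pos by simp
    show "E y 0 = y" using flow_onD(2)[OF flow y] E[OF y z] by simp
    fix u :: "real^'a" assume "u \<in> ball 0 \<rho>"
    then have u: "norm u < \<rho>" by simp
    show "(E y has_derivative (\<lambda>h. \<Sum>l\<in>UNIV. h $ l *\<^sub>R D y l u)) (at u)" using dE[OF y u] D[OF y u] by simp
    show "(\<Sum>l\<in>UNIV. u $ l *\<^sub>R D y l u) = (\<Sum>j\<in>UNIV. u $ j *\<^sub>R S j y (E y u))"
      using flow_onD(4)[OF flow y u] D[OF y u] E[OF y u] by simp
    show "norm (E y u - E z u) \<le> K * dist y z powr \<alpha>" if "z \<in> ball y0 \<epsilon>" for z
      using flow_onD(5)[OF flow y u that] E[OF y u] E[OF that u] by simp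
    show "norm (D y l u - D z l u) \<le> K * dist y z powr \<alpha>" if "z \<in> ball y0 \<epsilon>" for z l
      using flow_onD(6)[OF flow y u that] D[OF y u] D[OF that u] by simp
    fix w :: "real^'a" assume "w \<in> ball 0 \<rho>"
    then have w: "norm w < \<rho>" by simp
    show "norm (E y u - E y w) \<le> K * norm (u - w)" using flow_onD(7)[OF flow y u w] E[OF y u] E[OF y w] by simp
    show "norm (D y l u - D y l w) \<le> K * norm (u - w)" for l using flow_onD(8)[OF flow y u w] D[OF y u] D[OF y w] by simp
  qed
  then show ?thesis using pos by blast
qed

lemma D_center:
  assumes flow: "flow_on \<alpha> S N \<rho> K E D" "0 < \<rho>" and y: "y \<in> N" "y \<in> \<Omega>"
  shows "D y l 0 = commutator X (B l) y"
proof -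
  have ax: "(\<Sum>m\<in>UNIV. ((\<rho> / 2) *\<^sub>R axis l (1::real)) $ m *\<^sub>R a m) = (\<rho> / 2) *\<^sub>R a l" for a :: "'a \<Rightarrow> real^'a"
  proof -
    have "(\<Sum>m\<in>UNIV. ((\<rho> / 2) *\<^sub>R axis l (1::real)) $ m *\<^sub>R a m) = (\<Sum>m\<in>UNIV. if m = l then (\<rho> / 2) *\<^sub>R a m else 0)"
      by (intro sum.cong) (auto simp: axis_def)
    then show ?thesis by simp
  qed
  have "norm ((\<rho> / 2) *\<^sub>R axis l (1::real)) < \<rho>" using flow(2) by (simp add: norm_axis)
  from flow_is_exp(2)[OF flow(1) y(1) this smooth_S] show ?thesis
    unfolding ax using flow(2) S_center[OF y(2)] by simp
qed

text \<open>At the origin the columns are the fields \<open>commutator X (B l) y\<close>, which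
  span. A surjective endomorphism is injective, hence bounded below.\<close>

lemma J_center_bounded_below:
  assumes flow: "flow_on \<alpha> S N \<rho> K E D" "0 < \<rho>" and y: "y \<in> N" "y \<in> \<Omega>"
  shows "\<exists>c>0. \<forall>h. c * norm h \<le> norm (J y 0 *v h)"
proof -
  let ?b = "\<lambda>j. commutator X (B j) y"
  have J: "J y 0 *v h = (\<Sum>l\<in>UNIV. h $ l *\<^sub>R ?b l)" for h
    by (simp add: frame_matrix_vec D_center[OF flow y])
  have lin: "linear ((*v) (J y 0))" by (rule matrix_vector_mul_linear)
  have "?b j \<in> range ((*v) (J y 0))" for j
  proof (rule image_eqI)
    have "(\<Sum>l\<in>UNIV. axis j (1::real) $ l *\<^sub>R ?b l) = (\<Sum>l\<in>UNIV. if l = j then ?b l else 0)"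
      by (intro sum.cong) (auto simp: axis_def)
    then show "?b j = J y 0 *v axis j 1" unfolding J by simp
  qed simp
  then have "span (range ?b) \<subseteq> range ((*v) (J y 0))"
    by (intro span_minimal linear_subspace_image lin) auto
  moreover have "span (range ?b) = UNIV" using basis y(2) by (simp add: basis_multiindices_def)
  ultimately have "surj ((*v) (J y 0))" by auto
  then have "inj ((*v) (J y 0))" using linear_surjective_imp_injective[OF lin] by blast
  from linear_inj_bounded_below_pos[OF lin this] show ?thesis by metis
qed

text \<open>Radius and constants are common to all base points in a ball about \<open>y0\<close>.
  The number \<open>c\<close> bounds from below both the Jacobian and the displacement under
  \<open>E y\<close>, so it controls the inverse and the derivative of the inverse.\<close>

definition uniform_chart :: "real^'a \<Rightarrow> real \<Rightarrow> real \<Rightarrow> real \<Rightarrow> real \<Rightarrow> bool" where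
  "uniform_chart y0 \<epsilon> \<rho> K c \<longleftrightarrow> 0 < c \<and> 0 < \<rho> \<and> 0 < \<epsilon> \<and> ball y0 \<epsilon> \<subseteq> \<Omega> \<and> flow_on \<alpha> S (ball y0 \<epsilon>) \<rho> K E D \<and>
     (\<forall>y\<in>ball y0 \<epsilon>. \<forall>u. norm u < \<rho> \<longrightarrow> E y u \<in> \<Omega> \<and> (\<forall>h. c * norm h \<le> norm (J y u *v h)) \<and>
        (\<forall>w. norm w < \<rho> \<longrightarrow> c * norm (u - w) \<le> norm (E y u - E y w)))"

lemma uniform_chartD:
  assumes "uniform_chart y0 \<epsilon> \<rho> K c"
  shows "0 < c" "0 < \<rho>" "0 < \<epsilon>" "ball y0 \<epsilon> \<subseteq> \<Omega>" "flow_on \<alpha> S (ball y0 \<epsilon>) \<rho> K E D"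
    "\<lbrakk>y \<in> ball y0 \<epsilon>; norm u < \<rho>\<rbrakk> \<Longrightarrow> E y u \<in> \<Omega>"
    "\<lbrakk>y \<in> ball y0 \<epsilon>; norm u < \<rho>\<rbrakk> \<Longrightarrow> c * norm h \<le> norm (J y u *v h)"
    "\<lbrakk>y \<in> ball y0 \<epsilon>; norm u < \<rho>; norm w < \<rho>\<rbrakk> \<Longrightarrow> c * norm (u - w) \<le> norm (E y u - E y w)"
    "0 \<le> K"
  using assms unfolding uniform_chart_def flow_on_def by blast+

lemma J_diff:
  assumes flow: "flow_on \<alpha> S N \<rho> K E D" and y: "y \<in> N" "z \<in> N" and u: "norm u < \<rho>" "norm w < \<rho>"
  shows "norm (J y u *v h - J z w *v h) \<le> real CARD('a) * (K * norm (u - w) + K * dist y z powr \<alpha>) * norm h"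
proof (rule frame_matrix_diff_le)
  fix l
  have "norm (D y l u - D z l w) \<le> norm (D y l u - D y l w) + norm (D y l w - D z l w)"
    using norm_triangle_ineq[of "D y l u - D y l w" "D y l w - D z l w"] by simp
  then show "norm (D y l u - D z l w) \<le> K * norm (u - w) + K * dist y z powr \<alpha>"
    using flow_onD(8)[OF flow y(1) u, of l] flow_onD(6)[OF flow y(1) u(2) y(2), of l] by simp
qed

text \<open>Near \<open>y0\<close> and 0 the Jacobian differs from \<open>J y0 0\<close> by at most
  half the lower bound of the latter. The mean value inequality for \<open>E y\<close> minus this
  fixed linear map transfers the bound to \<open>E y\<close>, hence injectivity on a ball whose
  radius is uniform in \<open>y\<close>.\<close>

lemma uniform_chart_exists:
  assumes y0: "y0 \<in> \<Omega>"
  shows "\<exists>\<epsilon> \<rho> K c. uniform_chart y0 \<epsilon> \<rho> K c"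
proof -
  obtain e s K where pos: "e > 0" "s > 0" and sub: "ball y0 e \<subseteq> \<Omega>" and flow: "flow_on \<alpha> S (ball y0 e) s K E D"
    using flow_at[OF y0] by blast
  have y0e: "y0 \<in> ball y0 e" using pos by simp
  have K: "0 \<le> K" using flow by (simp add: flow_on_def)
  obtain c where c: "c > 0" "\<And>h. c * norm h \<le> norm (J y0 0 *v h)"
    using J_center_bounded_below[OF flow pos(2) y0e y0] by blast
  let ?q = "real CARD('a)"
  have q: "?q > 0" by simp
  obtain d where d: "d > 0" "ball y0 d \<subseteq> \<Omega>" using open_\<Omega> y0 open_contains_ball by blast
  \<comment> \<open>The first entry lets the Jacobian move by at most c/2, one half of it on account
    of \<open>u\<close> and the other of \<open>y\<close>; the second keeps \<open>E y u\<close>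
    within d/2 of \<open>y\<close>. \<open>K + 1\<close> replaces \<open>K\<close>, which may be
    0.\<close>
  define \<eta> where "\<eta> = min (c / (4 * ?q * (K + 1))) (d / (2 * (K + 1)))"
  have \<eta>: "\<eta> > 0" using c(1) d(1) K q by (simp add: \<eta>_def)
  define \<rho> where "\<rho> = min s \<eta>"
  \<comment> \<open>The power 1/\<alpha> compensates for the Jacobian being only \<alpha>-Hoelder
    continuous in \<open>y\<close>.\<close>
  define \<epsilon> where "\<epsilon> = min (min e (d / 2)) (\<eta> powr (1 / \<alpha>))"
  have \<epsilon>: "\<epsilon> > 0" "\<epsilon> \<le> e" "\<epsilon> \<le> d / 2" "\<epsilon> \<le> \<eta> powr (1 / \<alpha>)" using pos d \<eta> by (auto simp: \<epsilon>_def)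
  have \<rho>: "\<rho> > 0" "\<rho> \<le> s" "\<rho> \<le> \<eta>" using pos \<eta> by (auto simp: \<rho>_def)
  have flow': "flow_on \<alpha> S (ball y0 \<epsilon>) \<rho> K E D" by (rule flow_on_mono[OF flow]) (use \<epsilon> \<rho> in auto)
  have y0': "y0 \<in> ball y0 \<epsilon>" using \<epsilon> by simp
  have K\<eta>: "?q * (K * \<eta> + K * \<eta>) \<le> c / 2" "K * \<eta> \<le> d / 2"
  proof -
    have "\<eta> \<le> c / (4 * ?q * (K + 1))" "\<eta> \<le> d / (2 * (K + 1))" by (simp_all add: \<eta>_def)
    then have a: "\<eta> * (4 * ?q * (K + 1)) \<le> c" "\<eta> * (2 * (K + 1)) \<le> d"
      using K q by (simp_all only: pos_le_divide_eq mult_pos_pos add_nonneg_pos zero_less_one zero_less_numeral)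
    have "0 \<le> \<eta> * ?q" using \<eta> by simp
    then have "4 * (?q * (K * \<eta>)) \<le> \<eta> * (4 * ?q * (K + 1))" "2 * (K * \<eta>) \<le> \<eta> * (2 * (K + 1))"
      using \<eta> by (simp_all add: algebra_simps)
    then have "4 * (?q * (K * \<eta>)) \<le> c" "2 * (K * \<eta>) \<le> d" using a by linarith+
    moreover have "?q * (K * \<eta> + K * \<eta>) = 2 * (?q * (K * \<eta>))" by (simp add: algebra_simps)
    ultimately show "?q * (K * \<eta> + K * \<eta>) \<le> c / 2" "K * \<eta> \<le> d / 2" by linarith+
  qed
  have near: "norm (J y u *v h - J y0 0 *v h) \<le> c / 2 * norm h" if y: "y \<in> ball y0 \<epsilon>" and u: "norm u < \<rho>" for y u h
  proof -
    have "dist y y0 powr \<alpha> \<le> (\<eta> powr (1 / \<alpha>)) powr \<alpha>"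
      using y \<epsilon>(4) \<alpha> by (intro powr_mono2) (auto simp: dist_commute)
    also have "\<dots> = \<eta>" using \<alpha> \<eta> by (simp add: powr_powr)
    finally have dy: "dist y y0 powr \<alpha> \<le> \<eta>" .
    have "norm (J y u *v h - J y0 0 *v h) \<le> ?q * (K * norm (u - 0) + K * dist y y0 powr \<alpha>) * norm h"
      by (rule J_diff[OF flow' y y0' u]) (use \<rho> in simp)
    also have "\<dots> \<le> ?q * (K * \<eta> + K * \<eta>) * norm h"
      using u \<rho>(3) dy K by (intro mult_right_mono mult_left_mono add_mono) auto
    also have "\<dots> \<le> c / 2 * norm h" by (intro mult_right_mono K\<eta>) simp
    finally show ?thesis .
  qed
  have low: "c / 2 * norm h \<le> norm (J y u *v h)" if "y \<in> ball y0 \<epsilon>" "norm u < \<rho>" for y u h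
    using near[OF that, of h] c(2)[of h] norm_triangle_ineq2[of "J y0 0 *v h" "J y u *v h"]
    by (simp add: norm_minus_commute)
  have lowE: "c / 2 * norm (u - w) \<le> norm (E y u - E y w)"
    if y: "y \<in> ball y0 \<epsilon>" and u: "norm u < \<rho>" and w: "norm w < \<rho>" for y u w
  proof -
    let ?f = "\<lambda>u. E y u - J y0 0 *v u"
    have "norm (?f u - ?f w) \<le> c / 2 * norm (u - w)"
    proof (rule differentiable_bound[where S = "ball 0 \<rho>"])
      fix x :: "real^'a" assume x: "x \<in> ball 0 \<rho>"
      have bl: "bounded_linear ((*v) (J y0 0))" by (rule matrix_vector_mul_bounded_linear)
      have "(E y has_derivative (\<lambda>h. J y x *v h)) (at x)"
        using flow_onD(3)[OF flow' y] x unfolding frame_matrix_vec by simp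
      then show "(?f has_derivative (\<lambda>h. J y x *v h - J y0 0 *v h)) (at x within ball 0 \<rho>)"
        by (rule has_derivative_at_withinI[OF has_derivative_diff[OF _ bounded_linear_imp_has_derivative[OF bl]]])
      show "onorm (\<lambda>h. J y x *v h - J y0 0 *v h) \<le> c / 2"
        by (rule onorm_le) (use near[OF y, of x] x in simp)
    qed (use u w in auto)
    moreover have "c * norm (u - w) \<le> norm (J y0 0 *v (u - w))" by (rule c(2))
    moreover have "norm (J y0 0 *v (u - w)) \<le> norm (E y u - E y w) + norm (?f u - ?f w)"
    proof -
      have "J y0 0 *v (u - w) = (E y u - E y w) - (?f u - ?f w)"
        by (simp add: matrix_vector_mult_diff_distrib)
      then show ?thesis by (metis norm_triangle_ineq4)
    qed
    ultimately show ?thesis by simp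
  qed
  have in\<Omega>: "E y u \<in> \<Omega>" if y: "y \<in> ball y0 \<epsilon>" and u: "norm u < \<rho>" for y u
  proof -
    have "norm (E y u - E y 0) \<le> K * norm (u - 0)" by (rule flow_onD(7)[OF flow' y u]) (use \<rho> in simp)
    also have "\<dots> \<le> K * \<eta>" using u \<rho> K by (intro mult_left_mono) auto
    finally have "dist (E y u) y \<le> d / 2" using K\<eta>(2) flow_onD(2)[OF flow' y] by (simp add: dist_norm)
    moreover have "dist y y0 < d / 2" using y \<epsilon>(3) by (simp add: dist_commute)
    ultimately have "dist (E y u) y0 < d" using dist_triangle[of "E y u" y0 y] by simp
    then show ?thesis using d(2) by (auto simp: dist_commute)
  qed
  have "uniform_chart y0 \<epsilon> \<rho> K (c / 2)"
    unfolding uniform_chart_def using c(1) \<rho>(1) \<epsilon>(1) flow' in\<Omega> low lowE subset_trans[OF subset_ball[OF \<epsilon>(2)] sub] by simp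
  then show ?thesis by blast
qed

text \<open>The union of all balls that some chart grants at \<open>y\<close>, not one chosen
  radius: a choice would depend on \<open>y\<close> without control, whereas the union is open in
  \<open>u\<close> and \<open>y\<close> jointly.\<close>

definition "U y = {u :: real^'a. \<exists>y0 \<epsilon> \<rho> K c. uniform_chart y0 \<epsilon> \<rho> K c \<and> y \<in> ball y0 \<epsilon> \<and> norm u < \<rho>}"

lemma mem_U: "u \<in> U y \<longleftrightarrow> (\<exists>y0 \<epsilon> \<rho> K c. uniform_chart y0 \<epsilon> \<rho> K c \<and> y \<in> ball y0 \<epsilon> \<and> norm u < \<rho>)"
  by (simp add: U_def)

definition "V y = E y ` U y"

definition "\<Theta> y = inv_into (U y) (E y)"

lemma ball_subset_U: "uniform_chart y0 \<epsilon> \<rho> K c \<Longrightarrow> y \<in> ball y0 \<epsilon> \<Longrightarrow> ball 0 \<rho> \<subseteq> U y"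
proof
  fix u :: "real^'a" assume "uniform_chart y0 \<epsilon> \<rho> K c" "y \<in> ball y0 \<epsilon>" "u \<in> ball 0 \<rho>"
  then show "u \<in> U y" unfolding mem_U by (intro exI[of _ y0] exI[of _ \<epsilon>] exI[of _ \<rho>] exI[of _ K] exI[of _ c]) simp
qed

lemma open_U: "open (U y)"
proof (subst open_subopen, rule ballI)
  fix u assume "u \<in> U y"
  then obtain y0 \<epsilon> \<rho> K c where g: "uniform_chart y0 \<epsilon> \<rho> K c" "y \<in> ball y0 \<epsilon>" "norm u < \<rho>" unfolding mem_U by blast
  then show "\<exists>T. open T \<and> u \<in> T \<and> T \<subseteq> U y"
    using ball_subset_U[OF g(1,2)] by (intro exI[of _ "ball 0 \<rho>"]) simp
qed

lemma zero_in_U: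
  assumes "y \<in> \<Omega>"
  shows "0 \<in> U y"
proof -
  from uniform_chart_exists[OF assms] obtain \<epsilon> \<rho> K c where g: "uniform_chart y \<epsilon> \<rho> K c" by blast
  have "y \<in> ball y \<epsilon>" using uniform_chartD(3)[OF g] by simp
  from ball_subset_U[OF g this] show ?thesis using uniform_chartD(2)[OF g] by auto
qed

text \<open>The charts at \<open>y\<close> provide concentric balls, so the larger one contains both
  points. This gives injectivity on the union.\<close>

lemma U_two:
  assumes "u \<in> U y" "w \<in> U y"
  shows "\<exists>y0 \<epsilon> \<rho> K c. uniform_chart y0 \<epsilon> \<rho> K c \<and> y \<in> ball y0 \<epsilon> \<and> norm u < \<rho> \<and> norm w < \<rho>"
proof -
  obtain y0 \<epsilon> \<rho> K c where 1: "uniform_chart y0 \<epsilon> \<rho> K c" "y \<in> ball y0 \<epsilon>" "norm u < \<rho>" using assms(1) mem_U by blast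
  obtain y0' \<epsilon>' \<rho>' K' c' where 2: "uniform_chart y0' \<epsilon>' \<rho>' K' c'" "y \<in> ball y0' \<epsilon>'" "norm w < \<rho>'" using assms(2) mem_U by blast
  show ?thesis
  proof (cases "\<rho> \<le> \<rho>'")
    case True
    then show ?thesis using 1(3) 2 by (meson order_less_le_trans)
  next
    case False
    then have "norm w < \<rho>" using 2(3) by simp
    then show ?thesis using 1 by blast
  qed
qed

lemma inj_E: "inj_on (E y) (U y)"
proof (rule inj_onI)
  fix u w assume "u \<in> U y" "w \<in> U y" and eq: "E y u = E y w"
  then obtain y0 \<epsilon> \<rho> K c where g: "uniform_chart y0 \<epsilon> \<rho> K c" "y \<in> ball y0 \<epsilon>" "norm u < \<rho>" "norm w < \<rho>"
    using U_two by blast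
  have "c * norm (u - w) \<le> 0" using uniform_chartD(8)[OF g] eq by simp
  then show "u = w" using uniform_chartD(1)[OF g(1)] by (simp add: mult_le_0_iff)
qed

lemma \<Theta>_E: "u \<in> U y \<Longrightarrow> \<Theta> y (E y u) = u"
  unfolding \<Theta>_def by (rule inv_into_f_f[OF inj_E])

lemma E_\<Theta>: "x \<in> V y \<Longrightarrow> \<Theta> y x \<in> U y \<and> E y (\<Theta> y x) = x"
  unfolding V_def \<Theta>_def using f_inv_into_f inv_into_into by metis

lemma V_subset: "V y \<subseteq> \<Omega>"
  unfolding V_def using mem_U uniform_chartD(6) by blast

lemma y_in_V: "y \<in> \<Omega> \<Longrightarrow> y \<in> V y"
proof -
  assume y: "y \<in> \<Omega>"
  from uniform_chart_exists[OF y] obtain \<epsilon> \<rho> K c where g: "uniform_chart y \<epsilon> \<rho> K c" by blast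
  have "E y 0 = y" by (rule flow_onD(2)[OF uniform_chartD(5)[OF g]]) (use uniform_chartD(3)[OF g] in simp)
  then show ?thesis unfolding V_def using zero_in_U[OF y] by (metis image_eqI)
qed

lemma is_exp_E: "u \<in> U y \<Longrightarrow> is_exp (canonical_field r X B y u) y (E y u)"
  unfolding mem_U canonical_field_eq using flow_is_exp(1)[OF uniform_chartD(5) _ _ smooth_S] by blast

lemma smooth_E: "smooth_on (U y) (E y)"
  unfolding smooth_on_def
proof (intro allI C_on_local)
  fix k u assume "u \<in> U y"
  then obtain y0 \<epsilon> \<rho> K c where g: "uniform_chart y0 \<epsilon> \<rho> K c" "y \<in> ball y0 \<epsilon>" "norm u < \<rho>" using mem_U by blast
  have "C_on k (ball 0 \<rho>) (E y)" using flow_onD(1)[OF uniform_chartD(5)[OF g(1)] g(2)] unfolding smooth_on_def by blast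
  then show "\<exists>T. open T \<and> u \<in> T \<and> C_on k T (E y)" using g(3) by (intro exI[of _ "ball 0 \<rho>"]) simp
qed

lemma E_has_derivative: "u \<in> U y \<Longrightarrow> (E y has_derivative (\<lambda>h. J y u *v h)) (at u)"
  unfolding mem_U frame_matrix_vec using flow_onD(3)[OF uniform_chartD(5)] by blast

lemma J_bounded_below: "u \<in> U y \<Longrightarrow> \<exists>c>0. \<forall>h. c * norm h \<le> norm (J y u *v h)"
  unfolding mem_U using uniform_chartD(1,7) by blast

lemma det_J: "u \<in> U y \<Longrightarrow> det (J y u) \<noteq> 0"
  using J_bounded_below det_nonzero_of_bounded_below by blast

lemma smooth_D: "smooth_on (U y) (\<lambda>u. D y l u $ i)"
proof (rule smooth_on_cong[OF open_U])
  have "smooth_on (U y) (\<lambda>u. E y u $ i)" using smooth_E smooth_on_vec[OF open_U] by blast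
  then show "smooth_on (U y) (\<lambda>u. pd l (\<lambda>u. E y u $ i) u)" by (rule smooth_on_frechet_derivative[OF open_U])
  show "pd l (\<lambda>u. E y u $ i) u = D y l u $ i" if "u \<in> U y" for u
    using differentiable_nth(2)[of "E y" u i "axis l 1"] E_has_derivative[OF that] differentiableI
    unfolding D_def by (metis differentiable_def)
qed

lemma smooth_J_inv: "smooth_on (U y) (\<lambda>u. matrix_inv (J y u) $ k $ i)"
  by (rule smooth_matrix_inv[OF open_U _ det_J]) (simp_all add: frame_matrix_def smooth_D)

section \<open>Joint openness of the domains\<close>

definition "T = {(u, y). y \<in> \<Omega> \<and> u \<in> U y}"

text \<open>Carrying \<open>y\<close> along makes domain and range subsets of the same Euclidean
  space, as invariance of domain demands.\<close>

definition "\<Phi> = (\<lambda>(u, y). (E y u, y))"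

lemma T_cover:
  assumes "p \<in> T"
  shows "\<exists>y0 \<epsilon> \<rho> K c. uniform_chart y0 \<epsilon> \<rho> K c \<and> p \<in> ball 0 \<rho> \<times> ball y0 \<epsilon>"
proof -
  obtain y0 \<epsilon> \<rho> K c where g: "uniform_chart y0 \<epsilon> \<rho> K c" "snd p \<in> ball y0 \<epsilon>" "norm (fst p) < \<rho>"
    using assms unfolding T_def mem_U by auto
  then have "p \<in> ball 0 \<rho> \<times> ball y0 \<epsilon>" by (simp add: mem_Times_iff)
  then show ?thesis using g(1) by blast
qed

lemma uniform_chart_subset_T:
  assumes g: "uniform_chart y0 \<epsilon> \<rho> K c"
  shows "ball 0 \<rho> \<times> ball y0 \<epsilon> \<subseteq> T"
proof (rule subrelI)
  fix u y assume "(u, y) \<in> ball (0 :: real^'a) \<rho> \<times> ball y0 \<epsilon>"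
  then have u: "u \<in> ball 0 \<rho>" and y: "y \<in> ball y0 \<epsilon>" by simp_all
  have "u \<in> U y" by (rule subsetD[OF ball_subset_U[OF g y] u])
  moreover have "y \<in> \<Omega>" by (rule subsetD[OF uniform_chartD(4)[OF g] y])
  ultimately show "(u, y) \<in> T" by (simp add: T_def)
qed

lemma open_T: "open T"
proof (subst open_subopen, rule ballI)
  fix p assume "p \<in> T"
  from T_cover[OF this] obtain y0 \<epsilon> \<rho> K c where g: "uniform_chart y0 \<epsilon> \<rho> K c" "p \<in> ball (0 :: real^'a) \<rho> \<times> ball y0 \<epsilon>" by blast
  then show "\<exists>W. open W \<and> p \<in> W \<and> W \<subseteq> T"
    using uniform_chart_subset_T[OF g(1)] by (intro exI[of _ "ball 0 \<rho> \<times> ball y0 \<epsilon>"] conjI open_Times open_ball)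
qed

lemma E_joint_continuous:
  assumes g: "uniform_chart y0 \<epsilon> \<rho> K c"
  shows "continuous_on (ball (0 :: real^'a) \<rho> \<times> ball y0 \<epsilon>) (\<lambda>(u, y). E y u)"
  unfolding continuous_on_def
proof
  fix p assume p: "p \<in> ball (0 :: real^'a) \<rho> \<times> ball y0 \<epsilon>"
  let ?F = "at p within ball (0 :: real^'a) \<rho> \<times> ball y0 \<epsilon>"
  note flow = uniform_chartD(5)[OF g]
  have p': "snd p \<in> ball y0 \<epsilon>" "norm (fst p) < \<rho>" using p by (auto simp: mem_Times_iff)
  have id: "((\<lambda>z. z) \<longlongrightarrow> p) ?F" by (rule tendsto_ident_at)
  have "((\<lambda>z. K * norm (fst z - fst p) + K * dist (snd z) (snd p) powr \<alpha>) \<longlongrightarrow> K * norm (fst p - fst p) + K * dist (snd p) (snd p) powr \<alpha>) ?F"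
    using \<alpha> by (intro tendsto_intros tendsto_fst[OF id] tendsto_snd[OF id]) auto
  then have lim: "((\<lambda>z. K * norm (fst z - fst p) + K * dist (snd z) (snd p) powr \<alpha>) \<longlongrightarrow> 0) ?F" by simp
  have "\<forall>\<^sub>F z in ?F. norm (E (snd z) (fst z) - E (snd p) (fst p)) \<le> K * norm (fst z - fst p) + K * dist (snd z) (snd p) powr \<alpha>"
    unfolding eventually_at_filter
  proof (rule always_eventually, intro allI impI)
    fix z assume "z \<in> ball (0 :: real^'a) \<rho> \<times> ball y0 \<epsilon>"
    then have z: "snd z \<in> ball y0 \<epsilon>" "norm (fst z) < \<rho>" by (auto simp: mem_Times_iff)
    have "norm (E (snd z) (fst z) - E (snd p) (fst p)) \<le> norm (E (snd z) (fst z) - E (snd z) (fst p)) + norm (E (snd z) (fst p) - E (snd p) (fst p))"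
      using norm_triangle_ineq[of "E (snd z) (fst z) - E (snd z) (fst p)" "E (snd z) (fst p) - E (snd p) (fst p)"] by simp
    then show "norm (E (snd z) (fst z) - E (snd p) (fst p)) \<le> K * norm (fst z - fst p) + K * dist (snd z) (snd p) powr \<alpha>"
      using flow_onD(7)[OF flow z(1,2) p'(2)] flow_onD(5)[OF flow z(1) p'(2) p'(1)] by simp
  qed
  then have "((\<lambda>z. norm (E (snd z) (fst z) - E (snd p) (fst p))) \<longlongrightarrow> 0) ?F"
    by (intro tendsto_sandwich[OF _ _ tendsto_const lim]) auto
  then show "((\<lambda>(u, y). E y u) \<longlongrightarrow> (\<lambda>(u, y). E y u) p) ?F"
    unfolding case_prod_unfold using tendsto_norm_zero_iff Lim_null by blast
qed

lemma \<Phi>_continuous_local: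
  assumes "uniform_chart y0 \<epsilon> \<rho> K c"
  shows "continuous_on (ball (0 :: real^'a) \<rho> \<times> ball y0 \<epsilon>) \<Phi>"
  unfolding \<Phi>_def case_prod_unfold
  using E_joint_continuous[OF assms, unfolded case_prod_unfold] by (intro continuous_intros)

lemma inj_\<Phi>: "inj_on \<Phi> T"
proof (rule inj_onI)
  fix p p' assume p: "p \<in> T" "p' \<in> T" and eq: "\<Phi> p = \<Phi> p'"
  have "snd p = snd p'" "E (snd p) (fst p) = E (snd p) (fst p')"
    using eq by (auto simp: \<Phi>_def case_prod_unfold)
  moreover have "fst p \<in> U (snd p)" "fst p' \<in> U (snd p)" using p \<open>snd p = snd p'\<close> by (auto simp: T_def)
  ultimately show "p = p'" using inj_onD[OF inj_E] by (simp add: prod_eq_iff)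
qed

lemma continuous_\<Phi>: "continuous_on T \<Phi>"
proof -
  have "isCont \<Phi> p" if p: "p \<in> T" for p
  proof -
    obtain y0 \<epsilon> \<rho> K c where g: "uniform_chart y0 \<epsilon> \<rho> K c" "p \<in> ball (0 :: real^'a) \<rho> \<times> ball y0 \<epsilon>" using T_cover[OF p] by blast
    have "open (ball (0 :: real^'a) \<rho> \<times> ball y0 \<epsilon>)" by (intro open_Times open_ball)
    then show ?thesis using \<Phi>_continuous_local[OF g(1)] g(2) continuous_on_eq_continuous_at by blast
  qed
  then show ?thesis by (simp add: continuous_at_imp_continuous_on)
qed

lemma \<Phi>_image: "\<Phi> ` T = {(x, y). y \<in> \<Omega> \<and> x \<in> V y}"
  by (auto simp: \<Phi>_def T_def V_def image_iff)

lemma open_\<Phi>_image: "W \<subseteq> T \<Longrightarrow> open W \<Longrightarrow> open (\<Phi> ` W)"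
  by (rule invariance_of_domain) (auto intro: continuous_on_subset[OF continuous_\<Phi>] inj_on_subset[OF inj_\<Phi>])

lemma open_V_graph: "open {(x, y). y \<in> \<Omega> \<and> x \<in> V y}"
  using open_\<Phi>_image[OF subset_refl open_T] unfolding \<Phi>_image .

text \<open>Openness of \<open>\<Phi>\<close> provides a neighbourhood on which the coordinates stay in one and the same ball.\<close>

lemma local_inverse:
  assumes "y \<in> \<Omega>" "x \<in> V y"
  obtains y0 \<epsilon> \<rho> K c \<delta> where "uniform_chart y0 \<epsilon> \<rho> K c" "\<delta> > 0"
    "\<And>x' y'. \<lbrakk>x' \<in> ball x \<delta>; y' \<in> ball y \<delta>\<rbrakk> \<Longrightarrow>
      y' \<in> ball y0 \<epsilon> \<and> x' \<in> V y' \<and> norm (\<Theta> y' x') < \<rho> \<and> E y' (\<Theta> y' x') = x'"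
proof -
  obtain u where u: "u \<in> U y" "x = E y u" using assms(2) by (auto simp: V_def)
  then obtain y0 \<epsilon> \<rho> K c where g: "uniform_chart y0 \<epsilon> \<rho> K c" "y \<in> ball y0 \<epsilon>" "norm u < \<rho>" using mem_U by blast
  let ?W = "ball (0 :: real^'a) \<rho> \<times> ball y0 \<epsilon>"
  have W: "?W \<subseteq> T" "open ?W" using uniform_chart_subset_T[OF g(1)] by (simp_all add: open_Times)
  have "\<Phi> (u, y) \<in> \<Phi> ` ?W" using g(2,3) by (intro imageI) simp
  then have xy: "(x, y) \<in> \<Phi> ` ?W" by (simp add: \<Phi>_def u(2))
  obtain A A' where A: "open A" "open A'" "(x, y) \<in> A \<times> A'" "A \<times> A' \<subseteq> \<Phi> ` ?W"
    by (rule open_prod_elim[OF open_\<Phi>_image[OF W] xy])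
  obtain d where d: "d > 0" "ball x d \<subseteq> A" using A(1,3) open_contains_ball by (metis mem_Sigma_iff)
  obtain d' where d': "d' > 0" "ball y d' \<subseteq> A'" using A(2,3) open_contains_ball by (metis mem_Sigma_iff)
  show ?thesis
  proof (rule that[OF g(1), of "min d d'"])
    fix x' y' assume "x' \<in> ball x (min d d')" "y' \<in> ball y (min d d')"
    then have "x' \<in> A" "y' \<in> A'" using d(2) d'(2) by auto
    then have "(x', y') \<in> \<Phi> ` ?W" using A(4) by blast
    then obtain u' where u': "norm u' < \<rho>" "y' \<in> ball y0 \<epsilon>" "x' = E y' u'" by (auto simp: \<Phi>_def)
    have "u' \<in> U y'" unfolding mem_U using g(1) u' by blast
    then show "y' \<in> ball y0 \<epsilon> \<and> x' \<in> V y' \<and> norm (\<Theta> y' x') < \<rho> \<and> E y' (\<Theta> y' x') = x'"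
      using u' \<Theta>_E[of u' y'] by (simp add: V_def)
  qed (use d d' in simp)
qed

section \<open>Regularity of the coordinate map in both variables\<close>

lemma open_V: "open (V y)"
  unfolding V_def using smooth_E[of y] inj_E open_U
  by (intro invariance_of_domain) (auto simp: smooth_on_def dest: spec[of _ 0])

text \<open>Since \<open>x\<close> is the image of both points, \<open>E y1 (\<Theta> y1 x)\<close>
  and \<open>E y1 (\<Theta> y2 x)\<close> differ only by the change of \<open>E\<close> with its
  parameter. The lower bound \<open>c\<close> turns this into a bound for \<Theta>.\<close>

lemma \<Theta>_holder_local:
  assumes g: "uniform_chart y0 \<epsilon> \<rho> K c" and y: "y1 \<in> ball y0 \<epsilon>" "y2 \<in> ball y0 \<epsilon>"
    and u: "norm (\<Theta> y1 x) < \<rho>" "norm (\<Theta> y2 x) < \<rho>" "E y1 (\<Theta> y1 x) = x" "E y2 (\<Theta> y2 x) = x"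
  shows "norm (\<Theta> y1 x - \<Theta> y2 x) \<le> K / c * dist y1 y2 powr \<alpha>"
proof -
  have "c * norm (\<Theta> y1 x - \<Theta> y2 x) \<le> norm (E y1 (\<Theta> y1 x) - E y1 (\<Theta> y2 x))"
    by (rule uniform_chartD(8)[OF g y(1) u(1,2)])
  also have "\<dots> = norm (E y2 (\<Theta> y2 x) - E y1 (\<Theta> y2 x))" using u by simp
  also have "\<dots> \<le> K * dist y1 y2 powr \<alpha>"
    using flow_onD(5)[OF uniform_chartD(5)[OF g] y(2) u(2) y(1)] by (simp add: dist_commute)
  finally show ?thesis using uniform_chartD(1)[OF g] by (simp add: field_simps)
qed

lemma holder_\<Theta>: "holder_dependence \<alpha> {(x, y). y \<in> \<Omega> \<and> x \<in> V y} \<Theta>"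
  unfolding holder_dependence_def
proof (intro ballI, clarify)
  fix x y assume y: "y \<in> \<Omega>" and x: "x \<in> V y"
  obtain y0 \<epsilon> \<rho> K c \<delta> where g: "uniform_chart y0 \<epsilon> \<rho> K c" "\<delta> > 0" and
    loc: "\<And>x' y'. \<lbrakk>x' \<in> ball x \<delta>; y' \<in> ball y \<delta>\<rbrakk> \<Longrightarrow>
      y' \<in> ball y0 \<epsilon> \<and> x' \<in> V y' \<and> norm (\<Theta> y' x') < \<rho> \<and> E y' (\<Theta> y' x') = x'"
    using local_inverse[OF y x] by metis
  have "dist (\<Theta> y1 x') (\<Theta> y2 x') \<le> K / c * dist y1 y2 powr \<alpha>"
    if "x' \<in> ball x \<delta>" "y1 \<in> ball y \<delta>" "y2 \<in> ball y \<delta>" for x' y1 y2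
    using loc[OF that(1,2)] loc[OF that(1,3)] unfolding dist_norm[of "\<Theta> y1 x'"]
    by (intro \<Theta>_holder_local[OF g(1)]) auto
  then show "\<exists>\<epsilon>>0. \<exists>C. \<forall>x'\<in>ball x \<epsilon>. \<forall>y1\<in>ball y \<epsilon>. \<forall>y2\<in>ball y \<epsilon>.
     (x', y1) \<in> {(x, y). y \<in> \<Omega> \<and> x \<in> V y} \<longrightarrow> (x', y2) \<in> {(x, y). y \<in> \<Omega> \<and> x \<in> V y} \<longrightarrow>
     dist (\<Theta> y1 x') (\<Theta> y2 x') \<le> C * dist y1 y2 powr \<alpha>"
    using g(2) by blast
qed

lemma continuous_\<Theta>:
  assumes y: "y \<in> \<Omega>" and x: "x \<in> V y"
  shows "isCont (\<Theta> y) x"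
proof -
  obtain y0 \<epsilon> \<rho> K c \<delta> where g: "uniform_chart y0 \<epsilon> \<rho> K c" "\<delta> > 0" and
    loc: "\<And>x' y'. \<lbrakk>x' \<in> ball x \<delta>; y' \<in> ball y \<delta>\<rbrakk> \<Longrightarrow>
      y' \<in> ball y0 \<epsilon> \<and> x' \<in> V y' \<and> norm (\<Theta> y' x') < \<rho> \<and> E y' (\<Theta> y' x') = x'"
    using local_inverse[OF y x] by metis
  have yy: "y \<in> ball y \<delta>" "x \<in> ball x \<delta>" using g(2) by auto
  have lip: "dist (\<Theta> y x') (\<Theta> y x) \<le> dist x' x / c" if "x' \<in> ball x \<delta>" for x'
  proof -
    have "c * norm (\<Theta> y x' - \<Theta> y x) \<le> norm (E y (\<Theta> y x') - E y (\<Theta> y x))"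
      using loc[OF that yy(1)] loc[OF yy(2,1)] by (intro uniform_chartD(8)[OF g(1)]) auto
    then have "c * norm (\<Theta> y x' - \<Theta> y x) \<le> norm (x' - x)" using loc[OF that yy(1)] loc[OF yy(2,1)] by simp
    then show ?thesis using uniform_chartD(1)[OF g(1)] by (simp add: dist_norm field_simps)
  qed
  have "((\<lambda>x'. dist x' x / c) \<longlongrightarrow> dist x x / c) (at x)"
    by (intro tendsto_intros) (use uniform_chartD(1)[OF g(1)] in simp)
  then have lim: "((\<lambda>x'. dist x' x / c) \<longlongrightarrow> 0) (at x)" by simp
  have "\<forall>\<^sub>F x' in at x. dist (\<Theta> y x') (\<Theta> y x) \<le> dist x' x / c"
    unfolding eventually_at using g(2) lip by (intro exI[of _ \<delta>]) (auto simp: dist_commute)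
  then have "((\<lambda>x'. dist (\<Theta> y x') (\<Theta> y x)) \<longlongrightarrow> 0) (at x)"
    by (intro tendsto_sandwich[OF _ _ tendsto_const lim]) auto
  then show ?thesis unfolding isCont_def using tendsto_dist_iff by blast
qed

lemma \<Theta>_has_derivative:
  assumes y: "y \<in> \<Omega>" and x: "x \<in> V y"
  shows "(\<Theta> y has_derivative (\<lambda>h. matrix_inv (J y (\<Theta> y x)) *v h)) (at x)"
proof (rule has_derivative_inverse_basic[where f = "E y" and f' = "\<lambda>h. J y (\<Theta> y x) *v h" and T = "V y"])
  have u: "\<Theta> y x \<in> U y" using E_\<Theta>[OF x] by blast
  show "(E y has_derivative (\<lambda>h. J y (\<Theta> y x) *v h)) (at (\<Theta> y x))" by (rule E_has_derivative[OF u])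
  show "bounded_linear ((*v) (matrix_inv (J y (\<Theta> y x))))" by (rule matrix_vector_mul_bounded_linear)
  show "(*v) (matrix_inv (J y (\<Theta> y x))) \<circ> (*v) (J y (\<Theta> y x)) = id"
    by (auto simp: fun_eq_iff matrix_vector_mul_assoc matrix_inv_mult[OF det_J[OF u]])
qed (use assms open_V E_\<Theta> continuous_\<Theta> in auto)

text \<open>The derivative of \<Theta> is the smooth function \<open>matrix_inv (J y u)\<close>
  composed with \<Theta> itself, so each order of differentiability yields the next.\<close>

lemma smooth_\<Theta>:
  assumes y: "y \<in> \<Omega>"
  shows "smooth_on (V y) (\<Theta> y)"
proof -
  interpret reg_V: regularity "V y" "continuous_on (V y)" by (rule regularity_continuous[OF open_V])
  have "Ck (continuous_on (V y)) k (V y) (\<lambda>x. \<Theta> y x $ i)" for k i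
  proof (induction k arbitrary: i)
    case 0
    have "isCont (\<lambda>x. \<Theta> y x $ i) x" if "x \<in> V y" for x
      using continuous_\<Theta>[OF y that] by (intro continuous_intros)
    then show ?case by (simp add: continuous_at_imp_continuous_on)
  next
    case (Suc k)
    show ?case
    proof (rule reg_V.Ck_SucI)
      show "((\<lambda>x. \<Theta> y x $ i) has_derivative (\<lambda>h. (matrix_inv (J y (\<Theta> y x)) *v h) $ i)) (at x)" if "x \<in> V y" for x
        by (rule bounded_linear.has_derivative[OF bounded_linear_vec_nth \<Theta>_has_derivative[OF y that]])
      fix v :: "real^'a" assume "v \<in> Basis"
      have "Ck (continuous_on (V y)) k (V y) (\<lambda>x. matrix_inv (J y (\<Theta> y x)) $ i $ m)" for m
      proof (rule Ck_compose[OF regularity_continuous[OF open_U] regularity_continuous[OF open_V], where f = "\<lambda>u. matrix_inv (J y u) $ i $ m"])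
        show "\<Theta> y x \<in> U y" if "x \<in> V y" for x using E_\<Theta>[OF that] by blast
        show "continuous_on (V y) (\<lambda>x. f (\<Theta> y x))" if f: "continuous_on (U y) f" for f :: "real^'a \<Rightarrow> real"
        proof (rule continuous_on_compose2[OF f])
          show "continuous_on (V y) (\<Theta> y)" using continuous_\<Theta>[OF y] by (simp add: continuous_at_imp_continuous_on)
          show "\<Theta> y ` V y \<subseteq> U y" using E_\<Theta> by blast
        qed
        show "Ck (continuous_on (V y)) k (V y) (\<lambda>x. \<Theta> y x \<bullet> b)" if "b \<in> Basis" for b
          using that Suc.IH by (auto simp: Basis_vec_def inner_axis)
        show "Ck (continuous_on (U y)) k (U y) (\<lambda>u. matrix_inv (J y u) $ i $ m)"
          using smooth_J_inv unfolding smooth_on_eq_Ck by blast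
      qed
      then show "Ck (continuous_on (V y)) k (V y) (\<lambda>x. (matrix_inv (J y (\<Theta> y x)) *v v) $ i)"
        unfolding matrix_vector_mult_def by (simp, intro reg_V.Ck_sum reg_V.Ck_mult reg_V.Ck_const)
    qed
  qed
  then show ?thesis by (subst smooth_on_vec[OF open_V]) (simp add: smooth_on_eq_Ck)
qed

lemma diffeomorphism_\<Theta>:
  assumes "y \<in> \<Omega>"
  shows "diffeomorphism (V y) (U y) (\<Theta> y) (E y)"
proof -
  have "homeomorphism (V y) (U y) (\<Theta> y) (E y)"
  proof (rule homeomorphismI)
    show "continuous_on (V y) (\<Theta> y)" using continuous_\<Theta>[OF assms] by (simp add: continuous_at_imp_continuous_on)
    show "continuous_on (U y) (E y)" using smooth_E unfolding smooth_on_def by (metis C_on.simps(1))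
  qed (use E_\<Theta> \<Theta>_E in \<open>auto simp: V_def\<close>)
  then show ?thesis unfolding diffeomorphism_def using open_V open_U smooth_\<Theta>[OF assms] smooth_E by blast
qed

end

section \<open>Comparison of two frames\<close>

text \<open>The constants \<open>c\<close> are a parameter so that two instances can share them.
  Half the radius puts \<open>N\<close> into a compact subset of the domain, where smooth
  coefficients are bounded.\<close>

locale weighted_frame = weighted B N r + canonical_frame \<rho> E D S
  for B :: "'p::finite \<Rightarrow> nat list" and N :: "(real^'p) set" and r :: nat and \<rho> :: real
    and E :: "real^'p \<Rightarrow> real^'p" and D S :: "'p \<Rightarrow> real^'p \<Rightarrow> real^'p" +
  fixes c :: "'p \<Rightarrow> 'p \<Rightarrow> 'p \<Rightarrow> real"
  assumes \<rho>_pos: "0 < \<rho>" and N_sub: "\<And>u. u \<in> N \<Longrightarrow> norm u \<le> \<rho> / 2"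
    and struct: "\<And>i j u. weight (B i) + weight (B j) \<le> r \<Longrightarrow> norm u < \<rho> \<Longrightarrow>
      lie_bracket (S i) (S j) (E u) = (\<Sum>k\<in>UNIV. c i j k *\<^sub>R S k (E u))"
    and det_D: "\<And>u. norm u < \<rho> \<Longrightarrow> det (frame_matrix D u) \<noteq> 0"
begin

definition "\<gamma> i j k u = (if w i + w j \<le> r then c i j k
  else (matrix_inv (frame_matrix S (E u)) *v lie_bracket (S i) (S j) (E u)) $ k)"

lemma bracket_expand:
  assumes u: "norm u < \<rho>"
  shows "lie_bracket (S i) (S j) (E u) = (\<Sum>k\<in>UNIV. \<gamma> i j k u *\<^sub>R S k (E u))"
proof (cases "w i + w j \<le> r")
  case True
  then show ?thesis using struct[OF True u] by (simp add: \<gamma>_def)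
next
  case False
  have "frame_matrix S (E u) *v (matrix_inv (frame_matrix S (E u)) *v lie_bracket (S i) (S j) (E u)) = lie_bracket (S i) (S j) (E u)"
    by (simp add: matrix_vector_mul_assoc matrix_inv_mult[OF frame[OF u]])
  then show ?thesis using False by (simp add: frame_matrix_vec \<gamma>_def)
qed

lemma smooth_imp_bigo:
  assumes "smooth_on (ball 0 \<rho>) f"
  shows "bigo 0 f"
proof -
  have "continuous_on (ball 0 \<rho>) f" using assms unfolding smooth_on_def by (metis C_on.simps(1))
  then have "continuous_on (cball 0 (\<rho> / 2)) f" by (rule continuous_on_subset) (use \<rho>_pos in auto)
  then have "bounded (f ` cball 0 (\<rho> / 2))" by (intro compact_imp_bounded compact_continuous_image compact_cball)
  then obtain b where b: "\<forall>u\<in>cball 0 (\<rho> / 2). \<bar>f u\<bar> \<le> b" unfolding bounded_iff by auto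
  have "\<bar>f u\<bar> \<le> max b 0 * Q u ^ 0" if "u \<in> N" for u
    using bspec[OF b, of u] N_sub[OF that] by simp
  then show ?thesis unfolding bigo_def by (intro exI[of _ "max b 0"]) simp
qed

lemma \<gamma>_bigo: "bigo 0 (\<gamma> i j k)"
proof (cases "w i + w j \<le> r")
  case True
  then have "\<gamma> i j k = (\<lambda>u. c i j k)" by (auto simp: \<gamma>_def)
  then show ?thesis by (simp add: bigo_const)
next
  case False
  have "smooth_on UNIV (\<lambda>x. lie_bracket (S i) (S j) x $ m)" for m
    using smooth_lie_bracket[OF open_UNIV smooth_S smooth_S] smooth_on_vec[OF open_UNIV] by blast
  from smooth_on_compose[OF open_UNIV open_ball UNIV_I this smooth_E]
  have "smooth_on (ball 0 \<rho>) (\<lambda>u. \<Sum>m\<in>UNIV. matrix_inv (frame_matrix S (E u)) $ k $ m * lie_bracket (S i) (S j) (E u) $ m)"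
    by (intro smooth_on_sum smooth_on_mult smooth_frame_inv open_ball)
  then have "bigo 0 (\<lambda>u. \<Sum>m\<in>UNIV. matrix_inv (frame_matrix S (E u)) $ k $ m * lie_bracket (S i) (S j) (E u) $ m)"
    by (rule smooth_imp_bigo)
  moreover have "\<gamma> i j k = (\<lambda>u. \<Sum>m\<in>UNIV. matrix_inv (frame_matrix S (E u)) $ k $ m * lie_bracket (S i) (S j) (E u) $ m)"
    using False by (auto simp: \<gamma>_def matrix_vector_mult_def)
  ultimately show ?thesis by simp
qed

lemma M_system: "frame_system c (\<lambda>u k l. M u $ k $ l) \<gamma>"
  unfolding frame_system_def
proof (intro conjI allI ballI impI)
  show "bigo 0 (\<gamma> i j k)" for i j k by (rule \<gamma>_bigo)
  show "bigo 0 (\<lambda>u. M u $ k $ l)" for k l by (rule smooth_imp_bigo[OF smooth_M])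
  show "\<gamma> i j k u = c i j k" if "w i + w j \<le> r" for i j k u using that by (simp add: \<gamma>_def)
  fix u k l assume u: "u \<in> N"
  have u': "norm u < \<rho>" using N_sub[OF u] \<rho>_pos by simp
  have tu: "norm (t *\<^sub>R u) < \<rho>" if "0 \<le> t" "t \<le> 1" for t
    using that u' mult_left_le_one_le[of "norm u" t] by simp
  show "continuous_on {0..1} (\<lambda>t. M (t *\<^sub>R u) $ k $ l)"
  proof (rule continuous_on_compose2[where f = "\<lambda>t. t *\<^sub>R u" and g = "\<lambda>v. M v $ k $ l"])
    show "continuous_on (ball 0 \<rho>) (\<lambda>v. M v $ k $ l)" using smooth_M unfolding smooth_on_def by (metis C_on.simps(1))
    show "(\<lambda>t. t *\<^sub>R u) ` {0..1} \<subseteq> ball 0 \<rho>" using tu by auto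
  qed (intro continuous_intros)
  fix t :: real assume t: "0 < t" "t < 1"
  show "((\<lambda>t. t * M (t *\<^sub>R u) $ k $ l) has_real_derivative
      (if k = l then 1 else 0) - (\<Sum>j\<in>UNIV. (\<Sum>i\<in>UNIV. u $ i * \<gamma> i j k (t *\<^sub>R u)) * (t * M (t *\<^sub>R u) $ j $ l))) (at t)"
    using transport_equation[OF u' t bracket_expand[OF tu], of k l] t by simp
qed

text \<open>The inverse of \<open>M\<close>: its columns are the coefficients of the frame fields in
  the coordinates \<open>u\<close>.\<close>

definition "A u = matrix_inv (frame_matrix D u) ** frame_matrix S (E u)"

lemma M_A:
  assumes "u \<in> N"
  shows "(\<Sum>j\<in>UNIV. M u $ k $ j * A u $ j $ l) = (if k = l then 1 else 0)"
    and "(\<Sum>j\<in>UNIV. A u $ k $ j * M u $ j $ l) = (if k = l then 1 else 0)"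
proof -
  have u: "norm u < \<rho>" using N_sub[OF assms] \<rho>_pos by simp
  let ?F = "frame_matrix S (E u)" and ?G = "frame_matrix D u"
  note inv = matrix_inv_mult[OF frame[OF u]] matrix_inv_mult[OF det_D[OF u]]
  have "M u ** A u = matrix_inv ?F ** (?G ** matrix_inv ?G) ** ?F" by (simp add: M_def A_def matrix_mul_assoc)
  then have "M u ** A u = mat 1" by (simp add: inv)
  then have "(M u ** A u) $ k $ l = mat 1 $ k $ l" by simp
  then show "(\<Sum>j\<in>UNIV. M u $ k $ j * A u $ j $ l) = (if k = l then 1 else 0)"
    by (simp add: matrix_matrix_mult_def mat_def)
  have "A u ** M u = matrix_inv ?G ** (?F ** matrix_inv ?F) ** ?G" by (simp add: M_def A_def matrix_mul_assoc)
  then have "A u ** M u = mat 1" by (simp add: inv)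
  then have "(A u ** M u) $ k $ l = mat 1 $ k $ l" by simp
  then show "(\<Sum>j\<in>UNIV. A u $ k $ j * M u $ j $ l) = (if k = l then 1 else 0)"
    by (simp add: matrix_matrix_mult_def mat_def)
qed

lemma A_bigo: "bigo 0 (\<lambda>u. A u $ k $ l)"
proof -
  have "smooth_on (ball 0 \<rho>) (\<lambda>u. matrix_inv (frame_matrix D u) $ k $ i)" for i
    by (rule smooth_matrix_inv[OF open_ball _ det_D]) (simp_all add: frame_matrix_def smooth_D)
  then have "smooth_on (ball 0 \<rho>) (\<lambda>u. \<Sum>i\<in>UNIV. matrix_inv (frame_matrix D u) $ k $ i * frame_matrix S (E u) $ i $ l)"
    by (intro smooth_on_sum smooth_on_mult smooth_S_E open_ball)
  then show ?thesis using smooth_imp_bigo by (simp add: A_def matrix_matrix_mult_def)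
qed

end

section \<open>The remainder fields\<close>

lemma locally_holder_compose:
  assumes "locally_holder_on \<alpha> S f" "0 < \<alpha>" and im: "\<And>x. x \<in> T \<Longrightarrow> g x \<in> S"
    and lip: "\<And>x. x \<in> T \<Longrightarrow> \<exists>\<epsilon>>0. \<exists>K\<ge>0. \<forall>y\<in>T. \<forall>z\<in>T. dist x y < \<epsilon> \<longrightarrow> dist x z < \<epsilon> \<longrightarrow> dist (g y) (g z) \<le> K * dist y z"
  shows "locally_holder_on \<alpha> T (\<lambda>x. f (g x))"
proof (rule locally_holder_onI)
  fix x assume x: "x \<in> T"
  obtain e C where e: "e > 0" "C \<ge> 0"
    "\<And>y z. \<lbrakk>y \<in> S; z \<in> S; dist (g x) y < e; dist (g x) z < e\<rbrakk> \<Longrightarrow> dist (f y) (f z) \<le> C * dist y z powr \<alpha>"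
    using locally_holder_onE[OF assms(1) im[OF x]] by metis
  obtain d K where d: "d > 0" "K \<ge> 0"
    and lip': "\<forall>y\<in>T. \<forall>z\<in>T. dist x y < d \<longrightarrow> dist x z < d \<longrightarrow> dist (g y) (g z) \<le> K * dist y z"
    using lip[OF x] by blast
  define s where "s = min d (e / (K + 1))"
  have s: "s > 0" "s \<le> d" using d(1,2) e(1) by (simp_all add: s_def)
  have "s \<le> e / (K + 1)" by (simp add: s_def)
  then have s': "s * (K + 1) \<le> e" using d(2) by (simp add: pos_le_divide_eq)
  have near: "dist (g x) (g y) < e" if "y \<in> T" "dist x y < s" for y
  proof -
    have "dist (g x) (g y) \<le> K * dist x y" using lip' x that s(2) d(1) by simp
    also have "\<dots> \<le> (K + 1) * dist x y" by (simp add: algebra_simps)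
    also have "\<dots> < (K + 1) * s" using that d(2) by (intro mult_strict_left_mono) auto
    finally show ?thesis using s' by (simp add: mult.commute)
  qed
  have "dist (f (g y)) (f (g z)) \<le> (C * K powr \<alpha>) * dist y z powr \<alpha>"
    if y: "y \<in> T" "z \<in> T" "dist x y < s" "dist x z < s" for y z
  proof -
    have "dist (f (g y)) (f (g z)) \<le> C * dist (g y) (g z) powr \<alpha>"
      using e(3)[OF im im near near] y by simp
    also have "\<dots> \<le> C * (K * dist y z) powr \<alpha>"
      using lip' y s(2) e(2) \<open>0 < \<alpha>\<close> by (intro mult_left_mono powr_mono2) auto
    finally show ?thesis using d(2) by (simp add: powr_mult mult_ac)
  qed
  then show "\<exists>\<epsilon>>0. \<exists>C. \<forall>y z. y \<in> T \<longrightarrow> z \<in> T \<longrightarrow> dist x y < \<epsilon> \<longrightarrow> dist x z < \<epsilon> \<longrightarrow> dist (f (g y)) (f (g z)) \<le> C * dist y z powr \<alpha>"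
    using s(1) by blast
qed

lemma smooth_imp_Ck_holder:
  fixes f :: "'a::euclidean_space \<Rightarrow> real"
  assumes "open S" "\<alpha> \<le> 1" "smooth_on S f"
  shows "Ck (locally_holder_on \<alpha> S) k S f"
proof -
  have "C_on (Suc k) S f" using assms(3) unfolding smooth_on_def by blast
  from C_on_Suc_imp_C_holder_on[OF assms(1,2) this] show ?thesis unfolding C_holder_on_eq_Ck .
qed

lemma nonzero_near_zero:
  fixes g :: "real^'p::finite \<Rightarrow> real"
  assumes "smooth_on (ball 0 \<rho>) g" "0 < \<rho>" "g 0 \<noteq> 0"
  shows "\<exists>\<rho>'>0. \<rho>' \<le> \<rho> \<and> (\<forall>u. norm u < \<rho>' \<longrightarrow> g u \<noteq> 0)"
proof -
  have "continuous_on (ball 0 \<rho>) g" using assms(1) unfolding smooth_on_def by (metis C_on.simps(1))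
  then have "isCont g 0" using assms(2) continuous_on_eq_continuous_at[of "ball 0 \<rho>" g] by simp
  from continuous_at_avoid[OF this assms(3)] obtain e where e: "e > 0" "\<forall>u. dist 0 u < e \<longrightarrow> g u \<noteq> 0" by blast
  show ?thesis using e assms(2) by (intro exI[of _ "min e \<rho>"]) simp
qed

lemma sum_axis: "(\<Sum>l\<in>UNIV. h $ l *\<^sub>R axis l 1) = h" for h :: "real^'p::finite"
proof -
  have "(\<Sum>l\<in>UNIV. h $ l *\<^sub>R axis l (1::real)) $ i = (\<Sum>l\<in>UNIV. if l = i then h $ l else 0)" for i
    unfolding sum_component by (intro sum.cong) (auto simp: axis_def)
  then show ?thesis by (simp add: vec_eq_iff)
qed

locale group_approximation = regularized_coordinates +
  fixes Y :: "nat \<Rightarrow> real^'a \<Rightarrow> real^'a"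
  assumes Y_smooth: "\<And>i. i \<le> n \<Longrightarrow> smooth_on UNIV (Y i)" and Y_free: "free_upto n r UNIV Y"
    and Y_basis: "\<And>j. commutator Y (B j) 0 = axis j 1"
    and Y_radial: "\<And>u. u = (\<Sum>j\<in>UNIV. (u $ j) *\<^sub>R commutator Y (B j) u)"
begin

definition "R I y u = matrix_inv (J y u) *v commutator X I (E y u) - commutator Y I u"

lemma smooth_Y: "I \<in> multiindices_upto n r \<Longrightarrow> smooth_on UNIV (commutator Y I)"
  by (intro smooth_commutator Y_smooth) (auto simp: multiindices_upto_def multiindices_def)

lemma range_B: "range B \<subseteq> multiindices_upto n r"
  using B by blast

lemma C_holder_R:
  assumes "y \<in> \<Omega>" and I: "I \<in> multiindices_upto n r"
  shows "C_holder_on \<alpha> (r - weight I) (U y) (R I y)"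
proof (subst C_holder_on_vec[OF open_U \<alpha>], rule allI, unfold C_holder_on_eq_Ck)
  fix k
  let ?P = "locally_holder_on \<alpha> (U y)"
  interpret reg_U: regularity "U y" ?P by (rule regularity_holder[OF open_U \<alpha>])
  have in\<Omega>: "E y u \<in> \<Omega>" if "u \<in> U y" for u using that V_subset by (auto simp: V_def)
  have Xm: "Ck ?P (r - weight I) (U y) (\<lambda>u. commutator X I (E y u) $ m)" for m
  proof (rule Ck_compose[OF regularity_axioms reg_U.regularity_axioms in\<Omega>])
    show "?P (\<lambda>u. f (E y u))" if "H f" for f :: "real^'a \<Rightarrow> real"
    proof (rule locally_holder_compose[OF that \<alpha>(1) in\<Omega>])
      fix u assume "u \<in> U y"
      then obtain y0 \<epsilon> \<rho> K c where g: "uniform_chart y0 \<epsilon> \<rho> K c" "y \<in> ball y0 \<epsilon>" "norm u < \<rho>" unfolding mem_U by blast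
      have near: "norm v < \<rho>" if "dist u v < \<rho> - norm u" for v
        using that norm_triangle_sub[of v u] by (simp add: dist_norm norm_minus_commute)
      have "dist (E y v) (E y w) \<le> K * dist v w" if "dist u v < \<rho> - norm u" "dist u w < \<rho> - norm u" for v w
        unfolding dist_norm by (rule flow_onD(7)[OF uniform_chartD(5)[OF g(1)] g(2) near[OF that(1)] near[OF that(2)]])
      then show "\<exists>\<epsilon>>0. \<exists>K\<ge>0. \<forall>v\<in>U y. \<forall>w\<in>U y. dist u v < \<epsilon> \<longrightarrow> dist u w < \<epsilon> \<longrightarrow> dist (E y v) (E y w) \<le> K * dist v w"
        using g(3) uniform_chartD(9)[OF g(1)] by (intro exI[of _ "\<rho> - norm u"] conjI exI[of _ K]) auto
    qed
    show "Ck ?P (r - weight I) (U y) (\<lambda>u. E y u \<bullet> b)" if "b \<in> Basis" for b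
      by (rule smooth_imp_Ck_holder[OF open_U \<alpha>(2) smooth_on_inner_right[OF open_U smooth_E]])
    show "Ck H (r - weight I) \<Omega> (\<lambda>x. commutator X I x $ m)" by (rule Ck_commutator_X[OF I])
  qed
  have "smooth_on UNIV (\<lambda>u. commutator Y I u $ k)" using smooth_Y[OF I] smooth_on_vec[OF open_UNIV] by blast
  then have Yk: "Ck ?P (r - weight I) (U y) (\<lambda>u. commutator Y I u $ k)"
    by (intro smooth_imp_Ck_holder open_U \<alpha>(2) smooth_on_subset[of UNIV _ "U y"]) simp_all
  have "Ck ?P (r - weight I) (U y) (\<lambda>u. (\<Sum>m\<in>UNIV. matrix_inv (J y u) $ k $ m * commutator X I (E y u) $ m) - commutator Y I u $ k)"
    by (intro reg_U.Ck_diff reg_U.Ck_sum reg_U.Ck_mult Xm Yk smooth_imp_Ck_holder open_U \<alpha>(2) smooth_J_inv)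
  then show "Ck ?P (r - weight I) (U y) (\<lambda>u. R I y u $ k)"
    by (simp add: R_def matrix_vector_mult_def)
qed

lemma commutator_in_coordinates:
  assumes y: "y \<in> \<Omega>" and W: "open W" "smooth_on W f" and x: "x \<in> V y" "\<Theta> y x \<in> W"
  shows "vf_apply (commutator X I) (\<lambda>x'. f (\<Theta> y x')) x =
    vf_apply (commutator Y I) f (\<Theta> y x) + vf_apply (R I y) f (\<Theta> y x)"
proof -
  have df: "f differentiable (at (\<Theta> y x))" by (rule smooth_on_differentiable[OF W(2) x(2)])
  interpret linear "frechet_derivative f (at (\<Theta> y x))" by (rule linear_frechet_derivative[OF df])
  have "vf_apply (commutator X I) (\<lambda>x'. f (\<Theta> y x')) x =
      frechet_derivative f (at (\<Theta> y x)) (matrix_inv (J y (\<Theta> y x)) *v commutator X I x)"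
    unfolding vf_apply_def
    by (subst frechet_derivative_unique[OF has_derivative_compose[OF \<Theta>_has_derivative[OF y x(1)] frechet_derivative_has_derivative[OF df]]]) simp
  also have "matrix_inv (J y (\<Theta> y x)) *v commutator X I x = commutator Y I (\<Theta> y x) + R I y (\<Theta> y x)"
    using E_\<Theta>[OF x(1)] by (simp add: R_def)
  finally show ?thesis by (simp add: vf_apply_def add)
qed

section \<open>Hoelder dependence of the remainders on the base point\<close>

lemma X_bounded_near:
  assumes "x \<in> \<Omega>" "I \<in> multiindices_upto n r"
  shows "\<exists>\<delta>>0. ball x \<delta> \<subseteq> \<Omega> \<and> (\<forall>x'\<in>ball x \<delta>. norm (commutator X I x') \<le> norm (commutator X I x) + 1)"
proof -
  have "C_on (r - weight I) \<Omega> (commutator X I)"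
    by (rule Ck_holder_imp_C_on[OF \<alpha>(1) C_holder_on_commutator_X[OF assms(2)]])
  then have "continuous_on \<Omega> (commutator X I)"
  proof (cases "r - weight I")
    case (Suc k)
    assume "C_on (r - weight I) \<Omega> (commutator X I)"
    then have "\<forall>x\<in>\<Omega>. commutator X I differentiable (at x)" by (simp add: Suc)
    then show ?thesis by (meson continuous_at_imp_continuous_on differentiable_imp_continuous_within)
  qed simp
  then obtain d where d: "d > 0" "\<And>x'. x' \<in> \<Omega> \<Longrightarrow> dist x' x < d \<Longrightarrow> dist (commutator X I x') (commutator X I x) < 1"
    using assms(1) unfolding continuous_on_iff by (metis zero_less_one)
  obtain e where e: "e > 0" "ball x e \<subseteq> \<Omega>" using open_\<Omega> assms(1) open_contains_ball by blast
  have "norm (commutator X I x') \<le> norm (commutator X I x) + 1" if "x' \<in> ball x (min d e)" for x'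
  proof -
    have "x' \<in> \<Omega>" using that e(2) by auto
    moreover have "dist x' x < d" using that by (simp add: dist_commute)
    ultimately have "dist (commutator X I x') (commutator X I x) < 1" by (rule d(2))
    then show ?thesis using norm_triangle_sub[of "commutator X I x'" "commutator X I x"] by (simp add: dist_norm)
  qed
  then show ?thesis using d(1) e by (intro exI[of _ "min d e"]) auto
qed

text \<open>Both the point and the vector may vary: at fixed \<open>x\<close> the points
  \<open>\<Theta> y x\<close> move and the vector stands still, at fixed \<open>u\<close> it is the
  other way round.\<close>

lemma J_perturbation:
  assumes g: "uniform_chart y0 \<epsilon> \<rho> K c" and y: "y1 \<in> ball y0 \<epsilon>" "y2 \<in> ball y0 \<epsilon>" and u: "norm u1 < \<rho>" "norm u2 < \<rho>"
    and uu: "norm (u1 - u2) \<le> L * dist y1 y2 powr \<alpha>" "0 \<le> L" and v: "norm v2 \<le> b" "norm (v1 - v2) \<le> L' * dist y1 y2 powr \<alpha>"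
  shows "norm (matrix_inv (J y1 u1) *v v1 - matrix_inv (J y2 u2) *v v2) \<le>
    ((L' + real CARD('a) * (K * L + K) * (b / c)) / c) * dist y1 y2 powr \<alpha>"
proof -
  let ?d = "dist y1 y2 powr \<alpha>"
  let ?\<eta> = "real CARD('a) * (K * (L * ?d) + K * ?d)"
  note c = uniform_chartD(1)[OF g] and K = uniform_chartD(9)[OF g]
  have b: "0 \<le> b" using order_trans[OF norm_ge_zero v(1)] .
  have "norm (matrix_inv (J y1 u1) *v v1 - matrix_inv (J y2 u2) *v v2) \<le> (norm (v1 - v2) + ?\<eta> * (b / c)) / c"
  proof (rule inverse_perturbation[OF c _ _ _ v(1)])
    show "c * norm h \<le> norm (J y1 u1 *v h)" for h by (rule uniform_chartD(7)[OF g y(1) u(1)])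
    show "c * norm h \<le> norm (J y2 u2 *v h)" for h by (rule uniform_chartD(7)[OF g y(2) u(2)])
    show "norm (J y1 u1 *v h - J y2 u2 *v h) \<le> ?\<eta> * norm h" for h
    proof -
      have "norm (J y1 u1 *v h - J y2 u2 *v h) \<le> real CARD('a) * (K * norm (u1 - u2) + K * ?d) * norm h"
        by (rule J_diff[OF uniform_chartD(5)[OF g] y u])
      also have "\<dots> \<le> ?\<eta> * norm h"
        using uu K by (intro mult_right_mono mult_left_mono add_right_mono) auto
      finally show ?thesis .
    qed
    show "0 \<le> ?\<eta>" using K uu(2) by simp
  qed
  also have "\<dots> \<le> (L' * ?d + ?\<eta> * (b / c)) / c"
    using v(2) c by (intro divide_right_mono add_right_mono) auto
  also have "\<dots> = ((L' + real CARD('a) * (K * L + K) * (b / c)) / c) * ?d"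
    by (simp add: algebra_simps add_divide_distrib)
  finally show ?thesis .
qed

text \<open>For a given \<open>x\<close> the field \<open>commutator X I\<close> is evaluated at
  that one point, so its modulus of continuity does not enter, and the exponent \<alpha> of \<Theta>
  and of the Jacobian is kept for every weight.\<close>

lemma holder_R_at_fixed_x:
  assumes I: "I \<in> multiindices_upto n r"
  shows "holder_dependence \<alpha> {(x, y). y \<in> \<Omega> \<and> x \<in> V y} (\<lambda>y x. R I y (\<Theta> y x))"
  unfolding holder_dependence_def
proof (intro ballI, clarify)
  fix x y assume y: "y \<in> \<Omega>" and x: "x \<in> V y"
  obtain y0 \<epsilon> \<rho> K c \<delta> where g: "uniform_chart y0 \<epsilon> \<rho> K c" "\<delta> > 0" and
    loc: "\<And>x' y'. \<lbrakk>x' \<in> ball x \<delta>; y' \<in> ball y \<delta>\<rbrakk> \<Longrightarrow>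
      y' \<in> ball y0 \<epsilon> \<and> x' \<in> V y' \<and> norm (\<Theta> y' x') < \<rho> \<and> E y' (\<Theta> y' x') = x'"
    using local_inverse[OF y x] by metis
  have "x \<in> \<Omega>" using x V_subset by blast
  from X_bounded_near[OF this I] obtain d where d: "d > 0"
    "\<And>x'. x' \<in> ball x d \<Longrightarrow> norm (commutator X I x') \<le> norm (commutator X I x) + 1" by blast
  let ?b = "norm (commutator X I x) + 1"
  obtain L where L: "L \<ge> 0" "\<forall>u\<in>cball 0 \<rho>. \<forall>v\<in>cball 0 \<rho>. norm (commutator Y I u - commutator Y I v) \<le> L * norm (u - v)"
    using smooth_lipschitz_on_cball[OF smooth_Y[OF I]] by blast
  let ?C = "(0 + real CARD('a) * (K * (K / c) + K) * (?b / c)) / c + L * (K / c)"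
  have Kc: "0 \<le> K / c" using uniform_chartD(1,9)[OF g(1)] by simp
  have "dist (R I y1 (\<Theta> y1 x')) (R I y2 (\<Theta> y2 x')) \<le> ?C * dist y1 y2 powr \<alpha>"
    if x': "x' \<in> ball x (min \<delta> d)" and y1: "y1 \<in> ball y (min \<delta> d)" and y2: "y2 \<in> ball y (min \<delta> d)" for x' y1 y2
  proof -
    let ?d = "dist y1 y2 powr \<alpha>"
    have l1: "y1 \<in> ball y0 \<epsilon>" "norm (\<Theta> y1 x') < \<rho>" "E y1 (\<Theta> y1 x') = x'" using loc[of x' y1] x' y1 by auto
    have l2: "y2 \<in> ball y0 \<epsilon>" "norm (\<Theta> y2 x') < \<rho>" "E y2 (\<Theta> y2 x') = x'" using loc[of x' y2] x' y2 by auto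
    have uu: "norm (\<Theta> y1 x' - \<Theta> y2 x') \<le> K / c * ?d"
      by (rule \<Theta>_holder_local[OF g(1) l1(1) l2(1) l1(2) l2(2) l1(3) l2(3)])
    have 1: "norm (matrix_inv (J y1 (\<Theta> y1 x')) *v commutator X I x' - matrix_inv (J y2 (\<Theta> y2 x')) *v commutator X I x')
       \<le> ((0 + real CARD('a) * (K * (K / c) + K) * (?b / c)) / c) * ?d"
      by (rule J_perturbation[OF g(1) l1(1) l2(1) l1(2) l2(2) uu Kc]) (use d(2)[of x'] x' in auto)
    have 2: "norm (commutator Y I (\<Theta> y1 x') - commutator Y I (\<Theta> y2 x')) \<le> L * (K / c) * ?d"
    proof -
      have "norm (commutator Y I (\<Theta> y1 x') - commutator Y I (\<Theta> y2 x')) \<le> L * norm (\<Theta> y1 x' - \<Theta> y2 x')"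
        using L(2) l1(2) l2(2) by simp
      also have "\<dots> \<le> L * (K / c * ?d)" by (intro mult_left_mono uu L(1))
      finally show ?thesis by (simp add: mult.assoc)
    qed
    have "R I y1 (\<Theta> y1 x') - R I y2 (\<Theta> y2 x') =
        (matrix_inv (J y1 (\<Theta> y1 x')) *v commutator X I x' - matrix_inv (J y2 (\<Theta> y2 x')) *v commutator X I x')
        - (commutator Y I (\<Theta> y1 x') - commutator Y I (\<Theta> y2 x'))"
      by (simp add: R_def l1(3) l2(3))
    then have "norm (R I y1 (\<Theta> y1 x') - R I y2 (\<Theta> y2 x')) \<le>
        ((0 + real CARD('a) * (K * (K / c) + K) * (?b / c)) / c) * ?d + L * (K / c) * ?d"
      using order_trans[OF norm_triangle_ineq4 add_mono[OF 1 2]] by (rule ord_eq_le_trans[OF arg_cong[where f = norm]])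
    then show ?thesis unfolding dist_norm[of "R I y1 (\<Theta> y1 x')"] distrib_right .
  qed
  then show "\<exists>\<epsilon>>0. \<exists>C. \<forall>x'\<in>ball x \<epsilon>. \<forall>y1\<in>ball y \<epsilon>. \<forall>y2\<in>ball y \<epsilon>.
     (x', y1) \<in> {(x, y). y \<in> \<Omega> \<and> x \<in> V y} \<longrightarrow> (x', y2) \<in> {(x, y). y \<in> \<Omega> \<and> x \<in> V y} \<longrightarrow>
     dist (R I y1 (\<Theta> y1 x')) (R I y2 (\<Theta> y2 x')) \<le> C * dist y1 y2 powr \<alpha>"
    using g(2) d(1) by (intro exI[of _ "min \<delta> d"] conjI exI[of _ ?C]) auto
qed

text \<open>If \<alpha> < 1, then \<open>weight I < r\<close> leaves at least one continuous
  derivative.\<close>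

lemma X_locally_lipschitz:
  assumes I: "I \<in> multiindices_upto n r" and "weight I < r \<or> \<alpha> = 1"
  shows "locally_holder_on 1 \<Omega> (commutator X I)"
proof (cases "\<alpha> = 1")
  case True
  have "Ck H 0 \<Omega> (\<lambda>x. commutator X I x $ m)" for m
    by (rule Ck_mono[OF Ck_commutator_X[OF I]]) simp
  then show ?thesis
    by (subst locally_holder_on_componentwise) (simp add: ball_Basis_vec inner_axis True)
next
  case False
  then have "1 \<le> r - weight I" using assms(2) by simp
  then have C1: "Ck H (Suc 0) \<Omega> (\<lambda>x. commutator X I x $ m)" for m
    by (intro Ck_mono[OF Ck_commutator_X[OF I]]) simp
  have "locally_holder_on 1 \<Omega> (\<lambda>x. commutator X I x $ m)" for m
    by (rule C1_imp_locally_holder[OF open_\<Omega> order_refl]) (use C1[of m] locally_holder_imp_continuous[OF \<alpha>(1)] in auto)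
  then show ?thesis
    by (subst locally_holder_on_componentwise) (simp add: ball_Basis_vec inner_axis)
qed

text \<open>For a given \<open>u\<close> the point \<open>E y u\<close> itself moves with
  \<open>y\<close> in an \<alpha>-Hoelder way, and composing with a Lipschitz field keeps the
  exponent.\<close>

lemma holder_R_at_fixed_u:
  assumes I: "I \<in> multiindices_upto n r" and reg: "weight I < r \<or> \<alpha> = 1"
  shows "holder_dependence \<alpha> {(u, y). y \<in> \<Omega> \<and> u \<in> U y} (R I)"
  unfolding holder_dependence_def
proof (intro ballI, clarify)
  fix u y assume y: "y \<in> \<Omega>" and u: "u \<in> U y"
  obtain y0 \<epsilon> \<rho> K c where g: "uniform_chart y0 \<epsilon> \<rho> K c" "y \<in> ball y0 \<epsilon>" "norm u < \<rho>" using u unfolding mem_U by blast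
  let ?x = "E y u"
  have x: "?x \<in> \<Omega>" by (rule uniform_chartD(6)[OF g])
  from X_bounded_near[OF x I] obtain d where d: "d > 0" "ball ?x d \<subseteq> \<Omega>"
    "\<And>x'. x' \<in> ball ?x d \<Longrightarrow> norm (commutator X I x') \<le> norm (commutator X I ?x) + 1" by blast
  obtain e L where e: "e > 0" "L \<ge> 0" "\<And>x1 x2. \<lbrakk>x1 \<in> \<Omega>; x2 \<in> \<Omega>; dist ?x x1 < e; dist ?x x2 < e\<rbrakk> \<Longrightarrow>
      dist (commutator X I x1) (commutator X I x2) \<le> L * dist x1 x2 powr 1"
    using locally_holder_onE[OF X_locally_lipschitz[OF I reg] x] by metis
  let ?b = "norm (commutator X I ?x) + 1"
  have op: "open (ball (0 :: real^'a) \<rho> \<times> ball y0 \<epsilon>)" by (intro open_Times open_ball)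
  have "isCont (\<lambda>(u, y). E y u) (u, y)"
    by (rule bspec[OF iffD1[OF continuous_on_eq_continuous_at[OF op] E_joint_continuous[OF g(1)]]]) (use g(2,3) in simp)
  from this[unfolded continuous_at_eps_delta, rule_format, of "min d e"]
  obtain s where s0: "s > 0" "\<forall>p. dist p (u, y) < s \<longrightarrow> dist ((\<lambda>(u, y). E y u) p) ((\<lambda>(u, y). E y u) (u, y)) < min d e"
    using d(1) e(1) by auto
  have s: "dist (E (snd p) (fst p)) ?x < min d e" if "dist p (u, y) < s" for p
    using s0(2) that by (simp add: case_prod_unfold)
  obtain s' where s': "s' > 0" "ball (u, y) s' \<subseteq> ball (0 :: real^'a) \<rho> \<times> ball y0 \<epsilon>"
  proof -
    have "(u, y) \<in> ball (0 :: real^'a) \<rho> \<times> ball y0 \<epsilon>" using g(2,3) by simp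
    then show ?thesis using op that unfolding open_contains_ball by blast
  qed
  let ?s = "min s s' / 2"
  \<comment> \<open>The factor 0 appears because the coordinate \<open>u'\<close> is the same for
    both parameters, so \<open>J_perturbation\<close> applies with points at distance zero.\<close>
  let ?C = "(L * K + real CARD('a) * (K * 0 + K) * (?b / c)) / c"
  have "dist (R I y1 u') (R I y2 u') \<le> ?C * dist y1 y2 powr \<alpha>"
    if u': "u' \<in> ball u ?s" and y1: "y1 \<in> ball y ?s" and y2: "y2 \<in> ball y ?s" for u' y1 y2
  proof -
    have near: "norm u' < \<rho> \<and> z \<in> ball y0 \<epsilon> \<and> E z u' \<in> ball ?x d \<and> dist ?x (E z u') < e" if z: "z \<in> ball y ?s" for z
    proof -
      have "dist (u', z) (u, y) \<le> dist u' u + dist z y"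
        unfolding dist_Pair_Pair by (rule sqrt_sum_squares_le_sum) auto
      also have "\<dots> < ?s + ?s" using u' z by (intro add_strict_mono) (auto simp: dist_commute)
      finally have "dist (u', z) (u, y) < min s s'" by simp
      then have lt: "dist (u', z) (u, y) < s" "dist (u', z) (u, y) < s'" by auto
      have "(u', z) \<in> ball (0 :: real^'a) \<rho> \<times> ball y0 \<epsilon>"
        by (rule subsetD[OF s'(2)]) (use lt(2) in \<open>simp add: dist_commute\<close>)
      then show ?thesis using s[OF lt(1)] by (simp add: dist_commute)
    qed
    note n1 = near[OF y1] and n2 = near[OF y2]
    have v: "norm (commutator X I (E y1 u') - commutator X I (E y2 u')) \<le> (L * K) * dist y1 y2 powr \<alpha>"
    proof -
      have "norm (commutator X I (E y1 u') - commutator X I (E y2 u')) \<le> L * dist (E y1 u') (E y2 u')"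
        unfolding dist_norm[symmetric]
        using e(3)[OF subsetD[OF d(2)] subsetD[OF d(2)], of "E y1 u'" "E y2 u'"] n1 n2 by simp
      also have "\<dots> \<le> L * (K * dist y1 y2 powr \<alpha>)"
        unfolding dist_norm[of "E y1 u'"] using flow_onD(5)[OF uniform_chartD(5)[OF g(1)], of y1 u' y2] n1 n2 e(2)
        by (intro mult_left_mono) auto
      finally show ?thesis by (simp add: mult.assoc)
    qed
    have "norm (matrix_inv (J y1 u') *v commutator X I (E y1 u') - matrix_inv (J y2 u') *v commutator X I (E y2 u')) \<le> ?C * dist y1 y2 powr \<alpha>"
      by (rule J_perturbation[OF g(1) _ _ _ _ _ _ _ v]) (use n1 n2 d(3) in auto)
    then show ?thesis by (simp add: R_def dist_norm)
  qed
  moreover have "?s > 0" using s0(1) s'(1) by simp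
  ultimately show "\<exists>\<epsilon>>0. \<exists>C. \<forall>u'\<in>ball u \<epsilon>. \<forall>y1\<in>ball y \<epsilon>. \<forall>y2\<in>ball y \<epsilon>.
     (u', y1) \<in> {(u, y). y \<in> \<Omega> \<and> u \<in> U y} \<longrightarrow> (u', y2) \<in> {(u, y). y \<in> \<Omega> \<and> u \<in> U y} \<longrightarrow>
     dist (R I y1 u') (R I y2 u') \<le> C * dist y1 y2 powr \<alpha>"
    by blast
qed

text \<open>\<open>?r1\<close> carries the Taylor error and \<open>?r2\<close> compares the two
  frames, which is possible because the approximation of \<open>commutator X I\<close> and
  \<open>commutator Y I\<close> have the same constants \<open>cI\<close> in their respective
  frames. Both estimates are made on one neighbourhood \<open>N\<close>.\<close>

lemma weight_R:
  assumes y: "y \<in> \<Omega>" and I: "I \<in> multiindices_upto n r"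
  shows "vf_weight_ge B (\<alpha> - real (weight I)) (R I y)"
proof -
  from uniform_chart_exists[OF y] obtain \<epsilon> \<rho> K c0 where g: "uniform_chart y \<epsilon> \<rho> K c0" by blast
  have yb: "y \<in> ball y \<epsilon>" using uniform_chartD(3)[OF g] by simp
  note flow = uniform_chartD(5)[OF g] and \<rho> = uniform_chartD(2)[OF g] and K = uniform_chartD(9)[OF g]
  have E0: "E y 0 = y" by (rule flow_onD(2)[OF flow yb])
  have smE: "smooth_on (ball 0 \<rho>) (E y)" by (rule flow_onD(1)[OF flow yb])
  let ?S = "\<lambda>j. S j y" and ?Y = "\<lambda>j. commutator Y (B j)"
  have smY: "smooth_on UNIV (?Y j)" for j by (rule smooth_Y[OF B(1)])

  have "\<exists>\<rho>1>0. \<rho>1 \<le> \<rho> \<and> (\<forall>u. norm u < \<rho>1 \<longrightarrow> det (frame_matrix ?S (E y u)) \<noteq> 0)"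
  proof (rule nonzero_near_zero[OF _ \<rho>])
    have "smooth_on UNIV (\<lambda>x. S j y x $ i)" for i j using smooth_S smooth_on_vec[OF open_UNIV] by blast
    from smooth_on_compose[OF open_UNIV open_ball UNIV_I this smE]
    show "smooth_on (ball 0 \<rho>) (\<lambda>u. det (frame_matrix ?S (E y u)))"
      by (intro smooth_det open_ball) (simp add: frame_matrix_def)
    have "frame_matrix ?S (E y 0) = J y 0"
      by (simp add: frame_matrix_def E0 S_center[OF y] D_center[OF flow \<rho> yb y])
    then show "det (frame_matrix ?S (E y 0)) \<noteq> 0" using det_J[OF zero_in_U[OF y]] by simp
  qed
  then obtain \<rho>1 where \<rho>1: "\<rho>1 > 0" "\<rho>1 \<le> \<rho>" "\<And>u. norm u < \<rho>1 \<Longrightarrow> det (frame_matrix ?S (E y u)) \<noteq> 0" by blast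
  have "\<exists>\<rho>2>0. \<rho>2 \<le> \<rho> \<and> (\<forall>u. norm u < \<rho>2 \<longrightarrow> det (frame_matrix ?Y u) \<noteq> 0)"
  proof (rule nonzero_near_zero[OF _ \<rho>])
    have "smooth_on (ball 0 \<rho>) (\<lambda>x. ?Y j x $ i)" for i j
      using smooth_on_subset[OF smY subset_UNIV] smooth_on_vec[OF open_ball] by blast
    then show "smooth_on (ball 0 \<rho>) (\<lambda>u. det (frame_matrix ?Y u))"
      by (intro smooth_det open_ball) (simp add: frame_matrix_def)
    have "frame_matrix ?Y 0 = mat 1" by (simp add: frame_matrix_def Y_basis mat_def axis_def vec_eq_iff)
    then show "det (frame_matrix ?Y 0) \<noteq> 0" by simp
  qed
  then obtain \<rho>2 where \<rho>2: "\<rho>2 > 0" "\<And>u. norm u < \<rho>2 \<Longrightarrow> det (frame_matrix ?Y u) \<noteq> 0" by blast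
  define \<rho>0 where "\<rho>0 = min \<rho>1 \<rho>2"
  have \<rho>0: "\<rho>0 > 0" "\<rho>0 \<le> \<rho>1" "\<rho>0 \<le> \<rho>2" "\<rho>0 \<le> \<rho>" using \<rho>1 \<rho>2 by (auto simp: \<rho>0_def)
  obtain d C where d: "d > 0" "C \<ge> 0" and est: "\<And>x. x \<in> ball y d \<Longrightarrow>
      norm (commutator X I x - commutator (approx_field r X y) I x) \<le> C * dist x y powr (real (r - weight I) + \<alpha>)"
    using commutator_approx_estimate[OF y I] by blast
  \<comment> \<open>Half of \<open>\<rho>0\<close> serves compactness, a homogeneous norm below 1
    the comparison of powers, and the last condition puts \<open>E y u\<close> into the ball where
    the Taylor estimate holds.\<close>
  define N where "N = {u :: real^'a. norm u < \<rho>0 / 2 \<and> hom_norm B u < 1 \<and> K * norm u < d}"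

  \<comment> \<open>The constants are fixed before either frame is considered; the comparison rests
    on their being common to both.\<close>
  have "\<exists>c. \<forall>i j. weight (B i) + weight (B j) \<le> r \<longrightarrow>
      (\<forall>k. c i j k \<noteq> 0 \<longrightarrow> weight (B k) = weight (B i) + weight (B j)) \<and>
      (\<forall>F :: nat \<Rightarrow> real^'a \<Rightarrow> real^'a. (\<forall>i\<le>n. smooth_on UNIV (F i)) \<longrightarrow>
         (\<forall>x. lie_bracket (commutator F (B i)) (commutator F (B j)) x = (\<Sum>k\<in>UNIV. c i j k *\<^sub>R commutator F (B k) x)))"
    using universal_structure_constants[OF Y_free Y_basis range_B] by (intro choice allI) blast
  then obtain c where c: "\<And>i j k. weight (B i) + weight (B j) \<le> r \<Longrightarrow> c i j k \<noteq> 0 \<Longrightarrow> weight (B k) = weight (B i) + weight (B j)"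
    and cF: "\<And>i j (F :: nat \<Rightarrow> real^'a \<Rightarrow> real^'a) x. \<lbrakk>weight (B i) + weight (B j) \<le> r; \<forall>i\<le>n. smooth_on UNIV (F i)\<rbrakk> \<Longrightarrow>
       lie_bracket (commutator F (B i)) (commutator F (B j)) x = (\<Sum>k\<in>UNIV. c i j k *\<^sub>R commutator F (B k) x)"
    by blast

  have wB: "0 < weight (B j)" "weight (B j) \<le> r" for j
    using B[of j] multiindices_weight_pos by (auto simp: multiindices_upto_def)
  interpret weighted B N r
  proof
    fix u and t :: real assume u: "u \<in> N" and t: "0 \<le> t" "t \<le> 1"
    have "norm (t *\<^sub>R u) \<le> norm u" using t mult_left_le_one_le[of "norm u" t] by simp
    moreover have "hom_norm B (t *\<^sub>R u) \<le> hom_norm B u"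
      unfolding hom_norm_def
    proof (intro sum_mono powr_mono2)
      show "\<bar>(t *\<^sub>R u) $ j\<bar> \<le> \<bar>u $ j\<bar>" for j
        using mult_left_le_one_le[of "\<bar>u $ j\<bar>" t] t by (simp add: abs_mult)
    qed simp_all
    ultimately show "t *\<^sub>R u \<in> N" using u mult_left_mono[of "norm (t *\<^sub>R u)" "norm u" K] K by (auto simp: N_def)
  qed (use wB in \<open>auto simp: N_def\<close>)
  have Nn: "norm u < \<rho>0 / 2" "norm u < \<rho>" "norm u < \<rho>0" "u \<in> U y" if "u \<in> N" for u
  proof -
    show 1: "norm u < \<rho>0 / 2" using that by (simp add: N_def)
    then show "norm u < \<rho>" "norm u < \<rho>0" using \<rho>0 by auto
    then show "u \<in> U y" using ball_subset_U[OF g yb] by auto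
  qed
  interpret F1: weighted_frame B N r \<rho>0 "E y" "D y" ?S c
  proof
    show "smooth_on (ball 0 \<rho>0) (E y)" by (rule smooth_on_subset[OF smE subset_ball[OF \<rho>0(4)]])
    fix u :: "real^'a" assume u: "norm u < \<rho>0"
    have u': "norm u < \<rho>" using u \<rho>0 by simp
    show "(E y has_derivative (\<lambda>h. \<Sum>l\<in>UNIV. h $ l *\<^sub>R D y l u)) (at u)" by (rule flow_onD(3)[OF flow yb u'])
    show "(\<Sum>l\<in>UNIV. u $ l *\<^sub>R D y l u) = (\<Sum>j\<in>UNIV. u $ j *\<^sub>R S j y (E y u))" by (rule flow_onD(4)[OF flow yb u'])
    show "det (frame_matrix ?S (E y u)) \<noteq> 0" using \<rho>1(3) u \<rho>0 by simp
    show "det (J y u) \<noteq> 0" using det_J ball_subset_U[OF g yb] u' by auto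
    show "lie_bracket (S i y) (S j y) (E y u) = (\<Sum>k\<in>UNIV. c i j k *\<^sub>R S k y (E y u))" if "weight (B i) + weight (B j) \<le> r" for i j
      unfolding S_def using cF[OF that, of "approx_field r X y"] smooth_approx_field by blast
  next
    show "smooth_on UNIV (S j y)" for j by (rule smooth_S)
  next
    show "norm u \<le> \<rho>0 / 2" if "u \<in> N" for u using Nn(1)[OF that] by simp
  qed (rule \<rho>0(1))
  \<comment> \<open>The group in its own canonical coordinates: by \<open>Y_radial\<close> the ray
    through \<open>u\<close> is an integral curve of the field with coefficients \<open>u\<close>,
    so the exponential is the identity.\<close>
  interpret F2: weighted_frame B N r \<rho>0 "\<lambda>u. u" "\<lambda>l u. axis l 1" ?Y c
  proof
    show "smooth_on (ball 0 \<rho>0) (\<lambda>u :: real^'a. u)"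
      by (rule smooth_on_componentwiseI[OF open_ball]) (rule smooth_on_inner[OF open_ball])
    fix u :: "real^'a" assume u: "norm u < \<rho>0"
    show "((\<lambda>u. u) has_derivative (\<lambda>h. \<Sum>l\<in>UNIV. h $ l *\<^sub>R axis l 1)) (at u)" unfolding sum_axis by (rule has_derivative_ident)
    show "(\<Sum>l\<in>UNIV. u $ l *\<^sub>R axis l 1) = (\<Sum>j\<in>UNIV. u $ j *\<^sub>R commutator Y (B j) u)" unfolding sum_axis by (rule Y_radial)
    show "det (frame_matrix ?Y u) \<noteq> 0" using \<rho>2(2) u \<rho>0 by simp
    have "frame_matrix (\<lambda>(l::'a) (u::real^'a). axis l (1::real)) u = mat 1" by (simp add: frame_matrix_def mat_def axis_def vec_eq_iff)
    then show "det (frame_matrix (\<lambda>(l::'a) (u::real^'a). axis l (1::real)) u) \<noteq> 0" by simp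
    show "lie_bracket (?Y i) (?Y j) u = (\<Sum>k\<in>UNIV. c i j k *\<^sub>R ?Y k u)" if "weight (B i) + weight (B j) \<le> r" for i j
      using cF[OF that, of Y] Y_smooth by blast
  next
    show "smooth_on UNIV (?Y j)" for j by (rule smY)
  next
    show "norm u \<le> \<rho>0 / 2" if "u \<in> N" for u using Nn(1)[OF that] by simp
  qed (rule \<rho>0(1))
  have A_diff: "bigo (Suc (weight (B k)) - weight (B l)) (\<lambda>u. F1.A u $ k $ l - F2.A u $ k $ l)" for k l
    by (rule frame_system_inverse_diff[OF c F1.M_system F2.M_system F1.A_bigo F2.A_bigo F1.M_A(1) F1.M_A(2) F2.M_A(1)])

  obtain cI where cI: "\<And>j. cI j \<noteq> 0 \<Longrightarrow> weight (B j) = weight I"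
    and cIF: "\<And>(F :: nat \<Rightarrow> real^'a \<Rightarrow> real^'a) x. \<forall>i\<le>n. smooth_on UNIV (F i) \<Longrightarrow> commutator F I x = (\<Sum>j\<in>UNIV. cI j *\<^sub>R commutator F (B j) x)"
    using universal_relation[OF Y_free Y_basis range_B I] by blast
  let ?SI = "commutator (approx_field r X y) I"
  let ?r1 = "\<lambda>u. matrix_inv (J y u) *v (commutator X I (E y u) - ?SI (E y u))"
  let ?r2 = "\<lambda>k u. \<Sum>j\<in>UNIV. cI j * (F1.A u $ k $ j - F2.A u $ k $ j)"
  \<comment> \<open>In the coordinates \<open>u\<close>, the approximating field and the group field
    are \<open>F1.A u\<close> and \<open>F2.A u\<close> applied to the same vector of constants;
    what is left over is the Taylor error.\<close>
  have decomp: "R I y u $ k = ?r1 u $ k + ?r2 k u" if u: "u \<in> N" for u k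
  proof -
    let ?c = "\<chi> j. cI j"
    have S1: "?SI (E y u) = frame_matrix ?S (E y u) *v ?c"
    proof -
      have "\<forall>i\<le>n. smooth_on UNIV (approx_field r X y i)" using smooth_approx_field by blast
      from cIF[OF this] show ?thesis by (simp add: frame_matrix_vec S_def)
    qed
    have Y1: "commutator Y I u = frame_matrix ?Y u *v ?c"
      using cIF[of Y] Y_smooth by (simp add: frame_matrix_vec)
    have m1: "frame_matrix (\<lambda>(l::'a) (u::real^'a). axis l (1::real)) u = mat 1" by (simp add: frame_matrix_def mat_def axis_def vec_eq_iff)
    have "matrix_inv (mat 1 :: real^'a^'a) = mat 1" using matrix_inv_mult(1)[of "mat 1 :: real^'a^'a"] by simp
    then have A2: "F2.A u = frame_matrix ?Y u" by (simp add: F2.A_def m1)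
    have "R I y u = ?r1 u + (F1.A u *v ?c - F2.A u *v ?c)"
      unfolding R_def A2 F1.A_def Y1 S1
      by (simp add: matrix_vector_mult_diff_distrib matrix_vector_mul_assoc)
    then show ?thesis by (simp add: matrix_vector_mult_def sum_subtractf right_diff_distrib mult.commute)
  qed
  have "bigo (Suc (weight (B k)) - weight I) (?r2 k)" for k
  proof (rule bigo_sum)
    fix j
    show "bigo (Suc (weight (B k)) - weight I) (\<lambda>u. cI j * (F1.A u $ k $ j - F2.A u $ k $ j))"
    proof (cases "cI j = 0")
      case False
      then show ?thesis using bigo_cmult[OF A_diff[of k j]] cI[OF False] by simp
    qed (simp add: bigo_zero)
  qed
  then have "\<forall>k. \<exists>C\<ge>0. \<forall>u\<in>N. \<bar>?r2 k u\<bar> \<le> C * Q u ^ (Suc (weight (B k)) - weight I)" by (simp add: bigo_def)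
  from choice[OF this] obtain C2 where C2: "\<And>k. C2 k \<ge> 0" "\<And>k u. u \<in> N \<Longrightarrow> \<bar>?r2 k u\<bar> \<le> C2 k * Q u ^ (Suc (weight (B k)) - weight I)"
    by blast
  let ?e = "real (r - weight I) + \<alpha>"
  let ?q = "real CARD('a)"
  let ?C1 = "C * (K * ?q) powr ?e / c0"
  have C1: "0 \<le> ?C1" using d(2) uniform_chartD(1)[OF g] by simp
  have r1: "norm (?r1 u) \<le> ?C1 * Q u powr ?e" if u: "u \<in> N" for u
  proof -
    let ?\<delta> = "commutator X I (E y u) - ?SI (E y u)"
    have "c0 * norm (?r1 u) \<le> norm (J y u *v ?r1 u)" by (rule uniform_chartD(7)[OF g yb Nn(2)[OF u]])
    also have "J y u *v ?r1 u = ?\<delta>" by (simp add: matrix_vector_mul_assoc matrix_inv_mult[OF det_J[OF Nn(4)[OF u]]])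
    finally have 1: "c0 * norm (?r1 u) \<le> norm ?\<delta>" .
    have "\<bar>u $ j\<bar> \<le> Q u" for j
    proof -
      have "Q u ^ weight (B j) \<le> Q u ^ 1"
        using wB(1)[of j] by (intro power_decreasing Q_nonneg N_unit[OF u]) simp
      then show ?thesis using coordinate_le[of u j] by simp
    qed
    then have nu: "norm u \<le> ?q * Q u" by (intro norm_vec_le) simp
    have "norm (E y u - E y 0) \<le> K * norm (u - 0)"
      by (rule flow_onD(7)[OF flow yb Nn(2)[OF u]]) (use \<rho> in simp)
    then have du: "dist (E y u) y \<le> K * norm u" by (simp add: E0 dist_norm)
    then have "E y u \<in> ball y d" using u by (simp add: N_def dist_commute)
    from est[OF this] have "norm ?\<delta> \<le> C * dist (E y u) y powr ?e" .
    also have "\<dots> \<le> C * (K * ?q * Q u) powr ?e"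
    proof (intro mult_left_mono powr_mono2 d(2))
      show "dist (E y u) y \<le> K * ?q * Q u" using du mult_left_mono[OF nu K] by (simp add: mult.assoc)
    qed (use \<alpha> in auto)
    also have "\<dots> = C * (K * ?q) powr ?e * Q u powr ?e" using K Q_nonneg by (simp add: powr_mult)
    finally have "c0 * norm (?r1 u) \<le> C * (K * ?q) powr ?e * Q u powr ?e" using 1 by simp
    then show ?thesis using uniform_chartD(1)[OF g] by (simp add: pos_le_divide_eq mult.commute)
  qed
  have final: "\<bar>R I y u $ k\<bar> \<le> (?C1 + (\<Sum>k\<in>UNIV. C2 k)) * Q u powr (\<alpha> - real (weight I) + real (weight (B k)))"
    if u: "u \<in> N" and cond: "u \<noteq> 0 \<or> 0 < \<alpha> - real (weight I) + real (weight (B k))" for u k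
  proof -
    let ?\<kappa> = "\<alpha> - real (weight I) + real (weight (B k))"
    let ?m = "Suc (weight (B k)) - weight I"
    have rI: "weight I \<le> r" using I by (simp add: multiindices_upto_def)
    \<comment> \<open>The exponent of the Taylor error is the same for all components, so the worst
      case is a component of maximal weight \<open>r\<close>.\<close>
    have \<kappa>e: "?\<kappa> \<le> ?e" using rI wB(2)[of k] by (simp add: of_nat_diff)
    \<comment> \<open>If the subtraction in \<open>?m\<close> is truncated, then
      \<open>?\<kappa>\<close> is negative; otherwise the extra power 1 dominates \<alpha>.\<close>
    have \<kappa>m: "?\<kappa> \<le> real ?m" using \<alpha>(2) by (cases "weight I \<le> Suc (weight (B k))") (auto simp: of_nat_diff)
    have q1: "Q u powr ?e \<le> Q u powr ?\<kappa>" by (rule powr_mono'[OF \<kappa>e Q_nonneg N_unit[OF u]])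
    have q2: "Q u ^ ?m \<le> Q u powr ?\<kappa>"
    proof (cases "Q u = 0")
      \<comment> \<open>At the origin the right-hand side is 0, so the left-hand side must vanish
        too: a positive \<open>?\<kappa>\<close> forces a positive exponent
        \<open>?m\<close>.\<close>
      case True
      have "u $ j = 0" for j using coordinate_le[of u j] wB(1)[of j] True by (simp add: zero_power)
      then have "u = 0" by (simp add: vec_eq_iff)
      then have "0 < ?\<kappa>" using cond by simp
      then have "real (weight I) < real (Suc (weight (B k)))" using \<alpha>(2) by simp
      then have "0 < ?m" by simp
      then show ?thesis using True by (simp add: zero_power)
    next
      case False
      then have Q: "Q u > 0" using Q_nonneg[of u] by simp
      have "Q u ^ ?m = Q u powr real ?m" using Q by (simp add: powr_realpow)
      also have "\<dots> \<le> Q u powr ?\<kappa>" by (rule powr_mono'[OF \<kappa>m Q_nonneg N_unit[OF u]])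
      finally show ?thesis .
    qed
    have "\<bar>R I y u $ k\<bar> \<le> \<bar>?r1 u $ k\<bar> + \<bar>?r2 k u\<bar>" unfolding decomp[OF u] by (rule abs_triangle_ineq)
    also have "\<dots> \<le> ?C1 * Q u powr ?e + C2 k * Q u ^ ?m"
      using order_trans[OF Finite_Cartesian_Product.norm_nth_le r1[OF u], of k] C2(2)[OF u, of k] by (intro add_mono) simp_all
    also have "\<dots> \<le> ?C1 * Q u powr ?\<kappa> + (\<Sum>k\<in>UNIV. C2 k) * Q u powr ?\<kappa>"
      by (intro add_mono mult_mono q1 q2 C1 order_refl sum_nonneg C2(1) member_le_sum) (auto simp: Q_nonneg C2(1))
    finally show ?thesis by (simp add: distrib_right)
  qed
  have "open N"
  proof -
    have "continuous_on UNIV (hom_norm B)"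
      unfolding hom_norm_def[abs_def]
      by (intro continuous_intros continuous_on_powr') (use wB(1) in auto)
    then have "open {u. hom_norm B u < 1}" by (intro open_Collect_less) (auto intro: continuous_intros)
    moreover have "open {u :: real^'a. norm u < \<rho>0 / 2}" "open {u :: real^'a. K * norm u < d}"
      by (intro open_Collect_less continuous_intros)+
    ultimately show ?thesis unfolding N_def by (intro open_Collect_conj)
  qed
  moreover have "0 \<in> N" using \<rho>0(1) d(1) wB(1) by (simp add: N_def hom_norm_def)
  ultimately show ?thesis unfolding vf_weight_ge_def using final
    by (intro exI[of _ N] exI[of _ "?C1 + (\<Sum>k\<in>UNIV. C2 k)"]) blast
qed

end

theorem theorem33:
  fixes n r :: nat and \<alpha> :: real and \<Omega> :: "(real^'p::finite) set"
    and X Y :: "nat \<Rightarrow> real^'p \<Rightarrow> real^'p" and B :: "'p \<Rightarrow> nat list"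
    and gm :: "real^'p \<Rightarrow> real^'p \<Rightarrow> real^'p"
  assumes "2 \<le> r" and "0 < \<alpha>" and "\<alpha> \<le> 1"
    and "open \<Omega>" and "connected \<Omega>" and "bounded \<Omega>"
    and "\<forall>i\<in>{1..n}. C_holder_on \<alpha> (r - 1) \<Omega> (X i)"
    and "C_holder_on \<alpha> (r - 2) \<Omega> (X 0)"
    and "hormander n r \<Omega> X"
    and "free_upto n r \<Omega> X"
    and "basis_multiindices n r \<Omega> X B"
    and "homogeneous_group n r B gm Y"
  shows "\<exists>(U :: real^'p \<Rightarrow> (real^'p) set) (V :: real^'p \<Rightarrow> (real^'p) set)
           (\<Theta> :: real^'p \<Rightarrow> real^'p \<Rightarrow> real^'p)
           (R :: nat list \<Rightarrow> real^'p \<Rightarrow> real^'p \<Rightarrow> real^'p).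
      (\<forall>y\<in>\<Omega>. 0 \<in> U y \<and> y \<in> V y \<and> V y \<subseteq> \<Omega> \<and>
         (\<forall>u\<in>U y. is_exp (canonical_field r X B y u) y (canonical_exp r X B y u)) \<and>
         diffeomorphism (V y) (U y) (\<Theta> y) (canonical_exp r X B y)) \<and>
      open {(u, y). y \<in> \<Omega> \<and> u \<in> U y} \<and> open {(x, y). y \<in> \<Omega> \<and> x \<in> V y} \<and>
      holder_dependence \<alpha> {(x, y). y \<in> \<Omega> \<and> x \<in> V y} \<Theta> \<and>
      (\<forall>I\<in>multiindices_upto n r.
         (\<forall>y\<in>\<Omega>. C_holder_on \<alpha> (r - weight I) (U y) (R I y) \<and>
            vf_weight_ge B (\<alpha> - real (weight I)) (R I y) \<and>
            (\<forall>W f. open W \<longrightarrow> 0 \<in> W \<longrightarrow> smooth_on W f \<longrightarrow>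
               (\<forall>x\<in>V y. \<Theta> y x \<in> W \<longrightarrow>
                  vf_apply (commutator X I) (\<lambda>x'. f (\<Theta> y x')) x =
                  vf_apply (commutator Y I) f (\<Theta> y x) + vf_apply (R I y) f (\<Theta> y x)))) \<and>
         holder_dependence \<alpha> {(x, y). y \<in> \<Omega> \<and> x \<in> V y} (\<lambda>y x. R I y (\<Theta> y x)) \<and>
         (weight I < r \<or> \<alpha> = 1 \<longrightarrow>
            holder_dependence \<alpha> {(u, y). y \<in> \<Omega> \<and> u \<in> U y} (R I)))"
proof -
  note G = assms(12)[unfolded homogeneous_group_def]
  interpret group_approximation n r \<alpha> \<Omega> X B Y
    by unfold_locales (use assms(1-4,7,8,11) G in auto)
  have E: "canonical_exp r X B y = E y" for y by (simp add: E_def)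
  show ?thesis
    unfolding E
  proof (rule exI[of _ U], rule exI[of _ V], rule exI[of _ \<Theta>], rule exI[of _ R], intro conjI ballI allI impI)
    show "open {(u, y). y \<in> \<Omega> \<and> u \<in> U y}" using open_T by (simp add: T_def)
    fix y assume y: "y \<in> \<Omega>"
    show "0 \<in> U y" by (rule zero_in_U[OF y])
    show "y \<in> V y" by (rule y_in_V[OF y])
    show "V y \<subseteq> \<Omega>" by (rule V_subset)
    show "is_exp (canonical_field r X B y u) y (E y u)" if "u \<in> U y" for u by (rule is_exp_E[OF that])
    show "diffeomorphism (V y) (U y) (\<Theta> y) (E y)" by (rule diffeomorphism_\<Theta>[OF y])
    fix I assume I: "I \<in> multiindices_upto n r"
    show "C_holder_on \<alpha> (r - weight I) (U y) (R I y)" by (rule C_holder_R[OF y I])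
    show "vf_weight_ge B (\<alpha> - real (weight I)) (R I y)" by (rule weight_R[OF y I])
    show "vf_apply (commutator X I) (\<lambda>x'. f (\<Theta> y x')) x = vf_apply (commutator Y I) f (\<Theta> y x) + vf_apply (R I y) f (\<Theta> y x)"
      if "open W" "smooth_on W f" "x \<in> V y" "\<Theta> y x \<in> W" for W f x
      by (rule commutator_in_coordinates[OF y that])
  next
    show "open {(x, y). y \<in> \<Omega> \<and> x \<in> V y}" by (rule open_V_graph)
    show "holder_dependence \<alpha> {(x, y). y \<in> \<Omega> \<and> x \<in> V y} \<Theta>" by (rule holder_\<Theta>)
    fix I assume I: "I \<in> multiindices_upto n r"
    show "holder_dependence \<alpha> {(x, y). y \<in> \<Omega> \<and> x \<in> V y} (\<lambda>y x. R I y (\<Theta> y x))" by (rule holder_R_at_fixed_x[OF I])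
    show "holder_dependence \<alpha> {(u, y). y \<in> \<Omega> \<and> u \<in> U y} (R I)" if "weight I < r \<or> \<alpha> = 1"
      by (rule holder_R_at_fixed_u[OF I that])
  qed
qed

end
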